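(* Let $\varphi\in\mathrm{LFM}(B_N)$ be elliptic and not an automorphism of $B_N$, and let $p=\dim L_U(\varphi,z_0)$ for its fixed point $z_0\in B_N$. If $p=0$ and $\varphi$ fixes no boundary point (no point of $\partial B_N$), then the spectrum of $C_\varphi$ on $H^2(B_N)$ is the set consisting of $0$, $1$ and all possible products of the eigenvalues of $\varphi'(z_0)$.
   Context: $B_N$ is the open Euclidean unit ball of $\mathbb{C}^N$; $H^2(B_N)$ is the classical Hardy space; $C_\varphi f=f\circ\varphi$ is the composition operator. $\mathrm{LFM}(B_N)$ is the set of linear fractional maps $\varphi(z)=\frac{Az+B}{\langle z,C\rangle+d}$ ($A\in\mathbb{C}^{N\times N}$, $B,C\in\mathbb{C}^N$, $d\in\mathbb{C}$) that map $B_N$ into itself; such maps extend holomorphically to a neighbourhood of $\overline{B_N}$, and $C_\varphi$ is bounded on $H^2(B_N)$. $\varphi$ is elliptic if it has a fixed point in $B_N$. The unitary space of $\varphi$ at a fixed point $z_0\in B_N$ is $L_U(\varphi,z_0)=\bigoplus_{|\alpha|=1}\ker(d\varphi_{z_0}-\alpha I)^N$ ($\alpha\in\mathbb{C}$, $|\alpha|=1$). $\varphi'(z_0)=d\varphi_{z_0}$ is the complex differential ($N\times N$ Jacobian matrix). "All possible products" means finite products of eigenvalues with repetitions allowed. *)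

theory Defs
  imports "HOL-Analysis.Analysis"
begin

section \<open>Linear fractional maps of the unit ball of \<open>\<complex>\<^sup>N\<close>\<close>

text \<open>
  \<open>\<complex>\<^sup>N\<close> is \<open>complex ^ 'n\<close> with \<open>N = CARD('n)\<close>; its library norm is the Euclidean norm, so
  \<open>B\<^sub>N\<close> is \<open>ball 0 1\<close>.  Complex scalars act by \<open>*s\<close>.
\<close>

definition cinner :: "complex ^ 'n \<Rightarrow> complex ^ 'n \<Rightarrow> complex" where
  "cinner z w = (\<Sum>i\<in>UNIV. z $ i * cnj (w $ i))"

definition linear_fractional ::
  "complex ^ 'n ^ 'n \<Rightarrow> complex ^ 'n \<Rightarrow> complex ^ 'n \<Rightarrow> complex \<Rightarrow> complex ^ 'n \<Rightarrow> complex ^ 'n"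
where
  "linear_fractional A B C d z = (1 / (cinner z C + d)) *s (A *v z + B)"

text \<open>
  The values of \<open>\<phi>\<close> on the unit sphere are those of the (unique) continuous extension of the
  self-map of the open ball to the closed ball; values outside the closed ball are irrelevant.
\<close>

definition LFM :: "(complex ^ 'n \<Rightarrow> complex ^ 'n) set" where
  "LFM = {\<phi>.
     (\<exists>A B C d. \<forall>z\<in>ball 0 1. cinner z C + d \<noteq> 0 \<and> \<phi> z = linear_fractional A B C d z) \<and>
     \<phi> ` ball 0 1 \<subseteq> ball 0 1 \<and>
     continuous_on (cball 0 1) \<phi>}"

definition elliptic :: "(complex ^ 'n \<Rightarrow> complex ^ 'n) \<Rightarrow> bool" where
  "elliptic \<phi> \<longleftrightarrow> (\<exists>z\<in>ball 0 1. \<phi> z = z)"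

text \<open>Holomorphy on an open set \<open>S\<close>: the real Frechet derivative exists and is complex-linear.\<close>

definition mv_holomorphic_on :: "(complex ^ 'n \<Rightarrow> complex) \<Rightarrow> (complex ^ 'n) set \<Rightarrow> bool" where
  "mv_holomorphic_on f S \<longleftrightarrow>
     (\<forall>z\<in>S. \<exists>L. (f has_derivative L) (at z) \<and> (\<forall>c v. L (c *s v) = c * L v))"

definition ball_automorphism :: "(complex ^ 'n \<Rightarrow> complex ^ 'n) \<Rightarrow> bool" where
  "ball_automorphism \<phi> \<longleftrightarrow>
     (\<exists>\<psi>. \<phi> ` ball 0 1 \<subseteq> ball 0 1 \<and> \<psi> ` ball 0 1 \<subseteq> ball 0 1 \<and>
          (\<forall>z\<in>ball 0 1. \<psi> (\<phi> z) = z \<and> \<phi> (\<psi> z) = z) \<and>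
          (\<forall>i. mv_holomorphic_on (\<lambda>z. \<phi> z $ i) (ball 0 1)) \<and>
          (\<forall>i. mv_holomorphic_on (\<lambda>z. \<psi> z $ i) (ball 0 1)))"

definition complex_jacobian ::
  "(complex ^ 'n \<Rightarrow> complex ^ 'n) \<Rightarrow> complex ^ 'n \<Rightarrow> complex ^ 'n ^ 'n"
where
  "complex_jacobian \<phi> z = matrix (frechet_derivative \<phi> (at z))"

definition matrix_eigenvalues :: "complex ^ 'n ^ 'n \<Rightarrow> complex set" where
  "matrix_eigenvalues M = {\<mu>. \<exists>v. v \<noteq> 0 \<and> M *v v = \<mu> *s v}"

text \<open>
  The \<open>N\<close>-th power of \<open>d\<phi>\<^sub>z - \<alpha>I\<close> is written as an iterated map because \<open>^\<close> on the vector type is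
  not the matrix power.  The (automatically direct) sum of the kernels is their complex span;
  its complex dimension is \<open>vec.dim\<close>, whereas \<open>dim\<close> would be the real dimension.
\<close>

definition unitary_space ::
  "(complex ^ 'n \<Rightarrow> complex ^ 'n) \<Rightarrow> complex ^ 'n \<Rightarrow> (complex ^ 'n) set"
where
  "unitary_space \<phi> z =
     vec.span (\<Union>\<alpha>\<in>{\<alpha>. norm \<alpha> = 1}.
       {v. ((\<lambda>w. (complex_jacobian \<phi> z - mat \<alpha>) *v w) ^^ CARD('n)) v = 0})"

section \<open>The Hardy space \<open>H\<^sup>2(B\<^sub>N)\<close>\<close>

text \<open>
  Normalized rotation-invariant measure on the unit sphere, obtained by projecting normalized
  Lebesgue measure on the ball radially onto the sphere.
\<close>

definition sphere_measure :: "(complex ^ 'n) measure" where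
  "sphere_measure =
     distr (uniform_measure lborel (ball 0 1)) borel (\<lambda>x. x /\<^sub>R norm x)"

definition hardy_mean :: "(complex ^ 'n \<Rightarrow> complex) \<Rightarrow> real \<Rightarrow> real" where
  "hardy_mean f r = (LINT \<zeta>|sphere_measure. (norm (f (r *\<^sub>R \<zeta>)))\<^sup>2)"

text \<open>
  Functions on the ball are represented by functions vanishing off the ball, so that equality in
  \<open>H\<^sup>2(B\<^sub>N)\<close> is equality in HOL.
\<close>

definition hardy_space :: "(complex ^ 'n \<Rightarrow> complex) set" where
  "hardy_space = {f.
     mv_holomorphic_on f (ball 0 1) \<and> (\<forall>z. z \<notin> ball 0 1 \<longrightarrow> f z = 0) \<and>
     bdd_above (hardy_mean f ` {0<..<1})}"

definition hardy_norm :: "(complex ^ 'n \<Rightarrow> complex) \<Rightarrow> real" where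
  "hardy_norm f = sqrt (SUP r\<in>{0<..<1}. hardy_mean f r)"

type_synonym 'n hardy_map = "(complex ^ 'n \<Rightarrow> complex) \<Rightarrow> complex ^ 'n \<Rightarrow> complex"

definition hardy_bounded_operator :: "('n::finite) hardy_map \<Rightarrow> bool" where
  "hardy_bounded_operator T \<longleftrightarrow>
     (\<forall>f\<in>hardy_space. T f \<in> hardy_space) \<and>
     (\<forall>f\<in>hardy_space. \<forall>g\<in>hardy_space. T (\<lambda>z. f z + g z) = (\<lambda>z. T f z + T g z)) \<and>
     (\<forall>c. \<forall>f\<in>hardy_space. T (\<lambda>z. c * f z) = (\<lambda>z. c * T f z)) \<and>
     (\<exists>K. \<forall>f\<in>hardy_space. hardy_norm (T f) \<le> K * hardy_norm f)"

text \<open>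
  Spectrum of a bounded operator \<open>T\<close> on \<open>H\<^sup>2(B\<^sub>N)\<close>: all \<open>c\<close> such that \<open>T - cI\<close> has no two-sided
  inverse among the bounded operators.
\<close>

definition hardy_spectrum :: "('n::finite) hardy_map \<Rightarrow> complex set" where
  "hardy_spectrum T = {c. \<not> (\<exists>S. hardy_bounded_operator S \<and>
     (\<forall>f\<in>hardy_space. S (\<lambda>z. T f z - c * f z) = f) \<and>
     (\<forall>f\<in>hardy_space. (\<lambda>z. T (S f) z - c * S f z) = f))}"

definition composition_operator :: "(complex ^ 'n \<Rightarrow> complex ^ 'n) \<Rightarrow> ('n::finite) hardy_map" where
  "composition_operator \<phi> f = (\<lambda>z. if z \<in> ball 0 1 then f (\<phi> z) else 0)"

end

theory Submission
  imports Defs "HOL-Complex_Analysis.Cauchy_Integral_Formula"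
    "HOL-Computational_Algebra.Fundamental_Theorem_Algebra"
begin

text \<open>
  A linear fractional self-map satisfies a Hermitian inequality (S-lemma) which makes a difference of
  powers of Szego kernels positive semidefinite; with the Szego formula this bounds \<open>C\<^sub>\<phi>\<close> on the
  Hardy space.  Since no eigenvalue of \<open>M = \<phi>'(z\<^sub>0)\<close> is unimodular, all lie in the open unit disc.
  A linear fractional change of coordinates \<open>\<sigma>\<close> with \<open>\<sigma>(\<phi>(z)) = M \<sigma>(z)\<close> has no pole on the closed
  ball because there is no fixed point on the boundary, and it maps the ball onto a star-shaped
  domain \<open>\<Omega>\<close>; moreover an iterate of \<open>\<phi>\<close> maps the closed ball into a smaller ball.

  Products of left eigenvectors of \<open>M\<close>, composed with \<open>\<sigma>\<close>, are eigenfunctions, and \<open>0\<close> is in the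
  spectrum because an iterate of \<open>C\<^sub>\<phi>\<close> shrinks \<open>z\<^sub>i\<^sup>k\<close> to norm at most \<open>\<rho>\<^sup>k\<close>, while the norm of
  \<open>z\<^sub>i\<^sup>k\<close> is at least a multiple of \<open>s\<^sup>k\<close> for some \<open>s > \<rho>\<close>.  For any other \<open>\<nu>\<close> the equation
  \<open>k(Mw) - \<nu> k(w) = f(w)\<close> is uniquely solvable in the holomorphic functions on \<open>\<Omega>\<close>: by a Neumann series if \<open>|\<nu>| > 1\<close>, and
  otherwise by writing \<open>k(w) = k(0) + \<Sum>\<^sub>i w\<^sub>i h\<^sub>i(w)\<close>, which replaces \<open>\<nu>\<close> by the larger
  numbers \<open>\<nu> / \<mu>\<close> with \<open>\<mu>\<close> an eigenvalue.  Expressing the solution on the ball by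
  its values on the image of an iterate of \<open>\<phi>\<close> shows that it is in the Hardy space.
\<close>

section \<open>Several complex variables\<close>

text \<open>For \<open>N > 1\<close> a holomorphic self-map of the ball need not induce a bounded
  composition operator, so boundedness has to come from the linear fractional form itself. The
  exponent \<open>N\<close> of the Szego kernel dictates the weight in that estimate: the kernel at
  the image points is compared after division by the \<open>N\<close>-th power of the denominator of
  \<phi>, which has no zero on the closed ball.

  A Hardy function may be unbounded near the sphere, and the image of a single application of \<phi>
  may still touch the sphere. Therefore solvability on \<Omega> is stated with estimates from one
  compact set to another whose constants do not depend on the data; this is what turns a pointwise
  solution into a bounded inverse.

  The passage from \<nu> to \<open>\<nu> / \<mu>\<close> stops because the eigenvalues have modulus
  at most some \<rho> < 1, and it never meets an excluded value because the set of products,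
  together with 0 and 1, is closed under multiplication by eigenvalues. The number 1 is excluded by
  the constant term \<open>k(0)\<close>, and 0 by the possibility that \<open>M\<close> is
  singular.\<close>

lemma norm_vec_smult: "norm (c *s v) = norm c * norm v" for c :: complex and v :: "complex ^ 'n"
  by (simp add: norm_vec_def L2_set_def norm_mult power_mult_distrib flip: sum_distrib_left
      real_sqrt_mult) (simp add: real_sqrt_mult)

lemma scaleR_eq_smult: "r *\<^sub>R v = complex_of_real r *s v" for v :: "complex ^ 'n"
proof -
  have "(r *\<^sub>R v) $ i = (complex_of_real r *s v) $ i" for i
    unfolding vector_scaleR_component vector_smult_component by (rule scaleR_conv_of_real)
  then show ?thesis by (simp add: vec_eq_iff)
qed

section \<open>Algebra of the Hermitian form\<close>

lemma cinner_add_left: "cinner (x + y) z = cinner x z + cinner y z"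
  by (simp add: cinner_def distrib_right sum.distrib)

lemma cinner_add_right: "cinner x (y + z) = cinner x y + cinner x z"
  by (simp add: cinner_def distrib_left sum.distrib)

lemma cinner_diff_left: "cinner (x - y) z = cinner x z - cinner y z"
  by (simp add: cinner_def left_diff_distrib sum_subtractf)

lemma cinner_diff_right: "cinner x (y - z) = cinner x y - cinner x z"
  by (simp add: cinner_def right_diff_distrib sum_subtractf)

lemma cinner_smult_left: "cinner (c *s x) y = c * cinner x y"
  by (simp add: cinner_def sum_distrib_left mult.assoc)

lemma cinner_smult_right: "cinner x (c *s y) = cnj c * cinner x y"
  by (simp add: cinner_def sum_distrib_left mult_ac)

lemma cinner_zero [simp]: "cinner 0 x = 0" "cinner x 0 = 0"
  by (simp_all add: cinner_def)

lemma cnj_cinner: "cnj (cinner x y) = cinner y x"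
  by (simp add: cinner_def mult.commute)

lemma cinner_self: "cinner x x = of_real ((norm x)\<^sup>2)"
  by (simp add: cinner_def norm_vec_def L2_set_def sum_nonneg complex_norm_square del: of_real_power)

lemma Re_cinner: "Re (cinner x y) = inner x y"
  by (simp add: cinner_def inner_vec_def inner_complex_def)

lemma norm_add_sq: "(norm (x + y))\<^sup>2 = (norm x)\<^sup>2 + 2 * Re (cinner x y) + (norm y)\<^sup>2"
  for x :: "complex ^ 'n"
  by (simp add: Re_cinner dot_norm field_simps)

lemma norm_cinner_le: "norm (cinner x y) \<le> norm x * norm y"
proof -
  have "norm (cinner x y) \<le> (\<Sum>i\<in>UNIV. \<bar>norm (x $ i)\<bar> * \<bar>norm (y $ i)\<bar>)"
    unfolding cinner_def by (rule order.trans[OF norm_sum]) (simp add: norm_mult)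
  also have "\<dots> \<le> norm x * norm y"
    unfolding norm_vec_def by (rule L2_set_mult_ineq)
  finally show ?thesis .
qed

lemma bounded_linear_cinner_left: "bounded_linear (\<lambda>x. cinner x y)"
  by (intro bounded_linear_intro[where K = "norm y"])
     (simp_all add: cinner_add_left scaleR_eq_smult cinner_smult_left norm_cinner_le scaleR_conv_of_real)

lemma continuous_on_cinner [continuous_intros]:
  assumes "continuous_on S f" "continuous_on S g"
  shows "continuous_on S (\<lambda>x. cinner (f x) (g x))"
  unfolding cinner_def by (intro continuous_intros assms)

lemma bounded_linear_matrix_vector_mult: "bounded_linear (\<lambda>x. A *v x)"
  for A :: "complex ^ 'n ^ 'm"
  by (intro linear_conv_bounded_linear[THEN iffD1] linearI)
     (simp_all add: matrix_vector_right_distrib scaleR_eq_smult matrix_vector_mult_scaleR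
        vector_scalar_commute)

lemma continuous_on_matrix_vector_mult_complex [continuous_intros]:
  "continuous_on S f \<Longrightarrow> continuous_on S (\<lambda>x. A *v f x)" for A :: "complex ^ 'n ^ 'm"
  using bounded_linear.continuous_on[OF bounded_linear_matrix_vector_mult] .

lemma continuous_on_vec_smult [continuous_intros]:
  assumes "continuous_on S f" "continuous_on S g"
  shows "continuous_on S (\<lambda>x. f x *s (g x :: complex ^ 'n))"
proof -
  have "continuous_on S (\<lambda>x. \<chi> i. f x * g x $ i)"
    by (intro continuous_intros assms)
  then show ?thesis
    by (simp add: vector_scalar_mult_def)
qed

lemma vec_eq_sum_axis: "v = (\<Sum>i\<in>UNIV. (v $ i) *s axis i 1)" for v :: "complex ^ 'n"
  by (simp add: vec_eq_iff axis_def if_distrib cong: if_cong)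

lemma norm_axis_complex [simp]: "norm (axis i (1::complex)) = 1"
proof -
  have "(\<Sum>j\<in>UNIV. (norm (axis i (1::complex) $ j))\<^sup>2) = (\<Sum>j\<in>UNIV. if j = i then 1 else 0)"
    by (intro sum.cong) (auto simp: axis_def)
  then show ?thesis by (simp add: norm_vec_def L2_set_def)
qed

lemma bounded_linear_smult_left: "bounded_linear (\<lambda>c. c *s v)" for v :: "complex ^ 'n"
  by (intro bounded_linear_intro[where K = "norm v"])
     (simp_all add: vector_sadd_rdistrib scaleR_eq_smult norm_vec_smult scaleR_conv_of_real)

section \<open>Holomorphy in several variables and its closure properties\<close>

definition cpartial :: "'n \<Rightarrow> (complex ^ 'n \<Rightarrow> complex) \<Rightarrow> complex ^ 'n \<Rightarrow> complex" where
  "cpartial i f z = deriv (\<lambda>c. f (z + c *s axis i 1)) 0"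

lemma mv_holomorphic_on_line:
  assumes "mv_holomorphic_on f S" "z + c *s v \<in> S"
  shows "(\<lambda>c. f (z + c *s v)) field_differentiable (at c)"
proof -
  obtain L where L: "(f has_derivative L) (at (z + c *s v))" "\<And>c v. L (c *s v) = c * L v"
    using assms unfolding mv_holomorphic_on_def by blast
  have "((\<lambda>c. z + c *s v) has_derivative (\<lambda>h. h *s v)) (at c)"
    by (auto intro!: derivative_eq_intros bounded_linear.has_derivative[OF bounded_linear_smult_left])
  from has_derivative_compose[OF this, of f L] L
  have "((\<lambda>c. f (z + c *s v)) has_derivative (\<lambda>h. L v * h)) (at c)"
    by (simp add: mult.commute)
  then show ?thesis
    unfolding field_differentiable_def has_field_derivative_def by auto
qed

lemma mv_holomorphic_on_imp_continuous_on: "mv_holomorphic_on f S \<Longrightarrow> continuous_on S f"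
  unfolding mv_holomorphic_on_def
  by (meson continuous_at_imp_continuous_on has_derivative_continuous)

text \<open>A complex-linear derivative is determined by its values on the coordinate vectors, and
  these are the slice derivatives.\<close>

lemma mv_holomorphic_on_has_derivative:
  assumes "mv_holomorphic_on f S" "z \<in> S"
  shows "(f has_derivative (\<lambda>v. \<Sum>i\<in>UNIV. v $ i * cpartial i f z)) (at z)"
proof -
  obtain L where L: "(f has_derivative L) (at z)" "\<And>c v. L (c *s v) = c * L v"
    using assms unfolding mv_holomorphic_on_def by blast
  have "L (axis i 1) = cpartial i f z" for i
  proof -
    have "((\<lambda>c. z + c *s axis i 1) has_derivative (\<lambda>h. h *s axis i 1)) (at 0)"
      by (auto intro!: derivative_eq_intros bounded_linear.has_derivative[OF bounded_linear_smult_left])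
    from has_derivative_compose[OF this, of f L] L
    have "((\<lambda>c. f (z + c *s axis i 1)) has_derivative (\<lambda>h. L (axis i 1) * h)) (at 0)"
      by (simp add: mult.commute)
    then show ?thesis
      unfolding cpartial_def by (intro DERIV_imp_deriv[symmetric]) (simp add: has_field_derivative_def)
  qed
  moreover have "L v = (\<Sum>i\<in>UNIV. v $ i * L (axis i 1))" for v
  proof -
    interpret bounded_linear L using L(1) has_derivative_bounded_linear by blast
    have "L v = L (\<Sum>i\<in>UNIV. (v $ i) *s axis i 1)"
      by (subst vec_eq_sum_axis[of v]) (rule refl)
    also have "\<dots> = (\<Sum>i\<in>UNIV. v $ i * L (axis i 1))"
      by (simp only: sum L(2))
    finally show ?thesis .
  qed
  ultimately show ?thesis
    using L(1) by (metis (no_types, lifting) ext sum.cong)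
qed

lemma mv_holomorphic_on_subset: "mv_holomorphic_on f S \<Longrightarrow> T \<subseteq> S \<Longrightarrow> mv_holomorphic_on f T"
  unfolding mv_holomorphic_on_def by blast

lemma mv_holomorphic_on_const [intro]: "mv_holomorphic_on (\<lambda>z. c) S"
  unfolding mv_holomorphic_on_def by (auto intro!: exI[of _ "\<lambda>v. 0"])

lemma mv_holomorphic_on_add:
  assumes "mv_holomorphic_on f S" "mv_holomorphic_on g S"
  shows "mv_holomorphic_on (\<lambda>z. f z + g z) S"
  unfolding mv_holomorphic_on_def
proof
  fix z assume "z \<in> S"
  then obtain L L' where L: "(f has_derivative L) (at z)" "\<And>c v. L (c *s v) = c * L v"
      "(g has_derivative L') (at z)" "\<And>c v. L' (c *s v) = c * L' v"
    using assms unfolding mv_holomorphic_on_def by meson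
  show "\<exists>L. ((\<lambda>z. f z + g z) has_derivative L) (at z) \<and> (\<forall>c v. L (c *s v) = c * L v)"
    by (rule exI[of _ "\<lambda>v. L v + L' v"]) (simp add: L has_derivative_add distrib_left)
qed

lemma mv_holomorphic_on_mult:
  assumes "mv_holomorphic_on f S" "mv_holomorphic_on g S"
  shows "mv_holomorphic_on (\<lambda>z. f z * g z) S"
  unfolding mv_holomorphic_on_def
proof
  fix z assume "z \<in> S"
  then obtain L L' where L: "(f has_derivative L) (at z)" "\<And>c v. L (c *s v) = c * L v"
      "(g has_derivative L') (at z)" "\<And>c v. L' (c *s v) = c * L' v"
    using assms unfolding mv_holomorphic_on_def by meson
  show "\<exists>L. ((\<lambda>z. f z * g z) has_derivative L) (at z) \<and> (\<forall>c v. L (c *s v) = c * L v)"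
    by (intro exI[of _ "\<lambda>v. f z * L' v + L v * g z"] conjI has_derivative_mult L)
       (simp add: L algebra_simps)
qed

lemma mv_holomorphic_on_cmult: "mv_holomorphic_on f S \<Longrightarrow> mv_holomorphic_on (\<lambda>z. c * f z) S"
  by (intro mv_holomorphic_on_mult mv_holomorphic_on_const)

lemma mv_holomorphic_on_diff:
  assumes "mv_holomorphic_on f S" "mv_holomorphic_on g S"
  shows "mv_holomorphic_on (\<lambda>z. f z - g z) S"
  using mv_holomorphic_on_add[OF assms(1) mv_holomorphic_on_cmult[OF assms(2), of "-1"]] by simp

lemma mv_holomorphic_on_sum:
  "(\<And>i. i \<in> I \<Longrightarrow> mv_holomorphic_on (f i) S) \<Longrightarrow> mv_holomorphic_on (\<lambda>z. \<Sum>i\<in>I. f i z) S"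
  by (induction I rule: infinite_finite_induct) (auto intro: mv_holomorphic_on_add)

lemma mv_holomorphic_on_inverse:
  assumes "mv_holomorphic_on f S" "\<And>z. z \<in> S \<Longrightarrow> f z \<noteq> 0"
  shows "mv_holomorphic_on (\<lambda>z. inverse (f z)) S"
  unfolding mv_holomorphic_on_def
proof
  fix z assume z: "z \<in> S"
  then obtain L where L: "(f has_derivative L) (at z)" "\<And>c v. L (c *s v) = c * L v"
    using assms unfolding mv_holomorphic_on_def by meson
  show "\<exists>L. ((\<lambda>z. inverse (f z)) has_derivative L) (at z) \<and> (\<forall>c v. L (c *s v) = c * L v)"
    by (rule exI[of _ "\<lambda>v. - (inverse (f z) * L v * inverse (f z))"])
       (auto simp: L assms(2)[OF z] intro!: has_derivative_inverse)
qed

lemma mv_holomorphic_on_linear: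
  assumes "bounded_linear f" "\<And>c v. f (c *s v) = c * f v"
  shows "mv_holomorphic_on f S"
  unfolding mv_holomorphic_on_def using assms bounded_linear_imp_has_derivative by blast

lemma mv_holomorphic_on_nth: "mv_holomorphic_on (\<lambda>z. z $ i) S"
  by (rule mv_holomorphic_on_linear) auto

lemma mv_holomorphic_on_compose:
  assumes f: "mv_holomorphic_on f T" and g: "\<And>i. mv_holomorphic_on (\<lambda>z. g z $ i) S"
    and sub: "\<And>z. z \<in> S \<Longrightarrow> g z \<in> T"
  shows "mv_holomorphic_on (\<lambda>z. f (g z)) S"
  unfolding mv_holomorphic_on_def
proof
  fix z assume z: "z \<in> S"
  then have "\<forall>i. \<exists>L. ((\<lambda>z. g z $ i) has_derivative L) (at z) \<and> (\<forall>c v. L (c *s v) = c * L v)"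
    using g unfolding mv_holomorphic_on_def by blast
  then obtain L where L: "\<And>i. ((\<lambda>z. g z $ i) has_derivative L i) (at z)"
    "\<And>i c v. L i (c *s v) = c * L i v" by metis
  obtain L' where L': "(f has_derivative L') (at (g z))" "\<And>c v. L' (c *s v) = c * L' v"
    using f sub[OF z] unfolding mv_holomorphic_on_def by blast
  have "(g has_derivative (\<lambda>v. \<chi> i. L i v)) (at z)"
    using L(1) by (subst has_derivative_componentwise_within)
      (auto simp: Basis_vec_def inner_axis has_derivative_inner_left)
  from has_derivative_compose[OF this L'(1)]
  have "((\<lambda>z. f (g z)) has_derivative (\<lambda>v. L' (\<chi> i. L i v))) (at z)" .
  moreover have "(\<chi> i. L i (c *s v)) = c *s (\<chi> i. L i v)" for c v
    by (simp add: vec_eq_iff L(2))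
  ultimately show "\<exists>L. ((\<lambda>z. f (g z)) has_derivative L) (at z) \<and> (\<forall>c v. L (c *s v) = c * L v)"
    using L'(2) by (intro exI[of _ "\<lambda>v. L' (\<chi> i. L i v)"]) auto
qed

lemma mv_holomorphic_on_cong:
  assumes "open S" "\<And>z. z \<in> S \<Longrightarrow> f z = g z"
  shows "mv_holomorphic_on f S \<longleftrightarrow> mv_holomorphic_on g S"
proof -
  have "(f has_derivative L) (at z) \<longleftrightarrow> (g has_derivative L) (at z)" if "z \<in> S" for z L
    using has_derivative_transform_within_open[of f L z UNIV S g]
      has_derivative_transform_within_open[of g L z UNIV S f] assms that by auto
  then show ?thesis unfolding mv_holomorphic_on_def by auto
qed

section \<open>Separate holomorphy and holomorphic partial derivatives\<close>

lemma coord_holomorphic: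
  assumes "\<And>z. z \<in> S \<Longrightarrow> (\<lambda>c. f (z + c *s axis i 1)) field_differentiable (at 0)"
    and "z + c *s axis i 1 \<in> S"
  shows "((\<lambda>c. f (z + c *s axis i 1)) has_field_derivative cpartial i f (z + c *s axis i 1)) (at c)"
proof -
  let ?w = "z + c *s axis i 1"
  have "((\<lambda>c. f (?w + c *s axis i 1)) has_field_derivative cpartial i f ?w) (at (c - c))"
    using assms(1)[OF assms(2)] unfolding cpartial_def
    by (simp add: field_differentiable_derivI)
  moreover have "((\<lambda>x. x - c) has_field_derivative 1) (at c)"
    by (auto intro!: derivative_eq_intros)
  ultimately have "((\<lambda>x. f (?w + (x - c) *s axis i 1)) has_field_derivative cpartial i f ?w * 1) (at c)"
    by (rule DERIV_chain2)
  then show ?thesis by (simp add: vec.scale_left_diff_distrib)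
qed

lemma open_contains_double_cball:
  fixes z :: "'a::metric_space"
  assumes "open S" "z \<in> S"
  obtains e where "e > 0" "cball z (2 * e) \<subseteq> S"
proof -
  obtain d where "d > 0" "cball z d \<subseteq> S"
    using assms open_contains_cball by blast
  then show ?thesis using that[of "d / 2"] by simp
qed

text \<open>The difference of the slices through two nearby points is uniformly small on a circle of
  fixed radius, so Cauchy's inequality makes the difference of their derivatives at 0 small.\<close>

lemma cpartial_continuous_on:
  assumes "open S" and f: "continuous_on S f"
    and "\<And>z. z \<in> S \<Longrightarrow> (\<lambda>c. f (z + c *s axis i 1)) field_differentiable (at 0)"
  shows "continuous_on S (cpartial i f)"
proof (rule continuous_at_imp_continuous_on, intro ballI)
  fix z assume "z \<in> S"
  then obtain e where e: "e > 0" "cball z (2 * e) \<subseteq> S"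
    using \<open>open S\<close> open_contains_double_cball by blast
  have uc: "uniformly_continuous_on (cball z (2 * e)) f"
    using f e(2) by (intro compact_uniformly_continuous continuous_on_subset[OF f]) auto
  show "isCont (cpartial i f) z"
    unfolding continuous_at_eps_delta
  proof (intro allI impI)
    fix \<eta> :: real assume "\<eta> > 0"
    \<comment> \<open>Cauchy's inequality divides by \<open>e\<close>; the factor 1/2 turns the
      resulting weak inequality into a strict one.\<close>
    define \<eta>' where "\<eta>' = \<eta> * e / 2"
    have "\<eta>' > 0" using \<open>\<eta> > 0\<close> e by (simp add: \<eta>'_def)
    then obtain d where d: "d > 0"
      "\<And>x y. x \<in> cball z (2*e) \<Longrightarrow> y \<in> cball z (2*e) \<Longrightarrow> dist y x < d \<Longrightarrow> dist (f y) (f x) < \<eta>'"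
      using uc unfolding uniformly_continuous_on_def by metis
    show "\<exists>d>0. \<forall>w. dist w z < d \<longrightarrow> dist (cpartial i f w) (cpartial i f z) < \<eta>"
    proof (intro exI[of _ "min d e"] conjI allI impI)
      fix w assume w: "dist w z < min d e"
      have in_ball: "w + c *s axis i 1 \<in> cball z (2*e)" "z + c *s axis i 1 \<in> cball z (2*e)"
        if "norm c \<le> e" for c
      proof -
        have "norm (w - z + c *s axis i 1) \<le> norm (w - z) + norm (c *s axis i (1::complex))"
          by (rule norm_triangle_ineq)
        with w that e show "w + c *s axis i 1 \<in> cball z (2*e)"
          by (simp add: dist_norm norm_vec_smult norm_minus_commute algebra_simps)
        show "z + c *s axis i 1 \<in> cball z (2*e)"
          using that e by (simp add: dist_norm norm_vec_smult)
      qed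
      define H where "H c = f (w + c *s axis i 1) - f (z + c *s axis i 1)" for c
      have der: "(H has_field_derivative (cpartial i f (w + c *s axis i 1) - cpartial i f (z + c *s axis i 1))) (at c)"
        if "norm c \<le> e" for c
        unfolding H_def using in_ball[OF that] e(2)
        by (intro derivative_intros coord_holomorphic[OF assms(3)]) auto
      have "norm ((deriv ^^ 1) H 0) \<le> fact 1 * \<eta>' / e ^ 1"
      proof (rule Cauchy_inequality)
        show "H holomorphic_on ball 0 e"
          unfolding holomorphic_on_def field_differentiable_def
          using has_field_derivative_at_within[OF der] by (metis less_imp_le mem_ball_0)
        show "continuous_on (cball 0 e) H"
          by (rule continuous_at_imp_continuous_on) (auto intro!: DERIV_isCont der)
        show "norm (H x) \<le> \<eta>'" if "norm (0 - x) = e" for x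
          using d(2)[OF in_ball(2)[of x] in_ball(1)[of x]] that w
          by (simp add: H_def dist_norm less_imp_le algebra_simps)
      qed (use e in auto)
      moreover have "deriv H 0 = cpartial i f w - cpartial i f z"
        using der[of 0] e by (intro DERIV_imp_deriv) auto
      ultimately have "dist (cpartial i f w) (cpartial i f z) \<le> \<eta> / 2"
        using e by (simp add: \<eta>'_def dist_norm)
      then show "dist (cpartial i f w) (cpartial i f z) < \<eta>" using \<open>\<eta> > 0\<close> by linarith
    qed (use d e in auto)
  qed
qed

text \<open>Separate holomorphy and continuity give continuous complex partial derivatives, hence
  total differentiability.\<close>

proposition mv_holomorphic_onI_coord:
  assumes "open S" and f: "continuous_on S f"
    and fd: "\<And>z i. z \<in> S \<Longrightarrow> (\<lambda>c. f (z + c *s axis i 1)) field_differentiable (at 0)"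
  shows "mv_holomorphic_on f S"
  unfolding mv_holomorphic_on_def
proof
  fix z assume "z \<in> S"
  then obtain e where e: "e > 0" "ball z e \<subseteq> S"
    using \<open>open S\<close> open_contains_ball by blast
  let ?h = "\<lambda>I h. \<Sum>i\<in>I. (h $ i) *s axis i 1 :: complex ^ 'a"
  have hle: "norm (?h I h) \<le> norm h" if "finite I" for I and h :: "complex ^ 'a"
  proof -
    have "?h I h $ j = (if j \<in> I then h $ j else 0)" for j
      using that by (simp add: axis_def if_distrib cong: if_cong)
    then show ?thesis
      by (intro norm_le_componentwise_cart) simp
  qed
  \<comment> \<open>Telescoping: the coordinates of the increment are switched on one at a time, and
    each switch is a mean value estimate along one slice.\<close>
  have approx: "\<exists>d>0. \<forall>h. norm h < d \<longrightarrow>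
      norm (f (z + ?h I h) - f z - (\<Sum>i\<in>I. h $ i * cpartial i f z)) \<le> \<eta> * norm h"
    if "finite I" "\<eta> > 0" for I \<eta>
    using that
  proof (induction I arbitrary: \<eta> rule: finite_induct)
    case empty
    then show ?case by (auto intro!: exI[of _ 1])
  next
    case (insert j I)
    obtain d1 where d1: "d1 > 0" "\<And>h. norm h < d1 \<Longrightarrow>
      norm (f (z + ?h I h) - f z - (\<Sum>i\<in>I. h $ i * cpartial i f z)) \<le> \<eta>/2 * norm h"
      using insert.IH[of "\<eta>/2"] insert.prems by auto
    have "isCont (cpartial j f) z"
      using cpartial_continuous_on[OF \<open>open S\<close> f fd] \<open>z \<in> S\<close> \<open>open S\<close>
      by (simp add: continuous_on_eq_continuous_at)
    then obtain d2 where d2: "d2 > 0"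
      "\<And>w. dist w z < d2 \<Longrightarrow> dist (cpartial j f w) (cpartial j f z) < \<eta>/2"
      unfolding continuous_at_eps_delta using insert.prems by (metis half_gt_zero)
    show ?case
    \<comment> \<open>The halving accounts for the displacement by the earlier coordinates plus that
      along the current slice, each of norm at most \<open>norm h\<close>.\<close>
    proof (intro exI[of _ "min d1 (min d2 e / 2)"] conjI allI impI)
      fix h :: "complex ^ 'a" assume h: "norm h < min d1 (min d2 e / 2)"
      let ?w = "z + ?h I h"
      let ?G = "\<lambda>c. f (?w + c *s axis j 1) - c * cpartial j f z"
      have w: "dist (?w + c *s axis j 1) z < d2" "dist (?w + c *s axis j 1) z < e"
        if "norm c \<le> norm h" for c
      proof -
        have "norm (?h I h + c *s axis j 1) \<le> norm (?h I h) + norm c"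
          using norm_triangle_ineq[of "?h I h" "c *s axis j 1"] by (simp add: norm_vec_smult)
        also have "\<dots> \<le> 2 * norm h" using hle[OF insert.hyps(1), of h] that by simp
        finally show "dist (?w + c *s axis j 1) z < d2" "dist (?w + c *s axis j 1) z < e"
          using h by (auto simp: dist_norm add.assoc)
      qed
      have hj: "norm (h $ j) \<le> norm h" by (rule Finite_Cartesian_Product.norm_nth_le)
      have "norm (?G (h $ j) - ?G 0) \<le> \<eta>/2 * norm (h $ j - 0)"
      proof (rule field_differentiable_bound[where S = "cball 0 (norm h)"])
        fix c :: complex assume c: "c \<in> cball 0 (norm h)"
        have "(?G has_field_derivative (cpartial j f (?w + c *s axis j 1) - cpartial j f z)) (at c)"
          using w[of c] c e(2)
          by (auto intro!: derivative_eq_intros coord_holomorphic[OF fd] simp: dist_commute subset_iff)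
        then show "(?G has_field_derivative (cpartial j f (?w + c *s axis j 1) - cpartial j f z))
          (at c within cball 0 (norm h))" by (rule has_field_derivative_at_within)
        show "norm (cpartial j f (?w + c *s axis j 1) - cpartial j f z) \<le> \<eta>/2"
          using d2(2)[OF w(1)] c by (simp add: dist_norm less_imp_le)
      qed (use hj in auto)
      moreover have "\<eta>/2 * norm (h $ j) \<le> \<eta>/2 * norm h"
        using hj insert.prems by (intro mult_left_mono) auto
      moreover have "norm (f ?w - f z - (\<Sum>i\<in>I. h $ i * cpartial i f z)) \<le> \<eta>/2 * norm h"
        using d1(2)[of h] h by simp
      ultimately have "norm ((?G (h $ j) - ?G 0) + (f ?w - f z - (\<Sum>i\<in>I. h $ i * cpartial i f z)))
          \<le> \<eta> * norm h"
        by (intro order.trans[OF norm_triangle_ineq]) simp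
      moreover have "f (z + ?h (insert j I) h) - f z - (\<Sum>i\<in>insert j I. h $ i * cpartial i f z)
         = (?G (h $ j) - ?G 0) + (f ?w - f z - (\<Sum>i\<in>I. h $ i * cpartial i f z))"
        using insert.hyps by (simp add: algebra_simps)
      ultimately show "norm (f (z + ?h (insert j I) h) - f z - (\<Sum>i\<in>insert j I. h $ i * cpartial i f z)) \<le> \<eta> * norm h"
        by (simp only:)
    qed (use d1 d2 e in auto)
  qed
  let ?L = "\<lambda>h. \<Sum>i\<in>UNIV. h $ i * cpartial i f z"
  have "(f has_derivative ?L) (at z)"
    unfolding has_derivative_at_alt
  proof (intro conjI allI impI)
    show "bounded_linear ?L"
      by (intro bounded_linear_sum bounded_linear_mult_const bounded_linear_vec_nth)
    fix \<eta> :: real assume "\<eta> > 0"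
    then obtain d where d: "d > 0" "\<And>h. norm h < d \<Longrightarrow>
      norm (f (z + ?h UNIV h) - f z - ?L h) \<le> \<eta> * norm h"
      using approx[of UNIV \<eta>] by auto
    show "\<exists>d>0. \<forall>y. norm (y - z) < d \<longrightarrow> norm (f y - f z - ?L (y - z)) \<le> \<eta> * norm (y - z)"
    proof (intro exI[of _ d] conjI allI impI d(1))
      fix y assume "norm (y - z) < d"
      from d(2)[OF this] show "norm (f y - f z - ?L (y - z)) \<le> \<eta> * norm (y - z)"
        by (simp only: vec_eq_sum_axis[symmetric] diff_add_cancel add_diff_cancel_left' add_diff_eq)
    qed
  qed
  then show "\<exists>L. (f has_derivative L) (at z) \<and> (\<forall>c v. L (c *s v) = c * L v)"
    by (intro exI[of _ ?L]) (simp add: sum_distrib_left mult_ac)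
qed

lemma mv_holomorphic_on_coord_differentiable:
  assumes "mv_holomorphic_on f S" "z \<in> S"
  shows "(\<lambda>c. f (z + c *s axis i 1)) field_differentiable (at 0)"
  using mv_holomorphic_on_line[OF assms(1), of z 0] assms(2) by simp

text \<open>Weierstrass' theorem: the limit is continuous, and its slices are locally uniform limits
  of holomorphic functions of one variable.\<close>

lemma mv_holomorphic_on_uniform_limit:
  assumes "open S" and hol: "\<And>n. mv_holomorphic_on (f n) S"
    and lim: "\<And>z. z \<in> S \<Longrightarrow> \<exists>d>0. cball z d \<subseteq> S \<and> uniform_limit (cball z d) f g sequentially"
  shows "mv_holomorphic_on g S"
proof (rule mv_holomorphic_onI_coord[OF \<open>open S\<close>])
  show "continuous_on S g"
  proof (rule continuous_at_imp_continuous_on, intro ballI)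
    fix z assume "z \<in> S"
    then obtain d where d: "d > 0" "cball z d \<subseteq> S" "uniform_limit (cball z d) f g sequentially"
      using lim by blast
    have "continuous_on (cball z d) g"
      by (rule uniform_limit_theorem[OF _ d(3)])
         (auto intro!: always_eventually continuous_on_subset[OF mv_holomorphic_on_imp_continuous_on[OF hol] d(2)])
    then show "isCont g z"
      using d(1) by (meson centre_in_ball ball_subset_cball continuous_on_eq_continuous_at
        continuous_on_subset open_ball)
  qed
  fix z i assume "z \<in> S"
  then obtain d where d: "d > 0" "cball z d \<subseteq> S" "uniform_limit (cball z d) f g sequentially"
    using lim by blast
  let ?p = "\<lambda>c. z + c *s axis i 1"
  have p: "?p c \<in> cball z d" if "norm c \<le> d" for c
    using that by (simp add: dist_norm norm_vec_smult)
  have "(\<lambda>c. g (?p c)) holomorphic_on ball 0 d"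
  proof (rule holomorphic_uniform_sequence[where f = "\<lambda>n c. f n (?p c)"])
    show "(\<lambda>c. f n (?p c)) holomorphic_on ball 0 d" for n
      using p d(2) by (auto simp: holomorphic_on_def intro!: field_differentiable_at_within
        mv_holomorphic_on_line[OF hol])
    show "\<exists>e>0. cball c e \<subseteq> ball 0 d \<and> uniform_limit (cball c e) (\<lambda>n c. f n (?p c)) (\<lambda>c. g (?p c)) sequentially"
      if c: "c \<in> ball 0 d" for c
    proof -
      obtain e where e: "e > 0" "cball c e \<subseteq> ball 0 d"
        using c open_contains_cball by blast
      moreover have "uniform_limit (cball c e) (\<lambda>n c. f n (?p c)) (\<lambda>c. g (?p c)) sequentially"
        by (rule uniform_limit_compose'[OF d(3)]) (use p e in fastforce)
      ultimately show ?thesis by blast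
    qed
  qed auto
  then show "(\<lambda>c. g (?p c)) field_differentiable (at 0)"
    using d(1) by (simp add: holomorphic_on_imp_differentiable_at)
qed

text \<open>A partial derivative is a locally uniform limit of difference quotients, which are
  holomorphic; the convergence is uniform because the partial derivative is uniformly continuous on
  a compact ball.\<close>

lemma mv_holomorphic_on_cpartial:
  assumes "open S" and hol: "mv_holomorphic_on f S"
  shows "mv_holomorphic_on (cpartial i f) S"
proof -
  have cont: "continuous_on S (cpartial i f)"
    by (rule cpartial_continuous_on[OF \<open>open S\<close> mv_holomorphic_on_imp_continuous_on[OF hol]
          mv_holomorphic_on_coord_differentiable[OF hol]])
  have fd: "(\<lambda>c. f (z + c *s axis i 1)) field_differentiable (at 0)" if "z \<in> S" for z i
    by (rule mv_holomorphic_on_coord_differentiable[OF hol that])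
  have local: "\<exists>e>0. mv_holomorphic_on (cpartial i f) (ball z e)" if z: "z \<in> S" for z
  proof -
    obtain e where e: "e > 0" "cball z (2 * e) \<subseteq> S"
      using \<open>open S\<close> z open_contains_double_cball by blast
    have uc: "uniformly_continuous_on (cball z (2 * e)) (cpartial i f)"
      by (intro compact_uniformly_continuous continuous_on_subset[OF cont] e) auto
    \<comment> \<open>The offset 2 keeps every step strictly below \<open>e\<close>, so that shifted
      points stay in the ball of radius \<open>2 * e\<close>.\<close>
    define h where "h n = e / real (n + 2)" for n :: nat
    have h: "0 < h n" "h n < e" for n
      using e by (auto simp: h_def divide_simps)
    have h0: "h \<longlonglongrightarrow> 0"
      unfolding h_def by real_asymp
    define q where "q n w = (f (w + of_real (h n) *s axis i 1) - f w) / of_real (h n)" for n w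
    have inb: "w + c *s axis i 1 \<in> cball z (2 * e)" if "dist z w < e" "norm c \<le> e" for w c
    proof -
      have "norm (w - z + c *s axis i 1) \<le> norm (w - z) + norm (c *s axis i (1::complex))"
        by (rule norm_triangle_ineq)
      with that e show ?thesis
        by (simp add: dist_norm norm_vec_smult norm_minus_commute algebra_simps)
    qed
    have "mv_holomorphic_on (cpartial i f) (ball z e)"
    proof (rule mv_holomorphic_on_uniform_limit[where f = q])
      show "mv_holomorphic_on (q n) (ball z e)" for n
      proof -
        have "mv_holomorphic_on (\<lambda>w. f (w + of_real (h n) *s axis i 1)) (ball z e)"
          by (rule mv_holomorphic_on_compose[OF hol])
             (use h[of n] inb[of _ "of_real (h n)"] e in \<open>auto simp: subset_iff less_imp_le
                intro!: mv_holomorphic_on_add mv_holomorphic_on_nth\<close>)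
        moreover have "ball z e \<subseteq> S" using e by force
        ultimately have "mv_holomorphic_on (\<lambda>w. (1 / of_real (h n)) * (f (w + of_real (h n) *s axis i 1) - f w)) (ball z e)"
          by (intro mv_holomorphic_on_cmult mv_holomorphic_on_diff) (auto intro: mv_holomorphic_on_subset[OF hol])
        then show ?thesis by (simp add: q_def[abs_def])
      qed
      fix w assume w: "w \<in> ball z e"
      then obtain d where d: "d > 0" "cball w d \<subseteq> ball z e"
        using open_contains_cball by blast
      have "uniform_limit (ball z e) q (cpartial i f) sequentially"
        unfolding uniform_limit_iff
      proof (intro allI impI)
        fix \<eta> :: real assume "\<eta> > 0"
        then obtain d where d: "d > 0" "\<And>x y. x \<in> cball z (2*e) \<Longrightarrow> y \<in> cball z (2*e) \<Longrightarrow>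
           dist y x < d \<Longrightarrow> dist (cpartial i f y) (cpartial i f x) < \<eta> / 2"
          using uc unfolding uniformly_continuous_on_def by (metis half_gt_zero)
        have "eventually (\<lambda>n. h n < d) sequentially"
          using order_tendstoD(2)[OF h0 d(1)] .
        then show "eventually (\<lambda>n. \<forall>w\<in>ball z e. dist (q n w) (cpartial i f w) < \<eta>) sequentially"
        proof eventually_elim
          case (elim n)
          show ?case
          proof
            fix w assume w: "w \<in> ball z e"
            let ?G = "\<lambda>c. f (w + c *s axis i 1) - c * cpartial i f w"
            have "norm (?G (of_real (h n)) - ?G 0) \<le> \<eta>/2 * norm (of_real (h n) - 0 :: complex)"
            proof (rule field_differentiable_bound[where S = "cball 0 (h n)"])
              fix c :: complex assume c: "c \<in> cball 0 (h n)"
              have c': "norm c \<le> e" using c h[of n] by simp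
              have "w + c *s axis i 1 \<in> S" using inb[OF _ c', of w] w e(2) by auto
              then have "((\<lambda>c. f (w + c *s axis i 1)) has_field_derivative
                  cpartial i f (w + c *s axis i 1)) (at c)"
                using coord_holomorphic[of S f i w c] fd by blast
              from DERIV_diff[OF this DERIV_cmult_right[OF DERIV_ident, of "cpartial i f w"]]
              have "(?G has_field_derivative (cpartial i f (w + c *s axis i 1) - cpartial i f w)) (at c)"
                by simp
              then show "(?G has_field_derivative (cpartial i f (w + c *s axis i 1) - cpartial i f w))
                (at c within cball 0 (h n))" by (rule has_field_derivative_at_within)
              have "dist (cpartial i f (w + c *s axis i 1)) (cpartial i f w) < \<eta>/2"
                by (rule d(2)) (use inb[OF _ c', of w] w c elim inb[of w 0] e in
                   \<open>auto simp: dist_norm norm_vec_smult\<close>)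
              then show "norm (cpartial i f (w + c *s axis i 1) - cpartial i f w) \<le> \<eta>/2"
                by (simp add: dist_norm)
            qed (use h[of n] in auto)
            then have "norm (f (w + of_real (h n) *s axis i 1) - f w - of_real (h n) * cpartial i f w) \<le> \<eta>/2 * h n"
              using h[of n] by (simp add: algebra_simps)
            moreover have "q n w - cpartial i f w
               = (f (w + of_real (h n) *s axis i 1) - f w - of_real (h n) * cpartial i f w) / of_real (h n)"
              using h[of n] by (simp add: q_def field_simps)
            ultimately have "norm (q n w - cpartial i f w) \<le> \<eta>/2"
              using h[of n] by (simp only: norm_divide norm_of_real) (simp add: divide_simps mult.commute)
            then show "dist (q n w) (cpartial i f w) < \<eta>"
              using \<open>\<eta> > 0\<close> by (simp add: dist_norm)
          qed
        qed
      qed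
      then show "\<exists>d>0. cball w d \<subseteq> ball z e \<and> uniform_limit (cball w d) q (cpartial i f) sequentially"
        using d uniform_limit_on_subset by blast
    qed auto
    then show ?thesis using e(1) by blast
  qed
  show ?thesis
    unfolding mv_holomorphic_on_def
  proof
    fix z assume "z \<in> S"
    then obtain e where "e > 0" "mv_holomorphic_on (cpartial i f) (ball z e)" using local by blast
    then show "\<exists>L. (cpartial i f has_derivative L) (at z) \<and> (\<forall>c v. L (c *s v) = c * L v)"
      unfolding mv_holomorphic_on_def using centre_in_ball by blast
  qed
qed

lemma mv_holomorphic_on_chain:
  assumes "mv_holomorphic_on f S" "z + c *s v \<in> S"
  shows "((\<lambda>c. f (z + c *s v)) has_field_derivative
      (\<Sum>i\<in>UNIV. v $ i * cpartial i f (z + c *s v))) (at c)"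
proof -
  have "((\<lambda>c. z + c *s v) has_derivative (\<lambda>h. h *s v)) (at c)"
    by (auto intro!: derivative_eq_intros bounded_linear.has_derivative[OF bounded_linear_smult_left])
  from has_derivative_compose[OF this mv_holomorphic_on_has_derivative[OF assms]]
  show ?thesis
    unfolding has_field_derivative_def
    by (rule has_derivative_eq_rhs) (auto simp: fun_eq_iff sum_distrib_left sum_distrib_right mult_ac)
qed

section \<open>Hadamard's lemma with holomorphic coefficients\<close>

definition hadamard :: "'n \<Rightarrow> (complex ^ 'n \<Rightarrow> complex) \<Rightarrow> complex ^ 'n \<Rightarrow> complex" where
  "hadamard i f z = integral {0..1} (\<lambda>t. cpartial i f (t *\<^sub>R z))"

lemma hadamard_integrand_continuous:
  assumes "mv_holomorphic_on f S" "\<And>t z. z \<in> S \<Longrightarrow> t \<in> {0..1} \<Longrightarrow> t *\<^sub>R z \<in> S"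
  shows "continuous_on (S \<times> {0..1::real}) (\<lambda>(z, t). f (t *\<^sub>R z))"
  unfolding case_prod_beta
  by (rule continuous_on_compose2[OF mv_holomorphic_on_imp_continuous_on[OF assms(1)]])
     (auto intro!: continuous_intros assms(2))

text \<open>Integration over \<open>{0..1}\<close> of the derivative of f along the segment from 0
  to z, which lies in S by star-shapedness.\<close>

lemma hadamard_decomposition:
  assumes "open S" "mv_holomorphic_on f S"
    and star: "\<And>t z. z \<in> S \<Longrightarrow> t \<in> {0..1} \<Longrightarrow> t *\<^sub>R z \<in> S" and z: "z \<in> S"
  shows "f z = f 0 + (\<Sum>i\<in>UNIV. z $ i * hadamard i f z)"
proof -
  have int: "(\<lambda>t. cpartial i f (t *\<^sub>R z)) integrable_on {0..1}" for i
  proof -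
    have "continuous_on {0..1} (\<lambda>t. cpartial i f (t *\<^sub>R z))"
      by (rule continuous_on_compose2[OF mv_holomorphic_on_imp_continuous_on[OF
          mv_holomorphic_on_cpartial[OF assms(1,2)]]]) (auto intro!: continuous_intros star z)
    then show ?thesis by (rule integrable_continuous_real)
  qed
  have "((\<lambda>t. \<Sum>i\<in>UNIV. z $ i * cpartial i f (t *\<^sub>R z)) has_integral f (1 *\<^sub>R z) - f (0 *\<^sub>R z)) {0..1}"
  proof (rule fundamental_theorem_of_calculus)
    fix t :: real assume t: "t \<in> {0..1}"
    have "((\<lambda>c. f (0 + c *s z)) has_field_derivative
      (\<Sum>i\<in>UNIV. z $ i * cpartial i f (0 + of_real t *s z))) (at (of_real t))"
      by (rule mv_holomorphic_on_chain[OF assms(2)]) (use star[OF z t] in \<open>simp add: scaleR_eq_smult\<close>)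
    then have "((\<lambda>t. f (of_real t *s z)) has_vector_derivative
      (\<Sum>i\<in>UNIV. z $ i * cpartial i f (of_real t *s z))) (at t)"
      by (intro has_vector_derivative_real_field) simp
    then show "((\<lambda>t. f (t *\<^sub>R z)) has_vector_derivative
       (\<Sum>i\<in>UNIV. z $ i * cpartial i f (t *\<^sub>R z))) (at t within {0..1})"
      by (simp add: scaleR_eq_smult has_vector_derivative_at_within)
  qed simp
  then have "f z - f 0 = integral {0..1} (\<lambda>t. \<Sum>i\<in>UNIV. z $ i * cpartial i f (t *\<^sub>R z))"
    by (simp add: integral_unique)
  also have "\<dots> = (\<Sum>i\<in>UNIV. z $ i * hadamard i f z)"
    using int by (subst integral_sum) (auto simp: hadamard_def intro!: integrable_on_mult_right)
  finally show ?thesis by (simp add: algebra_simps)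
qed

text \<open>Continuity in the parameter and differentiation under the integral along each slice;
  separate holomorphy together with continuity then suffices.\<close>

lemma mv_holomorphic_on_hadamard:
  assumes "open S" "mv_holomorphic_on f S"
    and star: "\<And>t z. z \<in> S \<Longrightarrow> t \<in> {0..1} \<Longrightarrow> t *\<^sub>R z \<in> S"
  shows "mv_holomorphic_on (hadamard i f) S"
proof (rule mv_holomorphic_onI_coord[OF \<open>open S\<close>])
  note hol = mv_holomorphic_on_cpartial[OF assms(1,2)]
  note cont = hadamard_integrand_continuous[OF hol star]
  show "continuous_on S (hadamard i f)"
    unfolding hadamard_def
    using integral_continuous_on_param[of S 0 1 "\<lambda>z t. cpartial i f (t *\<^sub>R z)"] cont by simp
  fix z j assume "z \<in> S"
  then obtain e where e: "e > 0" "ball z e \<subseteq> S"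
    using \<open>open S\<close> open_contains_ball by blast
  have inS: "z + c *s axis j 1 \<in> S" if "c \<in> ball 0 e" for c
    using that e by (auto simp: dist_norm norm_vec_smult subset_iff)
  have "(\<lambda>c. integral (cbox 0 1) (\<lambda>t::real. cpartial i f (t *\<^sub>R (z + c *s axis j 1)))) holomorphic_on ball 0 e"
  proof (rule leibniz_rule_holomorphic)
    show "((\<lambda>c. cpartial i f (t *\<^sub>R (z + c *s axis j 1))) has_field_derivative
        of_real t * cpartial j (cpartial i f) (t *\<^sub>R (z + c *s axis j 1))) (at c within ball 0 e)"
      if "c \<in> ball 0 e" "t \<in> cbox 0 1" for c t
    proof -
      have eq: "t *\<^sub>R (z + c *s axis j 1) = t *\<^sub>R z + c *s (of_real t *s axis j 1)" for c
        by (simp add: scaleR_eq_smult vector_add_ldistrib vector_smult_assoc mult.commute)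
      have "t *\<^sub>R (z + c *s axis j 1) \<in> S" using star inS that by simp
      from mv_holomorphic_on_chain[OF hol, of "t *\<^sub>R z" c "of_real t *s axis j 1" i] this
      have "((\<lambda>c. cpartial i f (t *\<^sub>R (z + c *s axis j 1))) has_field_derivative
        (\<Sum>k\<in>UNIV. (of_real t *s axis j 1) $ k * cpartial k (cpartial i f) (t *\<^sub>R (z + c *s axis j 1)))) (at c)"
        by (simp add: eq)
      moreover have "(\<Sum>k\<in>UNIV. (of_real t *s axis j 1) $ k * cpartial k (cpartial i f) (t *\<^sub>R (z + c *s axis j 1)))
        = of_real t * cpartial j (cpartial i f) (t *\<^sub>R (z + c *s axis j 1))"
        by (simp add: axis_def if_distrib if_distribR mult.assoc cong: if_cong)
      ultimately show ?thesis by (simp add: has_field_derivative_at_within)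
    qed
    show "(\<lambda>t. cpartial i f (t *\<^sub>R (z + c *s axis j 1))) integrable_on cbox 0 1" if "c \<in> ball 0 e" for c
    proof -
      have "continuous_on {0..1} (\<lambda>t. cpartial i f (t *\<^sub>R (z + c *s axis j 1)))"
        by (rule continuous_on_compose2[OF mv_holomorphic_on_imp_continuous_on[OF hol]])
           (auto intro!: continuous_intros star inS[OF that])
      then show ?thesis by (simp add: integrable_continuous_real)
    qed
    show "continuous_on (ball 0 e \<times> cbox 0 1)
        (\<lambda>(c, t). of_real t * cpartial j (cpartial i f) (t *\<^sub>R (z + c *s axis j 1)))"
      unfolding case_prod_beta
      by (intro continuous_intros continuous_on_compose2[OF mv_holomorphic_on_imp_continuous_on[OF
          mv_holomorphic_on_cpartial[OF \<open>open S\<close> hol]]]) (auto intro!: star inS continuous_intros)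
  qed auto
  then show "(\<lambda>c. hadamard i f (z + c *s axis j 1)) field_differentiable at 0"
    using e(1) unfolding hadamard_def by (auto intro!: holomorphic_on_imp_differentiable_at[of _ "ball 0 e"])
qed

lemma cpartial_bound:
  assumes "open S" "mv_holomorphic_on f S" "e > 0" "cball z e \<subseteq> S"
    and "\<And>w. w \<in> cball z e \<Longrightarrow> norm (f w) \<le> B"
  shows "norm (cpartial i f z) \<le> B / e"
proof -
  let ?H = "\<lambda>c. f (z + c *s axis i 1)"
  have inS: "z + c *s axis i 1 \<in> cball z e" if "norm c \<le> e" for c
    using that by (simp add: dist_norm norm_vec_smult)
  have fd: "?H field_differentiable (at c)" if "norm c \<le> e" for c
    using mv_holomorphic_on_line[OF assms(2)] inS[OF that] assms(4) by blast
  have "norm ((deriv ^^ 1) ?H 0) \<le> fact 1 * B / e ^ 1"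
  proof (rule Cauchy_inequality)
    show "?H holomorphic_on ball 0 e"
      unfolding holomorphic_on_def by (auto intro!: field_differentiable_at_within fd)
    show "continuous_on (cball 0 e) ?H"
      by (rule continuous_at_imp_continuous_on) (auto intro!: field_differentiable_imp_continuous_at fd)
  qed (use assms inS in auto)
  then show ?thesis by (simp add: cpartial_def)
qed

section \<open>Annihilating products and powers of matrices\<close>

text \<open>The product of the factors \<open>M - \<mu> I\<close> applied to a vector. A list of
  roots instead of a polynomial lets inductions remove one factor at a time.\<close>

fun linpoly :: "complex ^ 'n ^ 'n \<Rightarrow> complex list \<Rightarrow> complex ^ 'n \<Rightarrow> complex ^ 'n" where
  "linpoly M [] v = v"
| "linpoly M (\<mu> # \<mu>s) v = linpoly M \<mu>s (M *v v - \<mu> *s v)"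

lemma linpoly_add: "linpoly M \<mu>s (v + w) = linpoly M \<mu>s v + linpoly M \<mu>s w"
proof (induction \<mu>s arbitrary: v w)
  case (Cons \<mu> \<mu>s)
  have "M *v (v + w) - \<mu> *s (v + w) = (M *v v - \<mu> *s v) + (M *v w - \<mu> *s w)"
    by (simp add: matrix_vector_right_distrib vector_add_ldistrib)
  then show ?case by (simp only: linpoly.simps Cons.IH)
qed simp

lemma linpoly_smult: "linpoly M \<mu>s (c *s v) = c *s linpoly M \<mu>s v"
proof (induction \<mu>s arbitrary: v)
  case (Cons \<mu> \<mu>s)
  have "M *v (c *s v) - \<mu> *s (c *s v) = c *s (M *v v - \<mu> *s v)"
    by (simp add: vector_scalar_commute vec.scale_right_diff_distrib vector_smult_assoc mult.commute)
  then show ?case by (simp only: linpoly.simps Cons.IH)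
qed simp

lemma linpoly_zero [simp]: "linpoly M \<mu>s 0 = 0"
  using linpoly_smult[of M \<mu>s 0 0] by simp

lemma linpoly_diff: "linpoly M \<mu>s (v - w) = linpoly M \<mu>s v - linpoly M \<mu>s w"
  using linpoly_add[of M \<mu>s v "(-1) *s w"] linpoly_smult[of M \<mu>s "-1" w] by simp

lemma linpoly_sum: "linpoly M \<mu>s (\<Sum>i\<in>I. f i) = (\<Sum>i\<in>I. linpoly M \<mu>s (f i))"
  by (induction I rule: infinite_finite_induct) (simp_all add: linpoly_add)

lemma linpoly_mult: "linpoly M \<mu>s (M *v v) = M *v linpoly M \<mu>s v"
proof (induction \<mu>s arbitrary: v)
  case (Cons \<mu> \<mu>s)
  have "M *v (M *v v) - \<mu> *s (M *v v) = M *v (M *v v - \<mu> *s v)"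
    by (simp add: matrix_vector_mult_diff_distrib vector_scalar_commute)
  then show ?case by (simp only: linpoly.simps Cons.IH)
qed simp

lemma linpoly_factor: "linpoly M \<mu>s (M *v v - \<mu> *s v) = M *v linpoly M \<mu>s v - \<mu> *s linpoly M \<mu>s v"
  by (simp add: linpoly_diff linpoly_mult linpoly_smult)

lemma linpoly_append: "linpoly M (\<mu>s @ \<nu>s) v = linpoly M \<nu>s (linpoly M \<mu>s v)"
  by (induction \<mu>s arbitrary: v) simp_all

lemma linpoly_commute: "linpoly M \<nu>s (linpoly M \<mu>s v) = linpoly M \<mu>s (linpoly M \<nu>s v)"
  by (induction \<mu>s arbitrary: v) (simp_all add: linpoly_factor)

text \<open>A vector killed by a nonzero polynomial in M is killed by a product of linear factors,
  by splitting off roots over the complex numbers. The bound n on the degree drives the induction,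
  in which the vector changes as well.\<close>

lemma linpoly_of_poly:
  assumes "degree p \<le> n" "p \<noteq> 0" "(\<Sum>i\<le>n. coeff p i *s (((*v) M ^^ i) v)) = 0"
  shows "\<exists>\<mu>s. linpoly M \<mu>s v = 0"
  using assms
proof (induction n arbitrary: p v)
  case 0
  then have "coeff p 0 \<noteq> 0" using leading_coeff_0_iff[of p] by simp
  with 0 show ?case by (auto intro!: exI[of _ "[]"])
next
  case (Suc n)
  show ?case
  proof (cases "degree p = 0")
    case True
    then have "coeff p (Suc n) = 0" by (simp add: coeff_eq_0)
    with Suc True show ?thesis by (intro Suc.IH[of p v]) auto
  next
    case False
    \<comment> \<open>With \<open>p = (x - a) q\<close>, applying p to v is applying q to
      \<open>M *v v - a *s v\<close>.\<close>
    then obtain a where "poly p a = 0"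
      using fundamental_theorem_of_algebra[of p] constant_degree[of p] by auto
    then obtain q where q: "p = [:-a, 1:] * q" unfolding poly_eq_0_iff_dvd dvd_def by blast
    with Suc.prems have "q \<noteq> 0" by auto
    then have "degree p = Suc (degree q)" unfolding q by (subst degree_mult_eq) auto
    with Suc.prems have deg: "degree q \<le> n" by simp
    have co: "coeff p 0 = - a * coeff q 0" "coeff p (Suc i) = coeff q i - a * coeff q (Suc i)" for i
      by (simp_all add: q)
    have "(\<Sum>i\<le>Suc n. coeff p i *s (((*v) M ^^ i) v))
      = coeff p 0 *s v + (\<Sum>i\<le>n. coeff p (Suc i) *s (((*v) M ^^ Suc i) v))"
      by (subst sum.atMost_Suc_shift) simp
    also have "\<dots> = (\<Sum>i\<le>n. coeff q i *s (((*v) M ^^ Suc i) v))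
        - a *s (coeff q 0 *s v + (\<Sum>i\<le>n. coeff q (Suc i) *s (((*v) M ^^ Suc i) v)))"
      unfolding co by (simp add: vec.scale_left_diff_distrib sum_subtractf vector_add_ldistrib
         vec.scale_sum_right vector_smult_assoc)
    also have "coeff q 0 *s v + (\<Sum>i\<le>n. coeff q (Suc i) *s (((*v) M ^^ Suc i) v))
        = (\<Sum>i\<le>Suc n. coeff q i *s (((*v) M ^^ i) v))"
      by (subst sum.atMost_Suc_shift) simp
    also have "\<dots> = (\<Sum>i\<le>n. coeff q i *s (((*v) M ^^ i) v))"
      using deg by (simp add: coeff_eq_0)
    also have "(\<Sum>i\<le>n. coeff q i *s (((*v) M ^^ Suc i) v)) - a *s \<dots>
      = (\<Sum>i\<le>n. coeff q i *s (((*v) M ^^ i) (M *v v - a *s v)))"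
    proof -
      have pw: "((*v) M ^^ i) (M *v v - a *s v) = ((*v) M ^^ Suc i) v - a *s (((*v) M ^^ i) v)" for i
        by (induction i) (simp_all add: matrix_vector_mult_diff_distrib vector_scalar_commute)
      show ?thesis
        unfolding pw by (simp only: vec.scale_right_diff_distrib sum_subtractf vec.scale_sum_right
            vector_smult_assoc mult.commute)
    qed
    finally have "(\<Sum>i\<le>n. coeff q i *s (((*v) M ^^ i) (M *v v - a *s v))) = 0"
      using Suc.prems(3) by simp
    from Suc.IH[OF deg \<open>q \<noteq> 0\<close> this] obtain \<mu>s where "linpoly M \<mu>s (M *v v - a *s v) = 0" by blast
    then show ?thesis by (intro exI[of _ "a # \<mu>s"]) simp
  qed
qed

text \<open>One more iterate of v than the dimension gives a nontrivial linear relation, that is, a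
  nonzero polynomial in M killing v.\<close>

lemma linpoly_annihilates_vector: "\<exists>\<mu>s. linpoly M \<mu>s v = 0" for v :: "complex ^ 'n"
proof -
  define d where "d = card (cart_basis :: (complex ^ 'n) set)"
  let ?w = "\<lambda>i. ((*v) M ^^ i) v"
  have "\<exists>c. (\<exists>i\<le>d. c i \<noteq> 0) \<and> (\<Sum>i\<le>d. c i *s ?w i) = 0"
  proof (cases "inj_on ?w {..d}")
    case True
    have "vec.dependent (?w ` {..d})"
      using vec.dim_subset_UNIV[of "?w ` {..d}"] card_image[OF True]
      by (intro vec.dependent_biggerset_general) (simp add: vec.dimension_def flip: d_def)
    then obtain t u where t: "finite t" "t \<subseteq> ?w ` {..d}" "(\<Sum>x\<in>t. u x *s x) = 0" "\<exists>x\<in>t. u x \<noteq> 0"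
      unfolding vec.dependent_explicit by blast
    let ?c = "\<lambda>i. if ?w i \<in> t then u (?w i) else 0"
    have "(\<Sum>i\<le>d. ?c i *s ?w i) = (\<Sum>x\<in>?w ` {..d}. (if x \<in> t then u x else 0) *s x)"
      by (simp add: sum.reindex[OF True])
    also have "\<dots> = (\<Sum>x\<in>t. u x *s x)"
      using t(2) by (intro sum.mono_neutral_cong_right) auto
    finally show ?thesis using t by (intro exI[of _ ?c]) auto
  next
    \<comment> \<open>Linear dependence speaks of sets, so a repetition among the iterates has to be
      turned into a relation with coefficients 1 and -1.\<close>
    case False
    then obtain i j where ij: "i \<le> d" "j \<le> d" "i \<noteq> j" "?w i = ?w j"
      unfolding inj_on_def by auto
    have "(\<Sum>k\<le>d. (if k = i then 1 else if k = j then -1 else 0 :: complex) *s ?w k)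
       = (\<Sum>k\<le>d. (if k = i then ?w i else 0) + (if k = j then - ?w j else 0))"
      using ij(3) by (intro sum.cong) auto
    also have "\<dots> = 0" using ij by (simp add: sum.distrib)
    finally show ?thesis using ij(1)
      by (intro exI[of _ "\<lambda>k. if k = i then 1 else if k = j then -1 else 0"]) auto
  qed
  then obtain c where c: "\<exists>i\<le>d. c i \<noteq> 0" "(\<Sum>i\<le>d. c i *s ?w i) = 0" by blast
  define p where "p = (\<Sum>i\<le>d. monom (c i) i)"
  have co: "coeff p k = (if k \<le> d then c k else 0)" for k
    by (simp add: p_def coeff_sum)
  show ?thesis
  proof (rule linpoly_of_poly[of p d])
    show "degree p \<le> d" by (rule degree_le) (simp add: co)
    show "p \<noteq> 0" using c(1) co by (metis coeff_0)
    show "(\<Sum>i\<le>d. coeff p i *s ?w i) = 0" using c(2) by (simp add: co)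
  qed
qed

text \<open>If \<mu> is not an eigenvalue, \<open>M - \<mu> I\<close> is injective and its factor
  can be cancelled.\<close>

lemma linpoly_filter_eigenvalues:
  "linpoly M \<mu>s v = 0 \<Longrightarrow> linpoly M (filter (\<lambda>\<mu>. \<mu> \<in> matrix_eigenvalues M) \<mu>s) v = 0"
proof (induction \<mu>s arbitrary: v)
  case (Cons \<mu> \<mu>s)
  then have *: "linpoly M (filter (\<lambda>\<mu>. \<mu> \<in> matrix_eigenvalues M) \<mu>s) (M *v v - \<mu> *s v) = 0"
    by simp
  then show ?case
    by (auto simp: linpoly_factor matrix_eigenvalues_def)
qed simp

text \<open>The factors commute, so concatenating the lists that kill the individual basis vectors
  kills all of them. This product stands for the generalized eigenspace decomposition in everything
  that follows.\<close>

lemma ex_annihilating_eigenvalues: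
  "\<exists>\<mu>s. set \<mu>s \<subseteq> matrix_eigenvalues M \<and> (\<forall>v. linpoly M \<mu>s v = 0)"
proof -
  have "\<exists>\<mu>s. set \<mu>s \<subseteq> matrix_eigenvalues M \<and> (\<forall>i\<in>I. linpoly M \<mu>s (axis i 1) = 0)" if "finite I" for I
    using that
  proof (induction I rule: finite_induct)
    case empty
    show ?case by (rule exI[of _ "[]"]) simp
  next
    case (insert j I)
    then obtain \<mu>s where \<mu>s: "set \<mu>s \<subseteq> matrix_eigenvalues M" "\<forall>i\<in>I. linpoly M \<mu>s (axis i 1) = 0" by blast
    obtain \<nu>s where "linpoly M \<nu>s (axis j 1) = 0" using linpoly_annihilates_vector by blast
    from linpoly_filter_eigenvalues[OF this]
    show ?case using \<mu>s
      by (intro exI[of _ "\<mu>s @ filter (\<lambda>\<mu>. \<mu> \<in> matrix_eigenvalues M) \<nu>s"])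
        (auto simp: linpoly_append, metis linpoly_commute linpoly_zero)
  qed
  from this[OF finite[of UNIV]] obtain \<mu>s where \<mu>s: "set \<mu>s \<subseteq> matrix_eigenvalues M"
    "\<And>i. linpoly M \<mu>s (axis i 1) = 0" by blast
  have "linpoly M \<mu>s v = 0" for v
    by (subst vec_eq_sum_axis[of v]) (simp add: linpoly_sum linpoly_smult \<mu>s)
  with \<mu>s show ?thesis by blast
qed

section \<open>Decay of matrix powers when all eigenvalues lie in the open unit disc\<close>

lemma affine_recurrence_tendsto_zero:
  fixes x w :: "nat \<Rightarrow> 'a::real_normed_vector"
  assumes q: "0 \<le> q" "q < 1" and w: "w \<longlonglongrightarrow> 0"
    and rec: "\<And>n. norm (x (Suc n)) \<le> q * norm (x n) + norm (w n)"
  shows "x \<longlonglongrightarrow> 0"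
proof (rule LIMSEQ_I)
  fix r :: real assume r: "r > 0"
  \<comment> \<open>With this forcing term \<open>r / 2\<close> is the fixed point of the recursion
    for the bound.\<close>
  then have "r / 2 * (1 - q) > 0" using q by simp
  then obtain N where N: "\<And>n. n \<ge> N \<Longrightarrow> norm (w n) < r / 2 * (1 - q)"
    using LIMSEQ_D[OF w] by (metis diff_zero)
  have bd: "norm (x (N + k)) \<le> q ^ k * norm (x N) + r / 2" for k
  proof (induction k)
    case (Suc k)
    have "norm (x (N + Suc k)) \<le> q * norm (x (N + k)) + norm (w (N + k))"
      using rec[of "N + k"] by simp
    also have "\<dots> \<le> q * (q ^ k * norm (x N) + r / 2) + r / 2 * (1 - q)"
      using Suc N[of "N + k"] q by (intro add_mono mult_left_mono) auto
    also have "\<dots> = q ^ Suc k * norm (x N) + r / 2" by (simp add: field_simps)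
    finally show ?case .
  qed (use r in simp)
  have "(\<lambda>k. q ^ k * norm (x N)) \<longlonglongrightarrow> 0 * norm (x N)"
    using q by (intro tendsto_intros LIMSEQ_power_zero) auto
  then obtain K where K: "\<And>k. k \<ge> K \<Longrightarrow> norm (q ^ k * norm (x N)) < r / 2"
    using LIMSEQ_D[of "\<lambda>k. q ^ k * norm (x N)" 0 "r / 2"] r by auto
  show "\<exists>no. \<forall>n\<ge>no. norm (x n - 0) < r"
  proof (intro exI[of _ "N + K"] allI impI)
    fix n assume "n \<ge> N + K"
    then obtain k where k: "n = N + k" "k \<ge> K" by (metis add_leD1 le_Suc_ex nat_add_left_cancel_le)
    with bd[of k] K[of k] show "norm (x n - 0) < r" by simp
  qed
qed

text \<open>With \<open>w = M v - \<mu> v\<close>, the iterates of v satisfy an affine recurrence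
  with ratio \<mu> whose forcing term is the iterate of w, and w is killed by the shorter
  list.\<close>

lemma matrix_powers_tendsto_zero:
  assumes "\<And>\<mu>. \<mu> \<in> matrix_eigenvalues M \<Longrightarrow> norm \<mu> < 1"
  shows "(\<lambda>n. ((*v) M ^^ n) v) \<longlonglongrightarrow> 0"
proof -
  obtain \<mu>s where \<mu>s: "set \<mu>s \<subseteq> matrix_eigenvalues M" "linpoly M \<mu>s v = 0"
    using ex_annihilating_eigenvalues by blast
  then show ?thesis
  proof (induction \<mu>s arbitrary: v)
    case Nil
    then have "((*v) M ^^ n) v = 0" for n by (induction n) auto
    then show ?case by simp
  next
    case (Cons \<mu> \<mu>s)
    let ?w = "M *v v - \<mu> *s v"
    have pw: "((*v) M ^^ i) ?w = ((*v) M ^^ Suc i) v - \<mu> *s (((*v) M ^^ i) v)" for i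
      by (induction i) (simp_all add: matrix_vector_mult_diff_distrib vector_scalar_commute)
    show ?case
    proof (rule affine_recurrence_tendsto_zero[of "norm \<mu>"])
      show "(\<lambda>n. ((*v) M ^^ n) ?w) \<longlonglongrightarrow> 0" using Cons by simp
      show "norm \<mu> < 1" using assms Cons.prems by simp
      show "norm (((*v) M ^^ Suc n) v) \<le> norm \<mu> * norm (((*v) M ^^ n) v) + norm (((*v) M ^^ n) ?w)" for n
        unfolding norm_vec_smult[symmetric] pw
        by (metis add.commute diff_add_cancel norm_triangle_ineq)
    qed simp
  qed
qed

text \<open>Expansion in the standard basis makes the pointwise decay uniform in the vector.\<close>

lemma matrix_powers_norm_bound:
  assumes "\<And>\<mu>. \<mu> \<in> matrix_eigenvalues M \<Longrightarrow> norm \<mu> < 1" and "\<epsilon> > 0"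
  shows "\<exists>n0. \<forall>n\<ge>n0. \<forall>v. norm (((*v) M ^^ n) v) \<le> \<epsilon> * norm v"
proof -
  define S where "S n = (\<Sum>i\<in>UNIV. norm (((*v) M ^^ n) (axis i 1)))" for n
  have "S \<longlonglongrightarrow> (\<Sum>i\<in>(UNIV :: 'a set). 0)"
    unfolding S_def using matrix_powers_tendsto_zero[OF assms(1)]
    by (intro tendsto_sum tendsto_norm_zero) auto
  then have "eventually (\<lambda>n. S n < \<epsilon>) sequentially"
    using \<open>\<epsilon> > 0\<close> by (intro order_tendstoD(2)) auto
  then obtain n0 where n0: "\<And>n. n \<ge> n0 \<Longrightarrow> S n < \<epsilon>" by (auto simp: eventually_sequentially)
  have lin: "((*v) M ^^ n) (\<Sum>i\<in>I. c i *s f i) = (\<Sum>i\<in>I. c i *s ((*v) M ^^ n) (f i))"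
    for n I f and c :: "'a \<Rightarrow> complex"
    by (induction n) (simp_all add: vec.sum vector_scalar_commute)
  have "norm (((*v) M ^^ n) v) \<le> \<epsilon> * norm v" if "n \<ge> n0" for n v
  proof -
    have "((*v) M ^^ n) v = (\<Sum>i\<in>UNIV. (v $ i) *s ((*v) M ^^ n) (axis i 1))"
      by (subst vec_eq_sum_axis[of v]) (rule lin)
    also have "norm \<dots> \<le> (\<Sum>i\<in>UNIV. norm v * norm (((*v) M ^^ n) (axis i 1)))"
      by (rule sum_norm_le) (simp add: norm_vec_smult mult_right_mono Finite_Cartesian_Product.norm_nth_le)
    also have "\<dots> = norm v * S n" by (simp add: S_def sum_distrib_left)
    also have "\<dots> \<le> norm v * \<epsilon>" using n0[OF that] by (intro mult_left_mono) auto
    finally show ?thesis by (simp add: mult.commute)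
  qed
  then show ?thesis by blast
qed

lemma mat_mult_vec: "mat \<mu> *v v = \<mu> *s v" for v :: "complex ^ 'n"
  by (simp add: vec_eq_iff matrix_vector_mult_def mat_def if_distrib if_distribR cong: if_cong)

lemma matrix_eigenvalues_iff_det: "\<mu> \<in> matrix_eigenvalues M \<longleftrightarrow> det (M - mat \<mu>) = 0"
proof -
  have "(M - mat \<mu>) *v v = 0 \<longleftrightarrow> M *v v = \<mu> *s v" for v
    by (simp add: matrix_vector_mult_diff_rdistrib mat_mult_vec)
  then show ?thesis
    unfolding matrix_eigenvalues_def
    using invertible_det_nz[of "M - mat \<mu>"] matrix_left_invertible_ker[of "M - mat \<mu>"]
      invertible_left_inverse[of "M - mat \<mu>"] by auto
qed

lemma matrix_eigenvalues_transpose: "matrix_eigenvalues (transpose M) = matrix_eigenvalues M"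
proof -
  have "transpose M - mat \<mu> = transpose (M - mat \<mu>)" for \<mu>
    by (simp add: vec_eq_iff transpose_def mat_def eq_commute)
  then show ?thesis
    by (auto simp: matrix_eigenvalues_iff_det det_transpose)
qed

section \<open>Integration on the sphere\<close>

lemma ball_lborel: "emeasure lborel (ball (0::'a::euclidean_space) 1) \<noteq> \<infinity>"
    "emeasure lborel (ball (0::'a::euclidean_space) 1) \<noteq> 0"
  using emeasure_lborel_ball_finite[of "0::'a" 1] content_ball_pos[of 1 "0::'a"]
  by (auto simp: less_top measure_def)

text \<open>Uniqueness of translation-invariant measures: apply Tonelli to
  \<open>1\<^sub>A(U x) 1\<^sub>B(y - U x)\<close>, where \<open>B\<close> is the unit ball.\<close>

lemma lborel_distr_isometry:
  fixes U :: "'a::euclidean_space \<Rightarrow> 'a"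
  assumes "linear U" and norm: "\<And>x. norm (U x) = norm x"
  shows "distr lborel borel U = lborel"
proof (rule measure_eqI)
  have bl: "bounded_linear U" using assms(1) by (simp add: linear_conv_bounded_linear)
  interpret U: bounded_linear U by (rule bl)
  have [measurable]: "U \<in> borel_measurable borel"
    using bl by (intro borel_measurable_continuous_onI linear_continuous_on)
  have "inj U" using norm U.zero by (simp add: linear_injective_0[OF assms(1)]) (metis norm_eq_zero)
  then have "surj U" using linear_injective_imp_surjective assms(1) by blast
  then obtain V where V: "\<And>y. U (V y) = y" by (metis surjD)
  fix A assume "A \<in> sets (distr lborel borel U)"
  then have [measurable]: "A \<in> sets borel" by simp
  define B :: "'a set" where "B = ball 0 1"
  have [measurable]: "B \<in> sets borel" by (simp add: B_def)
  let ?L = "lborel :: 'a measure"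
  have trans: "(\<integral>\<^sup>+x. g (c + x) \<partial>?L) = (\<integral>\<^sup>+x. g x \<partial>?L)" if [measurable]: "g \<in> borel_measurable borel" for g c
  proof -
    have "(\<integral>\<^sup>+x. g x \<partial>?L) = (\<integral>\<^sup>+x. g x \<partial>distr lborel borel ((+) c))"
      by (simp only: lborel_distr_plus)
    then show ?thesis by (simp add: nn_integral_distr)
  qed
  have "emeasure (distr lborel borel U) A * emeasure ?L B
      = (\<integral>\<^sup>+x. indicator A (U x) * emeasure ?L B \<partial>?L)"
  proof -
    have "emeasure (distr lborel borel U) A = (\<integral>\<^sup>+x. indicator A x \<partial>distr lborel borel U)"
      by simp
    also have "\<dots> = (\<integral>\<^sup>+x. indicator A (U x) \<partial>?L)"
      by (simp add: nn_integral_distr del: nn_integral_indicator)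
    finally show ?thesis by (simp add: nn_integral_multc)
  qed
  also have "\<dots> = (\<integral>\<^sup>+x. \<integral>\<^sup>+y. indicator A (U x) * indicator B (- U x + y) \<partial>?L \<partial>?L)"
  proof (rule nn_integral_cong)
    fix x
    have "(\<integral>\<^sup>+y. indicator A (U x) * indicator B (- U x + y) \<partial>?L)
      = indicator A (U x) * (\<integral>\<^sup>+y. indicator B (- U x + y) \<partial>?L)"
      by (rule nn_integral_cmult) simp
    also have "(\<integral>\<^sup>+y. indicator B (- U x + y) \<partial>?L) = emeasure ?L B"
      by (subst trans[of "indicator B"]) simp_all
    finally show "indicator A (U x) * emeasure ?L B
      = (\<integral>\<^sup>+y. indicator A (U x) * indicator B (- U x + y) \<partial>?L)" by simp
  qed
  also have "\<dots> = (\<integral>\<^sup>+y. \<integral>\<^sup>+x. indicator A (U x) * indicator B (- U x + y) \<partial>?L \<partial>?L)"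
    by (rule lborel_pair.Fubini') simp
  also have "\<dots> = (\<integral>\<^sup>+y. \<integral>\<^sup>+x. indicator A (y + U x) * indicator B (- U x) \<partial>?L \<partial>?L)"
  proof (rule nn_integral_cong)
    \<comment> \<open>Translating the inner variable by a preimage \<open>V y\<close> of y replaces
      \<open>U x\<close> by \<open>y + U x\<close>, after which A is measured by a translation of
      Lebesgue measure alone.\<close>
    fix y
    have "(\<integral>\<^sup>+x. indicator A (U x) * indicator B (- U x + y) \<partial>?L)
      = (\<integral>\<^sup>+x. indicator A (U (V y + x)) * indicator B (- U (V y + x) + y) \<partial>?L)"
      by (rule trans[symmetric]) simp
    then show "(\<integral>\<^sup>+x. indicator A (U x) * indicator B (- U x + y) \<partial>?L)
      = (\<integral>\<^sup>+x. indicator A (y + U x) * indicator B (- U x) \<partial>?L)"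
      by (simp add: U.add V)
  qed
  also have "\<dots> = (\<integral>\<^sup>+x. \<integral>\<^sup>+y. indicator A (y + U x) * indicator B (- U x) \<partial>?L \<partial>?L)"
    by (rule lborel_pair.Fubini'[symmetric]) simp
  also have "\<dots> = (\<integral>\<^sup>+x. emeasure ?L A * indicator B x \<partial>?L)"
  proof (rule nn_integral_cong)
    fix x
    have "(\<integral>\<^sup>+y. indicator A (y + U x) * indicator B (- U x) \<partial>?L)
        = (\<integral>\<^sup>+y. indicator A (U x + y) \<partial>?L) * indicator B (- U x)"
      by (subst nn_integral_multc) (simp_all add: add.commute)
    also have "(\<integral>\<^sup>+y. indicator A (U x + y) \<partial>?L) = emeasure ?L A"
      by (subst trans[of "indicator A"]) simp_all
    moreover have "indicator B (- U x) = (indicator B x :: ennreal)"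
      by (simp add: B_def indicator_def norm)
    ultimately show "(\<integral>\<^sup>+y. indicator A (y + U x) * indicator B (- U x) \<partial>?L) = emeasure ?L A * indicator B x"
      by simp
  qed
  also have "\<dots> = emeasure ?L A * emeasure ?L B"
    by (simp add: nn_integral_cmult)
  finally have "emeasure (distr lborel borel U) A * emeasure ?L B = emeasure ?L A * emeasure ?L B" .
  moreover have "emeasure ?L B \<noteq> \<infinity>" "emeasure ?L B \<noteq> 0"
    unfolding B_def by (rule ball_lborel)+
  ultimately show "emeasure (distr lborel borel U) A = emeasure ?L A"
    by (simp add: mult.commute[of _ "emeasure ?L B"] ennreal_mult_cancel_left)
qed simp

text \<open>On the restriction to the sphere a function continuous on the sphere is measurable and
  integrable, whatever its values elsewhere.\<close>

definition usphere :: "(complex ^ 'n) measure" where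
  "usphere = restrict_space sphere_measure (sphere 0 1)"

lemma sets_sphere_measure [simp, measurable_cong]: "sets sphere_measure = sets borel"
  by (simp add: sphere_measure_def)

lemma space_sphere_measure [simp]: "space sphere_measure = UNIV"
  by (simp add: sphere_measure_def)

lemma emeasure_sphere_measure:
  fixes A :: "(complex ^ 'n) set"
  assumes "A \<in> sets borel"
  shows "emeasure sphere_measure A = emeasure lborel (ball 0 1 \<inter> (\<lambda>x. x /\<^sub>R norm x) -` A)
     / emeasure lborel (ball (0 :: complex ^ 'n) 1)"
proof -
  have m: "(\<lambda>x :: complex ^ 'n. x /\<^sub>R norm x) \<in> borel_measurable borel" by measurable
  then have "(\<lambda>x :: complex ^ 'n. x /\<^sub>R norm x) -` A \<in> sets borel"
    using measurable_sets[OF m assms] by simp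
  then show ?thesis
    unfolding sphere_measure_def using m assms
    by (subst emeasure_distr) (simp_all add: emeasure_uniform_measure)
qed

text \<open>The radial projection commutes with a norm-preserving linear map, so the claim reduces
  to invariance of Lebesgue measure on the ball.\<close>

lemma sphere_measure_isometry:
  fixes U :: "complex ^ 'n \<Rightarrow> complex ^ 'n"
  assumes "linear U" "\<And>x. norm (U x) = norm x"
  shows "distr sphere_measure borel U = sphere_measure"
proof (rule measure_eqI)
  have bl: "bounded_linear U" using assms(1) by (simp add: linear_conv_bounded_linear)
  have m: "U \<in> borel_measurable borel"
    using bl by (intro borel_measurable_continuous_onI linear_continuous_on)
  have pi: "(\<lambda>x :: complex ^ 'n. x /\<^sub>R norm x) \<in> borel_measurable borel" by measurable
  fix A :: "(complex ^ 'n) set" assume "A \<in> sets (distr sphere_measure borel U)"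
  then have A: "A \<in> sets borel" by simp
  let ?\<pi> = "\<lambda>x :: complex ^ 'n. x /\<^sub>R norm x"
  have UA: "U -` A \<in> sets borel" using measurable_sets[OF m A] by simp
  have pA: "ball 0 1 \<inter> ?\<pi> -` A \<in> sets borel" using measurable_sets[OF pi A] by simp
  have eq: "ball 0 1 \<inter> ?\<pi> -` (U -` A) = U -` (ball 0 1 \<inter> ?\<pi> -` A)"
    using linear_scale[OF assms(1)] assms(2) by auto
  have "emeasure (distr sphere_measure borel U) A = emeasure sphere_measure (U -` A)"
    using m A by (subst emeasure_distr) simp_all
  also have "\<dots> = emeasure lborel (U -` (ball 0 1 \<inter> ?\<pi> -` A)) / emeasure lborel (ball (0 :: complex ^ 'n) 1)"
    using UA by (simp add: emeasure_sphere_measure eq)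
  also have "emeasure lborel (U -` (ball 0 1 \<inter> ?\<pi> -` A)) = emeasure (distr lborel borel U) (ball 0 1 \<inter> ?\<pi> -` A)"
    using m pA by (subst emeasure_distr) simp_all
  also have "\<dots> = emeasure lborel (ball 0 1 \<inter> ?\<pi> -` A)"
    by (simp only: lborel_distr_isometry[OF assms])
  also have "\<dots> / emeasure lborel (ball (0 :: complex ^ 'n) 1) = emeasure sphere_measure A"
    using A by (simp add: emeasure_sphere_measure)
  finally show "emeasure (distr sphere_measure borel U) A = emeasure sphere_measure A" .
qed simp

lemma emeasure_sphere_measure_sphere: "emeasure sphere_measure (sphere (0 :: complex ^ 'n) 1) = 1"
proof -
  \<comment> \<open>The projection sends the origin to itself and not to the sphere, but a single
    point is a null set.\<close>
  have "(ball 0 1 \<inter> (\<lambda>x :: complex ^ 'n. x /\<^sub>R norm x) -` sphere 0 1) = ball 0 1 - {0}"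
    by auto
  moreover have "emeasure lborel (ball 0 1 - {0 :: complex ^ 'n}) = emeasure lborel (ball (0 :: complex ^ 'n) 1)"
    by (rule emeasure_Diff_null_set) (auto simp: null_sets_def)
  ultimately show ?thesis
    using ball_lborel[where 'a = "complex ^ 'n"]
    by (subst emeasure_sphere_measure) (auto intro: ennreal_divide_self simp: less_top)
qed

lemma emeasure_sphere_measure_UNIV: "emeasure sphere_measure (UNIV :: (complex ^ 'n) set) = 1"
  using ball_lborel[where 'a = "complex ^ 'n"]
  by (subst emeasure_sphere_measure) (auto intro: ennreal_divide_self simp: less_top)

lemma space_usphere [simp]: "space usphere = sphere 0 1"
  by (simp add: usphere_def space_restrict_space)

lemma sets_usphere: "sets usphere = sets (restrict_space borel (sphere 0 1))"
  unfolding usphere_def by (rule sets_restrict_space_cong) simp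

lemma emeasure_usphere: "emeasure usphere (sphere 0 1) = 1"
  unfolding usphere_def using emeasure_sphere_measure_sphere
  by (subst emeasure_restrict_space) auto

lemma finite_measure_usphere: "finite_measure usphere"
  by (rule finite_measureI) (simp add: emeasure_usphere)

lemma integrable_continuous_compact:
  fixes g :: "'a::topological_space \<Rightarrow> 'b::{banach, second_countable_topology}"
  assumes "finite_measure M" "sets M = sets (restrict_space borel A)" "compact A" "continuous_on A g"
  shows "integrable M g"
proof -
  have m: "g \<in> borel_measurable M"
    using borel_measurable_continuous_on_restrict[OF assms(4)]
    by (subst measurable_cong_sets[OF assms(2) refl])
  have sp: "space M = A"
    using sets_eq_imp_space_eq[OF assms(2)] by (simp add: space_restrict_space)
  obtain B where "\<And>x. x \<in> A \<Longrightarrow> norm (g x) \<le> B"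
    using compact_imp_bounded[OF compact_continuous_image[OF assms(4,3)]]
    by (auto simp: bounded_iff)
  then show ?thesis
    using m sp by (intro finite_measure.integrable_const_bound[OF assms(1), of _ B]) auto
qed

lemma usphere_integrable [intro]:
  fixes g :: "complex ^ 'n \<Rightarrow> 'b::{banach, second_countable_topology}"
  assumes "continuous_on (sphere 0 1) g"
  shows "integrable usphere g"
  by (rule integrable_continuous_compact[OF finite_measure_usphere sets_usphere _ assms]) simp

lemma usphere_isometry:
  fixes g :: "complex ^ 'n \<Rightarrow> 'b::{banach, second_countable_topology}"
    and U :: "complex ^ 'n \<Rightarrow> complex ^ 'n"
  assumes U: "linear U" "\<And>x. norm (U x) = norm x" and g: "continuous_on (sphere 0 1) g"
  shows "(LINT \<zeta>|usphere. g (U \<zeta>)) = (LINT \<zeta>|usphere. g \<zeta>)"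
proof -
  have bl: "bounded_linear U" using U(1) by (simp add: linear_conv_bounded_linear)
  have m: "U \<in> borel_measurable borel"
    using bl by (intro borel_measurable_continuous_onI linear_continuous_on)
  let ?h = "\<lambda>\<zeta>. indicator (sphere 0 1) \<zeta> *\<^sub>R g \<zeta>"
  have h: "?h \<in> borel_measurable borel"
    using g by (intro borel_measurable_continuous_on_indicator) auto
  have res: "(LINT \<zeta>|usphere. k \<zeta>) = (LINT \<zeta>|sphere_measure. indicator (sphere 0 1) \<zeta> *\<^sub>R k \<zeta>)"
    for k :: "complex ^ 'n \<Rightarrow> 'b"
    unfolding usphere_def by (rule integral_restrict_space) simp
  have "(LINT \<zeta>|usphere. g \<zeta>) = (LINT \<zeta>|distr sphere_measure borel U. ?h \<zeta>)"
    by (simp add: res sphere_measure_isometry[OF U])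
  also have "\<dots> = (LINT \<zeta>|sphere_measure. ?h (U \<zeta>))"
    using m h by (intro integral_distr) (auto simp: measurable_def)
  also have "\<dots> = (LINT \<zeta>|usphere. g (U \<zeta>))"
    unfolding res by (simp add: U(2) indicator_def)
  finally show ?thesis by simp
qed

lemma measurable_pair_continuous:
  fixes F :: "'a::second_countable_topology \<times> 'b::second_countable_topology \<Rightarrow> 'c::real_normed_vector"
  assumes "continuous_on (A \<times> B) F" "A \<in> sets borel" "B \<in> sets borel"
  shows "F \<in> borel_measurable (restrict_space borel A \<Otimes>\<^sub>M restrict_space borel B)"
proof -
  let ?R = "restrict_space borel A \<Otimes>\<^sub>M restrict_space borel B"
  have AB: "A \<times> B \<in> sets borel"
    using assms(2,3) by (simp flip: borel_prod)
  have 1: "(\<lambda>p. indicator (A \<times> B) p *\<^sub>R F p) \<in> borel_measurable borel"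
    by (rule borel_measurable_continuous_on_indicator[OF AB assms(1)])
  have f: "fst \<in> borel_measurable ?R" "snd \<in> borel_measurable ?R"
    using measurable_fst[of "restrict_space borel A" "restrict_space borel B"]
      measurable_snd[of "restrict_space borel A" "restrict_space borel B"]
    by (auto simp: measurable_restrict_space2_iff)
  have 2: "(\<lambda>p. (fst p, snd p)) \<in> ?R \<rightarrow>\<^sub>M borel"
    unfolding borel_prod[symmetric] by (rule measurable_Pair[OF f])
  have "(\<lambda>p. indicator (A \<times> B) p *\<^sub>R F p) \<in> borel_measurable ?R"
    using measurable_compose[OF 2 1] by simp
  then show ?thesis
    by (rule measurable_cong[THEN iffD1, rotated])
      (auto simp: space_pair_measure space_restrict_space)
qed

lemma Fubini_continuous:
  fixes F :: "'a::{second_countable_topology,t2_space} \<Rightarrow> 'b::{second_countable_topology,t2_space}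
    \<Rightarrow> 'c::{banach, second_countable_topology}"
  assumes M: "finite_measure M" "sets M = sets (restrict_space borel A)" "compact A"
    and N: "finite_measure N" "sets N = sets (restrict_space borel B)" "compact B"
    and F: "continuous_on (A \<times> B) (\<lambda>(x, y). F x y)"
  shows "(LINT x|M. LINT y|N. F x y) = (LINT y|N. LINT x|M. F x y)"
proof -
  interpret M: finite_measure M by fact
  interpret N: finite_measure N by fact
  interpret P: pair_sigma_finite M N ..
  have AB: "A \<in> sets borel" "B \<in> sets borel"
    using compact_imp_closed[OF M(3)] compact_imp_closed[OF N(3)] by auto
  have sets: "sets (M \<Otimes>\<^sub>M N) = sets (restrict_space borel A \<Otimes>\<^sub>M restrict_space borel B)"
    by (rule sets_pair_measure_cong) (rule M N)+
  have m: "(\<lambda>(x, y). F x y) \<in> borel_measurable (M \<Otimes>\<^sub>M N)"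
    using measurable_pair_continuous[OF F AB] by (subst measurable_cong_sets[OF sets refl])
  have sp: "space M = A" "space N = B"
    using sets_eq_imp_space_eq[OF M(2)] sets_eq_imp_space_eq[OF N(2)] by (simp_all add: space_restrict_space)
  obtain C where C: "\<And>p. p \<in> A \<times> B \<Longrightarrow> norm ((\<lambda>(x, y). F x y) p) \<le> C"
    using compact_imp_bounded[OF compact_continuous_image[OF F compact_Times[OF M(3) N(3)]]]
    by (auto simp: bounded_iff)
  have "integrable (M \<Otimes>\<^sub>M N) (\<lambda>(x, y). F x y)"
  proof (rule finite_measure.integrable_const_bound[OF _ _ m])
    show "finite_measure (M \<Otimes>\<^sub>M N)"
      by (rule finite_measure_pair_measure[OF N.finite_measure_axioms M.finite_measure_axioms])
    show "AE p in M \<Otimes>\<^sub>M N. norm ((\<lambda>(x, y). F x y) p) \<le> C"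
      using C by (intro AE_I2) (simp add: space_pair_measure sp)
  qed
  then show ?thesis by (rule P.Fubini_integral[symmetric])
qed

section \<open>Unitary invariance and the moments of the sphere\<close>

lemma linearI_complex:
  fixes U :: "complex ^ 'n \<Rightarrow> complex ^ 'm"
  assumes "\<And>x y. U (x + y) = U x + U y" "\<And>c x. U (c *s x) = c *s U x"
  shows "linear U"
  by (rule linearI) (simp_all add: assms scaleR_eq_smult)

lemma norm_power_even: "complex_of_real (norm w ^ (2 * m)) = w ^ m * cnj w ^ m"
proof -
  have "complex_of_real (norm w ^ (2 * m)) = complex_of_real ((norm w)\<^sup>2) ^ m"
    by (simp add: power_mult)
  then show ?thesis by (simp only: complex_norm_square power_mult_distrib)
qed

lemma cinner_axis_right: "cinner x (axis i 1) = x $ i"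
  by (simp add: cinner_def axis_def if_distrib cong: if_cong)

text \<open>A Householder reflection exchanges two unit vectors whose inner product is real; the phase
  \<open>\<alpha>\<close> makes it real.\<close>

lemma ex_isometry_unit_vectors:
  fixes e f :: "complex ^ 'n"
  assumes e: "norm e = 1" and f: "norm f = 1"
  shows "\<exists>U \<alpha>. linear U \<and> (\<forall>x. norm (U x) = norm x) \<and> norm \<alpha> = 1 \<and>
    (\<forall>x. cinner (U x) (\<alpha> *s f) = cinner x e)"
proof -
  define \<alpha> where "\<alpha> = (if cinner e f = 0 then 1 else sgn (cinner e f))"
  have \<alpha>: "norm \<alpha> = 1" by (simp add: \<alpha>_def norm_sgn)
  define g where "g = \<alpha> *s f"
  have g: "norm g = 1" by (simp add: g_def norm_vec_smult \<alpha> f)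
  have eg: "cinner e g \<in> \<real>"
  proof -
    have "cnj (sgn z) * z = of_real (norm z)" for z :: complex
      by (simp add: sgn_div_norm scaleR_conv_of_real complex_norm_square[symmetric] mult.commute
           power2_eq_square field_simps)
    then show ?thesis by (auto simp: g_def cinner_smult_right \<alpha>_def)
  qed
  show ?thesis
  proof (cases "e = g")
    case True
    show ?thesis
      by (rule exI[of _ "\<lambda>x. x"], rule exI[of _ \<alpha>]) (simp add: True[unfolded g_def, symmetric] \<alpha> linear_ident)
  next
    case False
    define w where "w = e - g"
    define n where "n = (norm w)\<^sup>2"
    have n: "n > 0" using False by (simp add: n_def w_def)
    \<comment> \<open>The reflection in the hyperplane orthogonal to \<open>e - g\<close>.\<close>
    define U where "U x = x - (2 * cinner x w / of_real n) *s w" for x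
    have ww: "cinner w w = of_real n" by (simp add: cinner_self n_def)
    have UU: "cinner (U x) (U y) = cinner x y" for x y
      using n by (simp add: U_def cinner_diff_left cinner_diff_right cinner_smult_left
          cinner_smult_right ww cnj_cinner field_simps)
    have "linear U"
      by (rule linearI_complex) (simp_all add: U_def cinner_add_left cinner_smult_left add_divide_distrib
          distrib_left vector_sadd_rdistrib vec.scale_right_diff_distrib vector_smult_assoc mult_ac)
    moreover have "norm (U x) = norm x" for x
    proof -
      have "complex_of_real ((norm (U x))\<^sup>2) = of_real ((norm x)\<^sup>2)"
        unfolding cinner_self[symmetric] by (rule UU)
      then show ?thesis by (simp only: of_real_eq_iff) simp
    qed
    \<comment> \<open>\<open>U\<close> preserves the Hermitian form and sends e to g, so the form of
      \<open>U x\<close> with \<open>g = U e\<close> is that of x with e.\<close>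
    moreover have "cinner (U x) g = cinner x e" for x
    proof -
      have "cnj (cinner e g) = cinner e g" using eg by (simp add: Reals_cnj_iff)
      then have ge: "cinner g e = cinner e g" by (simp add: cnj_cinner)
      have "cinner e e = 1" "cinner g g = 1" by (simp_all add: cinner_self e g)
      then have "complex_of_real n = 2 * (1 - cinner e g)"
        by (simp add: ww[symmetric] w_def cinner_diff_left cinner_diff_right ge)
      moreover have "cinner e w = 1 - cinner e g"
        using \<open>cinner e e = 1\<close> by (simp add: w_def cinner_diff_right)
      ultimately have "2 * cinner e w = complex_of_real n" by (simp only:)
      then have "2 * cinner e w / of_real n = 1" using n by simp
      then have "U e = g" by (simp add: U_def w_def)
      have "U (U x) = x"
        using n by (simp add: U_def cinner_diff_left cinner_smult_left ww vec.scale_left_diff_distrib)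
      then have "cinner (U x) g = cinner (U (U x)) (U g)" using UU[of "U x" g] by simp
      then show ?thesis
        using \<open>U e = g\<close> \<open>U (U x) = x\<close> UU[of x "U g"] UU[of e "U g"]
        by (metis UU)
    qed
    ultimately show ?thesis
      using \<alpha> unfolding g_def by blast
  qed
qed

text \<open>The coordinate \<open>undefined\<close> is an arbitrary one: by unitary invariance all
  unit directions have the same moments. The first argument only carries the dimension.\<close>

definition sphere_moment :: "'n::finite itself \<Rightarrow> nat \<Rightarrow> real" where
  "sphere_moment _ j = (LINT \<zeta>|usphere. norm (\<zeta> $ (undefined :: 'n)) ^ (2 * j))"

lemma sphere_moment_unit:
  fixes e :: "complex ^ 'n"
  assumes e: "norm e = 1"
  shows "(LINT \<zeta>|usphere. norm (cinner \<zeta> e) ^ (2 * j)) = sphere_moment TYPE('n) j"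
proof -
  let ?f = "axis undefined 1 :: complex ^ 'n"
  obtain U \<alpha> where U: "linear U" "\<And>x. norm (U x) = norm x" "norm \<alpha> = 1"
    "\<And>x. cinner (U x) (\<alpha> *s ?f) = cinner x e"
    using ex_isometry_unit_vectors[OF e norm_axis_complex] by metis
  have "cinner x ?f = x $ undefined" for x
    by (rule cinner_axis_right)
  then have "norm (U x $ undefined) = norm (cinner x e)" for x
    using U(4)[of x] U(3) by (metis cinner_smult_right complex_mod_cnj mult_1 norm_mult)
  then have "(LINT \<zeta>|usphere. norm (cinner \<zeta> e) ^ (2 * j)) = (LINT \<zeta>|usphere. norm (U \<zeta> $ undefined) ^ (2 * j))"
    by simp
  also have "\<dots> = sphere_moment TYPE('n) j"
    unfolding sphere_moment_def
    by (rule usphere_isometry[OF U(1,2), of "\<lambda>x. norm (x $ undefined) ^ (2 * j)"])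
       (intro continuous_intros)
  finally show ?thesis .
qed

lemma measure_usphere: "measure usphere (sphere 0 1) = 1"
  by (simp add: measure_def emeasure_usphere)

lemma sphere_moment_0: "sphere_moment TYPE('n::finite) 0 = 1"
  by (simp add: sphere_moment_def measure_usphere)

lemma sphere_moment_scaled:
  fixes a :: "complex ^ 'n"
  shows "(LINT \<zeta>|usphere. norm (cinner \<zeta> a) ^ (2 * j)) = norm a ^ (2 * j) * sphere_moment TYPE('n) j"
proof (cases "a = 0")
  case True
  then show ?thesis by (cases j) (simp_all add: sphere_moment_0 measure_usphere)
next
  case False
  define e where "e = (1 / complex_of_real (norm a)) *s a"
  have "norm e = 1" using False by (simp add: e_def norm_vec_smult norm_divide)
  have "a = of_real (norm a) *s e" using False by (simp add: e_def vector_smult_assoc)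
  then have "norm (cinner \<zeta> a) = norm a * norm (cinner \<zeta> e)" for \<zeta>
    by (metis cinner_smult_right complex_cnj_complex_of_real norm_mult norm_of_real abs_norm_cancel)
  then show ?thesis
    by (simp add: power_mult_distrib sphere_moment_unit[OF \<open>norm e = 1\<close>])
qed

text \<open>Rotating coordinate k alone multiplies the integrand by a phase power; a rotation for
  which this factor is -1 makes the integral equal to its negative.\<close>

lemma phase_orthogonality:
  fixes F :: "complex \<Rightarrow> complex" and i k :: "'n::finite"
  assumes "a \<noteq> b" "i \<noteq> k" "continuous_on UNIV F"
  shows "(LINT \<zeta>|usphere. (\<zeta> $ k) ^ a * cnj (\<zeta> $ k) ^ b * F (\<zeta> $ i)) = 0"
proof -
  \<comment> \<open>The angle makes the power \<open>a - b\<close> of the phase a half turn; a and b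
    differ, so the quotient is meaningful.\<close>
  define \<alpha> where "\<alpha> = cis (pi / (real a - real b))"
  have "\<alpha> ^ a = cis (real a * (pi / (real a - real b)))"
    "cnj \<alpha> ^ b = cis (- (real b * (pi / (real a - real b))))"
    unfolding \<alpha>_def cis_cnj Complex.DeMoivre by simp_all
  then have "\<alpha> ^ a * cnj \<alpha> ^ b = cis (real a * (pi / (real a - real b)) + - (real b * (pi / (real a - real b))))"
    by (simp only: cis_mult)
  also have "real a * (pi / (real a - real b)) + - (real b * (pi / (real a - real b)))
      = (real a - real b) * (pi / (real a - real b))"
    by (simp only: left_diff_distrib add_uminus_conv_diff)
  also have "\<dots> = pi" using assms(1) by simp
  finally have \<alpha>: "\<alpha> ^ a * cnj \<alpha> ^ b = -1" by simp
  define U :: "complex ^ 'n \<Rightarrow> complex ^ 'n" where "U z = (\<chi> l. if l = k then \<alpha> * z $ l else z $ l)" for z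
  have U: "linear U"
    by (rule linearI_complex) (auto simp: U_def vec_eq_iff algebra_simps)
  have nU: "norm (U z) = norm z" for z
    unfolding norm_vec_def L2_set_def U_def \<alpha>_def
    by (intro arg_cong[of _ _ sqrt] sum.cong) (auto simp: norm_mult)
  let ?g = "\<lambda>\<zeta> :: complex ^ 'n. (\<zeta> $ k) ^ a * cnj (\<zeta> $ k) ^ b * F (\<zeta> $ i)"
  have "continuous_on (sphere 0 1) ?g"
    by (intro continuous_intros continuous_on_compose2[OF assms(3)]) auto
  from usphere_isometry[OF U nU this]
  have "(LINT \<zeta>|usphere. ?g \<zeta>) = (LINT \<zeta>|usphere. ?g (U \<zeta>))" by simp
  also have "(\<lambda>\<zeta>. ?g (U \<zeta>)) = (\<lambda>\<zeta>. (\<alpha> ^ a * cnj \<alpha> ^ b) * ?g \<zeta>)"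
    using assms(2) by (auto simp: U_def power_mult_distrib mult_ac)
  finally show ?thesis by (simp add: \<alpha>)
qed

text \<open>The moment in the direction \<open>axis i 1 + s axis k 1\<close>, of squared norm
  \<open>1 + s^2\<close>, is computed twice: by scaling, and by the binomial expansion, of which
  phase orthogonality leaves only the diagonal. Comparing the coefficients of \<open>x = s^2\<close>
  gives the claim.\<close>

lemma mixed_moment:
  fixes i k :: "'n::finite"
  assumes "i \<noteq> k" "j \<ge> 1"
  shows "real j * (LINT \<zeta>|usphere. norm (\<zeta> $ i) ^ (2 * (j - 1)) * (norm (\<zeta> $ k))\<^sup>2) = sphere_moment TYPE('n) j"
proof -
  define I where "I l = (LINT \<zeta>|usphere. norm (\<zeta> $ i) ^ (2 * (j - l)) * norm (\<zeta> $ k) ^ (2 * l))" for l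
  let ?m = "sphere_moment TYPE('n) j"
  \<comment> \<open>The difference of the two evaluations as a polynomial in x. It vanishes for all
    nonnegative x, hence identically, and its coefficient at 1 is the desired relation times
    j.\<close>
  define p where "p = (\<Sum>l\<le>j. monom ((real (j choose l))\<^sup>2 * I l - real (j choose l) * ?m) l)"
  have "poly p x = 0" if "x \<ge> 0" for x
  proof -
    define s where "s = sqrt x"
    have s: "s\<^sup>2 = x" using that by (simp add: s_def)
    define a :: "complex ^ 'n" where "a = axis i 1 + of_real s *s axis k 1"
    have "(norm a)\<^sup>2 = 1 + x"
    proof -
      have "cinner (axis i 1) (axis k 1) = 0"
        using assms(1) unfolding cinner_axis_right by (simp add: axis_def)
      then show ?thesis
        unfolding a_def norm_add_sq by (simp add: norm_vec_smult cinner_smult_right s)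
    qed
    then have na: "norm a ^ (2 * j) = (1 + x) ^ j" by (simp add: power_mult)
    have ca: "cinner \<zeta> a = \<zeta> $ i + of_real s * \<zeta> $ k" for \<zeta>
      by (simp add: a_def cinner_add_right cinner_smult_right cinner_axis_right)
    let ?c = "\<lambda>l l'. complex_of_real (real (j choose l) * real (j choose l') * s ^ (l + l'))"
    let ?G = "\<lambda>l l' \<zeta>. (\<zeta> $ k) ^ l * cnj (\<zeta> $ k) ^ l' * ((\<zeta> $ i) ^ (j - l) * cnj (\<zeta> $ i) ^ (j - l'))"
    have ex: "complex_of_real (norm (cinner \<zeta> a) ^ (2 * j)) = (\<Sum>l\<le>j. \<Sum>l'\<le>j. ?c l l' * ?G l l' \<zeta>)" for \<zeta>
    proof -
      have bin: "(\<zeta> $ i + of_real s * \<zeta> $ k) ^ j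
        = (\<Sum>l\<le>j. of_nat (j choose l) * (of_real s * \<zeta> $ k) ^ l * (\<zeta> $ i) ^ (j - l))"
        by (subst add.commute) (rule binomial_ring)
      have "complex_of_real (norm (cinner \<zeta> a) ^ (2 * j)) = (cinner \<zeta> a) ^ j * cnj ((cinner \<zeta> a) ^ j)"
        by (simp only: complex_norm_square[symmetric] norm_power power_mult[symmetric] of_real_power)
           (simp add: mult.commute)
      also have "\<dots> = (\<Sum>l\<le>j. \<Sum>l'\<le>j. ?c l l' * ?G l l' \<zeta>)"
        unfolding ca bin cnj_sum sum_product
        by (intro sum.cong refl) (simp add: power_mult_distrib power_add mult_ac)
      finally show ?thesis .
    qed
    have int: "integrable usphere (?G l l')" for l l'
      by (intro usphere_integrable continuous_intros)
    have off: "(LINT \<zeta>|usphere. ?G l l' \<zeta>) = (if l' = l then of_real (I l) else 0)" if "l \<le> j" for l l'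
    proof (cases "l' = l")
      case True
      have "?G l l = (\<lambda>\<zeta>. complex_of_real (norm (\<zeta> $ i) ^ (2 * (j - l)) * norm (\<zeta> $ k) ^ (2 * l)))"
        by (simp only: fun_eq_iff of_real_mult norm_power_even) (simp only: mult_ac simp_thms)
      then show ?thesis using True by (simp add: I_def del: of_real_mult of_real_power)
    next
      case False
      then show ?thesis
        using phase_orthogonality[of l l' i k "\<lambda>x. x ^ (j - l) * cnj x ^ (j - l')"] assms(1)
        by (simp add: continuous_intros)
    qed
    have "complex_of_real ((1 + x) ^ j * ?m) = (LINT \<zeta>|usphere. complex_of_real (norm (cinner \<zeta> a) ^ (2 * j)))"
      using sphere_moment_scaled[of a j] na by (simp del: of_real_power)
    also have "\<dots> = (\<Sum>l\<le>j. \<Sum>l'\<le>j. ?c l l' * (LINT \<zeta>|usphere. ?G l l' \<zeta>))"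
      unfolding ex using int by (simp add: Bochner_Integration.integral_sum integrable_mult_right)
    also have "\<dots> = (\<Sum>l\<le>j. \<Sum>l'\<le>j. if l' = l then ?c l l * of_real (I l) else 0)"
      by (intro sum.cong refl) (auto simp: off)
    also have "\<dots> = complex_of_real (\<Sum>l\<le>j. (real (j choose l))\<^sup>2 * I l * x ^ l)"
    proof -
      have "s ^ (l + l) = x ^ l" for l using s by (simp add: power_add power2_eq_square flip: power_mult_distrib)
      then show ?thesis by (simp add: power2_eq_square mult_ac)
    qed
    finally have "(1 + x) ^ j * ?m = (\<Sum>l\<le>j. (real (j choose l))\<^sup>2 * I l * x ^ l)"
      by (simp only: of_real_eq_iff)
    moreover have "(1 + x) ^ j = (\<Sum>l\<le>j. real (j choose l) * x ^ l)"
      using binomial_ring[of x 1 j] by (simp add: add.commute)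
    moreover have "poly p x = (\<Sum>l\<le>j. (real (j choose l))\<^sup>2 * I l * x ^ l)
        - (\<Sum>l\<le>j. real (j choose l) * x ^ l) * ?m"
      unfolding p_def poly_sum poly_monom sum_distrib_right sum_subtractf[symmetric]
      by (intro sum.cong refl) (simp add: algebra_simps)
    ultimately show ?thesis by simp
  qed
  then have "{0..} \<subseteq> {x. poly p x = 0}" by auto
  then have "p = 0"
    using poly_roots_finite[of p] infinite_Ici[of "0::real"] finite_subset by blast
  then have "coeff p 1 = 0" by simp
  moreover have "coeff p 1 = (real j)\<^sup>2 * I 1 - real j * ?m"
    using assms(2) by (simp add: p_def coeff_sum)
  moreover have "(real j)\<^sup>2 * I 1 - real j * ?m = real j * (real j * I 1 - ?m)"
    by (simp only: power2_eq_square right_diff_distrib mult.assoc)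
  ultimately have "real j * (real j * I 1 - ?m) = 0" by (simp only:)
  then have "real j * I 1 - ?m = 0"
    using assms(2) by (metis mult_eq_0_iff not_one_le_zero of_nat_eq_0_iff)
  then show ?thesis by (simp add: I_def)
qed

text \<open>Inserting the factor \<open>1 = (\<Sum>k\<in>UNIV. (norm (\<zeta> $ k))^2)\<close>
  splits the moment into the next one and \<open>CARD('n) - 1\<close> equal mixed moments.\<close>

lemma sphere_moment_Suc:
  "real (CARD('n) + j) * sphere_moment TYPE('n::finite) (Suc j) = real (Suc j) * sphere_moment TYPE('n) j"
proof -
  let ?i = "undefined :: 'n"
  let ?m = "sphere_moment TYPE('n)"
  have "?m j = (LINT \<zeta>|usphere. (\<Sum>k\<in>UNIV. norm (\<zeta> $ ?i) ^ (2 * j) * (norm (\<zeta> $ k))\<^sup>2))"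
    unfolding sphere_moment_def
  proof (rule Bochner_Integration.integral_cong[OF refl])
    fix \<zeta> :: "complex ^ 'n" assume "\<zeta> \<in> space usphere"
    then have "(\<Sum>k\<in>UNIV. (norm (\<zeta> $ k))\<^sup>2) = 1"
      by (simp add: norm_vec_def L2_set_def)
    then show "norm (\<zeta> $ ?i) ^ (2 * j) = (\<Sum>k\<in>UNIV. norm (\<zeta> $ ?i) ^ (2 * j) * (norm (\<zeta> $ k))\<^sup>2)"
      by (simp flip: sum_distrib_left)
  qed
  also have "\<dots> = (\<Sum>k\<in>UNIV. LINT \<zeta>|usphere. norm (\<zeta> $ ?i) ^ (2 * j) * (norm (\<zeta> $ k))\<^sup>2)"
    by (intro Bochner_Integration.integral_sum usphere_integrable continuous_intros)
  also have "\<dots> = ?m (Suc j) + (\<Sum>k\<in>UNIV-{?i}. ?m (Suc j) / real (Suc j))"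
  proof -
    have "(LINT \<zeta>|usphere. norm (\<zeta> $ ?i) ^ (2 * j) * (norm (\<zeta> $ ?i))\<^sup>2) = ?m (Suc j)"
      by (simp add: sphere_moment_def mult.commute flip: power_add)
    moreover have "(LINT \<zeta>|usphere. norm (\<zeta> $ ?i) ^ (2 * j) * (norm (\<zeta> $ k))\<^sup>2) = ?m (Suc j) / real (Suc j)"
      if "k \<in> UNIV - {?i}" for k
      using mixed_moment[of ?i k "Suc j"] that by (simp add: field_simps)
    ultimately show ?thesis by (subst sum.remove[of _ ?i]) auto
  qed
  also have "\<dots> = ?m (Suc j) + real (CARD('n) - 1) * (?m (Suc j) / real (Suc j))"
    by (simp add: card_Diff_singleton)
  also have "real (CARD('n) - 1) = real CARD('n) - 1"
    by (simp add: of_nat_diff Suc_leI zero_less_card_finite)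
  finally show ?thesis by (simp add: field_simps)
qed

text \<open>The value is the reciprocal of the j-th Taylor coefficient of
  \<open>1 / (1 - x) ^ CARD('n)\<close>; this reciprocity is why that function gives the reproducing
  kernel.\<close>

lemma sphere_moment_eq: "sphere_moment TYPE('n::finite) j = fact j / pochhammer (real CARD('n)) j"
proof (induction j)
  case (Suc j)
  have "pochhammer (real CARD('n)) j > 0" by (intro pochhammer_pos) (simp add: zero_less_card_finite)
  moreover have "real (CARD('n) + j) > 0"
    by (simp only: of_nat_0_less_iff) (simp add: zero_less_card_finite)
  moreover have "real (CARD('n) + j) * sphere_moment TYPE('n) (Suc j)
      = real (Suc j) * (fact j / pochhammer (real CARD('n)) j)"
    using sphere_moment_Suc[where 'n = 'n, of j] unfolding Suc .
  ultimately have "sphere_moment TYPE('n) (Suc j)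
      = real (Suc j) * (fact j / pochhammer (real CARD('n)) j) / real (CARD('n) + j)"
    by (metis nonzero_mult_div_cancel_left less_numeral_extra(3))
  then show ?case by (simp add: pochhammer_Suc mult.commute)
qed (simp add: sphere_moment_0)

section \<open>The Szego formula\<close>

lemma unit_circle_mean:
  assumes hol: "H holomorphic_on ball 0 R" and "R > 1"
  shows "integral {0..1} (\<lambda>t. H (exp (2 * of_real pi * \<i> * of_real t)) / exp (2 * of_real pi * \<i> * of_real t) ^ j)
    = (deriv ^^ j) H 0 / fact j"
proof -
  let ?e = "\<lambda>t::real. exp (2 * of_real pi * \<i> * of_real t) :: complex"
  have "((\<lambda>u. H u / (u - 0) ^ Suc j) has_contour_integral (2 * pi * \<i>) / fact j * (deriv ^^ j) H 0) (circlepath 0 1)"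
    by (rule Cauchy_has_contour_integral_higher_derivative_circlepath)
      (use assms in \<open>auto intro!: holomorphic_on_imp_continuous_on intro: holomorphic_on_subset\<close>)
  then have "((\<lambda>t. H (?e t) / ?e t ^ Suc j * (2 * of_real pi * \<i> * ?e t)) has_integral
      (2 * pi * \<i>) / fact j * (deriv ^^ j) H 0) {0..1}"
    unfolding has_contour_integral vector_derivative_circlepath by (simp add: circlepath)
  from has_integral_mult_right[OF this, of "1 / (2 * of_real pi * \<i>)"]
  have "((\<lambda>t. H (?e t) / ?e t ^ j) has_integral (deriv ^^ j) H 0 / fact j) {0..1}"
    by (simp add: field_simps)
  then show ?thesis by (rule integral_unique)
qed

text \<open>Each \<open>T t\<close> preserves the measure, so the integral over the sphere does not
  depend on t; Fubini then moves the average over t inside.\<close>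

lemma usphere_average:
  fixes g :: "complex ^ 'n \<Rightarrow> complex" and T :: "real \<Rightarrow> complex ^ 'n \<Rightarrow> complex ^ 'n"
  assumes T: "\<And>t. linear (T t)" "\<And>t x. norm (T t x) = norm x"
    and contT: "continuous_on (sphere 0 1 \<times> {0..1}) (\<lambda>(x, t). T t x)"
    and g: "continuous_on (sphere 0 1) g"
  shows "(LINT \<zeta>|usphere. g \<zeta>) = (LINT \<zeta>|usphere. integral {0..1} (\<lambda>t. g (T t \<zeta>)))"
proof -
  let ?I = "restrict_space lborel {0..1::real}"
  have fin: "finite_measure ?I"
    by (rule finite_measureI) (simp add: space_restrict_space emeasure_restrict_space)
  have sets: "sets ?I = sets (restrict_space borel {0..1})"
    by (rule sets_restrict_space_cong) simp
  have cont: "continuous_on (sphere 0 1 \<times> {0..1}) (\<lambda>(x, t). g (T t x))"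
    using continuous_on_compose2[OF g contT] T(2) by (simp add: case_prod_beta image_subset_iff)
  have HK: "(LINT t|?I. g (T t \<zeta>)) = integral {0..1} (\<lambda>t. g (T t \<zeta>))" if "\<zeta> \<in> sphere 0 1" for \<zeta>
  proof -
    have "continuous_on {0..1} (\<lambda>t. (\<zeta>, t))" by (intro continuous_intros)
    from continuous_on_compose2[OF cont this]
    have c: "continuous_on {0..1} (\<lambda>t. g (T t \<zeta>))" using that by (simp add: image_subset_iff)
    have "(LINT t|?I. g (T t \<zeta>)) = (LINT t:{0..1}|lborel. g (T t \<zeta>))"
      unfolding set_lebesgue_integral_def by (rule integral_restrict_space) simp
    also have "\<dots> = integral {0..1} (\<lambda>t. g (T t \<zeta>))"
      by (rule set_borel_integral_eq_integral) (rule borel_integrable_compact[OF _ c, folded set_integrable_def], simp)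
    finally show ?thesis .
  qed
  have "(LINT \<zeta>|usphere. integral {0..1} (\<lambda>t. g (T t \<zeta>))) = (LINT \<zeta>|usphere. LINT t|?I. g (T t \<zeta>))"
    by (intro Bochner_Integration.integral_cong refl) (simp add: HK)
  also have "\<dots> = (LINT t|?I. LINT \<zeta>|usphere. g (T t \<zeta>))"
    by (rule Fubini_continuous[OF finite_measure_usphere sets_usphere _ fin sets _ cont]) auto
  also have "\<dots> = (LINT t|?I. LINT \<zeta>|usphere. g \<zeta>)"
    by (intro Bochner_Integration.integral_cong refl usphere_isometry T g)
  also have "\<dots> = (LINT \<zeta>|usphere. g \<zeta>)"
    by (simp add: measure_def space_restrict_space emeasure_restrict_space)
  finally show ?thesis by simp
qed

definition szego :: "complex ^ 'n \<Rightarrow> complex ^ 'n \<Rightarrow> complex" where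
  "szego z w = 1 / (1 - cinner z w) ^ CARD('n)"

lemma one_minus_nonzero: "norm x < 1 \<Longrightarrow> 1 - x \<noteq> (0::complex)"
  by auto

lemma szego_series:
  fixes x :: complex
  assumes "norm x < 1" "N > 0"
  shows "(\<lambda>j. of_real (pochhammer (real N) j / fact j) * x ^ j) sums (1 / (1 - x) ^ N)"
proof -
  have "(\<lambda>j. (- of_nat N gchoose j) * (- x) ^ j) sums (1 + (- x)) powr (- of_nat N)"
    by (rule gen_binomial_complex) (use assms in simp)
  moreover have "(- of_nat N gchoose j) * (- x) ^ j = of_real (pochhammer (real N) j / fact j) * x ^ j" for j
  proof -
    have "(- of_nat N gchoose j) * (- x) ^ j = (pochhammer (of_nat N) j / fact j) * ((-1) ^ j * (- x) ^ j)"
      by (simp add: gbinomial_pochhammer mult_ac)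
    also have "(-1) ^ j * (- x) ^ j = x ^ j" by (simp flip: power_mult_distrib)
    also have "pochhammer (of_nat N) j = (of_real (pochhammer (real N) j) :: complex)"
      using pochhammer_of_real[of "real N" j, where 'a = complex] by simp
    finally show ?thesis by simp
  qed
  moreover have "(1 + (- x)) powr (- of_nat N) = 1 / (1 - x) ^ N"
    using one_minus_nonzero[OF assms(1)] by (simp add: powr_minus powr_nat inverse_eq_divide)
  ultimately show ?thesis by simp
qed

text \<open>\<open>R\<close> multiplies the component orthogonal to e by the phase c and fixes the
  component along e, hence also the Szego kernel with a point on the line through e.\<close>

lemma linear_rotate:
  fixes e :: "complex ^ 'n"
  assumes "norm e = 1" "norm c = 1"
  defines "R \<equiv> (\<lambda>\<zeta>. cinner \<zeta> e *s e + c *s (\<zeta> - cinner \<zeta> e *s e))"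
  shows "linear R" "norm (R \<zeta>) = norm \<zeta>" "cinner (R \<zeta>) e = cinner \<zeta> e"
proof -
  show "linear R"
    unfolding R_def
    by (rule linearI_complex) (simp_all add: cinner_add_left cinner_smult_left vec_eq_iff algebra_simps)
  have ee: "cinner e e = 1" by (simp add: cinner_self assms)
  define v where "v = \<zeta> - cinner \<zeta> e *s e"
  have o: "cinner e v = 0"
    by (simp add: v_def cinner_diff_right cinner_smult_right ee cnj_cinner)
  have sq: "(norm (cinner \<zeta> e *s e + c *s v))\<^sup>2 = (norm (cinner \<zeta> e *s e))\<^sup>2 + (norm v)\<^sup>2"
    if "norm c = 1" for c
    unfolding norm_add_sq by (simp add: cinner_smult_left cinner_smult_right o norm_vec_smult that)
  have "(norm (R \<zeta>))\<^sup>2 = (norm \<zeta>)\<^sup>2"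
    using sq[OF assms(2)] sq[of 1] by (simp add: R_def v_def)
  then show "norm (R \<zeta>) = norm \<zeta>" by simp
  have "cinner v e = 0" by (simp add: v_def cinner_diff_left cinner_smult_left ee)
  moreover have "cinner (R \<zeta>) e = cinner \<zeta> e * cinner e e + c * cinner v e"
    by (simp only: R_def v_def cinner_add_left cinner_smult_left)
  ultimately show "cinner (R \<zeta>) e = cinner \<zeta> e" by (simp add: ee)
qed

lemma line_holomorphic:
  assumes "mv_holomorphic_on f S" "\<And>c. c \<in> A \<Longrightarrow> u + c *s v \<in> S"
  shows "(\<lambda>c. f (u + c *s v)) holomorphic_on A"
  unfolding holomorphic_on_def
  by (auto intro!: field_differentiable_at_within mv_holomorphic_on_line[OF assms(1)] assms(2))

text \<open>The dilation by s makes the integrand continuous on the sphere. Averaging over the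
  rotations around z replaces f by its restriction \<open>h\<close> to the complex line through z;
  in the expansion of the kernel the coefficients \<open>b j\<close> cancel the moments of the
  sphere, and the Taylor series of \<open>h\<close> remains.\<close>

theorem szego_formula:
  fixes f :: "complex ^ 'n \<Rightarrow> complex"
  assumes hol: "mv_holomorphic_on f (ball 0 1)" and s: "0 < s" "s < 1" and z: "norm z < 1"
  shows "(LINT \<zeta>|usphere. f (s *\<^sub>R \<zeta>) * szego z \<zeta>) = f (s *\<^sub>R z)"
proof -
  define \<rho> where "\<rho> = norm z"
  define e where "e = (if z = 0 then axis undefined 1 else (1 / complex_of_real \<rho>) *s z)"
  have e: "norm e = 1" by (auto simp: e_def \<rho>_def norm_vec_smult norm_divide)
  have z_eq: "z = of_real \<rho> *s e" by (auto simp: e_def \<rho>_def vector_smult_assoc)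
  have \<rho>: "0 \<le> \<rho>" "\<rho> < 1" using z by (simp_all add: \<rho>_def)
  define k where "k p = 1 / (1 - of_real \<rho> * cnj p) ^ CARD('n)" for p
  have kz: "szego z \<zeta> = k (cinner \<zeta> e)" for \<zeta>
    unfolding szego_def k_def z_eq by (simp add: cinner_smult_left cnj_cinner)
  have ce: "norm (cinner \<zeta> e) \<le> 1" if "\<zeta> \<in> sphere 0 1" for \<zeta>
    using norm_cinner_le[of \<zeta> e] that e by simp
  have knz: "1 - of_real \<rho> * cnj p \<noteq> 0" if "norm p \<le> 1" for p
    using \<rho> that by (intro one_minus_nonzero) (auto simp: norm_mult intro: le_less_trans[OF mult_left_le])
  have k_cont: "continuous_on (sphere 0 1) (\<lambda>\<zeta>. k (cinner \<zeta> e))"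
    unfolding k_def using knz ce by (intro continuous_intros) auto
  have fs_cont: "continuous_on A (\<lambda>\<zeta>. f (s *\<^sub>R g \<zeta>))"
    if "continuous_on A g" "\<And>\<zeta>. \<zeta> \<in> A \<Longrightarrow> norm (g \<zeta>) \<le> 1" for A and g :: "complex ^ 'n \<Rightarrow> complex ^ 'n"
  proof (rule continuous_on_compose2[OF mv_holomorphic_on_imp_continuous_on[OF hol]])
    show "continuous_on A (\<lambda>\<zeta>. s *\<^sub>R g \<zeta>)" by (intro continuous_intros that)
    have "s * norm (g \<zeta>) < 1" if "\<zeta> \<in> A" for \<zeta>
      using s \<open>\<And>\<zeta>. \<zeta> \<in> A \<Longrightarrow> norm (g \<zeta>) \<le> 1\<close>[OF that] by (meson le_less_trans mult_left_le less_imp_le)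
    then show "(\<lambda>\<zeta>. s *\<^sub>R g \<zeta>) ` A \<subseteq> ball 0 1" using s by auto
  qed
  have s1: "1 / s > 1" using s by simp
  let ?ex = "\<lambda>t::real. exp (2 * of_real pi * \<i> * of_real t) :: complex"
  have ex1: "norm (?ex t) = 1" for t by (simp add: norm_exp_eq_Re)
  have exnz: "?ex t \<noteq> 0" for t by simp
  define h where "h c = f (s *\<^sub>R (c *s e))" for c
  have h_hol: "h holomorphic_on ball 0 (1 / s)"
  proof -
    have "(\<lambda>c. f (0 + c *s (of_real s *s e))) holomorphic_on ball 0 (1 / s)"
      by (rule line_holomorphic[OF hol]) (use s e in \<open>auto simp: norm_vec_smult norm_mult field_simps\<close>)
    then show ?thesis by (simp add: h_def[abs_def] scaleR_eq_smult vector_smult_assoc mult.commute)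
  qed
  have h_cont: "continuous_on (sphere 0 1) (\<lambda>\<zeta>. h (cinner \<zeta> e))"
    unfolding h_def by (rule fs_cont) (auto intro!: continuous_intros simp: norm_vec_smult e ce)
  text \<open>Averaging over the rotations that fix \<open>\<langle>\<zeta>, e\<rangle>\<close> reduces to a function of one variable.\<close>
  have "(LINT \<zeta>|usphere. f (s *\<^sub>R \<zeta>) * szego z \<zeta>) = (LINT \<zeta>|usphere. f (s *\<^sub>R \<zeta>) * k (cinner \<zeta> e))"
    by (simp add: kz)
  also have "\<dots> = (LINT \<zeta>|usphere. integral {0..1} (\<lambda>t.
      f (s *\<^sub>R (cinner \<zeta> e *s e + ?ex t *s (\<zeta> - cinner \<zeta> e *s e)))
      * k (cinner (cinner \<zeta> e *s e + ?ex t *s (\<zeta> - cinner \<zeta> e *s e)) e)))"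
  proof (rule usphere_average[where T = "\<lambda>t \<zeta>. cinner \<zeta> e *s e + ?ex t *s (\<zeta> - cinner \<zeta> e *s e)"])
    show "continuous_on (sphere 0 1 \<times> {0..1})
       (\<lambda>(\<zeta>, t). cinner \<zeta> e *s e + ?ex t *s (\<zeta> - cinner \<zeta> e *s e))"
      unfolding case_prod_beta by (intro continuous_intros)
    show "continuous_on (sphere 0 1) (\<lambda>\<zeta>. f (s *\<^sub>R \<zeta>) * k (cinner \<zeta> e))"
      by (intro continuous_intros k_cont fs_cont) auto
  qed (rule linear_rotate[OF e ex1])+
  also have "\<dots> = (LINT \<zeta>|usphere. h (cinner \<zeta> e) * k (cinner \<zeta> e))"
  proof (rule Bochner_Integration.integral_cong[OF refl])
    fix \<zeta> :: "complex ^ 'n" assume "\<zeta> \<in> space usphere"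
    then have \<zeta>: "norm \<zeta> = 1" by simp
    define p where "p = cinner \<zeta> e"
    define v where "v = \<zeta> - p *s e"
    have ee: "cinner e e = 1" by (simp add: cinner_self e)
    have o: "cinner e v = 0"
      by (simp add: v_def p_def cinner_diff_right cinner_smult_right ee cnj_cinner)
    have sq: "(norm (p *s e + c *s v))\<^sup>2 = (norm p)\<^sup>2 + (norm c)\<^sup>2 * (norm v)\<^sup>2" for c
      unfolding norm_add_sq by (simp add: cinner_smult_left cinner_smult_right o norm_vec_smult e power_mult_distrib)
    have pv: "(norm p)\<^sup>2 + (norm v)\<^sup>2 = 1"
      using sq[of 1] \<zeta> by (simp add: v_def)
    have inball: "s *\<^sub>R (p *s e + c *s v) \<in> ball 0 1" if c: "norm c < 1 / s" for c
    proof -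
      have "s\<^sup>2 * ((norm p)\<^sup>2 + (norm c)\<^sup>2 * (norm v)\<^sup>2) < 1"
      proof -
        have "s * norm c < 1" using c s by (simp add: field_simps)
        then have "(s * norm c)\<^sup>2 < 1" using s by (simp add: power_less_one_iff abs_square_less_1)
        moreover have "s\<^sup>2 < 1" using s by (simp add: power_less_one_iff)
        ultimately have m: "max (s\<^sup>2) ((s * norm c)\<^sup>2) < 1" by simp
        have "s\<^sup>2 * ((norm p)\<^sup>2 + (norm c)\<^sup>2 * (norm v)\<^sup>2) = s\<^sup>2 * (norm p)\<^sup>2 + (s * norm c)\<^sup>2 * (norm v)\<^sup>2"
          by (simp add: algebra_simps power_mult_distrib)
        also have "\<dots> \<le> max (s\<^sup>2) ((s * norm c)\<^sup>2) * (norm p)\<^sup>2 + max (s\<^sup>2) ((s * norm c)\<^sup>2) * (norm v)\<^sup>2"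
          by (intro add_mono mult_right_mono) auto
        also have "\<dots> = max (s\<^sup>2) ((s * norm c)\<^sup>2)" using pv by (simp flip: distrib_left)
        finally show ?thesis using m by linarith
      qed
      then have "(s * norm (p *s e + c *s v))\<^sup>2 < 1" by (simp add: power_mult_distrib sq)
      then have "s * norm (p *s e + c *s v) < 1" using s by (simp add: abs_square_less_1)
      then show ?thesis using s by simp
    qed
    let ?H = "\<lambda>c. f (s *\<^sub>R (p *s e + c *s v)) * k p"
    have "?H holomorphic_on ball 0 (1 / s)"
    proof -
      have eq: "s *\<^sub>R (p *s e + c *s v) = s *\<^sub>R (p *s e) + c *s (of_real s *s v)" for c
        by (simp add: scaleR_eq_smult vector_add_ldistrib vector_smult_assoc mult.commute)
      have "(\<lambda>c. f (s *\<^sub>R (p *s e) + c *s (of_real s *s v))) holomorphic_on ball 0 (1 / s)"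
        by (rule line_holomorphic[OF hol]) (use inball eq in auto)
      then show ?thesis unfolding eq by (intro holomorphic_intros)
    qed
    \<comment> \<open>\<open>?H\<close> is holomorphic in the factor of the orthogonal component, so
      its mean over the unit circle is its value at 0, where that component is gone.\<close>
    from unit_circle_mean[OF this s1, of 0]
    have "integral {0..1} (\<lambda>t. ?H (?ex t)) = ?H 0" by simp
    moreover have "cinner (p *s e + ?ex t *s v) e = p" for t
      using linear_rotate(3)[OF e ex1, of \<zeta> t] by (simp add: p_def v_def)
    ultimately show "integral {0..1} (\<lambda>t.
      f (s *\<^sub>R (cinner \<zeta> e *s e + ?ex t *s (\<zeta> - cinner \<zeta> e *s e)))
      * k (cinner (cinner \<zeta> e *s e + ?ex t *s (\<zeta> - cinner \<zeta> e *s e)) e)) = h (cinner \<zeta> e) * k (cinner \<zeta> e)"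
      by (simp add: h_def p_def[symmetric] v_def[symmetric])
  qed
  also have "\<dots> = h (of_real \<rho>)"
  proof -
    define a where "a j = (deriv ^^ j) h 0 / fact j" for j
    define b where "b j = complex_of_real (pochhammer (real CARD('n)) j / fact j)" for j
    let ?m = "sphere_moment TYPE('n)"
    have b_eq: "b j * of_real (?m j) = 1" for j
    proof -
      have "pochhammer (real CARD('n)) j > 0" by (intro pochhammer_pos) (simp add: zero_less_card_finite)
      then show ?thesis by (simp add: b_def sphere_moment_eq flip: of_real_mult of_real_divide)
    qed
    let ?F = "\<lambda>j \<zeta>. h (cinner \<zeta> e) * (b j * (of_real \<rho> * cnj (cinner \<zeta> e)) ^ j)"
    \<comment> \<open>A second average, over scalar rotations of \<zeta>, picks out the j-th Taylor
      coefficient of \<open>h\<close>.\<close>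
    have coeff: "(LINT \<zeta>|usphere. h (cinner \<zeta> e) * cnj (cinner \<zeta> e) ^ j) = a j * of_real (?m j)" for j
    proof -
      let ?g = "\<lambda>\<zeta>. h (cinner \<zeta> e) * cnj (cinner \<zeta> e) ^ j"
      have lin: "linear (\<lambda>\<zeta> :: complex ^ 'n. ?ex t *s \<zeta>)" for t
        by (rule linearI_complex) (simp_all add: vector_add_ldistrib vector_smult_assoc mult.commute)
      have "(LINT \<zeta>|usphere. ?g \<zeta>) = (LINT \<zeta>|usphere. integral {0..1} (\<lambda>t. ?g (?ex t *s \<zeta>)))"
        by (rule usphere_average[where T = "\<lambda>t \<zeta>. ?ex t *s \<zeta>"])
           (auto intro!: lin continuous_intros h_cont simp: norm_vec_smult ex1 case_prod_beta)
      also have "\<dots> = (LINT \<zeta>|usphere. a j * of_real (norm (cinner \<zeta> e) ^ (2 * j)))"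
      proof (rule Bochner_Integration.integral_cong[OF refl])
        fix \<zeta> :: "complex ^ 'n" assume "\<zeta> \<in> space usphere"
        then have p: "norm (cinner \<zeta> e) \<le> 1" using ce by simp
        let ?p = "cinner \<zeta> e"
        let ?H = "\<lambda>c. h (?p * c)"
        have sub: "?p * c \<in> ball 0 (1 / s)" if "c \<in> ball 0 (1 / s)" for c
          using that p mult_right_mono[OF p, of "norm c"] by (auto simp: norm_mult)
        have H: "?H holomorphic_on ball 0 (1 / s)"
          by (rule holomorphic_on_compose_gen[OF _ h_hol, unfolded o_def])
             (use sub in \<open>auto intro!: holomorphic_intros\<close>)
        have "(deriv ^^ j) ?H 0 = ?p ^ j * (deriv ^^ j) h (?p * 0)"
          by (rule higher_deriv_compose_linear[OF h_hol, of "ball 0 (1/s)"]) (use sub s in auto)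
        with unit_circle_mean[OF H s1, of j]
        have "integral {0..1} (\<lambda>t. ?H (?ex t) / ?ex t ^ j) = ?p ^ j * a j" by (simp add: a_def)
        moreover have "?g (?ex t *s \<zeta>) = (?H (?ex t) / ?ex t ^ j) * cnj ?p ^ j" for t
        proof -
          have "cnj (?ex t) = 1 / ?ex t"
            using complex_norm_square[of "?ex t"] exnz[of t] by (simp add: ex1 field_simps)
          then have "?g (?ex t *s \<zeta>) = h (?ex t * ?p) * (1 / ?ex t * cnj ?p) ^ j"
            by (simp only: cinner_smult_left complex_cnj_mult)
          then show ?thesis by (simp only: power_mult_distrib power_one_over) (simp add: mult.commute)
        qed
        ultimately have "integral {0..1} (\<lambda>t. ?g (?ex t *s \<zeta>)) = ?p ^ j * a j * cnj ?p ^ j"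
          by (simp only: integral_mult_left)
        also have "\<dots> = a j * of_real (norm ?p ^ (2 * j))"
          unfolding norm_power_even by (simp only: mult_ac)
        finally show "integral {0..1} (\<lambda>t. ?g (?ex t *s \<zeta>)) = a j * of_real (norm ?p ^ (2 * j))" .
      qed
      also have "\<dots> = a j * of_real (?m j)"
        using sphere_moment_unit[OF e, of j] by (simp del: of_real_power)
      finally show ?thesis .
    qed
    obtain B where B: "\<And>\<zeta>. \<zeta> \<in> sphere 0 1 \<Longrightarrow> norm (h (cinner \<zeta> e)) \<le> B"
      using compact_imp_bounded[OF compact_continuous_image[OF h_cont compact_sphere]]
      unfolding bounded_iff by blast
    have nb: "norm (b j) = pochhammer (real CARD('n)) j / fact j" for j
      by (simp add: b_def norm_mult norm_divide pochhammer_nonneg)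
    have sum_b: "summable (\<lambda>j. norm (b j) * \<rho> ^ j)"
    proof -
      have "(\<lambda>j. b j * of_real \<rho> ^ j) sums (1 / (1 - of_real \<rho>) ^ CARD('n))"
        unfolding b_def using \<rho> by (intro szego_series) (simp_all add: zero_less_card_finite)
      then have "summable (\<lambda>j. Re (b j * of_real \<rho> ^ j))"
        by (intro summable_Re sums_summable)
      moreover have "Re (b j * of_real \<rho> ^ j) = norm (b j) * \<rho> ^ j" for j
      proof -
        have "b j * of_real \<rho> ^ j = complex_of_real (norm (b j) * \<rho> ^ j)"
          unfolding nb by (simp add: b_def)
        then show ?thesis by (simp only: Re_complex_of_real)
      qed
      ultimately show ?thesis by (simp only:)
    qed
    have Fint: "integrable usphere (?F j)" for j
      by (intro usphere_integrable continuous_intros h_cont)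
    have Fle: "norm (?F j \<zeta>) \<le> B * (norm (b j) * \<rho> ^ j)" if "\<zeta> \<in> sphere 0 1" for j \<zeta>
    proof -
      have "norm (of_real \<rho> * cnj (cinner \<zeta> e)) \<le> \<rho>"
        using ce[OF that] \<rho> by (simp add: norm_mult mult_left_le)
      then have "norm (of_real \<rho> * cnj (cinner \<zeta> e)) ^ j \<le> \<rho> ^ j" by (intro power_mono) auto
      moreover have "0 \<le> B" using B[OF that] norm_ge_zero order_trans by blast
      ultimately show ?thesis
        using B[OF that] unfolding norm_mult norm_power by (intro mult_mono) auto
    qed
    have "(\<lambda>j. LINT \<zeta>|usphere. ?F j \<zeta>) sums (LINT \<zeta>|usphere. (\<Sum>j. ?F j \<zeta>))"
    proof (rule sums_integral[OF Fint])
      show "AE \<zeta> in usphere. summable (\<lambda>j. norm (?F j \<zeta>))"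
      proof (rule AE_I2)
        fix \<zeta> :: "complex ^ 'n" assume "\<zeta> \<in> space usphere"
        then show "summable (\<lambda>j. norm (?F j \<zeta>))"
          by (intro summable_comparison_test'[OF summable_mult[OF sum_b, of B]]) (use Fle in auto)
      qed
      show "summable (\<lambda>j. LINT \<zeta>|usphere. norm (?F j \<zeta>))"
      proof (rule summable_comparison_test'[OF summable_mult[OF sum_b, of B]])
        fix j :: nat
        have "(LINT \<zeta>|usphere. norm (?F j \<zeta>)) \<le> (LINT \<zeta>|(usphere :: (complex ^ 'n) measure). B * (norm (b j) * \<rho> ^ j))"
          by (intro integral_mono integrable_norm Fint) (use Fle in \<open>auto intro!: usphere_integrable\<close>)
        then show "norm (LINT \<zeta>|usphere. norm (?F j \<zeta>)) \<le> B * (norm (b j) * \<rho> ^ j)"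
          by (simp add: measure_usphere)
      qed
    qed
    moreover have "(LINT \<zeta>|usphere. (\<Sum>j. ?F j \<zeta>)) = (LINT \<zeta>|usphere. h (cinner \<zeta> e) * k (cinner \<zeta> e))"
    proof (rule Bochner_Integration.integral_cong[OF refl])
      fix \<zeta> :: "complex ^ 'n" assume "\<zeta> \<in> space usphere"
      then have "norm (of_real \<rho> * cnj (cinner \<zeta> e)) < 1"
        using ce[of \<zeta>] \<rho> by (auto simp: norm_mult intro: le_less_trans[OF mult_left_le])
      from szego_series[OF this, of "CARD('n)"]
      have "(\<lambda>j. b j * (of_real \<rho> * cnj (cinner \<zeta> e)) ^ j) sums k (cinner \<zeta> e)"
        by (simp add: b_def k_def zero_less_card_finite)
      from sums_mult[OF this, of "h (cinner \<zeta> e)"]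
      show "(\<Sum>j. ?F j \<zeta>) = h (cinner \<zeta> e) * k (cinner \<zeta> e)" by (rule sums_unique[symmetric])
    qed
    moreover have "(LINT \<zeta>|usphere. ?F j \<zeta>) = a j * of_real \<rho> ^ j" for j
    proof -
      have "?F j = (\<lambda>\<zeta>. (b j * of_real \<rho> ^ j) * (h (cinner \<zeta> e) * cnj (cinner \<zeta> e) ^ j))"
        by (simp add: fun_eq_iff power_mult_distrib mult_ac)
      then have "(LINT \<zeta>|usphere. ?F j \<zeta>) = (b j * of_real \<rho> ^ j) * (a j * of_real (?m j))"
        by (simp only: integral_mult_right_zero coeff)
      also have "\<dots> = (b j * of_real (?m j)) * (a j * of_real \<rho> ^ j)" by (simp only: mult_ac)
      finally show ?thesis by (simp only: b_eq mult_1)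
    qed
    ultimately have "(\<lambda>j. a j * of_real \<rho> ^ j) sums (LINT \<zeta>|usphere. h (cinner \<zeta> e) * k (cinner \<zeta> e))"
      by simp
    moreover have "(\<lambda>j. a j * (of_real \<rho> - 0) ^ j) sums h (of_real \<rho>)"
      unfolding a_def by (rule holomorphic_power_series[OF h_hol]) (use \<rho> less_trans[OF \<rho>(2) s1] in auto)
    ultimately show ?thesis by (simp add: sums_unique2)
  qed
  also have "\<dots> = f (s *\<^sub>R z)" by (simp add: h_def z_eq)
  finally show ?thesis .
qed

section \<open>Integral estimates on the sphere and monotonicity of the means\<close>

lemma continuous_on_LINT:
  fixes F :: "'a::metric_space \<Rightarrow> 'b::metric_space \<Rightarrow> 'c::{banach, second_countable_topology}"
  assumes N: "finite_measure N" "sets N = sets (restrict_space borel B)" "compact B" and "compact A"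
    and F: "continuous_on (A \<times> B) (\<lambda>(x, y). F x y)"
  shows "continuous_on A (\<lambda>x. LINT y|N. F x y)"
  unfolding continuous_on_sequentially o_def
proof (intro allI ballI impI)
  fix u x assume x: "x \<in> A" and u: "(\<forall>n. u n \<in> A) \<and> u \<longlonglongrightarrow> x"
  interpret N: finite_measure N by fact
  have sp: "space N = B"
    using sets_eq_imp_space_eq[OF N(2)] by (simp add: space_restrict_space)
  obtain C where C: "\<And>p. p \<in> A \<times> B \<Longrightarrow> norm ((\<lambda>(x, y). F x y) p) \<le> C"
    using compact_imp_bounded[OF compact_continuous_image[OF F compact_Times[OF \<open>compact A\<close> N(3)]]]
    by (auto simp: bounded_iff)
  have c: "continuous_on B (F z)" if "z \<in> A" for z
  proof -
    have "continuous_on B (\<lambda>y. (z, y))" by (intro continuous_intros)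
    from continuous_on_compose2[OF F this] show ?thesis using that by (simp add: image_subset_iff)
  qed
  note m = integrable_continuous_compact[OF N c, THEN borel_measurable_integrable]
  show "(\<lambda>n. LINT y|N. F (u n) y) \<longlonglongrightarrow> (LINT y|N. F x y)"
  proof (rule integral_dominated_convergence[where w = "\<lambda>_. C"])
    show "AE y in N. (\<lambda>n. F (u n) y) \<longlonglongrightarrow> F x y"
    proof (rule AE_I2)
      fix y assume "y \<in> space N"
      moreover have "(\<lambda>n. (u n, y)) \<longlonglongrightarrow> (x, y)" using u by (intro tendsto_intros) auto
      ultimately have "((\<lambda>(x, y). F x y) \<circ> (\<lambda>n. (u n, y))) \<longlonglongrightarrow> (\<lambda>(x, y). F x y) (x, y)"
        using F x u sp unfolding continuous_on_sequentially by auto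
      then show "(\<lambda>n. F (u n) y) \<longlonglongrightarrow> F x y" by (simp add: o_def)
    qed
    show "AE y in N. norm (F (u n) y) \<le> C" for n
      using C u sp by (intro AE_I2) auto
  qed (use m x u in auto)
qed

lemma usphere_Fubini:
  fixes F :: "complex ^ 'n \<Rightarrow> complex ^ 'n \<Rightarrow> complex"
  assumes "continuous_on (sphere 0 1 \<times> sphere 0 1) (\<lambda>(x, y). F x y)"
  shows "(LINT x|usphere. LINT y|usphere. F x y) = (LINT y|usphere. LINT x|usphere. F x y)"
  by (rule Fubini_continuous[OF finite_measure_usphere sets_usphere compact_sphere
      finite_measure_usphere sets_usphere compact_sphere assms])

lemma usphere_continuous_LINT:
  fixes F :: "'a::metric_space \<Rightarrow> complex ^ 'n \<Rightarrow> complex"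
  assumes "compact A" "continuous_on (A \<times> sphere 0 1) (\<lambda>(x, y). F x y)"
  shows "continuous_on A (\<lambda>x. LINT y|usphere. F x y)"
  by (rule continuous_on_LINT[OF finite_measure_usphere sets_usphere compact_sphere assms])

lemma usphere_Cauchy_Schwarz:
  fixes a b :: "complex ^ 'n \<Rightarrow> complex"
  assumes a: "continuous_on (sphere 0 1) a" and b: "continuous_on (sphere 0 1) b"
  shows "(norm (LINT \<zeta>|usphere. a \<zeta> * b \<zeta>))\<^sup>2
    \<le> (LINT \<zeta>|usphere. (norm (a \<zeta>))\<^sup>2) * (LINT \<zeta>|usphere. (norm (b \<zeta>))\<^sup>2)"
proof -
  define X where "X = (LINT \<zeta>|usphere. (norm (a \<zeta>))\<^sup>2)"
  define Y where "Y = (LINT \<zeta>|usphere. (norm (b \<zeta>))\<^sup>2)"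
  define Z where "Z = (LINT \<zeta>|usphere. norm (a \<zeta>) * norm (b \<zeta>))"
  have sq: "0 \<le> p\<^sup>2 * X - 2 * p * q * Z + q\<^sup>2 * Y" for p q
  proof -
    have "0 \<le> (LINT \<zeta>|usphere. (p * norm (a \<zeta>) - q * norm (b \<zeta>))\<^sup>2)"
      by (rule integral_nonneg_AE) simp
    also have "\<dots> = (LINT \<zeta>|usphere. p\<^sup>2 * (norm (a \<zeta>))\<^sup>2 - (2 * p * q) * (norm (a \<zeta>) * norm (b \<zeta>)) + q\<^sup>2 * (norm (b \<zeta>))\<^sup>2)"
      by (intro Bochner_Integration.integral_cong refl) (simp add: power2_eq_square algebra_simps)
    also have "\<dots> = p\<^sup>2 * X - 2 * p * q * Z + q\<^sup>2 * Y"
      unfolding X_def Y_def Z_def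
      by (subst Bochner_Integration.integral_add Bochner_Integration.integral_diff;
          (intro usphere_integrable continuous_intros a b)?)+ simp
    finally show ?thesis .
  qed
  have nonneg: "0 \<le> X" "0 \<le> Y" "0 \<le> Z"
    unfolding X_def Y_def Z_def by (auto intro!: integral_nonneg_AE)
  have "norm (LINT \<zeta>|usphere. a \<zeta> * b \<zeta>) \<le> Z"
    unfolding Z_def norm_mult[symmetric] by (rule integral_norm_bound)
  then have "(norm (LINT \<zeta>|usphere. a \<zeta> * b \<zeta>))\<^sup>2 \<le> Z\<^sup>2" by (intro power_mono) auto
  also have "Z\<^sup>2 \<le> X * Y"
  proof -
    \<comment> \<open>The quadratic form is evaluated at the vectors \<open>(Y, Z)\<close> and
      \<open>(Z, X)\<close>, where it factors through the discriminant; \<open>(1, 1)\<close>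
      settles the case that both X and Y vanish.\<close>
    have 1: "0 \<le> Y * (X * Y - Z\<^sup>2)" using sq[of Y Z] by (simp add: power2_eq_square algebra_simps)
    have 2: "0 \<le> X * (X * Y - Z\<^sup>2)" using sq[of Z X] by (simp add: power2_eq_square algebra_simps)
    show ?thesis
    proof (cases "X = 0 \<and> Y = 0")
      case True
      with sq[of 1 1] nonneg show ?thesis by simp
    next
      case False
      with 1 2 nonneg show ?thesis by (auto simp: zero_le_mult_iff)
    qed
  qed
  finally show ?thesis unfolding X_def Y_def .
qed

lemma szego_formula_ball:
  fixes G :: "complex ^ 'n \<Rightarrow> complex"
  assumes G: "mv_holomorphic_on G (ball 0 R)" and "R > 1" and z: "norm z < 1"
  shows "(LINT \<zeta>|usphere. G \<zeta> * szego z \<zeta>) = G z"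
proof -
  have "mv_holomorphic_on (\<lambda>w. G (of_real R *s w)) (ball 0 1)"
    by (rule mv_holomorphic_on_compose[OF G])
      (use \<open>R > 1\<close> in \<open>auto simp: norm_vec_smult intro!: mv_holomorphic_on_cmult mv_holomorphic_on_nth\<close>)
  from szego_formula[OF this _ _ z, of "1 / R"] \<open>R > 1\<close>
  show ?thesis by (simp add: scaleR_eq_smult vector_smult_assoc)
qed

lemma mv_holomorphic_on_power: "mv_holomorphic_on f S \<Longrightarrow> mv_holomorphic_on (\<lambda>z. f z ^ n) S"
  by (induction n) (auto intro: mv_holomorphic_on_mult)

lemma mv_holomorphic_on_cinner: "mv_holomorphic_on (\<lambda>z. cinner z w) S"
  by (rule mv_holomorphic_on_linear[OF bounded_linear_cinner_left]) (simp add: cinner_smult_left)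

lemma cinner_prod_less_1:
  assumes "norm z * norm w < 1"
  shows "1 - cinner z w \<noteq> 0"
  using norm_cinner_le[of z w] assms by (intro one_minus_nonzero) simp

lemma mv_holomorphic_on_szego:
  assumes "\<And>z. z \<in> S \<Longrightarrow> norm z * norm w < 1"
  shows "mv_holomorphic_on (\<lambda>z. szego z w) S"
proof -
  have "mv_holomorphic_on (\<lambda>z. inverse ((1 - cinner z w) ^ CARD('a))) S"
    by (intro mv_holomorphic_on_inverse mv_holomorphic_on_power mv_holomorphic_on_diff
        mv_holomorphic_on_const mv_holomorphic_on_cinner)
       (use cinner_prod_less_1[OF assms] in auto)
  then show ?thesis by (simp add: szego_def inverse_eq_divide)
qed

lemma cnj_szego: "cnj (szego z w) = szego w z"
  by (simp add: szego_def cnj_cinner)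

lemma norm_szego_commute: "norm (szego z w) = norm (szego w z)"
  by (metis cnj_szego complex_mod_cnj)

lemma continuous_on_szego:
  assumes "continuous_on S f" "continuous_on S g" "\<And>x. x \<in> S \<Longrightarrow> norm (f x) * norm (g x) < 1"
  shows "continuous_on S (\<lambda>x. szego (f x) (g x))"
  unfolding szego_def by (intro continuous_intros assms) (use cinner_prod_less_1[OF assms(3)] in auto)

lemma szego_self: "szego z z = of_real (1 / (1 - (norm z)\<^sup>2) ^ CARD('n))" for z :: "complex ^ 'n"
  by (simp add: szego_def cinner_self)

text \<open>The reproducing formula is applied to \<open>h^2\<close> times the kernel with pole
  parameter z, so that two conjugate kernels multiply to a squared modulus, the Poisson-Szego kernel
  up to normalization. Squaring \<open>h\<close> prepares a bound for its squared modulus.\<close>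

lemma szego_square_formula:
  fixes h :: "complex ^ 'n \<Rightarrow> complex"
  assumes h: "mv_holomorphic_on h (ball 0 R)" and "R > 1" and z: "norm z < 1"
  shows "(LINT \<zeta>|usphere. (h \<zeta>)\<^sup>2 * of_real ((norm (szego z \<zeta>))\<^sup>2)) = (h z)\<^sup>2 * szego z z"
proof -
  \<comment> \<open>On the ball of this radius the kernel \<open>szego w z\<close> is still
    holomorphic in w; for \<open>z = 0\<close> it has no pole.\<close>
  define R' where "R' = (if z = 0 then R else min R (1 / norm z))"
  have R': "R' > 1" "R' \<le> R" "R' * norm z \<le> 1"
    using \<open>R > 1\<close> z by (auto simp: R'_def min_def field_simps)
  have "norm w * norm z < 1" if "w \<in> ball 0 R'" for w
  proof (cases "z = 0")
    case False
    then have "norm w * norm z < R' * norm z" using that by (intro mult_strict_right_mono) auto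
    then show ?thesis using R'(3) by linarith
  qed simp
  then have "mv_holomorphic_on (\<lambda>w. (h w)\<^sup>2 * szego w z) (ball 0 R')"
    using R'(2) by (intro mv_holomorphic_on_mult mv_holomorphic_on_power mv_holomorphic_on_szego
        mv_holomorphic_on_subset[OF h]) auto
  from szego_formula_ball[OF this R'(1) z]
  have "(LINT \<zeta>|usphere. (h \<zeta>)\<^sup>2 * szego \<zeta> z * szego z \<zeta>) = (h z)\<^sup>2 * szego z z" .
  moreover have "(h \<zeta>)\<^sup>2 * szego \<zeta> z * szego z \<zeta> = (h \<zeta>)\<^sup>2 * of_real ((norm (szego z \<zeta>))\<^sup>2)" for \<zeta>
    unfolding complex_norm_square cnj_szego by (simp add: mult_ac)
  ultimately show ?thesis by simp
qed

lemma mv_holomorphic_scale: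
  assumes h: "mv_holomorphic_on h (ball 0 1)" and "0 < s"
  shows "mv_holomorphic_on (\<lambda>z. h (s *\<^sub>R z)) (ball 0 (1 / s))"
  by (rule mv_holomorphic_on_compose[OF h])
     (use assms(2) in \<open>auto simp: scaleR_eq_smult norm_vec_smult field_simps
        intro!: mv_holomorphic_on_cmult mv_holomorphic_on_nth\<close>)

lemma continuous_on_scaled:
  assumes h: "mv_holomorphic_on h (ball 0 1)" and g: "continuous_on A g"
    and "\<And>x. x \<in> A \<Longrightarrow> norm (g x) < 1"
  shows "continuous_on A (\<lambda>x. h (g x))"
  by (rule continuous_on_compose2[OF mv_holomorphic_on_imp_continuous_on[OF h] g])
     (use assms(3) in auto)

text \<open>The Poisson-Szego kernel \<open>?P\<close> bounds the inner value by a mean over the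
  larger sphere; since \<open>?P\<close> is symmetric with constant integral k in either variable,
  integrating and exchanging the order removes it.\<close>

lemma sphere_mean_mono:
  fixes h :: "complex ^ 'n \<Rightarrow> complex"
  assumes h: "mv_holomorphic_on h (ball 0 1)" and s: "0 < s" "s < 1" and r: "0 \<le> r" "r < 1"
  shows "(LINT \<zeta>|usphere. (norm (h ((s * r) *\<^sub>R \<zeta>)))\<^sup>2) \<le> (LINT \<zeta>|usphere. (norm (h (s *\<^sub>R \<zeta>)))\<^sup>2)"
proof -
  let ?S = "sphere (0 :: complex ^ 'n) 1"
  define k where "k = 1 / (1 - r\<^sup>2) ^ CARD('n)"
  have r2: "r\<^sup>2 < 1" using r by (simp add: power_less_one_iff)
  have k: "k > 0" using r2 by (simp add: k_def)
  have kk: "szego (r *\<^sub>R \<zeta>) (r *\<^sub>R \<zeta>) = of_real k" if "\<zeta> \<in> ?S" for \<zeta> :: "complex ^ 'n"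
    using that by (simp add: szego_self k_def power_mult_distrib)
  have hs: "continuous_on A (\<lambda>x. h (s *\<^sub>R g x))" if "continuous_on A g" "\<And>x. x \<in> A \<Longrightarrow> norm (g x) \<le> 1"
    for A :: "'b::topological_space set" and g
    by (rule continuous_on_scaled[OF h])
       (use that s in \<open>auto intro!: continuous_intros intro: le_less_trans[OF mult_left_le]\<close>)
  let ?P = "\<lambda>\<zeta> \<xi> :: complex ^ 'n. (norm (szego (r *\<^sub>R \<zeta>) \<xi>))\<^sup>2"
  have Pc: "continuous_on (?S \<times> ?S) (\<lambda>(\<zeta>, \<xi>). ?P \<zeta> \<xi>)"
    unfolding case_prod_beta using r by (intro continuous_intros continuous_on_szego) auto
  have Pc1: "continuous_on ?S (?P \<zeta>)" if "\<zeta> \<in> ?S" for \<zeta>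
    using r that by (intro continuous_intros continuous_on_szego) auto
  have Psym: "?P \<zeta> \<xi> = ?P \<xi> \<zeta>" for \<zeta> \<xi>
  proof -
    have "szego (r *\<^sub>R \<xi>) \<zeta> = szego \<xi> (r *\<^sub>R \<zeta>)"
      by (simp add: szego_def scaleR_eq_smult cinner_smult_left cinner_smult_right)
    then show ?thesis by (simp only: norm_szego_commute[of \<xi>])
  qed
  have rn: "norm (r *\<^sub>R \<zeta>) < 1" if "\<zeta> \<in> ?S" for \<zeta> :: "complex ^ 'n" using r that by simp
  have Pint: "(LINT \<xi>|usphere. ?P \<zeta> \<xi>) = k" if "\<zeta> \<in> ?S" for \<zeta>
  proof -
    have "(LINT \<xi>|usphere. (1::complex)\<^sup>2 * of_real (?P \<zeta> \<xi>)) = 1\<^sup>2 * szego (r *\<^sub>R \<zeta>) (r *\<^sub>R \<zeta>)"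
      by (rule szego_square_formula[where R = 2 and h = "\<lambda>_. 1", OF _ _ rn[OF that]]) auto
    then have "(LINT \<xi>|usphere. of_real (?P \<zeta> \<xi>)) = complex_of_real k" by (simp add: kk[OF that] del: of_real_power)
    then show ?thesis by (simp only: integral_complex_of_real of_real_eq_iff)
  qed
  have pw: "(norm (h ((s * r) *\<^sub>R \<zeta>)))\<^sup>2 * k \<le> (LINT \<xi>|usphere. (norm (h (s *\<^sub>R \<xi>)))\<^sup>2 * ?P \<zeta> \<xi>)"
    if "\<zeta> \<in> ?S" for \<zeta>
  proof -
    have "(LINT \<xi>|usphere. (h (s *\<^sub>R \<xi>))\<^sup>2 * of_real (?P \<zeta> \<xi>)) = (h (s *\<^sub>R (r *\<^sub>R \<zeta>)))\<^sup>2 * of_real k"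
      using szego_square_formula[OF mv_holomorphic_scale[OF h s(1)] _ rn[OF that]] s kk[OF that] by simp
    then have "norm ((h (s *\<^sub>R (r *\<^sub>R \<zeta>)))\<^sup>2 * of_real k) \<le> (LINT \<xi>|usphere. norm ((h (s *\<^sub>R \<xi>))\<^sup>2 * of_real (?P \<zeta> \<xi>)))"
      using integral_norm_bound[of usphere "\<lambda>\<xi>. (h (s *\<^sub>R \<xi>))\<^sup>2 * of_real (?P \<zeta> \<xi>)"] by simp
    then show ?thesis using k by (simp add: norm_mult norm_power)
  qed
  have c1: "continuous_on (?S \<times> ?S) (\<lambda>(\<zeta>, \<xi>). (norm (h (s *\<^sub>R \<xi>)))\<^sup>2 * ?P \<zeta> \<xi>)"
    unfolding case_prod_beta
    by (rule continuous_on_mult[OF _ Pc[unfolded case_prod_beta]]) (intro continuous_intros hs, auto)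
  have c2: "continuous_on ?S (\<lambda>\<zeta>. LINT \<xi>|usphere. (norm (h (s *\<^sub>R \<xi>)))\<^sup>2 * ?P \<zeta> \<xi>)"
    by (rule continuous_on_LINT[OF finite_measure_usphere sets_usphere compact_sphere compact_sphere c1])
  have c3: "continuous_on ?S (\<lambda>\<zeta>. (norm (h ((s * r) *\<^sub>R \<zeta>)))\<^sup>2 * k)"
  proof -
    have "continuous_on ?S (\<lambda>\<zeta>. h (s *\<^sub>R (r *\<^sub>R \<zeta>)))"
      by (rule hs) (use r in \<open>auto intro!: continuous_intros\<close>)
    then show ?thesis by (intro continuous_intros) simp
  qed
  have "(LINT \<zeta>|usphere. (norm (h ((s * r) *\<^sub>R \<zeta>)))\<^sup>2 * k) \<le> (LINT \<zeta>|usphere. LINT \<xi>|usphere. (norm (h (s *\<^sub>R \<xi>)))\<^sup>2 * ?P \<zeta> \<xi>)"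
    by (rule integral_mono[OF usphere_integrable[OF c3] usphere_integrable[OF c2]]) (simp add: pw)
  also have "\<dots> = (LINT \<xi>|usphere. LINT \<zeta>|usphere. (norm (h (s *\<^sub>R \<xi>)))\<^sup>2 * ?P \<zeta> \<xi>)"
    by (rule Fubini_continuous[OF finite_measure_usphere sets_usphere compact_sphere
      finite_measure_usphere sets_usphere compact_sphere c1])
  also have "\<dots> = (LINT \<xi>|usphere. (norm (h (s *\<^sub>R \<xi>)))\<^sup>2 * k)"
  proof (rule Bochner_Integration.integral_cong[OF refl])
    fix \<xi> :: "complex ^ 'n" assume "\<xi> \<in> space usphere"
    then have "(LINT \<zeta>|usphere. ?P \<xi> \<zeta>) = k" by (intro Pint) simp
    then show "(LINT \<zeta>|usphere. (norm (h (s *\<^sub>R \<xi>)))\<^sup>2 * ?P \<zeta> \<xi>) = (norm (h (s *\<^sub>R \<xi>)))\<^sup>2 * k"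
      by (simp only: Psym[of _ \<xi>] integral_mult_right_zero)
  qed
  finally show ?thesis using k by simp
qed

section \<open>Positive semidefinite kernels\<close>

abbreviation usphere2 :: "((complex ^ 'n) \<times> (complex ^ 'n)) measure" where
  "usphere2 \<equiv> usphere \<Otimes>\<^sub>M usphere"

lemma sets_usphere2:
  "sets usphere2 = sets (restrict_space borel (sphere 0 1) \<Otimes>\<^sub>M restrict_space borel (sphere 0 1))"
  by (rule sets_pair_measure_cong) (rule sets_usphere)+

lemma finite_measure_usphere2: "finite_measure usphere2"
  by (rule finite_measure_pair_measure) (rule finite_measure_usphere)+

lemma usphere2_measurable:
  fixes F :: "(complex ^ 'n) \<times> (complex ^ 'n) \<Rightarrow> complex"
  assumes "continuous_on (sphere 0 1 \<times> sphere 0 1) F"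
  shows "F \<in> borel_measurable usphere2"
  using measurable_pair_continuous[OF assms] by (subst measurable_cong_sets[OF sets_usphere2 refl]) auto

lemma usphere2_integrable:
  fixes F :: "(complex ^ 'n) \<times> (complex ^ 'n) \<Rightarrow> complex"
  assumes "continuous_on (sphere 0 1 \<times> sphere 0 1) F"
  shows "integrable usphere2 F"
proof -
  obtain C where C: "\<forall>x\<in>F ` (sphere 0 1 \<times> sphere 0 1). norm x \<le> C"
    using compact_imp_bounded[OF compact_continuous_image[OF assms compact_Times[OF compact_sphere compact_sphere]]]
    unfolding bounded_iff by blast
  show ?thesis
    by (rule finite_measure.integrable_const_bound[OF finite_measure_usphere2, of _ C, OF _ usphere2_measurable[OF assms]])
       (use C in \<open>auto intro!: AE_I2 simp: space_pair_measure\<close>)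
qed

lemma usphere2_iterated:
  fixes F :: "(complex ^ 'n) \<times> (complex ^ 'n) \<Rightarrow> complex"
  assumes "continuous_on (sphere 0 1 \<times> sphere 0 1) F"
  shows "(LINT p|usphere2. F p) = (LINT x|usphere. LINT y|usphere. F (x, y))"
proof -
  interpret U: finite_measure usphere by (rule finite_measure_usphere)
  interpret P: pair_sigma_finite usphere usphere ..
  show ?thesis using P.integral_fst'[OF usphere2_integrable[OF assms]] by simp
qed

lemma usphere2_split:
  fixes u v :: "complex ^ 'n \<Rightarrow> complex"
  assumes "continuous_on (sphere 0 1) u" "continuous_on (sphere 0 1) v"
  shows "(LINT p|usphere2. u (fst p) * cnj (v (snd p))) = (LINT x|usphere. u x) * cnj (LINT x|usphere. v x)"
proof -
  have "continuous_on (sphere 0 1 \<times> sphere 0 1) (\<lambda>p. u (fst p) * cnj (v (snd p)))"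
    by (intro continuous_intros continuous_on_compose2[OF assms(1)] continuous_on_compose2[OF assms(2)]) auto
  from usphere2_iterated[OF this] show ?thesis by simp
qed

text \<open>Finite sums of rank-one kernels. Products of such sums are again such sums, which is
  Schur's product theorem in this setting; infinite series enter only as limits.\<close>

inductive gram :: "(complex ^ 'n \<Rightarrow> complex ^ 'n \<Rightarrow> complex) \<Rightarrow> bool" where
  rank_one: "continuous_on (sphere 0 1) p \<Longrightarrow> gram (\<lambda>x y. p x * cnj (p y))"
| add: "gram P \<Longrightarrow> gram Q \<Longrightarrow> gram (\<lambda>x y. P x y + Q x y)"

text \<open>Positivity is tested against continuous functions instead of finite point sets because
  it is needed inside a double integral over the sphere.\<close>

definition psd_kernel :: "(complex ^ 'n \<Rightarrow> complex ^ 'n \<Rightarrow> complex) \<Rightarrow> bool" where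
  "psd_kernel Q \<longleftrightarrow> continuous_on (sphere 0 1 \<times> sphere 0 1) (\<lambda>p. Q (fst p) (snd p)) \<and>
    (\<forall>a. continuous_on (sphere 0 1) a \<longrightarrow>
      0 \<le> Re (LINT p|usphere2. a (fst p) * cnj (a (snd p)) * Q (fst p) (snd p)))"

lemma continuous_on_fst_snd:
  assumes "continuous_on (sphere 0 1) a"
  shows "continuous_on (sphere 0 1 \<times> sphere 0 1) (\<lambda>p. a (fst p))"
    "continuous_on (sphere 0 1 \<times> sphere 0 1) (\<lambda>p. a (snd p))"
  by (auto intro!: continuous_on_compose2[OF assms] continuous_intros)

lemma gram_continuous: "gram P \<Longrightarrow> continuous_on (sphere 0 1 \<times> sphere 0 1) (\<lambda>p. P (fst p) (snd p))"
  by (induction rule: gram.induct) (intro continuous_intros continuous_on_fst_snd; assumption)+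

lemma gram_zero: "gram (\<lambda>x y. 0)"
  using gram.rank_one[of "\<lambda>x. 0"] by simp

lemma gram_const: "c \<ge> 0 \<Longrightarrow> gram (\<lambda>x y. of_real c)"
  using gram.rank_one[of "\<lambda>x. of_real (sqrt c)"] by (simp flip: of_real_mult)

lemma gram_rank_one_mult:
  assumes p: "continuous_on (sphere 0 1) p" and "gram Q"
  shows "gram (\<lambda>x y. p x * cnj (p y) * Q x y)"
  using assms(2)
proof (induction rule: gram.induct)
  case (rank_one q)
  have "gram (\<lambda>x y. (p x * q x) * cnj (p y * q y))"
    by (intro gram.rank_one continuous_intros p rank_one)
  then show ?case by (simp add: mult_ac)
next
  case (add P Q)
  from gram.add[OF add.IH] show ?case by (simp add: distrib_left)
qed

lemma gram_mult:
  assumes "gram P" "gram Q"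
  shows "gram (\<lambda>x y. P x y * Q x y)"
  using assms(1)
proof (induction rule: gram.induct)
  case (rank_one p)
  then show ?case by (rule gram_rank_one_mult[OF _ assms(2)])
next
  case (add P1 P2)
  from gram.add[OF add.IH] show ?case by (simp add: distrib_right)
qed

lemma gram_power: "gram P \<Longrightarrow> gram (\<lambda>x y. P x y ^ n)"
  by (induction n) (use gram_const[of 1] in \<open>auto intro: gram_mult\<close>)

lemma gram_sum:
  "(\<And>i. i \<in> I \<Longrightarrow> gram (P i)) \<Longrightarrow> gram (\<lambda>x y. \<Sum>i\<in>I. P i x y)"
  by (induction I rule: infinite_finite_induct) (auto intro: gram.add gram_zero)

lemma gram_cinner:
  assumes "continuous_on (sphere 0 1) u"
  shows "gram (\<lambda>x y. cinner (u x) (u y))"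
  unfolding cinner_def
  by (intro gram_sum gram.rank_one continuous_intros assms)

text \<open>A rank-one factor \<open>q x * cnj (q y)\<close> is absorbed into the test
  function.\<close>

lemma psd_kernel_gram_mult:
  assumes "gram G" and Q: "psd_kernel Q"
  shows "psd_kernel (\<lambda>x y. G x y * Q x y)"
  using assms(1)
proof (induction rule: gram.induct)
  case (rank_one q)
  show ?case
    unfolding psd_kernel_def
  proof (intro conjI allI impI)
    show "continuous_on (sphere 0 1 \<times> sphere 0 1) (\<lambda>p. q (fst p) * cnj (q (snd p)) * Q (fst p) (snd p))"
      using Q unfolding psd_kernel_def by (intro continuous_intros continuous_on_fst_snd rank_one) auto
    fix a :: "complex ^ 'a \<Rightarrow> complex" assume a: "continuous_on (sphere 0 1) a"
    then have "continuous_on (sphere 0 1) (\<lambda>x. a x * q x)" by (intro continuous_intros rank_one)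
    with Q have "0 \<le> Re (LINT p|usphere2. (a (fst p) * q (fst p)) * cnj (a (snd p) * q (snd p)) * Q (fst p) (snd p))"
      unfolding psd_kernel_def by blast
    then show "0 \<le> Re (LINT p|usphere2. a (fst p) * cnj (a (snd p)) * (q (fst p) * cnj (q (snd p)) * Q (fst p) (snd p)))"
      by (simp add: mult_ac)
  qed
next
  case (add P1 P2)
  have Qc: "continuous_on (sphere 0 1 \<times> sphere 0 1) (\<lambda>p. Q (fst p) (snd p))"
    using Q unfolding psd_kernel_def by blast
  show ?case
    unfolding psd_kernel_def
  proof (intro conjI allI impI)
    show "continuous_on (sphere 0 1 \<times> sphere 0 1) (\<lambda>p. (P1 (fst p) (snd p) + P2 (fst p) (snd p)) * Q (fst p) (snd p))"
      by (intro continuous_on_mult continuous_on_add Qc gram_continuous[OF add.hyps(1)] gram_continuous[OF add.hyps(2)])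
    fix a :: "complex ^ 'a \<Rightarrow> complex" assume a: "continuous_on (sphere 0 1) a"
    have i: "integrable usphere2 (\<lambda>p. a (fst p) * cnj (a (snd p)) * (P (fst p) (snd p) * Q (fst p) (snd p)))"
      if "gram P" for P
      by (intro usphere2_integrable continuous_on_mult continuous_on_cnj Qc gram_continuous[OF that] continuous_on_fst_snd a)
    have "(LINT p|usphere2. a (fst p) * cnj (a (snd p)) * ((P1 (fst p) (snd p) + P2 (fst p) (snd p)) * Q (fst p) (snd p)))
      = (LINT p|usphere2. a (fst p) * cnj (a (snd p)) * (P1 (fst p) (snd p) * Q (fst p) (snd p)))
      + (LINT p|usphere2. a (fst p) * cnj (a (snd p)) * (P2 (fst p) (snd p) * Q (fst p) (snd p)))"
      using Bochner_Integration.integral_add[OF i[OF add.hyps(1)] i[OF add.hyps(2)]]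
      by (simp add: algebra_simps)
    then show "0 \<le> Re (LINT p|usphere2. a (fst p) * cnj (a (snd p)) * ((P1 (fst p) (snd p) + P2 (fst p) (snd p)) * Q (fst p) (snd p)))"
      using add.IH a unfolding psd_kernel_def by simp
  qed
qed

text \<open>Dominated convergence: bounded pointwise convergence is enough once the limit is known
  to be continuous.\<close>

lemma psd_kernel_limit:
  assumes P: "\<And>n. psd_kernel (P n)"
    and Q: "continuous_on (sphere 0 1 \<times> sphere 0 1) (\<lambda>p. Q (fst p) (snd p))"
    and bd: "\<And>n x y. x \<in> sphere 0 1 \<Longrightarrow> y \<in> sphere 0 1 \<Longrightarrow> norm (P n x y) \<le> B"
    and lim: "\<And>x y. x \<in> sphere 0 1 \<Longrightarrow> y \<in> sphere 0 1 \<Longrightarrow> (\<lambda>n. P n x y) \<longlonglongrightarrow> Q x y"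
  shows "psd_kernel Q"
  unfolding psd_kernel_def
proof (intro conjI allI impI Q)
  fix a :: "complex ^ 'a \<Rightarrow> complex" assume a: "continuous_on (sphere 0 1) a"
  obtain C where C: "\<forall>x\<in>a ` sphere 0 1. norm x \<le> C"
    using compact_imp_bounded[OF compact_continuous_image[OF a compact_sphere]] unfolding bounded_iff by blast
  have "norm (a (axis undefined 1)) \<le> C" using C by simp
  then have C0: "C \<ge> 0" using norm_ge_zero order_trans by blast
  have PC: "continuous_on (sphere 0 1 \<times> sphere 0 1) (\<lambda>p. P n (fst p) (snd p))" for n
    using P unfolding psd_kernel_def by blast
  have "(\<lambda>n. LINT p|usphere2. a (fst p) * cnj (a (snd p)) * P n (fst p) (snd p))
    \<longlonglongrightarrow> (LINT p|usphere2. a (fst p) * cnj (a (snd p)) * Q (fst p) (snd p))"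
  proof (rule integral_dominated_convergence[where w = "\<lambda>_. C * C * B"])
    show "integrable usphere2 (\<lambda>_. C * C * B)"
      using finite_measure.integrable_const[OF finite_measure_usphere2] .
    show "AE p in usphere2. (\<lambda>n. a (fst p) * cnj (a (snd p)) * P n (fst p) (snd p))
        \<longlonglongrightarrow> a (fst p) * cnj (a (snd p)) * Q (fst p) (snd p)"
      by (rule AE_I2) (auto intro!: tendsto_intros lim simp: space_pair_measure)
    show "AE p in usphere2. norm (a (fst p) * cnj (a (snd p)) * P n (fst p) (snd p)) \<le> C * C * B" for n
      using C C0 bd by (intro AE_I2) (auto simp: space_pair_measure norm_mult intro!: mult_mono)
  qed (auto intro!: usphere2_measurable continuous_intros continuous_on_fst_snd a PC Q)
  then have "(\<lambda>n. Re (LINT p|usphere2. a (fst p) * cnj (a (snd p)) * P n (fst p) (snd p)))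
    \<longlonglongrightarrow> Re (LINT p|usphere2. a (fst p) * cnj (a (snd p)) * Q (fst p) (snd p))"
    by (rule tendsto_Re)
  then show "0 \<le> Re (LINT p|usphere2. a (fst p) * cnj (a (snd p)) * Q (fst p) (snd p))"
    by (rule LIMSEQ_le_const) (use P a in \<open>auto simp: psd_kernel_def\<close>)
qed

lemma psd_kernel_sum:
  fixes P :: "'i \<Rightarrow> complex ^ 'n \<Rightarrow> complex ^ 'n \<Rightarrow> complex"
  assumes "\<And>i. i \<in> I \<Longrightarrow> psd_kernel (P i)"
  shows "psd_kernel (\<lambda>x y. \<Sum>i\<in>I. P i x y)"
proof -
  have c: "continuous_on (sphere 0 1 \<times> sphere 0 1) (\<lambda>p. P i (fst p) (snd p))" if "i \<in> I" for i
    using assms[OF that] unfolding psd_kernel_def by blast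
  show ?thesis
    unfolding psd_kernel_def
  proof (intro conjI allI impI)
    show "continuous_on (sphere 0 1 \<times> sphere 0 1) (\<lambda>p. \<Sum>i\<in>I. P i (fst p) (snd p))"
      by (intro continuous_intros c)
    fix a :: "complex ^ 'n \<Rightarrow> complex" assume a: "continuous_on (sphere 0 1) a"
    have "(LINT p|usphere2. a (fst p) * cnj (a (snd p)) * (\<Sum>i\<in>I. P i (fst p) (snd p)))
      = (\<Sum>i\<in>I. LINT p|usphere2. a (fst p) * cnj (a (snd p)) * P i (fst p) (snd p))"
      unfolding sum_distrib_left
      by (intro Bochner_Integration.integral_sum usphere2_integrable continuous_intros continuous_on_fst_snd a c)
    then show "0 \<le> Re (LINT p|usphere2. a (fst p) * cnj (a (snd p)) * (\<Sum>i\<in>I. P i (fst p) (snd p)))"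
      using assms a by (auto simp: psd_kernel_def intro!: sum_nonneg)
  qed
qed

section \<open>Linear fractional self-maps of the ball\<close>

text \<open>\<open>t\<close> is the multiplier produced by the S-lemma: the Hermitian form of the linear fractional map
  dominates \<open>t\<close> times the form \<open>|w|\<^sup>2 - |z|\<^sup>2\<close> defining the ball.\<close>

locale lfm_form =
  fixes A :: "complex ^ 'n ^ 'n" and B C :: "complex ^ 'n" and d :: complex and t :: real
  assumes t: "t > 0"
    and form: "\<And>z w. t * ((norm w)\<^sup>2 - (norm z)\<^sup>2)
      \<le> (norm (cinner z C + d * w))\<^sup>2 - (norm (A *v z + w *s B))\<^sup>2"
    and denominator: "\<And>z. norm z \<le> 1 \<Longrightarrow> cinner z C + d \<noteq> 0"
begin

abbreviation "\<delta> z \<equiv> cinner z C + d"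
abbreviation "\<phi> z \<equiv> linear_fractional A B C d z"

lemma norm_image: "(norm (\<phi> z))\<^sup>2 * (norm (\<delta> z))\<^sup>2 \<le> (norm (\<delta> z))\<^sup>2 - t * (1 - (norm z)\<^sup>2)" if "norm z \<le> 1"
proof -
  have "norm (\<phi> z) * norm (\<delta> z) = norm (A *v z + B)"
    using denominator[OF that] unfolding linear_fractional_def norm_vec_smult by (simp add: norm_divide)
  then have "(norm (\<phi> z))\<^sup>2 * (norm (\<delta> z))\<^sup>2 = (norm (A *v z + B))\<^sup>2"
    by (simp flip: power_mult_distrib)
  then show ?thesis using form[of 1 z] by simp
qed

lemma image_cball: "norm (\<phi> z) \<le> 1" if "norm z \<le> 1"
proof -
  have "(norm (\<phi> z))\<^sup>2 * (norm (\<delta> z))\<^sup>2 \<le> 1 * (norm (\<delta> z))\<^sup>2"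
    using norm_image[OF that] t that by (smt (verit) mult_nonneg_nonneg norm_ge_zero power_le_one)
  then show ?thesis using denominator[OF that] by (simp add: abs_square_le_1)
qed

lemma image_ball: "norm (\<phi> z) < 1" if "norm z < 1"
proof -
  have "(norm z)\<^sup>2 < 1" using that by (simp add: power_less_one_iff)
  then have "0 < t * (1 - (norm z)\<^sup>2)" using t by simp
  then have "(norm (\<phi> z))\<^sup>2 * (norm (\<delta> z))\<^sup>2 < 1 * (norm (\<delta> z))\<^sup>2"
    using norm_image[of z] that by simp
  then have "(norm (\<phi> z))\<^sup>2 < 1" by (rule mult_right_less_imp_less) simp
  then show ?thesis by (simp add: abs_square_less_1)
qed

lemma continuous_on_delta: "continuous_on S f \<Longrightarrow> continuous_on S (\<lambda>x. \<delta> (f x))"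
  by (intro continuous_intros)

lemma continuous_on_phi:
  assumes "continuous_on S f" "\<And>x. x \<in> S \<Longrightarrow> norm (f x) \<le> 1"
  shows "continuous_on S (\<lambda>x. \<phi> (f x))"
  unfolding linear_fractional_def using denominator assms(2) by (intro continuous_intros assms) auto

lemma mv_holomorphic_delta: "mv_holomorphic_on \<delta> S"
  by (intro mv_holomorphic_on_add mv_holomorphic_on_const mv_holomorphic_on_cinner)

lemma mv_holomorphic_phi: "mv_holomorphic_on (\<lambda>z. \<phi> z $ i) (ball 0 1)"
proof -
  have "mv_holomorphic_on (\<lambda>z. (A *v z) $ i) (ball 0 1)"
    by (rule mv_holomorphic_on_linear)
       (auto simp: vector_scalar_commute intro!: bounded_linear_compose[OF bounded_linear_vec_nth bounded_linear_matrix_vector_mult])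
  then have "mv_holomorphic_on (\<lambda>z. inverse (\<delta> z) * ((A *v z) $ i + B $ i)) (ball 0 1)"
    using denominator
    by (intro mv_holomorphic_on_mult mv_holomorphic_on_inverse mv_holomorphic_delta
        mv_holomorphic_on_add mv_holomorphic_on_const) auto
  then show ?thesis by (simp add: linear_fractional_def inverse_eq_divide add_divide_distrib)
qed

text \<open>The sesquilinear polarization of the slack in \<open>form\<close>, taken at the
  homogeneous vectors \<open>(r x, 1)\<close> and \<open>(r y, 1)\<close>.\<close>

definition Q :: "real \<Rightarrow> complex ^ 'n \<Rightarrow> complex ^ 'n \<Rightarrow> complex" where
  "Q r x y = \<delta> (r *\<^sub>R x) * cnj (\<delta> (r *\<^sub>R y)) - cinner (A *v (r *\<^sub>R x) + B) (A *v (r *\<^sub>R y) + B)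
     - of_real t * (1 - cinner (r *\<^sub>R x) (r *\<^sub>R y))"

text \<open>Testing with a evaluates the Hermitian form of the slack at the vector
  \<open>(?X, ?y)\<close> of moments of a. This vector is arbitrary, which is why
  \<open>form\<close> is stated for all homogeneous coordinates and not only for
  \<open>w = 1\<close>.\<close>

lemma psd_Q: "psd_kernel (Q r)"
  unfolding psd_kernel_def
proof (intro conjI allI impI)
  show "continuous_on (sphere 0 1 \<times> sphere 0 1) (\<lambda>p. Q r (fst p) (snd p))"
    unfolding Q_def by (intro continuous_intros)
  fix a :: "complex ^ 'n \<Rightarrow> complex" assume a: "continuous_on (sphere 0 1) a"
  let ?X = "\<chi> i. LINT x|usphere. a x * (r *\<^sub>R x) $ i"
  let ?y = "LINT x|usphere. a x"
  let ?T = "\<lambda>u p. (a (fst p) * u (fst p)) * cnj (a (snd p) * u (snd p))"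
  have split: "(LINT p|usphere2. ?T u p) = of_real ((norm (LINT x|usphere. a x * u x))\<^sup>2)"
    if u: "continuous_on (sphere 0 1) u" for u
    unfolding complex_norm_square by (rule usphere2_split) (intro continuous_intros a u)+
  have int: "integrable usphere2 (?T u)" if "continuous_on (sphere 0 1) u" for u
    by (intro usphere2_integrable continuous_on_mult continuous_on_cnj continuous_on_fst_snd a that)
  have aint: "integrable usphere (\<lambda>x. a x * u x)" if "continuous_on (sphere 0 1) u" for u
    by (intro usphere_integrable continuous_intros a that)
  have d_cont: "continuous_on (sphere 0 1) (\<lambda>x. \<delta> (r *\<^sub>R x))" by (intro continuous_intros)
  have rc: "continuous_on (sphere 0 1) (\<lambda>x :: complex ^ 'n. r *\<^sub>R x)"
    by (rule bounded_linear.continuous_on[OF bounded_linear_scaleR_right continuous_on_id])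
  have A_cont: "continuous_on (sphere 0 1) (\<lambda>x. (A *v (r *\<^sub>R x) + B) $ i)" for i
    by (rule continuous_on_component[OF continuous_on_add[OF
          continuous_on_matrix_vector_mult_complex[OF rc] continuous_on_const]])
  have x_cont: "continuous_on (sphere 0 1) (\<lambda>x :: complex ^ 'n. (r *\<^sub>R x) $ i)" for i
    by (rule continuous_on_component[OF rc])
  have 1: "(LINT x|usphere. a x * \<delta> (r *\<^sub>R x)) = cinner ?X C + d * ?y"
  proof -
    have "(LINT x|usphere. a x * \<delta> (r *\<^sub>R x))
      = (LINT x|usphere. (\<Sum>i\<in>UNIV. (a x * (r *\<^sub>R x) $ i) * cnj (C $ i)) + d * a x)"
      by (simp add: cinner_def distrib_left sum_distrib_left mult_ac)
    also have "\<dots> = (\<Sum>i\<in>UNIV. (LINT x|usphere. a x * (r *\<^sub>R x) $ i) * cnj (C $ i)) + d * ?y"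
    proof (subst Bochner_Integration.integral_add)
      show "integrable usphere (\<lambda>x. \<Sum>i\<in>UNIV. (a x * (r *\<^sub>R x) $ i) * cnj (C $ i))"
        by (intro usphere_integrable continuous_intros a)
      show "integrable usphere (\<lambda>x. d * a x)"
        by (intro usphere_integrable continuous_intros a)
      show "(LINT x|usphere. (\<Sum>i\<in>UNIV. (a x * (r *\<^sub>R x) $ i) * cnj (C $ i))) + (LINT x|usphere. d * a x)
         = (\<Sum>i\<in>UNIV. (LINT x|usphere. a x * (r *\<^sub>R x) $ i) * cnj (C $ i)) + d * ?y"
        by (subst Bochner_Integration.integral_sum)
           (auto intro!: usphere_integrable continuous_intros a simp del: vector_scaleR_component)
    qed
    finally show ?thesis by (simp add: cinner_def)
  qed
  have 2: "(LINT x|usphere. a x * (A *v (r *\<^sub>R x) + B) $ i) = (A *v ?X + ?y *s B) $ i" for i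
  proof -
    have "(LINT x|usphere. a x * (A *v (r *\<^sub>R x) + B) $ i)
      = (LINT x|usphere. (\<Sum>j\<in>UNIV. A $ i $ j * (a x * (r *\<^sub>R x) $ j)) + a x * B $ i)"
      by (simp add: matrix_vector_mult_def distrib_left sum_distrib_left mult_ac)
    also have "\<dots> = (\<Sum>j\<in>UNIV. A $ i $ j * (LINT x|usphere. a x * (r *\<^sub>R x) $ j)) + ?y * B $ i"
    proof (subst Bochner_Integration.integral_add)
      show "integrable usphere (\<lambda>x. \<Sum>j\<in>UNIV. A $ i $ j * (a x * (r *\<^sub>R x) $ j))"
        by (intro usphere_integrable continuous_intros a)
      show "integrable usphere (\<lambda>x. a x * B $ i)"
        by (intro usphere_integrable continuous_intros a)
      show "(LINT x|usphere. (\<Sum>j\<in>UNIV. A $ i $ j * (a x * (r *\<^sub>R x) $ j))) + (LINT x|usphere. a x * B $ i)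
         = (\<Sum>j\<in>UNIV. A $ i $ j * (LINT x|usphere. a x * (r *\<^sub>R x) $ j)) + ?y * B $ i"
        by (subst Bochner_Integration.integral_sum)
           (auto intro!: usphere_integrable continuous_intros a simp del: vector_scaleR_component)
    qed
    finally show ?thesis by (simp add: matrix_vector_mult_def)
  qed
  have vec_norm: "(norm v)\<^sup>2 = (\<Sum>i\<in>UNIV. (norm (v $ i))\<^sup>2)" for v :: "complex ^ 'n"
    by (simp add: norm_vec_def L2_set_def sum_nonneg)
  let ?d = "\<lambda>x. \<delta> (r *\<^sub>R x)"
  let ?A = "\<lambda>i x. (A *v (r *\<^sub>R x) + B) $ i"
  let ?x = "\<lambda>i x. (r *\<^sub>R x) $ i"
  have "a (fst p) * cnj (a (snd p)) * Q r (fst p) (snd p)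
    = ?T ?d p - (\<Sum>i\<in>UNIV. ?T (?A i) p) - of_real t * ?T (\<lambda>x. 1) p + of_real t * (\<Sum>i\<in>UNIV. ?T (?x i) p)" for p
  proof -
    have s: "a (fst p) * cnj (a (snd p)) * cinner (u (fst p)) (u (snd p)) = (\<Sum>i\<in>UNIV. ?T (\<lambda>x. u x $ i) p)" for u
      unfolding cinner_def sum_distrib_left by (intro sum.cong refl) (simp add: mult_ac)
    show ?thesis
      unfolding s[of "\<lambda>x. A *v (r *\<^sub>R x) + B", symmetric] s[of "\<lambda>x. r *\<^sub>R x", symmetric] Q_def
      by (simp only: complex_cnj_mult complex_cnj_one mult_1 mult_1_right) (simp only: algebra_simps mult_1_left mult_1_right)
  qed
  then have "(LINT p|usphere2. a (fst p) * cnj (a (snd p)) * Q r (fst p) (snd p))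
    = (LINT p|usphere2. ?T ?d p - (\<Sum>i\<in>UNIV. ?T (?A i) p) - of_real t * ?T (\<lambda>x. 1) p + of_real t * (\<Sum>i\<in>UNIV. ?T (?x i) p))"
    by (simp only:)
  also have "\<dots> = (LINT p|usphere2. ?T ?d p) - (\<Sum>i\<in>UNIV. LINT p|usphere2. ?T (?A i) p)
     - of_real t * (LINT p|usphere2. ?T (\<lambda>x. 1) p) + of_real t * (\<Sum>i\<in>UNIV. LINT p|usphere2. ?T (?x i) p)"
    using int[OF d_cont] int[OF A_cont] int[OF x_cont] int[OF continuous_on_const]
    by (simp only: Bochner_Integration.integral_add Bochner_Integration.integral_diff
        Bochner_Integration.integral_sum integral_mult_right_zero
        Bochner_Integration.integrable_add Bochner_Integration.integrable_diff
        Bochner_Integration.integrable_sum integrable_mult_right)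
  also have "\<dots> = of_real ((norm (cinner ?X C + d * ?y))\<^sup>2) - (\<Sum>i\<in>UNIV. of_real ((norm ((A *v ?X + ?y *s B) $ i))\<^sup>2))
     - of_real t * of_real ((norm ?y)\<^sup>2) + of_real t * (\<Sum>i\<in>UNIV. of_real ((norm (?X $ i))\<^sup>2))"
    unfolding split[OF d_cont] split[OF A_cont] split[OF x_cont] split[OF continuous_on_const] 1 2 by simp
  also have "\<dots> = of_real ((norm (cinner ?X C + d * ?y))\<^sup>2 - (norm (A *v ?X + ?y *s B))\<^sup>2
     - t * ((norm ?y)\<^sup>2 - (norm ?X)\<^sup>2))"
    unfolding vec_norm of_real_diff of_real_mult of_real_sum by (simp only: algebra_simps)
  finally have *: "(LINT p|usphere2. a (fst p) * cnj (a (snd p)) * Q r (fst p) (snd p))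
    = of_real ((norm (cinner ?X C + d * ?y))\<^sup>2 - (norm (A *v ?X + ?y *s B))\<^sup>2 - t * ((norm ?y)\<^sup>2 - (norm ?X)\<^sup>2))" .
  show "0 \<le> Re (LINT p|usphere2. a (fst p) * cnj (a (snd p)) * Q r (fst p) (snd p))"
    unfolding * Re_complex_of_real using form[of ?y ?X] by simp
qed

text \<open>Its power \<open>CARD('n)\<close> is the Szego kernel on the sphere of radius r up to
  the constant \<open>1 / t ^ CARD('n)\<close>.\<close>

definition X :: "real \<Rightarrow> complex ^ 'n \<Rightarrow> complex ^ 'n \<Rightarrow> complex" where
  "X r x y = 1 / (of_real t * (1 - cinner (r *\<^sub>R x) (r *\<^sub>R y)))"

text \<open>Its power \<open>CARD('n)\<close> is the Szego kernel at the image points with the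
  weight \<open>1 / \<delta> ^ CARD('n)\<close> in each variable. Its reciprocal is the part of
  \<open>Q\<close> without t, because the weights clear the denominators of \<phi>.\<close>

definition Y :: "real \<Rightarrow> complex ^ 'n \<Rightarrow> complex ^ 'n \<Rightarrow> complex" where
  "Y r x y = 1 / (\<delta> (r *\<^sub>R x) * cnj (\<delta> (r *\<^sub>R y)) * (1 - cinner (\<phi> (r *\<^sub>R x)) (\<phi> (r *\<^sub>R y))))"

lemma geometric_partial_sums:
  fixes q :: real and c :: complex
  assumes "norm c \<le> q" "q < 1"
  shows "(\<lambda>n. \<Sum>k<n. c ^ k) \<longlonglongrightarrow> 1 / (1 - c)" "norm (\<Sum>k<n. c ^ k) \<le> 1 / (1 - q)"
proof -
  have c: "norm c < 1" using assms by linarith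
  show "(\<lambda>n. \<Sum>k<n. c ^ k) \<longlonglongrightarrow> 1 / (1 - c)"
    using geometric_sums[OF c] by (simp add: sums_def)
  have q: "0 \<le> q" using assms(1) norm_ge_zero order_trans by blast
  have "norm (\<Sum>k<n. c ^ k) \<le> (\<Sum>k<n. q ^ k)"
    by (rule sum_norm_le) (simp add: norm_power power_mono assms)
  also have "\<dots> \<le> (\<Sum>k. q ^ k)"
    by (rule sum_le_suminf) (use q assms in \<open>auto intro: summable_geometric\<close>)
  also have "\<dots> = 1 / (1 - q)" using q assms by (simp add: suminf_geometric)
  finally show "norm (\<Sum>k<n. c ^ k) \<le> 1 / (1 - q)" .
qed

text \<open>Since \<open>1/Y - 1/X = Q\<close>, the difference \<open>X\<^sup>N - Y\<^sup>N\<close> is a sum of kernels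
  \<open>Q X\<^sup>i\<^sup>+\<^sup>1 Y\<^sup>N\<^sup>-\<^sup>i\<close>, each positive semidefinite by Schur's product theorem.\<close>

lemma psd_kernel_difference:
  assumes r: "0 \<le> r" "r < 1"
  shows "psd_kernel (\<lambda>x y. X r x y ^ N - Y r x y ^ N)"
proof -
  let ?S = "sphere (0 :: complex ^ 'n) 1"
  have rS: "norm (r *\<^sub>R x) \<le> r" "norm (r *\<^sub>R x) \<le> 1" "norm (r *\<^sub>R x) < 1" if "x \<in> ?S" for x
    using that r by auto
  have cphi: "continuous_on ?S (\<lambda>x. \<phi> (r *\<^sub>R x))"
    by (rule continuous_on_phi) (use rS in \<open>auto intro!: continuous_intros\<close>)
  have cdel: "continuous_on ?S (\<lambda>x. 1 / \<delta> (r *\<^sub>R x))"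
    using denominator rS by (intro continuous_intros) auto
  \<comment> \<open>The geometric series for \<open>Y\<close> needs one bound below 1 for all image
    points, supplied by compactness of the sphere.\<close>
  obtain \<rho> where \<rho>: "\<rho> < 1" "\<And>x. x \<in> ?S \<Longrightarrow> norm (\<phi> (r *\<^sub>R x)) \<le> \<rho>"
  proof -
    have "continuous_on ?S (\<lambda>x. norm (\<phi> (r *\<^sub>R x)))" by (intro continuous_intros cphi)
    from continuous_attains_sup[OF compact_sphere _ this] obtain x0 where
      "x0 \<in> ?S" "\<And>x. x \<in> ?S \<Longrightarrow> norm (\<phi> (r *\<^sub>R x)) \<le> norm (\<phi> (r *\<^sub>R x0))" by auto
    then show ?thesis using that[of "norm (\<phi> (r *\<^sub>R x0))"] image_ball[OF rS(3)] by blast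
  qed
  have \<rho>0: "0 \<le> \<rho>"
    using \<rho>(2)[of "axis undefined 1"] norm_ge_zero order_trans
    by (metis dist_0_norm mem_sphere norm_axis_complex)
  have cz: "norm (cinner (r *\<^sub>R x) (r *\<^sub>R y)) \<le> r\<^sup>2" if "x \<in> ?S" "y \<in> ?S" for x y
    using norm_cinner_le[of "r *\<^sub>R x" "r *\<^sub>R y"] that r by (simp add: power2_eq_square)
  have cp: "norm (cinner (\<phi> (r *\<^sub>R x)) (\<phi> (r *\<^sub>R y))) \<le> \<rho>\<^sup>2" if "x \<in> ?S" "y \<in> ?S" for x y
    using norm_cinner_le[of "\<phi> (r *\<^sub>R x)" "\<phi> (r *\<^sub>R y)"] \<rho>(2)[OF that(1)] \<rho>(2)[OF that(2)] \<rho>0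
    unfolding power2_eq_square by (meson mult_mono norm_ge_zero order_trans)
  have r2: "r\<^sup>2 < 1" "\<rho>\<^sup>2 < 1" using r \<rho> \<rho>0 by (simp_all add: power_less_one_iff)
  have nz1: "1 - cinner (r *\<^sub>R x) (r *\<^sub>R y) \<noteq> 0" if "x \<in> ?S" "y \<in> ?S" for x y
    using cz[OF that] r2 by (intro one_minus_nonzero) linarith
  have nz2: "1 - cinner (\<phi> (r *\<^sub>R x)) (\<phi> (r *\<^sub>R y)) \<noteq> 0" if "x \<in> ?S" "y \<in> ?S" for x y
    using cp[OF that] r2 by (intro one_minus_nonzero) linarith
  have dnz: "\<delta> (r *\<^sub>R x) \<noteq> 0" if "x \<in> ?S" for x using denominator rS that by blast
  \<comment> \<open>The truncated geometric series for \<open>X\<close> and \<open>Y\<close> are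
    \<open>gram\<close> kernels, bounded uniformly in n.\<close>
  define Xn where "Xn n x y = of_real (1 / t) * (\<Sum>k<n. cinner (r *\<^sub>R x) (r *\<^sub>R y) ^ k)" for n and x y :: "complex ^ 'n"
  define Yn where "Yn n x y = (1 / \<delta> (r *\<^sub>R x)) * cnj (1 / \<delta> (r *\<^sub>R y)) *
      (\<Sum>k<n. cinner (\<phi> (r *\<^sub>R x)) (\<phi> (r *\<^sub>R y)) ^ k)" for n and x y :: "complex ^ 'n"
  have gX: "gram (Xn n)" for n
    unfolding Xn_def using t
    by (intro gram_mult gram_const gram_sum gram_power gram_cinner continuous_intros) auto
  have gY: "gram (Yn n)" for n
    unfolding Yn_def by (intro gram_mult gram.rank_one gram_sum gram_power gram_cinner cphi cdel)
  have limX: "(\<lambda>n. Xn n x y) \<longlonglongrightarrow> X r x y" if "x \<in> ?S" "y \<in> ?S" for x y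
  proof -
    have "(\<lambda>n. Xn n x y) \<longlonglongrightarrow> of_real (1 / t) * (1 / (1 - cinner (r *\<^sub>R x) (r *\<^sub>R y)))"
      unfolding Xn_def by (intro tendsto_intros geometric_partial_sums(1)[OF cz[OF that] r2(1)])
    then show ?thesis by (simp add: X_def)
  qed
  have limY: "(\<lambda>n. Yn n x y) \<longlonglongrightarrow> Y r x y" if "x \<in> ?S" "y \<in> ?S" for x y
  proof -
    have "(\<lambda>n. Yn n x y) \<longlonglongrightarrow> (1 / \<delta> (r *\<^sub>R x)) * cnj (1 / \<delta> (r *\<^sub>R y)) *
      (1 / (1 - cinner (\<phi> (r *\<^sub>R x)) (\<phi> (r *\<^sub>R y))))"
      unfolding Yn_def by (intro tendsto_intros geometric_partial_sums(1)[OF cp[OF that] r2(2)])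
    then show ?thesis by (simp add: Y_def)
  qed
  obtain D where D: "\<And>x. x \<in> ?S \<Longrightarrow> norm (1 / \<delta> (r *\<^sub>R x)) \<le> D"
    using compact_imp_bounded[OF compact_continuous_image[OF cdel compact_sphere]]
    unfolding bounded_iff by blast
  have D0: "0 \<le> D" using D[of "axis undefined 1"] norm_ge_zero[of "1 / \<delta> (r *\<^sub>R axis undefined 1)"]
    by (smt (verit) dist_0_norm mem_sphere norm_axis_complex)
  have bX: "norm (Xn n x y) \<le> (1 / t) * (1 / (1 - r\<^sup>2))" if "x \<in> ?S" "y \<in> ?S" for n x y
    unfolding Xn_def norm_mult using geometric_partial_sums(2)[OF cz[OF that] r2(1), of n] t
    by (intro mult_mono) (auto simp: norm_divide)
  have bY: "norm (Yn n x y) \<le> D * D * (1 / (1 - \<rho>\<^sup>2))" if "x \<in> ?S" "y \<in> ?S" for n x y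
    unfolding Yn_def norm_mult complex_mod_cnj
    using geometric_partial_sums(2)[OF cp[OF that] r2(2), of n] D[OF that(1)] D[OF that(2)] D0
    by (intro mult_mono) auto
  have cX: "continuous_on (?S \<times> ?S) (\<lambda>p. X r (fst p) (snd p))"
    unfolding X_def using nz1 t by (intro continuous_intros) auto
  have cY: "continuous_on (?S \<times> ?S) (\<lambda>p. Y r (fst p) (snd p))"
  proof -
    have cd: "continuous_on ?S (\<lambda>x. \<delta> (r *\<^sub>R x))" by (intro continuous_intros)
    show ?thesis
      unfolding Y_def
      by (intro continuous_on_divide continuous_on_const continuous_on_mult continuous_on_cnj
          continuous_on_diff continuous_on_cinner continuous_on_fst_snd[OF cphi] continuous_on_fst_snd[OF cd])
        (use nz2 dnz in \<open>auto simp: mem_Times_iff simp del: complex_cnj_add\<close>)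
  qed
  have cQ: "continuous_on (?S \<times> ?S) (\<lambda>p. Q r (fst p) (snd p))"
    using psd_Q unfolding psd_kernel_def by blast
  obtain E where E: "\<forall>q \<in> (\<lambda>p. Q r (fst p) (snd p)) ` (?S \<times> ?S). norm q \<le> E"
    using compact_imp_bounded[OF compact_continuous_image[OF cQ compact_Times[OF compact_sphere compact_sphere]]]
    unfolding bounded_iff by blast
  have QE: "norm (Q r x y) \<le> E" if "x \<in> ?S" "y \<in> ?S" for x y using E that by auto
  have E0: "0 \<le> E" using QE[of "axis undefined 1" "axis undefined 1"] norm_ge_zero order_trans
    by (metis dist_0_norm mem_sphere norm_axis_complex)
  have psd_term: "psd_kernel (\<lambda>x y. (X r x y ^ i * Y r x y ^ j) * Q r x y)" for i j
  proof (rule psd_kernel_limit)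
    show "psd_kernel (\<lambda>x y. (Xn n x y ^ i * Yn n x y ^ j) * Q r x y)" for n
      by (intro psd_kernel_gram_mult gram_mult gram_power gX gY psd_Q)
    show "continuous_on (?S \<times> ?S) (\<lambda>p. (X r (fst p) (snd p) ^ i * Y r (fst p) (snd p) ^ j) * Q r (fst p) (snd p))"
      by (intro continuous_intros cX cY cQ)
    show "(\<lambda>n. (Xn n x y ^ i * Yn n x y ^ j) * Q r x y) \<longlonglongrightarrow> (X r x y ^ i * Y r x y ^ j) * Q r x y"
      if "x \<in> ?S" "y \<in> ?S" for x y
      by (intro tendsto_intros limX limY that)
    show "norm ((Xn n x y ^ i * Yn n x y ^ j) * Q r x y)
      \<le> (((1 / t) * (1 / (1 - r\<^sup>2))) ^ i * (D * D * (1 / (1 - \<rho>\<^sup>2))) ^ j) * E"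
      if "x \<in> ?S" "y \<in> ?S" for n x y
      unfolding norm_mult norm_power
      using bX[OF that] bY[OF that] QE[OF that] t r2 D0 E0
      by (intro mult_mono power_mono mult_nonneg_nonneg zero_le_power) auto
  qed
  \<comment> \<open>With \<open>X = 1/u\<close> and \<open>Y = 1/v\<close> one has
    \<open>Q = v - u\<close>; the identity is the difference of two reciprocals.\<close>
  have XY: "X r x y - Y r x y = X r x y * Y r x y * Q r x y" if "x \<in> ?S" "y \<in> ?S" for x y
  proof -
    have Y: "Y r x y = 1 / (\<delta> (r *\<^sub>R x) * cnj (\<delta> (r *\<^sub>R y)) - cinner (A *v (r *\<^sub>R x) + B) (A *v (r *\<^sub>R y) + B))"
    proof -
      have "cinner (\<phi> (r *\<^sub>R x)) (\<phi> (r *\<^sub>R y)) = (1 / \<delta> (r *\<^sub>R x)) * (cnj (1 / \<delta> (r *\<^sub>R y)) *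
        cinner (A *v (r *\<^sub>R x) + B) (A *v (r *\<^sub>R y) + B))"
        unfolding linear_fractional_def cinner_smult_left cinner_smult_right by simp
      then have "\<delta> (r *\<^sub>R x) * cnj (\<delta> (r *\<^sub>R y)) * (1 - cinner (\<phi> (r *\<^sub>R x)) (\<phi> (r *\<^sub>R y)))
        = \<delta> (r *\<^sub>R x) * cnj (\<delta> (r *\<^sub>R y)) - cinner (A *v (r *\<^sub>R x) + B) (A *v (r *\<^sub>R y) + B)"
        using dnz[OF that(1)] dnz[OF that(2)] by (simp add: right_diff_distrib del: complex_cnj_add)
      then show ?thesis unfolding Y_def by simp
    qed
    define u where "u = of_real t * (1 - cinner (r *\<^sub>R x) (r *\<^sub>R y))"
    define v where "v = \<delta> (r *\<^sub>R x) * cnj (\<delta> (r *\<^sub>R y)) - cinner (A *v (r *\<^sub>R x) + B) (A *v (r *\<^sub>R y) + B)"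
    have X: "X r x y = 1 / u" by (simp add: X_def u_def)
    have Y: "Y r x y = 1 / v" unfolding Y v_def ..
    have u: "u \<noteq> 0" using nz1[OF that] t by (simp add: u_def)
    have "Y r x y \<noteq> 0"
      using dnz[OF that(1)] dnz[OF that(2)] nz2[OF that] by (simp add: Y_def del: complex_cnj_add)
    then have v: "v \<noteq> 0" using Y by auto
    have "Q r x y = v - u" unfolding Q_def u_def v_def by simp
    then show ?thesis using u v by (simp add: X Y field_simps)
  qed
  have sum: "psd_kernel (\<lambda>x y. \<Sum>i<N. (X r x y ^ Suc i * Y r x y ^ Suc (N - Suc i)) * Q r x y)"
    by (rule psd_kernel_sum) (rule psd_term)
  have eq: "X r x y ^ N - Y r x y ^ N = (\<Sum>i<N. (X r x y ^ Suc i * Y r x y ^ Suc (N - Suc i)) * Q r x y)"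
    if "x \<in> ?S" "y \<in> ?S" for x y
    unfolding power_diff_sumr2 XY[OF that] sum_distrib_left
    by (intro sum.cong refl) (simp add: mult_ac)
  show ?thesis
    unfolding psd_kernel_def
  proof (intro conjI allI impI)
    show "continuous_on (?S \<times> ?S) (\<lambda>p. X r (fst p) (snd p) ^ N - Y r (fst p) (snd p) ^ N)"
      by (intro continuous_intros cX cY)
    fix a :: "complex ^ 'n \<Rightarrow> complex" assume a: "continuous_on ?S a"
    have "(LINT p|usphere2. a (fst p) * cnj (a (snd p)) * (X r (fst p) (snd p) ^ N - Y r (fst p) (snd p) ^ N))
      = (LINT p|usphere2. a (fst p) * cnj (a (snd p)) * (\<Sum>i<N. (X r (fst p) (snd p) ^ Suc i * Y r (fst p) (snd p) ^ Suc (N - Suc i)) * Q r (fst p) (snd p)))"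
      by (intro Bochner_Integration.integral_cong refl, subst eq) (auto simp: space_pair_measure)
    then show "0 \<le> Re (LINT p|usphere2. a (fst p) * cnj (a (snd p)) * (X r (fst p) (snd p) ^ N - Y r (fst p) (snd p) ^ N))"
      using sum a unfolding psd_kernel_def by simp
  qed
qed

end

section \<open>The Hardy space\<close>

lemma mult_less_1: "0 \<le> a \<Longrightarrow> a < 1 \<Longrightarrow> 0 \<le> b \<Longrightarrow> b < 1 \<Longrightarrow> a * b < (1::real)"
  using mult_strict_mono'[of a 1 b 1] by simp

lemma norm_scaleR_less_1: "0 \<le> s \<Longrightarrow> s \<le> 1 \<Longrightarrow> norm x < 1 \<Longrightarrow> norm (s *\<^sub>R x) < 1"
  using mult_left_le_one_le[of "norm x" s] by simp

text \<open>The sphere carries all of the mass, and f is Borel measurable on the whole space because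
  it vanishes off the ball.\<close>

lemma hardy_mean_usphere:
  fixes f :: "complex ^ 'n \<Rightarrow> complex"
  assumes f: "mv_holomorphic_on f (ball 0 1)" and zero: "\<And>z. z \<notin> ball 0 1 \<Longrightarrow> f z = 0" and "0 < r"
  shows "hardy_mean f r = (LINT \<zeta>|usphere. (norm (f (r *\<^sub>R \<zeta>)))\<^sup>2)"
proof -
  have "(\<lambda>z. indicator (ball 0 1) z *\<^sub>R f z) \<in> borel_measurable borel"
    by (rule borel_measurable_continuous_on_indicator[OF _ mv_holomorphic_on_imp_continuous_on[OF f]]) simp
  moreover have "(\<lambda>z. indicator (ball 0 1) z *\<^sub>R f z) = f"
    using zero by (auto simp: indicator_def fun_eq_iff)
  ultimately have [measurable]: "f \<in> borel_measurable borel" by simp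
  have [measurable]: "sphere (0 :: complex ^ 'n) 1 \<in> sets borel" by simp
  have "AE \<zeta> in sphere_measure. \<zeta> \<in> sphere (0 :: complex ^ 'n) 1"
  proof (rule AE_I[where N = "- sphere 0 1"])
    have "emeasure sphere_measure (UNIV - sphere (0 :: complex ^ 'n) 1)
        = emeasure sphere_measure (UNIV :: (complex ^ 'n) set) - emeasure sphere_measure (sphere (0 :: complex ^ 'n) 1)"
      by (rule emeasure_Diff) (auto simp: emeasure_sphere_measure_sphere)
    then show "emeasure sphere_measure (- sphere (0 :: complex ^ 'n) 1) = 0"
      by (simp add: emeasure_sphere_measure_sphere emeasure_sphere_measure_UNIV Compl_eq_Diff_UNIV)
  qed auto
  then have "hardy_mean f r = (LINT \<zeta>|sphere_measure. indicator (sphere 0 1) \<zeta> *\<^sub>R (norm (f (r *\<^sub>R \<zeta>)))\<^sup>2)"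
    unfolding hardy_mean_def by (intro integral_cong_AE) (auto elim: eventually_mono)
  also have "\<dots> = (LINT \<zeta>|usphere. (norm (f (r *\<^sub>R \<zeta>)))\<^sup>2)"
    unfolding usphere_def by (rule integral_restrict_space[symmetric]) simp
  finally show ?thesis .
qed

lemma Re_of_real_mult: "Re (of_real x * z) = x * Re z"
  by simp

lemma hardy_spaceD:
  assumes "f \<in> hardy_space"
  shows "mv_holomorphic_on f (ball 0 1)" "\<And>z. z \<notin> ball 0 1 \<Longrightarrow> f z = 0"
  using assms by (auto simp: hardy_space_def)

lemma hardy_mean_nonneg: "0 \<le> hardy_mean f r"
  unfolding hardy_mean_def by (rule integral_nonneg_AE) simp

lemma hardy_mean_le_norm:
  assumes "f \<in> hardy_space" "0 < r" "r < 1"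
  shows "hardy_mean f r \<le> (hardy_norm f)\<^sup>2"
proof -
  have le: "hardy_mean f r \<le> (SUP r\<in>{0<..<1}. hardy_mean f r)"
    using assms by (intro cSUP_upper) (auto simp: hardy_space_def)
  then have "0 \<le> (SUP r\<in>{0<..<1}. hardy_mean f r)" using hardy_mean_nonneg order_trans by blast
  then show ?thesis using le by (simp add: hardy_norm_def)
qed

lemma hardy_norm_nonneg: "f \<in> hardy_space \<Longrightarrow> 0 \<le> hardy_norm f"
  using hardy_mean_le_norm[of f "1/2"] hardy_mean_nonneg[of f "1/2"]
  unfolding hardy_norm_def by (intro real_sqrt_ge_zero) (auto simp: hardy_space_def intro!: order_trans[OF hardy_mean_nonneg[of f "1/2"]] cSUP_upper)

lemma hardy_spaceI:
  assumes "mv_holomorphic_on f (ball 0 1)" "\<And>z. z \<notin> ball 0 1 \<Longrightarrow> f z = 0"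
    and bd: "\<And>r. 0 < r \<Longrightarrow> r < 1 \<Longrightarrow> hardy_mean f r \<le> b\<^sup>2" and b: "0 \<le> b"
  shows "f \<in> hardy_space" "hardy_norm f \<le> b"
proof -
  show "f \<in> hardy_space"
    using assms by (auto simp: hardy_space_def bdd_above_def intro!: exI[of _ "b\<^sup>2"])
  have "(SUP r\<in>{0<..<1}. hardy_mean f r) \<le> b\<^sup>2"
    by (rule cSUP_least) (use bd in auto)
  then have "hardy_norm f \<le> sqrt (b\<^sup>2)" unfolding hardy_norm_def by (rule real_sqrt_le_mono)
  then show "hardy_norm f \<le> b" using b by simp
qed

lemma scaled_sphere_continuous:
  assumes "mv_holomorphic_on f (ball 0 1)" "0 < r" "r < 1"
  shows "continuous_on (sphere 0 1) (\<lambda>\<zeta>. f (r *\<^sub>R \<zeta>))"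
  by (rule continuous_on_scaled[OF assms(1)])
     (use assms in \<open>auto intro!: bounded_linear.continuous_on[OF bounded_linear_scaleR_right continuous_on_id]\<close>)

lemma hardy_space_bounded:
  fixes f :: "complex ^ 'n \<Rightarrow> complex"
  assumes f: "mv_holomorphic_on f (ball 0 1)" "\<And>z. z \<notin> ball 0 1 \<Longrightarrow> f z = 0"
    and bd: "\<And>z. z \<in> ball 0 1 \<Longrightarrow> norm (f z) \<le> b"
  shows "f \<in> hardy_space" "hardy_norm f \<le> b"
proof -
  have b: "0 \<le> b" using order_trans[OF norm_ge_zero bd[of 0]] by simp
  have "hardy_mean f r \<le> b\<^sup>2" if r: "0 < r" "r < 1" for r
  proof -
    have "(LINT \<zeta>|usphere. (norm (f (r *\<^sub>R \<zeta>)))\<^sup>2) \<le> (LINT \<zeta>|(usphere :: (complex ^ 'n) measure). b\<^sup>2)"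
    proof (rule integral_mono)
      show "integrable usphere (\<lambda>\<zeta>. (norm (f (r *\<^sub>R \<zeta>)))\<^sup>2)"
        by (intro usphere_integrable continuous_intros scaled_sphere_continuous f r)
      show "integrable usphere (\<lambda>\<zeta> :: complex ^ 'n. b\<^sup>2)" by (intro usphere_integrable continuous_intros)
      fix \<zeta> :: "complex ^ 'n" assume "\<zeta> \<in> space usphere"
      then show "(norm (f (r *\<^sub>R \<zeta>)))\<^sup>2 \<le> b\<^sup>2"
        using r by (intro power_mono bd) auto
    qed
    moreover have "hardy_mean f r = (LINT \<zeta>|usphere. (norm (f (r *\<^sub>R \<zeta>)))\<^sup>2)"
      by (rule hardy_mean_usphere) (use f r in auto)
    ultimately show ?thesis by (simp add: measure_usphere)
  qed
  from hardy_spaceI[OF f this b] show "f \<in> hardy_space" "hardy_norm f \<le> b" by auto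
qed

text \<open>From \<open>(a + b)^2 \<le> 2 a^2 + 2 b^2\<close> under the integral; the factor 2 in
  the norm estimate for sums originates here.\<close>

lemma hardy_mean_add:
  fixes f g :: "complex ^ 'n \<Rightarrow> complex"
  assumes f: "f \<in> hardy_space" and g: "g \<in> hardy_space" and r: "0 < r" "r < 1"
  shows "hardy_mean (\<lambda>z. f z + g z) r \<le> 2 * hardy_mean f r + 2 * hardy_mean g r"
proof -
  note fc = scaled_sphere_continuous[OF hardy_spaceD(1)[OF f] r]
    and gc = scaled_sphere_continuous[OF hardy_spaceD(1)[OF g] r]
  have "(LINT \<zeta>|usphere. (norm (f (r *\<^sub>R \<zeta>) + g (r *\<^sub>R \<zeta>)))\<^sup>2)
    \<le> (LINT \<zeta>|usphere. 2 * (norm (f (r *\<^sub>R \<zeta>)))\<^sup>2 + 2 * (norm (g (r *\<^sub>R \<zeta>)))\<^sup>2)"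
  proof (rule integral_mono)
    fix \<zeta> :: "complex ^ 'n"
    let ?u = "f (r *\<^sub>R \<zeta>)" and ?v = "g (r *\<^sub>R \<zeta>)"
    have "(norm (?u + ?v))\<^sup>2 \<le> (norm ?u + norm ?v)\<^sup>2"
      by (intro power_mono norm_triangle_ineq) simp
    also have "\<dots> \<le> 2 * (norm ?u)\<^sup>2 + 2 * (norm ?v)\<^sup>2"
      using sum_squares_bound[of "norm ?u" "norm ?v"] by (simp add: power2_sum)
    finally show "(norm (?u + ?v))\<^sup>2 \<le> 2 * (norm ?u)\<^sup>2 + 2 * (norm ?v)\<^sup>2" .
  qed (intro usphere_integrable continuous_intros fc gc)+
  also have "\<dots> = 2 * (LINT \<zeta>|usphere. (norm (f (r *\<^sub>R \<zeta>)))\<^sup>2) + 2 * (LINT \<zeta>|usphere. (norm (g (r *\<^sub>R \<zeta>)))\<^sup>2)"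
    by (subst Bochner_Integration.integral_add) ((intro usphere_integrable continuous_intros fc gc)+, simp)
  finally show ?thesis
    using hardy_mean_usphere[OF hardy_spaceD[OF f] r(1)] hardy_mean_usphere[OF hardy_spaceD[OF g] r(1)]
      hardy_mean_usphere[of "\<lambda>z. f z + g z", OF _ _ r(1)] hardy_spaceD[OF f] hardy_spaceD[OF g]
    by (simp add: mv_holomorphic_on_add)
qed

lemma hardy_space_add:
  assumes f: "f \<in> hardy_space" and g: "g \<in> hardy_space"
  shows "(\<lambda>z. f z + g z) \<in> hardy_space" "hardy_norm (\<lambda>z. f z + g z) \<le> 2 * (hardy_norm f + hardy_norm g)"
proof -
  have "hardy_mean (\<lambda>z. f z + g z) r \<le> (2 * (hardy_norm f + hardy_norm g))\<^sup>2" if r: "0 < r" "r < 1" for r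
  proof -
    have "hardy_mean (\<lambda>z. f z + g z) r \<le> 2 * (hardy_norm f)\<^sup>2 + 2 * (hardy_norm g)\<^sup>2"
      using hardy_mean_add[OF f g r] hardy_mean_le_norm[OF f r] hardy_mean_le_norm[OF g r] by linarith
    also have "\<dots> \<le> (2 * (hardy_norm f + hardy_norm g))\<^sup>2"
      using hardy_norm_nonneg[OF f] hardy_norm_nonneg[OF g] by (simp add: power2_eq_square algebra_simps)
    finally show ?thesis .
  qed
  from hardy_spaceI[OF mv_holomorphic_on_add[OF hardy_spaceD(1)[OF f] hardy_spaceD(1)[OF g]] _ this]
  show "(\<lambda>z. f z + g z) \<in> hardy_space" "hardy_norm (\<lambda>z. f z + g z) \<le> 2 * (hardy_norm f + hardy_norm g)"
    using hardy_spaceD(2)[OF f] hardy_spaceD(2)[OF g] hardy_norm_nonneg[OF f] hardy_norm_nonneg[OF g]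
    by auto
qed

lemma hardy_space_cmult:
  assumes f: "f \<in> hardy_space"
  shows "(\<lambda>z. c * f z) \<in> hardy_space" "hardy_norm (\<lambda>z. c * f z) \<le> norm c * hardy_norm f"
proof -
  have "hardy_mean (\<lambda>z. c * f z) r \<le> (norm c * hardy_norm f)\<^sup>2" if r: "0 < r" "r < 1" for r
  proof -
    have "hardy_mean (\<lambda>z. c * f z) r = (norm c)\<^sup>2 * hardy_mean f r"
      by (simp add: hardy_mean_def norm_mult power_mult_distrib)
    then show ?thesis
      using hardy_mean_le_norm[OF f r] by (simp add: power_mult_distrib mult_left_mono)
  qed
  note mean = this
  have hol: "mv_holomorphic_on (\<lambda>z. c * f z) (ball 0 1)"
    by (rule mv_holomorphic_on_cmult[OF hardy_spaceD(1)[OF f]])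
  have zero: "c * f z = 0" if "z \<notin> ball 0 1" for z
    using hardy_spaceD(2)[OF f that] by simp
  have nonneg: "0 \<le> norm c * hardy_norm f" using hardy_norm_nonneg[OF f] by simp
  show "(\<lambda>z. c * f z) \<in> hardy_space"
    by (rule hardy_spaceI(1)[OF hol zero mean nonneg])
  show "hardy_norm (\<lambda>z. c * f z) \<le> norm c * hardy_norm f"
    by (rule hardy_spaceI(2)[OF hol zero mean nonneg])
qed

section \<open>Boundedness of composition operators\<close>

lemma hardy_space_zero: "(\<lambda>z. 0) \<in> hardy_space"
  by (rule hardy_space_bounded(1)[OF mv_holomorphic_on_const, of _ 0]) simp_all

text \<open>The Szego formula on a sphere of radius strictly between \<rho> and 1, followed by the
  Cauchy-Schwarz inequality.\<close>

lemma hardy_point_evaluation: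
  assumes \<rho>: "0 \<le> \<rho>" "\<rho> < 1"
  shows "\<exists>c\<ge>0. \<forall>f\<in>hardy_space. \<forall>z :: complex ^ 'n. norm z \<le> \<rho> \<longrightarrow> norm (f z) \<le> c * hardy_norm f"
proof -
  \<comment> \<open>After division by this radius the evaluation point still has norm at most
    \<open>q = \<rho> / s < 1\<close>, where the kernel is bounded by \<open>k\<close>.\<close>
  define s where "s = (1 + \<rho>) / 2"
  have s: "0 < s" "s < 1" "\<rho> < s" using \<rho> by (auto simp: s_def)
  define q where "q = \<rho> / s"
  have q: "0 \<le> q" "q < 1" using s \<rho> by (auto simp: q_def)
  define k where "k = 1 / (1 - q) ^ CARD('n)"
  have k: "k \<ge> 0" using q by (simp add: k_def)
  show ?thesis
  proof (intro exI[of _ k] conjI ballI allI impI k)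
    fix f :: "complex ^ 'n \<Rightarrow> complex" and z :: "complex ^ 'n"
    assume f: "f \<in> hardy_space" and z: "norm z \<le> \<rho>"
    let ?w = "(1 / s) *\<^sub>R z"
    have w: "norm ?w \<le> q" using z s by (simp add: q_def divide_right_mono)
    then have w1: "norm ?w < 1" using q by linarith
    note fc = scaled_sphere_continuous[OF hardy_spaceD(1)[OF f] s(1,2)]
    have sc: "continuous_on (sphere 0 1) (\<lambda>\<zeta>. szego ?w \<zeta>)"
      by (intro continuous_on_szego continuous_intros) (use w1 in simp)
    have sz: "norm (szego ?w \<zeta>) \<le> k" if "\<zeta> \<in> sphere 0 1" for \<zeta>
    proof -
      have "norm (cinner ?w \<zeta>) \<le> q" using norm_cinner_le[of ?w \<zeta>] w that by simp
      then have "1 - q \<le> norm (1 - cinner ?w \<zeta>)"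
        using norm_triangle_ineq2[of 1 "cinner ?w \<zeta>"] by simp
      then have "(1 - q) ^ CARD('n) \<le> norm (1 - cinner ?w \<zeta>) ^ CARD('n)"
        using q by (intro power_mono) auto
      then show ?thesis
        unfolding szego_def k_def norm_divide norm_power norm_one
        using q by (intro divide_left_mono) (auto intro!: mult_pos_pos zero_less_power elim: less_le_trans[rotated])
    qed
    have "f z = (LINT \<zeta>|usphere. f (s *\<^sub>R \<zeta>) * szego ?w \<zeta>)"
      using szego_formula[OF hardy_spaceD(1)[OF f] s(1,2) w1] s by simp
    then have "(norm (f z))\<^sup>2 \<le> (LINT \<zeta>|usphere. (norm (f (s *\<^sub>R \<zeta>)))\<^sup>2) * (LINT \<zeta>|usphere. (norm (szego ?w \<zeta>))\<^sup>2)"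
      using usphere_Cauchy_Schwarz[OF fc sc] by simp
    also have "\<dots> \<le> (hardy_norm f)\<^sup>2 * k\<^sup>2"
    proof (rule mult_mono)
      show "(LINT \<zeta>|usphere. (norm (f (s *\<^sub>R \<zeta>)))\<^sup>2) \<le> (hardy_norm f)\<^sup>2"
        using hardy_mean_le_norm[OF f s(1,2)] hardy_mean_usphere[OF hardy_spaceD[OF f] s(1)] by simp
      have "(LINT \<zeta>|usphere. (norm (szego ?w \<zeta>))\<^sup>2) \<le> (LINT \<zeta>|(usphere :: (complex ^ 'n) measure). k\<^sup>2)"
        by (intro integral_mono usphere_integrable continuous_intros sc power_mono) (use sz in auto)
      then show "(LINT \<zeta>|usphere. (norm (szego ?w \<zeta>))\<^sup>2) \<le> k\<^sup>2" by (simp add: measure_usphere)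
    qed (auto intro!: integral_nonneg_AE)
    finally have "(norm (f z))\<^sup>2 \<le> (k * hardy_norm f)\<^sup>2" by (simp add: power_mult_distrib mult.commute)
    then show "norm (f z) \<le> k * hardy_norm f"
      by (rule power2_le_imp_le) (use k hardy_norm_nonneg[OF f] in simp)
  qed
qed

context lfm_form
begin

text \<open>A duality argument. The weighted mean \<Phi> is written as a pairing of the dilated f
  with a superposition \<open>E\<close> of kernels at the image points. The squared norm of
  \<open>E\<close> is a double integral against the power of \<open>Y\<close>, hence at most the one
  against the power of \<open>X\<close>, which is at most \<Phi> times the constant. Cauchy-Schwarz
  gives a bound for the square of \<Phi> with a factor \<Phi> on the right, which is divided
  out.\<close>

lemma weighted_mean_bound:
  fixes f :: "complex ^ 'n \<Rightarrow> complex"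
  assumes f: "mv_holomorphic_on f (ball 0 1)" and r: "0 < r" "r < 1" and s: "0 < s" "s < 1"
  shows "(LINT \<zeta>|usphere. (norm (f (s *\<^sub>R \<phi> (r *\<^sub>R \<zeta>)) / \<delta> (r *\<^sub>R \<zeta>) ^ CARD('n)))\<^sup>2)
    \<le> (1 / t ^ CARD('n)) * (LINT \<zeta>|usphere. (norm (f (s *\<^sub>R \<zeta>)))\<^sup>2)"
proof -
  let ?N = "CARD('n)"
  let ?S = "sphere (0 :: complex ^ 'n) 1"
  define h where "h z = f (s *\<^sub>R \<phi> z) / \<delta> z ^ ?N" for z
  define \<psi> where "\<psi> \<zeta> = \<phi> (r *\<^sub>R \<zeta>)" for \<zeta>
  define a where "a \<zeta> = cnj (h (r *\<^sub>R \<zeta>))" for \<zeta>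
  define b where "b \<zeta> = a \<zeta> / \<delta> (r *\<^sub>R \<zeta>) ^ ?N" for \<zeta>
  define \<Phi> where "\<Phi> = (LINT \<zeta>|usphere. (norm (h (r *\<^sub>R \<zeta>)))\<^sup>2)"
  define F where "F = (LINT \<zeta>|usphere. (norm (f (s *\<^sub>R \<zeta>)))\<^sup>2)"
  have rS: "norm (r *\<^sub>R x) < 1" "norm (r *\<^sub>R x) \<le> 1" if "x \<in> ?S" for x using that r by auto
  have rc: "continuous_on ?S (\<lambda>x. r *\<^sub>R x)"
    by (rule bounded_linear.continuous_on[OF bounded_linear_scaleR_right continuous_on_id])
  have h_hol: "mv_holomorphic_on h (ball 0 1)"
  proof -
    have "mv_holomorphic_on (\<lambda>z. f (s *\<^sub>R \<phi> z)) (ball 0 1)"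
    proof (rule mv_holomorphic_on_compose[OF f])
      show "mv_holomorphic_on (\<lambda>z. (s *\<^sub>R \<phi> z) $ i) (ball 0 1)" for i
        using mv_holomorphic_on_cmult[OF mv_holomorphic_phi, of "of_real s" i] by (simp add: scaleR_eq_smult)
      show "s *\<^sub>R \<phi> z \<in> ball 0 1" if "z \<in> ball 0 1" for z
        using image_ball[of z] that s norm_scaleR_less_1[of s "\<phi> z"] by simp
    qed
    then have "mv_holomorphic_on (\<lambda>z. f (s *\<^sub>R \<phi> z) * inverse (\<delta> z ^ ?N)) (ball 0 1)"
      using denominator by (intro mv_holomorphic_on_mult mv_holomorphic_on_inverse mv_holomorphic_on_power mv_holomorphic_delta) auto
    then show ?thesis unfolding h_def divide_inverse .
  qed
  have \<psi>: "norm (\<psi> x) < 1" if "x \<in> ?S" for x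
    unfolding \<psi>_def by (rule image_ball[OF rS(1)[OF that]])
  have \<psi>c: "continuous_on ?S \<psi>" unfolding \<psi>_def by (rule continuous_on_phi[OF rc rS(2)])
  have hc: "continuous_on ?S (\<lambda>\<zeta>. h (r *\<^sub>R \<zeta>))" by (rule scaled_sphere_continuous[OF h_hol r])
  have ac: "continuous_on ?S a" unfolding a_def by (intro continuous_intros hc)
  have bc: "continuous_on ?S b"
    unfolding b_def using denominator rS(2)
    by (intro continuous_on_divide ac continuous_on_power continuous_on_delta rc) auto
  have fc: "continuous_on ?S (\<lambda>\<zeta>. f (s *\<^sub>R \<zeta>))" by (rule scaled_sphere_continuous[OF f s])
  have Kc: "continuous_on (?S \<times> ?S) (\<lambda>p. szego (\<psi> (fst p)) (snd p))"
    by (intro continuous_on_szego continuous_on_fst_snd[OF \<psi>c] continuous_intros) (use \<psi> in auto)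
  define E where "E \<xi> = (LINT \<zeta>|usphere. b \<zeta> * szego (\<psi> \<zeta>) \<xi>)" for \<xi>
  have bK: "continuous_on (?S \<times> ?S) (\<lambda>p. b (fst p) * szego (\<psi> (fst p)) (snd p))"
    by (intro continuous_on_mult Kc continuous_on_fst_snd bc)
  have swap: "continuous_on (?S \<times> ?S) (\<lambda>(x, y). G x y)" if "continuous_on (?S \<times> ?S) (\<lambda>p. G (fst p) (snd p))"
    for G :: "complex ^ 'n \<Rightarrow> complex ^ 'n \<Rightarrow> complex" using that by (simp add: case_prod_beta)
  have swap': "continuous_on (?S \<times> ?S) (\<lambda>(x, y). G y x)" if c: "continuous_on (?S \<times> ?S) (\<lambda>p. G (fst p) (snd p))"
    for G :: "complex ^ 'n \<Rightarrow> complex ^ 'n \<Rightarrow> complex"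
  proof -
    have "continuous_on (?S \<times> ?S) (\<lambda>p. G (fst (prod.swap p)) (snd (prod.swap p)))"
      by (rule continuous_on_compose2[OF c]) (auto intro!: continuous_on_swap)
    then show ?thesis by (simp add: case_prod_beta)
  qed
  have Ec: "continuous_on ?S E"
    unfolding E_def by (rule usphere_continuous_LINT[OF compact_sphere swap'[OF bK]])
  have "complex_of_real \<Phi> = (LINT \<zeta>|usphere. b \<zeta> * f (s *\<^sub>R \<psi> \<zeta>))"
  proof -
    have "complex_of_real \<Phi> = (LINT \<zeta>|usphere. a \<zeta> * h (r *\<^sub>R \<zeta>))"
      unfolding \<Phi>_def integral_complex_of_real[symmetric]
      by (intro Bochner_Integration.integral_cong refl, unfold complex_norm_square) (simp add: a_def mult.commute)
    then show ?thesis by (simp add: b_def h_def \<psi>_def)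
  qed
  also have "\<dots> = (LINT \<zeta>|usphere. LINT \<xi>|usphere. b \<zeta> * szego (\<psi> \<zeta>) \<xi> * f (s *\<^sub>R \<xi>))"
  proof (rule Bochner_Integration.integral_cong[OF refl])
    fix \<zeta> :: "complex ^ 'n" assume "\<zeta> \<in> space usphere"
    then have "f (s *\<^sub>R \<psi> \<zeta>) = (LINT \<xi>|usphere. f (s *\<^sub>R \<xi>) * szego (\<psi> \<zeta>) \<xi>)"
      using szego_formula[OF f s \<psi>] by simp
    then show "b \<zeta> * f (s *\<^sub>R \<psi> \<zeta>) = (LINT \<xi>|usphere. b \<zeta> * szego (\<psi> \<zeta>) \<xi> * f (s *\<^sub>R \<xi>))"
      by (simp only: integral_mult_right_zero[symmetric] mult_ac)
  qed
  also have "\<dots> = (LINT \<xi>|usphere. LINT \<zeta>|usphere. b \<zeta> * szego (\<psi> \<zeta>) \<xi> * f (s *\<^sub>R \<xi>))"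
    by (rule usphere_Fubini[OF swap]) (intro continuous_on_mult bK continuous_on_fst_snd fc)
  also have "\<dots> = (LINT \<xi>|usphere. E \<xi> * f (s *\<^sub>R \<xi>))"
    by (simp add: E_def)
  finally have \<Phi>_eq: "complex_of_real \<Phi> = (LINT \<xi>|usphere. E \<xi> * f (s *\<^sub>R \<xi>))" .
  have "\<Phi>\<^sup>2 = (norm (complex_of_real \<Phi>))\<^sup>2" by simp
  also have "\<dots> \<le> (LINT \<xi>|usphere. (norm (E \<xi>))\<^sup>2) * F"
    unfolding \<Phi>_eq F_def by (rule usphere_Cauchy_Schwarz[OF Ec fc])
  finally have \<Phi>2: "\<Phi>\<^sup>2 \<le> (LINT \<xi>|usphere. (norm (E \<xi>))\<^sup>2) * F" .
  have E2: "complex_of_real (LINT \<xi>|usphere. (norm (E \<xi>))\<^sup>2)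
      = (LINT p|usphere2. a (fst p) * cnj (a (snd p)) * Y r (fst p) (snd p) ^ ?N)"
  proof -
    have cE: "cnj (E \<xi>) = (LINT \<eta>|usphere. cnj (b \<eta>) * szego \<xi> (\<psi> \<eta>))" for \<xi>
    proof -
      have "cnj (E \<xi>) = (LINT \<eta>|usphere. cnj (b \<eta> * szego (\<psi> \<eta>) \<xi>))"
        unfolding E_def by (rule Bochner_Integration.integral_cnj[symmetric])
      then show ?thesis by (simp only: complex_cnj_mult cnj_szego)
    qed
    \<comment> \<open>The kernel is itself reproduced by the Szego formula, since it is holomorphic
      on a ball of radius above 1.\<close>
    have kk: "(LINT \<xi>|usphere. szego (\<psi> \<zeta>) \<xi> * szego \<xi> w) = szego (\<psi> \<zeta>) w"
      if "\<zeta> \<in> ?S" "norm w < 1" for \<zeta> w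
    proof -
      define R where "R = (if w = 0 then 2 else 1 / norm w)"
      have R: "R > 1" using that(2) by (auto simp: R_def)
      have "mv_holomorphic_on (\<lambda>z. szego z w) (ball 0 R)"
        by (rule mv_holomorphic_on_szego) (auto simp: R_def field_simps split: if_splits)
      from szego_formula_ball[OF this R \<psi>[OF that(1)]] show ?thesis by (simp add: mult.commute)
    qed
    have "complex_of_real (LINT \<xi>|usphere. (norm (E \<xi>))\<^sup>2) = (LINT \<xi>|usphere. E \<xi> * cnj (E \<xi>))"
      unfolding integral_complex_of_real[symmetric] complex_norm_square ..
    also have "\<dots> = (LINT \<xi>|usphere. LINT \<zeta>|usphere. b \<zeta> * szego (\<psi> \<zeta>) \<xi> * cnj (E \<xi>))"
      by (simp add: E_def)
    also have "\<dots> = (LINT \<zeta>|usphere. LINT \<xi>|usphere. b \<zeta> * szego (\<psi> \<zeta>) \<xi> * cnj (E \<xi>))"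
      by (rule usphere_Fubini[OF swap, symmetric])
         (intro continuous_on_mult bK continuous_on_cnj continuous_on_fst_snd Ec)
    also have "\<dots> = (LINT \<zeta>|usphere. LINT \<eta>|usphere. b \<zeta> * cnj (b \<eta>) * szego (\<psi> \<zeta>) (\<psi> \<eta>))"
    proof (rule Bochner_Integration.integral_cong[OF refl])
      fix \<zeta> :: "complex ^ 'n" assume "\<zeta> \<in> space usphere"
      then have \<zeta>: "\<zeta> \<in> ?S" by simp
      have szc: "continuous_on ?S (\<lambda>\<xi>. szego (\<psi> \<zeta>) \<xi>)"
        by (intro continuous_on_szego continuous_intros) (use \<psi>[OF \<zeta>] in auto)
      have K': "continuous_on (?S \<times> ?S) (\<lambda>p. szego (fst p) (\<psi> (snd p)))"
        by (intro continuous_on_szego continuous_on_fst_snd[OF \<psi>c] continuous_intros) (use \<psi> in auto)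
      have "(LINT \<xi>|usphere. b \<zeta> * szego (\<psi> \<zeta>) \<xi> * cnj (E \<xi>))
        = (LINT \<xi>|usphere. LINT \<eta>|usphere. b \<zeta> * szego (\<psi> \<zeta>) \<xi> * (cnj (b \<eta>) * szego \<xi> (\<psi> \<eta>)))"
        by (simp add: cE)
      also have "\<dots> = (LINT \<eta>|usphere. LINT \<xi>|usphere. b \<zeta> * szego (\<psi> \<zeta>) \<xi> * (cnj (b \<eta>) * szego \<xi> (\<psi> \<eta>)))"
        by (rule usphere_Fubini[OF swap])
           (intro continuous_on_mult continuous_on_const continuous_on_fst_snd szc continuous_on_cnj bc K')
      also have "\<dots> = (LINT \<eta>|usphere. (b \<zeta> * cnj (b \<eta>)) * (LINT \<xi>|usphere. szego (\<psi> \<zeta>) \<xi> * szego \<xi> (\<psi> \<eta>)))"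
        by (simp only: integral_mult_right_zero[symmetric] mult_ac)
      also have "\<dots> = (LINT \<eta>|usphere. b \<zeta> * cnj (b \<eta>) * szego (\<psi> \<zeta>) (\<psi> \<eta>))"
        by (intro Bochner_Integration.integral_cong refl) (use kk[OF \<zeta>] \<psi> in simp)
      finally show "(LINT \<xi>|usphere. b \<zeta> * szego (\<psi> \<zeta>) \<xi> * cnj (E \<xi>))
        = (LINT \<eta>|usphere. b \<zeta> * cnj (b \<eta>) * szego (\<psi> \<zeta>) (\<psi> \<eta>))" .
    qed
    also have "\<dots> = (LINT p|usphere2. b (fst p) * cnj (b (snd p)) * szego (\<psi> (fst p)) (\<psi> (snd p)))"
    proof -
      have "continuous_on (?S \<times> ?S) (\<lambda>p. szego (\<psi> (fst p)) (\<psi> (snd p)))"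
        by (intro continuous_on_szego continuous_on_fst_snd[OF \<psi>c])
           (use \<psi> in \<open>auto intro!: mult_less_1\<close>)
      then show ?thesis
        by (subst usphere2_iterated) (auto intro!: continuous_on_mult continuous_on_cnj continuous_on_fst_snd bc)
    qed
    also have "\<dots> = (LINT p|usphere2. a (fst p) * cnj (a (snd p)) * Y r (fst p) (snd p) ^ ?N)"
      by (intro Bochner_Integration.integral_cong refl)
         (simp add: b_def Y_def \<psi>_def szego_def power_mult_distrib power_one_over)
    finally show ?thesis .
  qed
  have E\<Phi>: "(LINT \<xi>|usphere. (norm (E \<xi>))\<^sup>2) \<le> (1 / t ^ ?N) * \<Phi>"
  proof -
    have Xeq: "X r x y ^ ?N = of_real (1 / t ^ ?N) * szego (r *\<^sub>R x) (r *\<^sub>R y)" for x y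
      by (simp add: X_def szego_def power_mult_distrib power_one_over)
    have K: "continuous_on (?S \<times> ?S) (\<lambda>p. szego (r *\<^sub>R fst p) (r *\<^sub>R snd p))"
    proof -
      have "r * r < 1" using r by (simp add: mult_less_1)
      then show ?thesis
        by (intro continuous_on_szego continuous_on_fst_snd[OF rc]) (use r in auto)
    qed
    have iX: "integrable usphere2 (\<lambda>p. a (fst p) * cnj (a (snd p)) * X r (fst p) (snd p) ^ ?N)"
      unfolding Xeq by (intro usphere2_integrable continuous_on_mult continuous_on_const K continuous_on_cnj continuous_on_fst_snd ac)
    have psd: "psd_kernel (\<lambda>x y. X r x y ^ ?N - Y r x y ^ ?N)"
      by (rule psd_kernel_difference) (use r in auto)
    have iD: "integrable usphere2 (\<lambda>p. a (fst p) * cnj (a (snd p)) * (X r (fst p) (snd p) ^ ?N - Y r (fst p) (snd p) ^ ?N))"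
      using psd unfolding psd_kernel_def by (intro usphere2_integrable continuous_on_mult continuous_on_cnj continuous_on_fst_snd ac) auto
    have "(LINT p|usphere2. a (fst p) * cnj (a (snd p)) * Y r (fst p) (snd p) ^ ?N)
      = (LINT p|usphere2. a (fst p) * cnj (a (snd p)) * X r (fst p) (snd p) ^ ?N)
       - (LINT p|usphere2. a (fst p) * cnj (a (snd p)) * (X r (fst p) (snd p) ^ ?N - Y r (fst p) (snd p) ^ ?N))"
      by (subst Bochner_Integration.integral_diff[OF iX iD, symmetric]) (simp add: right_diff_distrib)
    moreover have "0 \<le> Re (LINT p|usphere2. a (fst p) * cnj (a (snd p)) * (X r (fst p) (snd p) ^ ?N - Y r (fst p) (snd p) ^ ?N))"
      using psd ac unfolding psd_kernel_def by blast
    ultimately have "Re (complex_of_real (LINT \<xi>|usphere. (norm (E \<xi>))\<^sup>2))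
      \<le> Re (LINT p|usphere2. a (fst p) * cnj (a (snd p)) * X r (fst p) (snd p) ^ ?N)"
      unfolding E2 by simp
    also have "(LINT p|usphere2. a (fst p) * cnj (a (snd p)) * X r (fst p) (snd p) ^ ?N)
      = of_real (1 / t ^ ?N) * (LINT p|usphere2. a (fst p) * cnj (a (snd p)) * szego (r *\<^sub>R fst p) (r *\<^sub>R snd p))"
      unfolding Xeq integral_mult_right_zero[symmetric] by (simp only: mult_ac)
    also have "(LINT p|usphere2. a (fst p) * cnj (a (snd p)) * szego (r *\<^sub>R fst p) (r *\<^sub>R snd p))
      = (LINT \<zeta>|usphere. a \<zeta> * h ((r * r\<^sup>2) *\<^sub>R \<zeta>))"
    proof -
      have "(LINT p|usphere2. a (fst p) * cnj (a (snd p)) * szego (r *\<^sub>R fst p) (r *\<^sub>R snd p))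
        = (LINT \<zeta>|usphere. LINT \<eta>|usphere. a \<zeta> * cnj (a \<eta>) * szego (r *\<^sub>R \<zeta>) (r *\<^sub>R \<eta>))"
        by (subst usphere2_iterated) (auto intro!: continuous_on_mult K continuous_on_cnj continuous_on_fst_snd ac)
      \<comment> \<open>Moving one r across the form turns the kernel into one at
        \<open>r^2 \<zeta>\<close>; it reproduces the function \<open>h\<close> dilated by r, so
        \<open>h\<close> appears at radius \<open>r^3\<close>.\<close>
      also have "\<dots> = (LINT \<zeta>|usphere. a \<zeta> * h ((r * r\<^sup>2) *\<^sub>R \<zeta>))"
      proof (rule Bochner_Integration.integral_cong[OF refl])
        fix \<zeta> :: "complex ^ 'n" assume "\<zeta> \<in> space usphere"
        then have "norm (r\<^sup>2 *\<^sub>R \<zeta>) < 1" using r by (simp add: power_less_one_iff)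
        from szego_formula[OF h_hol r this]
        have "(LINT \<eta>|usphere. h (r *\<^sub>R \<eta>) * szego (r\<^sup>2 *\<^sub>R \<zeta>) \<eta>) = h ((r * r\<^sup>2) *\<^sub>R \<zeta>)" by simp
        moreover have "szego (r\<^sup>2 *\<^sub>R \<zeta>) \<eta> = szego (r *\<^sub>R \<zeta>) (r *\<^sub>R \<eta>)" for \<eta>
          by (simp add: szego_def scaleR_eq_smult cinner_smult_left cinner_smult_right power2_eq_square mult.assoc)
        ultimately have "h ((r * r\<^sup>2) *\<^sub>R \<zeta>) = (LINT \<eta>|usphere. cnj (a \<eta>) * szego (r *\<^sub>R \<zeta>) (r *\<^sub>R \<eta>))"
          by (simp add: a_def)
        then show "(LINT \<eta>|usphere. a \<zeta> * cnj (a \<eta>) * szego (r *\<^sub>R \<zeta>) (r *\<^sub>R \<eta>)) = a \<zeta> * h ((r * r\<^sup>2) *\<^sub>R \<zeta>)"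
          by (simp only: integral_mult_right_zero[symmetric] mult.assoc)
      qed
      finally show ?thesis .
    qed
    also have "Re (of_real (1 / t ^ ?N) * (LINT \<zeta>|usphere. a \<zeta> * h ((r * r\<^sup>2) *\<^sub>R \<zeta>)))
      \<le> (1 / t ^ ?N) * norm (LINT \<zeta>|usphere. a \<zeta> * h ((r * r\<^sup>2) *\<^sub>R \<zeta>))"
      using t by (simp only: Re_of_real_mult) (intro mult_left_mono complex_Re_le_cmod, simp)
    also have "\<dots> \<le> (1 / t ^ ?N) * \<Phi>"
    proof (rule mult_left_mono[OF power2_le_imp_le])
      have r3: "0 < r * r\<^sup>2" "r * r\<^sup>2 < 1"
        using r by (auto intro!: mult_less_1 simp: power_less_one_iff)
      have "(norm (LINT \<zeta>|usphere. a \<zeta> * h ((r * r\<^sup>2) *\<^sub>R \<zeta>)))\<^sup>2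
        \<le> (LINT \<zeta>|usphere. (norm (a \<zeta>))\<^sup>2) * (LINT \<zeta>|usphere. (norm (h ((r * r\<^sup>2) *\<^sub>R \<zeta>)))\<^sup>2)"
        by (rule usphere_Cauchy_Schwarz[OF ac scaled_sphere_continuous[OF h_hol r3]])
      also have "(LINT \<zeta>|usphere. (norm (a \<zeta>))\<^sup>2) = \<Phi>" by (simp add: a_def \<Phi>_def)
      also have "\<Phi> * (LINT \<zeta>|usphere. (norm (h ((r * r\<^sup>2) *\<^sub>R \<zeta>)))\<^sup>2) \<le> \<Phi> * \<Phi>"
      proof (rule mult_left_mono)
        show "(LINT \<zeta>|usphere. (norm (h ((r * r\<^sup>2) *\<^sub>R \<zeta>)))\<^sup>2) \<le> \<Phi>"
          unfolding \<Phi>_def by (rule sphere_mean_mono[OF h_hol r]) (use r in \<open>auto simp: power_less_one_iff\<close>)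
        show "0 \<le> \<Phi>" unfolding \<Phi>_def by (rule integral_nonneg_AE) simp
      qed
      finally show "(norm (LINT \<zeta>|usphere. a \<zeta> * h ((r * r\<^sup>2) *\<^sub>R \<zeta>)))\<^sup>2 \<le> \<Phi>\<^sup>2" by (simp add: power2_eq_square)
      show "0 \<le> \<Phi>" unfolding \<Phi>_def by (rule integral_nonneg_AE) simp
      show "0 \<le> 1 / t ^ ?N" using t by simp
    qed
    finally show ?thesis unfolding Re_complex_of_real .
  qed
  have F0: "0 \<le> F" unfolding F_def by (rule integral_nonneg_AE) simp
  have "\<Phi>\<^sup>2 \<le> ((1 / t ^ ?N) * \<Phi>) * F"
    by (rule order_trans[OF \<Phi>2 mult_right_mono[OF E\<Phi> F0]])
  then have "\<Phi> * \<Phi> \<le> \<Phi> * ((1 / t ^ ?N) * F)" by (simp add: power2_eq_square mult_ac)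
  moreover have "0 \<le> \<Phi>" unfolding \<Phi>_def by (rule integral_nonneg_AE) simp
  ultimately have "\<Phi> \<le> (1 / t ^ ?N) * F"
  proof (cases "\<Phi> = 0")
    case True
    then show ?thesis using F0 t by simp
  next
    case False
    with \<open>0 \<le> \<Phi>\<close> have "0 < \<Phi>" by simp
    with \<open>\<Phi> * \<Phi> \<le> \<Phi> * ((1 / t ^ ?N) * F)\<close> show ?thesis by (rule mult_left_le_imp_le)
  qed
  then show ?thesis unfolding \<Phi>_def F_def h_def .
qed

text \<open>The weight is removed by the bound \<open>D\<close> for the power of the denominator on
  the closed ball, and the inner dilation s by letting it tend to 1 on a fixed sphere of radius
  r.\<close>

lemma composition_hardy:
  shows "\<exists>K\<ge>0. \<forall>f\<in>hardy_space. (\<lambda>z. if z \<in> ball 0 1 then f (\<phi> z) else 0) \<in> hardy_space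
    \<and> hardy_norm (\<lambda>z. if z \<in> ball 0 1 then f (\<phi> z) else 0) \<le> K * hardy_norm f"
proof -
  let ?N = "CARD('n)"
  have "continuous_on (cball 0 1) (\<lambda>z. \<delta> z ^ ?N)" by (intro continuous_intros)
  from compact_imp_bounded[OF compact_continuous_image[OF this compact_cball]]
  obtain D0 where D0: "\<forall>x\<in>(\<lambda>z. \<delta> z ^ ?N) ` cball 0 1. norm x \<le> D0" unfolding bounded_iff by blast
  define D where "D = max D0 0"
  have D: "0 \<le> D" "\<And>z. norm z \<le> 1 \<Longrightarrow> norm (\<delta> z ^ ?N) \<le> D" using D0 by (force simp: D_def le_max_iff_disj)+
  define K where "K = D * sqrt (1 / t ^ ?N)"
  have K0: "0 \<le> K" using D t by (simp add: K_def)
  have K2: "K\<^sup>2 = D\<^sup>2 * (1 / t ^ ?N)" using t by (simp add: K_def power_mult_distrib real_sqrt_divide power_divide)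
  show ?thesis
  proof (intro exI[of _ K] conjI ballI K0)
    fix f :: "complex ^ 'n \<Rightarrow> complex" assume f: "f \<in> hardy_space"
    let ?g = "\<lambda>z. if z \<in> ball 0 1 then f (\<phi> z) else 0"
    have fh: "mv_holomorphic_on f (ball 0 1)" using hardy_spaceD(1)[OF f] .
    have g0: "mv_holomorphic_on (\<lambda>z. f (\<phi> z)) (ball 0 1)"
      by (rule mv_holomorphic_on_compose[OF fh mv_holomorphic_phi]) (use image_ball in auto)
    have g: "mv_holomorphic_on ?g (ball 0 1)"
      using g0 by (subst mv_holomorphic_on_cong[OF open_ball, of _ _ _ "\<lambda>z. f (\<phi> z)"]) auto
    have mean: "hardy_mean ?g r \<le> (K * hardy_norm f)\<^sup>2" if r: "0 < r" "r < 1" for r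
    proof -
      let ?S = "sphere (0 :: complex ^ 'n) 1"
      have rS: "norm (r *\<^sub>R x) < 1" "norm (r *\<^sub>R x) \<le> 1" if "x \<in> ?S" for x using that r by auto
      have rc: "continuous_on ?S (\<lambda>x. r *\<^sub>R x)"
        by (rule bounded_linear.continuous_on[OF bounded_linear_scaleR_right continuous_on_id])
      note phc = continuous_on_phi[OF rc rS(2)]
      have sc: "continuous_on ?S (\<lambda>x. f (s *\<^sub>R \<phi> (r *\<^sub>R x)))" if "0 \<le> s" "s \<le> 1" for s
        by (intro continuous_on_scaled[OF fh] continuous_on_scaleR continuous_on_const phc
            norm_scaleR_less_1 image_ball[OF rS(1)] that) auto
      have step: "(LINT \<zeta>|usphere. (norm (f (s *\<^sub>R \<phi> (r *\<^sub>R \<zeta>))))\<^sup>2) \<le> (K * hardy_norm f)\<^sup>2"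
        if s: "0 < s" "s < 1" for s
      proof -
        have dc: "continuous_on ?S (\<lambda>\<zeta>. f (s *\<^sub>R \<phi> (r *\<^sub>R \<zeta>)) / \<delta> (r *\<^sub>R \<zeta>) ^ ?N)"
          using s denominator[OF rS(2)]
          by (intro continuous_on_divide sc continuous_on_power continuous_on_delta rc) auto
        have "(LINT \<zeta>|usphere. (norm (f (s *\<^sub>R \<phi> (r *\<^sub>R \<zeta>))))\<^sup>2)
          \<le> (LINT \<zeta>|usphere. D\<^sup>2 * (norm (f (s *\<^sub>R \<phi> (r *\<^sub>R \<zeta>)) / \<delta> (r *\<^sub>R \<zeta>) ^ ?N))\<^sup>2)"
        proof (rule integral_mono)
          show "integrable usphere (\<lambda>\<zeta>. (norm (f (s *\<^sub>R \<phi> (r *\<^sub>R \<zeta>))))\<^sup>2)"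
            using s by (intro usphere_integrable continuous_on_power continuous_on_norm sc) auto
          show "integrable usphere (\<lambda>\<zeta>. D\<^sup>2 * (norm (f (s *\<^sub>R \<phi> (r *\<^sub>R \<zeta>)) / \<delta> (r *\<^sub>R \<zeta>) ^ ?N))\<^sup>2)"
            by (intro usphere_integrable continuous_on_mult continuous_on_const continuous_on_power continuous_on_norm dc)
          fix \<zeta> :: "complex ^ 'n" assume "\<zeta> \<in> space usphere"
          then have \<zeta>: "norm (r *\<^sub>R \<zeta>) \<le> 1" using rS by simp
          let ?u = "f (s *\<^sub>R \<phi> (r *\<^sub>R \<zeta>))" and ?d = "\<delta> (r *\<^sub>R \<zeta>) ^ ?N"
          have "?d \<noteq> 0" using denominator[OF \<zeta>] by simp
          then have "norm ?u = norm ?d * norm (?u / ?d)" by (simp add: norm_divide)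
          also have "\<dots> \<le> D * norm (?u / ?d)" using D(2)[OF \<zeta>] by (intro mult_right_mono) auto
          finally have "(norm ?u)\<^sup>2 \<le> (D * norm (?u / ?d))\<^sup>2" by (intro power_mono) auto
          then show "(norm ?u)\<^sup>2 \<le> D\<^sup>2 * (norm (?u / ?d))\<^sup>2" by (simp only: power_mult_distrib)
        qed
        also have "\<dots> = D\<^sup>2 * (LINT \<zeta>|usphere. (norm (f (s *\<^sub>R \<phi> (r *\<^sub>R \<zeta>)) / \<delta> (r *\<^sub>R \<zeta>) ^ ?N))\<^sup>2)"
          by (rule integral_mult_right_zero)
        also have "\<dots> \<le> D\<^sup>2 * ((1 / t ^ ?N) * (hardy_norm f)\<^sup>2)"
        proof (rule mult_left_mono)
          have "(LINT \<zeta>|usphere. (norm (f (s *\<^sub>R \<zeta>)))\<^sup>2) \<le> (hardy_norm f)\<^sup>2"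
            using hardy_mean_le_norm[OF f s] hardy_mean_usphere[OF hardy_spaceD[OF f] s(1)] by simp
          then have "(1 / t ^ ?N) * (LINT \<zeta>|usphere. (norm (f (s *\<^sub>R \<zeta>)))\<^sup>2) \<le> (1 / t ^ ?N) * (hardy_norm f)\<^sup>2"
            using t by (intro mult_left_mono) auto
          then show "(LINT \<zeta>|usphere. (norm (f (s *\<^sub>R \<phi> (r *\<^sub>R \<zeta>)) / \<delta> (r *\<^sub>R \<zeta>) ^ ?N))\<^sup>2)
            \<le> (1 / t ^ ?N) * (hardy_norm f)\<^sup>2"
            using weighted_mean_bound[OF fh r s] by linarith
        qed simp
        also have "\<dots> = (K * hardy_norm f)\<^sup>2" by (simp only: power_mult_distrib K2 mult.assoc)
        finally show ?thesis .
      qed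
      \<comment> \<open>Any sequence in the open unit interval tending to 1; the image of the sphere
        of radius r is compact in the open ball, so the means depend continuously on the dilation up
        to 1.\<close>
      define s where "s n = 1 - 1 / real (n + 2)" for n
      have s: "0 < s n" "s n < 1" for n by (auto simp: s_def field_simps)
      have s_lim: "s \<longlonglongrightarrow> 1" unfolding s_def by real_asymp
      define F where "F = (\<lambda>\<sigma> x. f (\<sigma> *\<^sub>R \<phi> (r *\<^sub>R x)))"
      have Fc: "continuous_on ({0..1::real} \<times> ?S) (\<lambda>(\<sigma>, x). (norm (F \<sigma> x))\<^sup>2)"
      proof -
        have "continuous_on ({0..1::real} \<times> ?S) (\<lambda>p. \<phi> (r *\<^sub>R snd p))"
          by (rule continuous_on_compose2[OF phc continuous_on_snd[OF continuous_on_id]]) auto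
        then have "continuous_on ({0..1::real} \<times> ?S) (\<lambda>p. f (fst p *\<^sub>R \<phi> (r *\<^sub>R snd p)))"
          by (intro continuous_on_scaled[OF fh] continuous_on_scaleR continuous_on_fst continuous_on_id
              norm_scaleR_less_1 image_ball[OF rS(1)]) auto
        then show ?thesis unfolding F_def case_prod_beta by (intro continuous_on_power continuous_on_norm)
      qed
      have "continuous_on {0..1} (\<lambda>\<sigma>. LINT x|usphere. (norm (F \<sigma> x))\<^sup>2)"
        by (rule continuous_on_LINT[OF finite_measure_usphere sets_usphere compact_sphere _ Fc]) simp
      then have "(\<lambda>n. LINT x|usphere. (norm (F (s n) x))\<^sup>2) \<longlonglongrightarrow> (LINT x|usphere. (norm (F 1 x))\<^sup>2)"
        unfolding continuous_on_sequentially o_def using s s_lim by (auto simp: less_imp_le)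
      then have "(LINT x|usphere. (norm (F 1 x))\<^sup>2) \<le> (K * hardy_norm f)\<^sup>2"
        by (rule LIMSEQ_le_const2) (use step s in \<open>auto simp: F_def\<close>)
      moreover have "hardy_mean ?g r = (LINT x|usphere. (norm (F 1 x))\<^sup>2)"
      proof -
        have "hardy_mean ?g r = (LINT x|usphere. (norm (?g (r *\<^sub>R x)))\<^sup>2)"
          by (rule hardy_mean_usphere[OF g _ r(1)]) auto
        also have "\<dots> = (LINT x|usphere. (norm (F 1 x))\<^sup>2)"
          by (intro Bochner_Integration.integral_cong refl) (use r in \<open>auto simp: F_def\<close>)
        finally show ?thesis .
      qed
      ultimately show ?thesis by simp
    qed
    show "?g \<in> hardy_space" "hardy_norm ?g \<le> K * hardy_norm f"
      using hardy_spaceI[OF g _ mean] K0 hardy_norm_nonneg[OF f] by auto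
  qed
qed

end

text \<open>An S-lemma for two Hermitian forms in homogeneous coordinates. Self-mapping says that
  \<open>F1\<close> is nonnegative where \<open>F0\<close> is; the multiplier is the infimum of
  \<open>F1\<close> over \<open>F0 = 1\<close>, and \<open>balanced\<close> carries the inequality
  over to the region where \<open>F0\<close> is negative.\<close>

lemma ex_lfm_form:
  fixes \<phi> :: "complex ^ 'n \<Rightarrow> complex ^ 'n"
  assumes "\<phi> \<in> LFM"
  shows "\<exists>A B C d t. lfm_form A B C d t \<and> (\<forall>z\<in>cball 0 1. \<phi> z = linear_fractional A B C d z)"
proof -
  obtain A B C d where rep: "\<And>z. z \<in> ball 0 1 \<Longrightarrow> cinner z C + d \<noteq> 0"
      "\<And>z. z \<in> ball 0 1 \<Longrightarrow> \<phi> z = linear_fractional A B C d z"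
    and self: "\<And>z. z \<in> ball 0 1 \<Longrightarrow> \<phi> z \<in> ball 0 1" and cont: "continuous_on (cball 0 1) \<phi>"
    using assms unfolding LFM_def by blast
  have extend: "\<forall>z\<in>cball 0 1. \<phi> z = linear_fractional A' B' C' d' z"
    if den: "\<And>z. norm z \<le> 1 \<Longrightarrow> cinner z C' + d' \<noteq> 0"
      and eq: "\<And>z. z \<in> ball 0 1 \<Longrightarrow> \<phi> z = linear_fractional A' B' C' d' z" for A' B' C' d'
  proof
    fix z :: "complex ^ 'n" assume z: "z \<in> cball 0 1"
    have cl: "closure (ball 0 1) = cball (0 :: complex ^ 'n) 1" by simp
    have "continuous_on (cball 0 1) (\<lambda>z. \<phi> z - linear_fractional A' B' C' d' z)"
      unfolding linear_fractional_def using den by (intro continuous_intros cont) auto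
    then have "\<phi> z - linear_fractional A' B' C' d' z = 0"
      using continuous_constant_on_closure[of "ball 0 1" "\<lambda>z. \<phi> z - linear_fractional A' B' C' d' z" 0 z] eq z
      unfolding cl by auto
    then show "\<phi> z = linear_fractional A' B' C' d' z" by simp
  qed
  have d: "d \<noteq> 0" using rep(1)[of 0] by simp
  show ?thesis
  proof (cases "\<exists>c. \<forall>z\<in>ball 0 1. \<phi> z = c")
    \<comment> \<open>A constant map may be given with numerator and denominator vanishing together
      on the sphere, so it is rewritten with denominator 1; its multiplier is then explicit.\<close>
    case True
    then obtain c where c: "\<And>z. z \<in> ball 0 1 \<Longrightarrow> \<phi> z = c" by blast
    then have c1: "norm c < 1" using self[of 0] by simp
    have form: "(1 - (norm c)\<^sup>2) * ((norm w)\<^sup>2 - (norm z)\<^sup>2)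
        \<le> (norm (cinner z 0 + 1 * w))\<^sup>2 - (norm (0 *v z + w *s c))\<^sup>2" for z :: "complex ^ 'n" and w :: complex
    proof -
      have "(norm c)\<^sup>2 \<le> 1" using c1 by (simp add: abs_square_le_1)
      then have "0 \<le> (1 - (norm c)\<^sup>2) * (norm z)\<^sup>2" by simp
      then show ?thesis by (simp add: norm_vec_smult power_mult_distrib algebra_simps)
    qed
    have "lfm_form 0 c 0 1 (1 - (norm c)\<^sup>2)"
      by (unfold_locales) (use c1 form in \<open>auto simp: power_less_one_iff abs_square_less_1\<close>)
    moreover have "\<forall>z\<in>cball 0 1. \<phi> z = linear_fractional 0 c 0 1 z"
      by (rule extend) (auto simp: c linear_fractional_def)
    ultimately show ?thesis by blast
  next
    case False
    define F0 where "F0 z w = (norm w)\<^sup>2 - (norm z)\<^sup>2" for z :: "complex ^ 'n" and w :: complex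
    define F1 where "F1 z w = (norm (cinner z C + d * w))\<^sup>2 - (norm (A *v z + w *s B))\<^sup>2" for z w
    have hom: "F0 (c *s z) (c * w) = (norm c)\<^sup>2 * F0 z w" "F1 (c *s z) (c * w) = (norm c)\<^sup>2 * F1 z w" for c z w
    proof -
      show "F0 (c *s z) (c * w) = (norm c)\<^sup>2 * F0 z w"
        by (simp add: F0_def norm_vec_smult norm_mult power_mult_distrib right_diff_distrib)
      have "cinner (c *s z) C + d * (c * w) = c * (cinner z C + d * w)"
        "A *v (c *s z) + (c * w) *s B = c *s (A *v z + w *s B)"
        by (simp_all add: cinner_smult_left algebra_simps vector_scalar_commute vector_add_ldistrib vector_smult_assoc)
      then show "F1 (c *s z) (c * w) = (norm c)\<^sup>2 * F1 z w"
        by (simp only: F1_def norm_vec_smult norm_mult power_mult_distrib right_diff_distrib)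
    qed
    have pos1: "F1 z 1 > 0" if "norm z < 1" for z
    proof -
      have "norm (\<phi> z) < 1" using self that by simp
      then have "norm (A *v z + B) < norm (cinner z C + d)"
        using rep(1)[of z] that unfolding rep(2)[of z, simplified, OF that] linear_fractional_def norm_vec_smult
        by (simp add: norm_divide divide_simps split: if_splits)
      then have "(norm (A *v z + B))\<^sup>2 < (norm (cinner z C + d))\<^sup>2"
        by (intro power_strict_mono) auto
      then show ?thesis by (simp add: F1_def)
    qed
    have pos: "F1 z w > 0" if "F0 z w > 0" for z w
    proof -
      have "norm z < norm w" using that by (simp add: F0_def power_less_imp_less_base)
      then have w: "w \<noteq> 0" by auto
      have "norm ((1 / w) *s z) < 1" using \<open>norm z < norm w\<close> w by (simp add: norm_vec_smult norm_divide)
      from pos1[OF this] hom(2)[of w "(1 / w) *s z" 1] w show ?thesis by (simp add: vector_smult_assoc)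
    qed
    have nonneg: "F1 z w \<ge> 0" if "F0 z w \<ge> 0" for z w
    proof (cases "w = 0")
      case True
      then have "z = 0" using that by (simp add: F0_def)
      then show ?thesis using True by (simp add: F1_def)
    next
      case False
      \<comment> \<open>Enlarging w slightly makes \<open>F0\<close> strictly positive; the
        inequality passes to the limit.\<close>
      have "(\<lambda>n. F1 z (of_real (1 + 1 / real (Suc n)) * w)) \<longlonglongrightarrow> F1 z (of_real (1 + 0) * w)"
      proof -
        have l: "(\<lambda>n. complex_of_real (1 + 1 / real (Suc n)) * w) \<longlonglongrightarrow> of_real (1 + 0) * w"
          by (intro tendsto_intros LIMSEQ_Suc[OF lim_inverse_n'])
        have "continuous_on UNIV (\<lambda>w. F1 z w)" unfolding F1_def by (intro continuous_intros)
        then have "isCont (F1 z) (of_real (1 + 0) * w)" by (simp add: continuous_on_eq_continuous_at)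
        from isCont_tendsto_compose[OF this l] show ?thesis .
      qed
      moreover have "0 \<le> F1 z (of_real (1 + 1 / real (Suc n)) * w)" for n
      proof -
        have "F0 z (of_real (1 + 1 / real (Suc n)) * w) > 0"
        proof -
          have "1 < (1 + 1 / real (Suc n))\<^sup>2" by (simp add: one_less_power)
          then have "(norm w)\<^sup>2 < (1 + 1 / real (Suc n))\<^sup>2 * (norm w)\<^sup>2" using False by simp
          moreover have "(norm (of_real (1 + 1 / real (Suc n)) * w))\<^sup>2 = (1 + 1 / real (Suc n))\<^sup>2 * (norm w)\<^sup>2"
            unfolding norm_mult norm_of_real power_mult_distrib power2_abs ..
          ultimately show ?thesis using that unfolding F0_def by linarith
        qed
        then show ?thesis using pos less_imp_le by blast
      qed
      ultimately have "0 \<le> F1 z (of_real (1 + 0) * w)" by (intro LIMSEQ_le_const) auto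
      then show ?thesis by simp
    qed
    \<comment> \<open>The phase \<alpha> makes the cross term of \<open>F0\<close> purely imaginary,
      so both combinations of the two vectors with \<alpha> and with -\<alpha> lie on the null cone
      of \<open>F0\<close>. There \<open>F1\<close> is nonnegative, and by the parallelogram law the
      two values add up to twice the sum in question.\<close>
    have balanced: "F1 z w + F1 z' w' \<ge> 0" if "F0 z w + F0 z' w' = 0" for z w z' w'
    proof -
      define H where "H = w * cnj w' - cinner z z'"
      define \<alpha> where "\<alpha> = (if H = 0 then 1 else \<i> * sgn H)"
      have \<alpha>: "norm \<alpha> = 1" by (simp add: \<alpha>_def norm_mult norm_sgn)
      have ReH: "Re (cnj \<alpha> * H) = 0"
      proof -
        have "cnj (sgn H) * H = of_real (norm H)"
          by (simp add: sgn_div_norm scaleR_conv_of_real complex_norm_square[symmetric] mult.commute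
             power2_eq_square field_simps)
        then show ?thesis by (simp add: \<alpha>_def mult.assoc)
      qed
      have F0_add: "F0 (z + \<beta> *s z') (w + \<beta> * w') = 0" if "\<beta> = \<alpha> \<or> \<beta> = - \<alpha>" for \<beta>
      proof -
        have \<beta>: "norm \<beta> = 1" "Re (cnj \<beta> * H) = 0" using that \<alpha> ReH by auto
        have 1: "(norm (w + \<beta> * w'))\<^sup>2 = (norm w)\<^sup>2 + 2 * Re (cnj \<beta> * (w * cnj w')) + (norm w')\<^sup>2"
        proof -
          have "(norm (w + \<beta> * w'))\<^sup>2 = (norm w)\<^sup>2 + 2 * Re (cnj (\<beta> * w') * w) + (norm (\<beta> * w'))\<^sup>2"
            unfolding cmod_power2 by (simp add: power2_eq_square algebra_simps)
          moreover have "cnj (\<beta> * w') * w = cnj \<beta> * (w * cnj w')" by simp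
          ultimately show ?thesis using \<beta>(1) by (simp only: norm_mult mult_1)
        qed
        have 2: "(norm (z + \<beta> *s z'))\<^sup>2 = (norm z)\<^sup>2 + 2 * Re (cnj \<beta> * cinner z z') + (norm z')\<^sup>2"
          unfolding norm_add_sq cinner_smult_right norm_vec_smult \<beta>(1) by simp
        have "Re (cnj \<beta> * (w * cnj w')) - Re (cnj \<beta> * cinner z z') = 0"
          using \<beta>(2) unfolding H_def right_diff_distrib minus_complex.sel .
        then show ?thesis using \<open>F0 z w + F0 z' w' = 0\<close> unfolding F0_def 1 2 by linarith
      qed
      have par: "(norm (x + y))\<^sup>2 + (norm (x - y))\<^sup>2 = 2 * (norm x)\<^sup>2 + 2 * (norm y)\<^sup>2" for x y :: "'b::real_inner"
        by (simp add: power2_norm_eq_inner inner_add inner_diff inner_commute)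
      have sum: "F1 (z + \<alpha> *s z') (w + \<alpha> * w') + F1 (z + (- \<alpha>) *s z') (w + (- \<alpha>) * w') = 2 * (F1 z w + F1 z' w')"
      proof -
        let ?x = "cinner z C + d * w" and ?y = "\<alpha> * (cinner z' C + d * w')"
        let ?X = "A *v z + w *s B" and ?Y = "\<alpha> *s (A *v z' + w' *s B)"
        have e1: "cinner (z + \<alpha> *s z') C + d * (w + \<alpha> * w') = ?x + ?y"
          "cinner (z + (- \<alpha>) *s z') C + d * (w + (- \<alpha>) * w') = ?x - ?y"
          unfolding cinner_add_left cinner_smult_left by (simp_all add: algebra_simps)
        have e2: "A *v (z + \<alpha> *s z') + (w + \<alpha> * w') *s B = ?X + ?Y"
          "A *v (z + (- \<alpha>) *s z') + (w + (- \<alpha>) * w') *s B = ?X - ?Y"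
          unfolding matrix_vector_right_distrib vector_scalar_commute
          by (simp_all add: vector_add_ldistrib vector_sadd_rdistrib vector_smult_assoc algebra_simps)
        have "F1 (z + \<alpha> *s z') (w + \<alpha> * w') + F1 (z + (- \<alpha>) *s z') (w + (- \<alpha>) * w')
          = ((norm (?x + ?y))\<^sup>2 + (norm (?x - ?y))\<^sup>2) - ((norm (?X + ?Y))\<^sup>2 + (norm (?X - ?Y))\<^sup>2)"
          unfolding F1_def e1 e2 by linarith
        also have "\<dots> = 2 * (F1 z w + F1 z' w')"
          unfolding par norm_vec_smult norm_mult \<alpha> F1_def by simp
        finally show ?thesis .
      qed
      have "0 \<le> F1 (z + \<alpha> *s z') (w + \<alpha> * w')" "0 \<le> F1 (z + (- \<alpha>) *s z') (w + (- \<alpha>) * w')"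
        by (rule nonneg, subst F0_add; simp)+
      then have "0 \<le> 2 * (F1 z w + F1 z' w')" unfolding sum[symmetric] by (rule add_nonneg_nonneg)
      then show ?thesis by simp
    qed
    define T where "T = {F1 z w | z w. F0 z w = 1}"
    define t where "t = Inf T"
    have "F0 0 1 = 1" unfolding F0_def by simp
    then have "F1 0 1 \<in> T" unfolding T_def by blast
    then have "T \<noteq> {}" by blast
    moreover have "bdd_below T"
      by (rule bdd_belowI[of _ 0]) (auto simp: T_def intro!: nonneg)
    ultimately have T: "T \<noteq> {}" "bdd_below T" by blast+
    have tT: "t \<le> F1 z w" if "F0 z w = 1" for z w
      unfolding t_def by (rule cInf_lower) (use T that in \<open>auto simp: T_def\<close>)
    have t0: "0 \<le> t"
      unfolding t_def by (rule cInf_greatest[OF T(1)]) (auto simp: T_def intro!: nonneg)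
    have normalize: "F0 (of_real (1 / sqrt q) *s z) (of_real (1 / sqrt q) * w) = F0 z w / q"
        "F1 (of_real (1 / sqrt q) *s z) (of_real (1 / sqrt q) * w) = F1 z w / q" if "q > 0" for q z w
      unfolding hom using that by (simp_all add: norm_divide power_divide)
    have form: "t * F0 z w \<le> F1 z w" for z w
    proof (cases "F0 z w" "0 :: real" rule: linorder_cases)
      case greater
      then have "t \<le> F1 z w / F0 z w"
        using tT[of "of_real (1 / sqrt (F0 z w)) *s z" "of_real (1 / sqrt (F0 z w)) * w"] normalize[OF greater, of z w]
        by simp
      then show ?thesis using greater by (simp add: field_simps)
    next
      case equal
      then show ?thesis using nonneg[of z w] by simp
    next
      case less
      define q where "q = - F0 z w"
      have q: "q > 0" using less by (simp add: q_def)
      have "- (F1 z w / q) \<le> t"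
        unfolding t_def
      proof (rule cInf_greatest[OF T(1)])
        fix x assume "x \<in> T"
        then obtain z' w' where x: "x = F1 z' w'" "F0 z' w' = 1" by (auto simp: T_def)
        have "F0 z' w' + F0 (of_real (1 / sqrt q) *s z) (of_real (1 / sqrt q) * w) = 0"
          unfolding normalize[OF q] x(2) using q by (simp add: q_def field_simps)
        from balanced[OF this] show "- (F1 z w / q) \<le> x" unfolding normalize[OF q] x(1) by simp
      qed
      then show ?thesis using q by (simp add: q_def field_simps)
    qed
    \<comment> \<open>Otherwise \<open>F1\<close> is nonnegative everywhere. At the w that makes the
      denominator vanish this forces the numerator to vanish, and the map is constant.\<close>
    have "t \<noteq> 0"
    proof
      assume "t = 0"
      then have nn: "0 \<le> F1 z w" for z w using form[of z w] by simp
      have const: "\<phi> z = (1 / d) *s B" if "z \<in> ball 0 1" for z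
      proof -
        let ?w = "- (cinner z C / d)"
        have "0 \<le> F1 z ?w" by (rule nn)
        then have "A *v z + ?w *s B = 0" using d by (simp add: F1_def)
        then have "A *v z = (cinner z C / d) *s B" by simp
        then have "A *v z + B = ((cinner z C + d) / d) *s B"
          using d by (simp add: vector_sadd_rdistrib add_divide_distrib)
        then show ?thesis
          using rep[OF that] by (simp add: linear_fractional_def vector_smult_assoc)
      qed
      then show False using False by blast
    qed
    then have t: "t > 0" using t0 by simp
    \<comment> \<open>At a zero of the denominator on the sphere the numerator vanishes too. Then
      \<open>F1\<close> does not change along the ray from \<open>(0, 1)\<close> in direction
      \<open>(z, 1)\<close>, whereas \<open>F0\<close> grows linearly there.\<close>
    have den: "cinner z C + d \<noteq> 0" if z: "norm z \<le> 1" for z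
    proof
      assume 0: "cinner z C + d = 0"
      then have "norm z = 1" using rep(1)[of z] z by (metis le_less mem_ball_0)
      then have "F0 z 1 = 0" by (simp add: F0_def)
      then have "0 \<le> F1 z 1" by (intro nonneg) simp
      then have AB: "A *v z + B = 0" using 0 by (simp add: F1_def)
      \<comment> \<open>Large enough that \<open>t * (1 + 2 * c)\<close> exceeds
        \<open>F1 0 1\<close>.\<close>
      define c where "c = \<bar>F1 0 1\<bar> / t + 1"
      have c: "c > 0" using t by (simp add: c_def add_nonneg_pos)
      have "F1 (of_real c *s z) (1 + of_real c) = F1 0 1"
      proof -
        have e1: "cinner (of_real c *s z) C + d * (1 + of_real c) = of_real c * (cinner z C + d) + d"
          by (simp add: cinner_smult_left algebra_simps)
        have e2: "A *v (of_real c *s z) + (1 + of_real c) *s B = of_real c *s (A *v z + B) + B"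
          by (simp add: vector_scalar_commute vector_add_ldistrib vector_sadd_rdistrib)
        show ?thesis unfolding F1_def e1 e2 0 AB by simp
      qed
      moreover have "F0 (of_real c *s z) (1 + of_real c) = 1 + 2 * c"
      proof -
        have "norm (1 + complex_of_real c) = 1 + c"
          using c by (metis abs_of_pos add_pos_pos norm_of_real of_real_1 of_real_add zero_less_one)
        then show ?thesis using \<open>norm z = 1\<close> by (simp add: F0_def norm_vec_smult power2_eq_square algebra_simps)
      qed
      ultimately have "t * (1 + 2 * c) \<le> F1 0 1" using form[of "of_real c *s z" "1 + of_real c"] by simp
      moreover have "t * c = \<bar>F1 0 1\<bar> + t" using t by (simp add: c_def field_simps)
      ultimately show False using t by (simp add: algebra_simps)
    qed
    have "lfm_form A B C d t"
      by unfold_locales (use t form den in \<open>auto simp: F0_def F1_def\<close>)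
    then show ?thesis using extend[OF den rep(2)] by blast
  qed
qed

section \<open>Linearization at an attracting fixed point\<close>

lemma bounded_bilinear_smult: "bounded_bilinear (\<lambda>c v. c *s (v :: complex ^ 'n))"
proof
  show "\<exists>K. \<forall>a b. norm (a *s (b :: complex ^ 'n)) \<le> norm a * norm b * K"
    by (rule exI[of _ 1]) (simp add: norm_vec_smult)
qed (simp_all add: vector_sadd_rdistrib vector_add_ldistrib scaleR_eq_smult vector_smult_assoc
      scaleR_conv_of_real mult.commute)

context lfm_form
begin

section \<open>The normal form at a fixed point\<close>

abbreviation "b_of p u \<equiv> cinner u C / \<delta> p"

text \<open>The quotient rule with the value of the map at p replaced by p; it is the Jacobian
  matrix only at a fixed point.\<close>

definition jac :: "complex ^ 'n \<Rightarrow> complex ^ 'n ^ 'n" where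
  "jac p = (\<chi> i j. (A $ i $ j - p $ i * cnj (C $ j)) / \<delta> p)"

lemma jac_mult: "jac p *v u = (1 / \<delta> p) *s (A *v u - cinner u C *s p)"
  by (simp add: vec_eq_iff jac_def matrix_vector_mult_def cinner_def sum_distrib_left sum_distrib_right
      sum_subtractf diff_divide_distrib left_diff_distrib sum_divide_distrib right_diff_distrib mult_ac)

text \<open>Recentring at a fixed point removes the constant term of the numerator; in homogeneous
  coordinates the map becomes block triangular.\<close>

lemma normal_form:
  assumes p: "norm p \<le> 1" "\<phi> p = p" and nz: "\<delta> (p + u) \<noteq> 0"
  shows "1 + b_of p u \<noteq> 0" "\<phi> (p + u) = p + (1 / (1 + b_of p u)) *s (jac p *v u)"
proof -
  have dp: "\<delta> p \<noteq> 0" using denominator p(1) by blast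
  have du: "\<delta> (p + u) = \<delta> p * (1 + b_of p u)"
    using dp by (simp add: cinner_add_left field_simps)
  show 1: "1 + b_of p u \<noteq> 0" using nz du by auto
  have "A *v p + B = \<delta> p *s \<phi> p"
    using dp by (simp only: linear_fractional_def vector_smult_assoc) simp
  then have fixp: "A *v p + B = \<delta> p *s p" by (simp only: p(2))
  have "A *v (p + u) + B = \<delta> (p + u) *s p + (A *v u - cinner u C *s p)"
    using fixp by (simp add: matrix_vector_right_distrib cinner_add_left vector_sadd_rdistrib algebra_simps)
  then have "\<phi> (p + u) = (1 / \<delta> (p + u)) *s (\<delta> (p + u) *s p) + (1 / \<delta> (p + u)) *s (A *v u - cinner u C *s p)"
    by (simp only: linear_fractional_def vector_add_ldistrib)
  also have "(1 / \<delta> (p + u)) *s (\<delta> (p + u) *s p) = p"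
    using nz by (simp only: vector_smult_assoc) simp
  also have "(1 / \<delta> (p + u)) *s (A *v u - cinner u C *s p) = (1 / (1 + b_of p u)) *s (jac p *v u)"
    unfolding du jac_mult vector_smult_assoc by (simp add: mult.commute)
  finally show "\<phi> (p + u) = p + (1 / (1 + b_of p u)) *s (jac p *v u)" .
qed

lemma jac_eq_complex_jacobian:
  assumes p: "norm p < 1" "\<phi> p = p" and f: "\<And>z. z \<in> ball 0 1 \<Longrightarrow> f z = \<phi> z"
  shows "complex_jacobian f p = jac p"
proof -
  let ?h = "\<lambda>z. p + (1 / (1 + b_of p (z - p))) *s (jac p *v (z - p))"
  have lin: "bounded_linear (\<lambda>u. b_of p u)"
    by (rule bounded_linear_compose[OF bounded_linear_divide bounded_linear_cinner_left])
  have d1: "((\<lambda>z. jac p *v (z - p)) has_derivative (\<lambda>h. jac p *v h)) (at p)"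
    by (auto intro!: derivative_eq_intros bounded_linear.has_derivative[OF bounded_linear_matrix_vector_mult])
  have d2: "((\<lambda>z. 1 / (1 + b_of p (z - p))) has_derivative (\<lambda>h. - b_of p h)) (at p)"
  proof -
    have dp: "((\<lambda>z. z - p) has_derivative (\<lambda>h. h)) (at p)"
      by (auto intro!: derivative_eq_intros)
    have "((\<lambda>z. b_of p (z - p)) has_derivative (\<lambda>h. b_of p h)) (at p)"
      by (rule bounded_linear.has_derivative[OF lin dp])
    from has_derivative_add[OF has_derivative_const[of "1::complex"] this]
    have "((\<lambda>z. 1 + b_of p (z - p)) has_derivative (\<lambda>h. 0 + b_of p h)) (at p)" .
    from Deriv.has_derivative_inverse[OF _ this] show ?thesis by (simp add: inverse_eq_divide)
  qed
  have "(?h has_derivative (\<lambda>h. jac p *v h)) (at p)"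
    using has_derivative_add[OF has_derivative_const bounded_bilinear.FDERIV[OF bounded_bilinear_smult d2 d1]]
    by simp
  then have "(f has_derivative (\<lambda>h. jac p *v h)) (at p)"
  proof (rule has_derivative_transform_within_open)
    fix z :: "complex ^ 'n" assume z: "z \<in> ball 0 1"
    then have "\<delta> (p + (z - p)) \<noteq> 0" using denominator[of z] by simp
    from normal_form(2)[OF _ p(2) this] p z f[OF z] show "?h z = f z" by simp
  qed (use p in auto)
  then have "frechet_derivative f (at p) = (\<lambda>h. jac p *v h)"
    by (rule frechet_derivative_at[symmetric])
  then show ?thesis unfolding complex_jacobian_def by simp
qed

text \<open>The Schwarz lemma on an invariant complex line, by explicit iteration: if \<nu> had
  modulus above 1, some point of the disc would leave the ball or be sent to the pole.\<close>

lemma multiplier_le_1: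
  assumes p: "norm p < 1" and v: "v \<noteq> 0"
    and line: "\<And>c. norm (p + c *s v) < 1 \<Longrightarrow> 1 + \<beta> * c \<noteq> 0 \<and> \<phi> (p + c *s v) = p + (\<nu> * c / (1 + \<beta> * c)) *s v"
  shows "norm \<nu> \<le> 1"
proof (rule ccontr)
  assume "\<not> norm \<nu> \<le> 1"
  then have \<nu>: "norm \<nu> > 1" by simp
  then have n1: "\<nu> \<noteq> 1" by auto
  \<comment> \<open>Summing a geometric series, the n-th iterate of c is
    \<open>\<nu>^n c / (1 + g c - g \<nu>^n c)\<close>. The claim \<open>iter\<close> is multiplied
    out, so that it remains informative when this denominator vanishes.\<close>
  define g where "g = \<beta> / (1 - \<nu>)"
  have g: "\<beta> = g * (1 - \<nu>)" using n1 by (simp add: g_def)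
  have iter: "\<exists>f. norm (p + f *s v) < 1 \<and> f * (1 + g * c - g * \<nu> ^ n * c) = \<nu> ^ n * c"
    if c: "norm (p + c *s v) < 1" for n c
  proof (induction n)
    case 0
    then show ?case using c by (intro exI[of _ c]) simp
  next
    case (Suc n)
    then obtain f where f: "norm (p + f *s v) < 1" "f * (1 + g * c - g * \<nu> ^ n * c) = \<nu> ^ n * c" by blast
    let ?f = "\<nu> * f / (1 + \<beta> * f)"
    have nz: "1 + \<beta> * f \<noteq> 0" using line[OF f(1)] by blast
    have "norm (p + ?f *s v) < 1" using line[OF f(1)] image_ball[OF f(1)] by simp
    moreover have "?f * (1 + g * c - g * \<nu> ^ Suc n * c) = \<nu> ^ Suc n * c"
    proof -
      have "(1 + \<beta> * f) * (1 + g * c - g * \<nu> ^ n * c) = (1 + g * c - g * \<nu> ^ n * c) + \<beta> * (f * (1 + g * c - g * \<nu> ^ n * c))"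
        by (simp add: algebra_simps)
      also have "\<dots> = 1 + g * c - g * \<nu> ^ Suc n * c" unfolding f(2) g by (simp add: algebra_simps)
      finally have "?f * (1 + g * c - g * \<nu> ^ Suc n * c) = ?f * ((1 + \<beta> * f) * (1 + g * c - g * \<nu> ^ n * c))"
        by simp
      also have "\<dots> = \<nu> * (f * (1 + g * c - g * \<nu> ^ n * c))" using nz by (simp add: field_simps)
      finally show ?thesis unfolding f(2) by simp
    qed
    ultimately show ?case by blast
  qed
  define e where "e = (1 - norm p) / norm v"
  have e: "e > 0" using p v by (simp add: e_def)
  have small: "norm (p + c *s v) < 1" if "norm c < e" for c
  proof -
    have "norm c * norm v < 1 - norm p" using that v by (simp add: e_def field_simps)
    then show ?thesis using norm_triangle_ineq[of p "c *s v"] by (simp add: norm_vec_smult)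
  qed
  show False
  proof (cases "g = 0")
    case True
    define c where "c = complex_of_real (e / 2)"
    have c: "norm c < e" "c \<noteq> 0" using e by (auto simp: c_def)
    obtain n where n: "2 / (norm v * norm c) < norm \<nu> ^ n" using real_arch_pow[OF \<nu>] by blast
    obtain f where f: "norm (p + f *s v) < 1" "f = \<nu> ^ n * c" using iter[OF small[OF c(1)], of n] True by auto
    have "norm (f *s v) \<le> norm (p + f *s v) + norm p"
      using norm_triangle_ineq4[of "p + f *s v" p] by simp
    then have "norm \<nu> ^ n * (norm v * norm c) < 2"
      using f p by (simp add: norm_vec_smult norm_mult norm_power mult_ac)
    moreover have "0 < norm v * norm c" using v c by simp
    ultimately show False using n by (simp add: field_simps)
  next
    case False
    obtain n where n: "1 / (e * norm g) + 1 < norm \<nu> ^ n" using real_arch_pow[OF \<nu>] by blast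
    have "0 < 1 / (e * norm g)" using e False by simp
    then have big: "1 / (e * norm g) < norm (\<nu> ^ n - 1)"
      using n norm_triangle_ineq2[of "\<nu> ^ n" 1] by (simp add: norm_power)
    with \<open>0 < 1 / (e * norm g)\<close> have ne: "\<nu> ^ n - 1 \<noteq> 0" by auto
    \<comment> \<open>The starting point at which the denominator of the n-th iterate vanishes; for
      large n it is small enough to lie in the ball.\<close>
    define c where "c = 1 / (g * (\<nu> ^ n - 1))"
    have nc: "norm c = 1 / (norm g * norm (\<nu> ^ n - 1))"
      by (simp only: c_def norm_divide norm_mult norm_one)
    have aux: "1 / (e * a) < X \<Longrightarrow> 0 < a \<Longrightarrow> 0 < X \<Longrightarrow> 1 / (a * X) < e" for a X :: real
      using e by (simp add: divide_simps mult_ac)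
    have "norm c < e" unfolding nc by (rule aux[OF big]) (use False ne in auto)
    from iter[OF small[OF this], of n] obtain f where f: "f * (1 + g * c - g * \<nu> ^ n * c) = \<nu> ^ n * c" by blast
    have "g * c * (\<nu> ^ n - 1) = 1" using False ne by (simp add: c_def)
    then have "1 + g * c - g * \<nu> ^ n * c = 0" by (simp add: algebra_simps)
    then have "\<nu> ^ n * c = 0" using f by simp
    then show False using \<nu> ne False by (auto simp: c_def)
  qed
qed

end

section \<open>Attracting fixed points and the linearizing coordinate\<close>

locale lfm_attracting = lfm_form A B C d t
  for A :: "complex ^ 'n ^ 'n" and B C :: "complex ^ 'n" and d :: complex and t :: real +
  fixes p :: "complex ^ 'n"
  assumes p: "norm p < 1" "\<phi> p = p"
    and no_unimodular: "\<And>\<mu>. \<mu> \<in> matrix_eigenvalues (jac p) \<Longrightarrow> norm \<mu> \<noteq> 1"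
    and no_boundary: "\<And>z. norm z = 1 \<Longrightarrow> \<phi> z \<noteq> z"
begin

abbreviation "M \<equiv> jac p"
abbreviation "b \<equiv> b_of p"

lemma form_at: "norm (p + u) \<le> 1 \<Longrightarrow> 1 + b u \<noteq> 0"
    "norm (p + u) \<le> 1 \<Longrightarrow> \<phi> (p + u) = p + (1 / (1 + b u)) *s (M *v u)"
  using normal_form[OF less_imp_le[OF p(1)] p(2) denominator] by blast+

lemma b_smult: "b (c *s u) = c * b u"
  by (simp add: cinner_smult_left)

text \<open>The line through p along an eigenvector is invariant with the eigenvalue as its
  multiplier, and modulus 1 is excluded by assumption.\<close>

lemma eigenvalue_less_1:
  assumes "\<mu> \<in> matrix_eigenvalues M"
  shows "norm \<mu> < 1"
proof -
  obtain v where v: "v \<noteq> 0" "M *v v = \<mu> *s v" using assms unfolding matrix_eigenvalues_def by blast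
  have "norm \<mu> \<le> 1"
  proof (rule multiplier_le_1[OF p(1) v(1)])
    fix c assume c: "norm (p + c *s v) < 1"
    have "(1 / (1 + b (c *s v))) *s (M *v (c *s v)) = (\<mu> * c / (1 + b v * c)) *s v"
      by (simp add: vector_scalar_commute v(2) vector_smult_assoc cinner_smult_left mult_ac)
    then show "1 + b v * c \<noteq> 0 \<and> \<phi> (p + c *s v) = p + (\<mu> * c / (1 + b v * c)) *s v"
      using form_at[of "c *s v"] c by (simp add: cinner_smult_left mult.commute)
  qed
  with no_unimodular[OF assms] show ?thesis by simp
qed

definition "resolvent_at_1 = (SOME N. N ** (mat 1 - M) = mat 1)"

lemma resolvent_at_1: "resolvent_at_1 *v (u - M *v u) = u"
proof -
  have "\<forall>x. (mat 1 - M) *v x = 0 \<longrightarrow> x = 0"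
  proof (intro allI impI)
    fix x assume "(mat 1 - M) *v x = 0"
    then have "M *v x = 1 *s x" by (simp add: matrix_vector_mult_diff_rdistrib)
    then show "x = 0" using eigenvalue_less_1[of 1] unfolding matrix_eigenvalues_def by auto
  qed
  then have "\<exists>N. N ** (mat 1 - M) = mat 1" by (simp add: matrix_left_invertible_ker)
  then have "resolvent_at_1 ** (mat 1 - M) = mat 1" unfolding resolvent_at_1_def by (rule someI_ex)
  then have "resolvent_at_1 *v ((mat 1 - M) *v u) = u" by (simp add: matrix_vector_mul_assoc)
  then show ?thesis by (simp add: matrix_vector_mult_diff_rdistrib)
qed

text \<open>The functional \<open>g\<close> solves \<open>g (u) = b (u) + g (M u)\<close>, which makes \<open>\<sigma>\<close> below linearize the map.\<close>

definition g :: "complex ^ 'n \<Rightarrow> complex" where "g u = b (resolvent_at_1 *v u)"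

lemma g_add: "g (u + v) = g u + g v"
  by (simp add: g_def matrix_vector_right_distrib cinner_add_left add_divide_distrib)

lemma g_smult: "g (c *s u) = c * g u"
  by (simp add: g_def vector_scalar_commute cinner_smult_left)

lemma g_zero: "g 0 = 0"
  by (simp add: g_def)

lemma g_functional: "b u + g (M *v u) = g u"
proof -
  have "g (u - M *v u) = b u" unfolding g_def resolvent_at_1 ..
  moreover have "g (u - M *v u) = g u - g (M *v u)"
    by (simp add: g_def matrix_vector_mult_diff_distrib cinner_diff_left diff_divide_distrib)
  ultimately have "b u = g u - g (M *v u)" by (simp only:)
  then show ?thesis by (simp only: diff_add_cancel)
qed

lemma continuous_on_g: "continuous_on S f \<Longrightarrow> continuous_on S (\<lambda>x. g (f x))"
  unfolding g_def using denominator[of p] p(1) by (intro continuous_intros) auto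

text \<open>On the slice \<open>1 + g u = 0\<close> of the closed ball, which is invariant, Brouwer's theorem would give a
  fixed point \<open>e\<close>; by assumption it would lie inside the ball, where the multiplier of the map along
  the line through \<open>p\<close> and \<open>e\<close> is the inverse of its multiplier at \<open>p\<close>.\<close>

lemma one_plus_g_nonzero:
  assumes "norm (p + u) \<le> 1"
  shows "1 + g u \<noteq> 0"
proof
  assume u: "1 + g u = 0"
  define S where "S = {z \<in> cball 0 1. 1 + g (z - p) = 0}"
  have "closed S"
  proof -
    have "continuous_on (cball 0 1) (\<lambda>z. 1 + g (z - p))"
      by (intro continuous_on_add continuous_on_const continuous_on_g continuous_on_diff continuous_on_id)
    from continuous_closed_preimage_constant[OF this closed_cball] show ?thesis unfolding S_def .
  qed
  moreover have "S \<subseteq> cball 0 1" by (auto simp: S_def)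
  ultimately have "compact S" using compact_eq_bounded_closed bounded_subset bounded_cball by blast
  moreover have "convex S"
    unfolding convex_alt
  proof (intro ballI allI impI)
    fix x y and s :: real assume xy: "x \<in> S" "y \<in> S" and s: "0 \<le> s \<and> s \<le> 1"
    have "(1 - s) *\<^sub>R x + s *\<^sub>R y \<in> cball 0 1"
      using convex_cball[of "0 :: complex ^ 'n" 1] xy s unfolding convex_alt S_def by blast
    moreover have "(1 - s) *\<^sub>R x + s *\<^sub>R y - p = of_real (1 - s) *s (x - p) + of_real s *s (y - p)"
      unfolding scaleR_eq_smult by (simp add: vec_eq_iff algebra_simps)
    then have "1 + g ((1 - s) *\<^sub>R x + s *\<^sub>R y - p) = of_real (1 - s) * (1 + g (x - p)) + of_real s * (1 + g (y - p))"
      by (simp only: g_add g_smult) (simp add: algebra_simps)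
    ultimately show "(1 - s) *\<^sub>R x + s *\<^sub>R y \<in> S" using xy by (simp add: S_def)
  qed
  moreover have "p + u \<in> S" using assms u by (simp add: S_def)
  moreover have "continuous_on S \<phi>"
    by (rule continuous_on_phi[OF continuous_on_id]) (auto simp: S_def)
  moreover have "\<phi> \<in> S \<rightarrow> S"
  proof
    fix z assume z: "z \<in> S"
    define v where "v = z - p"
    have v: "norm (p + v) \<le> 1" "1 + g v = 0" using z by (auto simp: S_def v_def)
    have "\<phi> z - p = (1 / (1 + b v)) *s (M *v v)" using form_at(2)[OF v(1)] by (simp add: v_def)
    then have "1 + g (\<phi> z - p) = (1 + b v + g (M *v v)) / (1 + b v)"
      using form_at(1)[OF v(1)] by (simp only: g_smult) (simp add: field_simps)
    also have "1 + b v + g (M *v v) = 0" using g_functional[of v] v(2) by (simp add: add.assoc)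
    finally show "\<phi> z \<in> S" using image_cball[of z] z by (simp add: S_def)
  qed
  ultimately obtain e where e: "e \<in> S" "\<phi> e = e" using brouwer[of S "linear_fractional A B C d"] by blast
  define v where "v = e - p"
  have v: "norm (p + v) \<le> 1" "1 + g v = 0" using e by (auto simp: S_def v_def)
  have "v \<noteq> 0" using v(2) g_zero by auto
  have e1: "norm e < 1" using e no_boundary[of e] by (auto simp: S_def order_less_le)
  define \<mu> where "\<mu> = 1 + b v"
  have \<mu>: "\<mu> \<noteq> 0" using form_at(1)[OF v(1)] by (simp add: \<mu>_def)
  have pv: "p + v = e" by (simp add: v_def)
  have "p + v = p + (1 / \<mu>) *s (M *v v)" using form_at(2)[OF v(1)] unfolding \<mu>_def pv e(2) .
  then have "v = (1 / \<mu>) *s (M *v v)" by (simp only: add_left_cancel)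
  then have "\<mu> *s v = \<mu> *s ((1 / \<mu>) *s (M *v v))" by simp
  then have Mv: "M *v v = \<mu> *s v" using \<mu> by (simp add: vector_smult_assoc)
  then have "norm \<mu> < 1"
    using \<open>v \<noteq> 0\<close> by (intro eigenvalue_less_1) (auto simp: matrix_eigenvalues_def)
  have "norm (1 / \<mu>) \<le> 1"
  proof (rule multiplier_le_1[OF e1 \<open>v \<noteq> 0\<close>])
    fix c assume c: "norm (e + c *s v) < 1"
    have ev: "e + c *s v = p + (1 + c) *s v" by (simp add: v_def vector_sadd_rdistrib)
    have b1: "1 + b ((1 + c) *s v) = \<mu> * (1 + (1 - 1 / \<mu>) * c)"
    proof -
      have bv: "b v = \<mu> - 1" by (simp add: \<mu>_def)
      show ?thesis unfolding b_smult bv using \<mu> by (simp add: field_simps)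
    qed
    have le: "norm (p + (1 + c) *s v) \<le> 1" using c unfolding ev by simp
    have nz: "1 + (1 - 1 / \<mu>) * c \<noteq> 0" using form_at(1)[OF le] unfolding b1 by auto
    have "\<phi> (e + c *s v) = p + (1 / (\<mu> * (1 + (1 - 1 / \<mu>) * c))) *s (((1 + c) * \<mu>) *s v)"
      unfolding ev form_at(2)[OF le] b1 vector_scalar_commute Mv vector_smult_assoc ..
    also have "\<dots> = p + ((1 + c) / (1 + (1 - 1 / \<mu>) * c)) *s v"
      unfolding vector_smult_assoc using \<mu> by simp
    also have "(1 + c) / (1 + (1 - 1 / \<mu>) * c) = 1 + 1 / \<mu> * c / (1 + (1 - 1 / \<mu>) * c)"
    proof -
      have "1 + c = (1 + (1 - 1 / \<mu>) * c) + 1 / \<mu> * c" by (simp add: algebra_simps)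
      then show ?thesis using nz by (metis add_divide_distrib divide_self)
    qed
    also have "p + (1 + 1 / \<mu> * c / (1 + (1 - 1 / \<mu>) * c)) *s v = e + (1 / \<mu> * c / (1 + (1 - 1 / \<mu>) * c)) *s v"
      unfolding vector_sadd_rdistrib by (simp add: v_def)
    finally show "1 + (1 - 1 / \<mu>) * c \<noteq> 0 \<and>
       \<phi> (e + c *s v) = e + (1 / \<mu> * c / (1 + (1 - 1 / \<mu>) * c)) *s v" using nz by simp
  qed
  then have "1 \<le> norm \<mu>" using \<mu> by (simp add: norm_divide field_simps)
  with \<open>norm \<mu> < 1\<close> show False by simp
qed

text \<open>Up to a translation, the projective change of coordinates that sends the invariant
  hyperplane \<open>1 + g (z - p) = 0\<close> to infinity and so makes the normal form
  linear.\<close>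

definition \<sigma> :: "complex ^ 'n \<Rightarrow> complex ^ 'n" where
  "\<sigma> z = (1 / (1 + g (z - p))) *s (z - p)"

definition \<tau> :: "complex ^ 'n \<Rightarrow> complex ^ 'n" where
  "\<tau> w = p + (1 / (1 - g w)) *s w"

text \<open>The condition \<open>norm (\<tau> w) < 1\<close> with the denominator cleared. The
  strict inequality itself forces \<open>1 - g w\<close> to be nonzero, so openness needs no
  separate treatment of the pole.\<close>

definition \<Omega> :: "(complex ^ 'n) set" where
  "\<Omega> = {w. norm ((1 - g w) *s p + w) < norm (1 - g w)}"

lemma one_plus_g_nonzero': "norm z \<le> 1 \<Longrightarrow> 1 + g (z - p) \<noteq> 0"
  using one_plus_g_nonzero[of "z - p"] by simp

lemma sigma_phi:
  assumes "norm z \<le> 1"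
  shows "\<sigma> (\<phi> z) = M *v \<sigma> z"
proof -
  define u where "u = z - p"
  have u: "norm (p + u) \<le> 1" "z = p + u" using assms by (simp_all add: u_def)
  have nz: "1 + b u \<noteq> 0" "1 + g u \<noteq> 0" using form_at(1)[OF u(1)] one_plus_g_nonzero[OF u(1)] by auto
  have d: "\<phi> z - p = (1 / (1 + b u)) *s (M *v u)" using form_at(2)[OF u(1)] u(2) by simp
  have "1 + g (\<phi> z - p) = (1 + b u + g (M *v u)) / (1 + b u)"
    unfolding d g_smult using nz(1) by (simp add: field_simps)
  then have "1 + g (\<phi> z - p) = (1 + g u) / (1 + b u)"
    using g_functional[of u] by (simp add: add.assoc)
  then have "\<sigma> (\<phi> z) = (1 / (1 + g u)) *s (M *v u)"
    unfolding \<sigma>_def d vector_smult_assoc using nz by simp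
  then show ?thesis by (simp only: \<sigma>_def u_def[symmetric] vector_scalar_commute)
qed

lemma one_minus_g_sigma:
  assumes "norm z \<le> 1"
  shows "1 - g (\<sigma> z) = 1 / (1 + g (z - p))"
  unfolding \<sigma>_def g_smult using one_plus_g_nonzero'[OF assms] by (simp add: field_simps)

lemma tau_sigma:
  assumes "norm z \<le> 1"
  shows "\<tau> (\<sigma> z) = z"
  unfolding \<tau>_def one_minus_g_sigma[OF assms] unfolding \<sigma>_def vector_smult_assoc
  using one_plus_g_nonzero'[OF assms] by simp

lemma sigma_mem:
  assumes "norm z < 1"
  shows "\<sigma> z \<in> \<Omega>"
proof -
  have z: "norm z \<le> 1" using assms by simp
  note nz = one_plus_g_nonzero'[OF z]
  have "(1 / (1 + g (z - p))) *s p + \<sigma> z = (1 / (1 + g (z - p))) *s z"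
    unfolding \<sigma>_def by (simp add: vec.scale_right_diff_distrib)
  then show ?thesis
    unfolding \<Omega>_def one_minus_g_sigma[OF z] mem_Collect_eq
    using nz assms by (simp add: norm_vec_smult norm_divide divide_strict_right_mono)
qed

lemma Omega_mem:
  assumes "w \<in> \<Omega>"
  shows "1 - g w \<noteq> 0" "norm (\<tau> w) < 1" "\<sigma> (\<tau> w) = w"
proof -
  have w: "norm ((1 - g w) *s p + w) < norm (1 - g w)" using assms by (simp add: \<Omega>_def)
  then show nz: "1 - g w \<noteq> 0" using norm_ge_zero[of "(1 - g w) *s p + w"] by (metis norm_zero not_le)
  have tw: "\<tau> w = (1 / (1 - g w)) *s ((1 - g w) *s p + w)"
    unfolding \<tau>_def vector_add_ldistrib vector_smult_assoc using nz by simp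
  show "norm (\<tau> w) < 1"
    unfolding tw norm_vec_smult using w nz by (simp add: norm_divide)
  have d: "\<tau> w - p = (1 / (1 - g w)) *s w" by (simp add: \<tau>_def)
  have "1 + g (\<tau> w - p) = 1 / (1 - g w)" unfolding d g_smult using nz by (simp add: field_simps)
  then show "\<sigma> (\<tau> w) = w" unfolding \<sigma>_def d vector_smult_assoc using nz by simp
qed

lemma Omega_invariant:
  assumes "w \<in> \<Omega>"
  shows "M *v w \<in> \<Omega>" "\<phi> (\<tau> w) = \<tau> (M *v w)"
proof -
  have t: "norm (\<tau> w) < 1" by (rule Omega_mem[OF assms])
  have eq: "\<sigma> (\<phi> (\<tau> w)) = M *v w" using sigma_phi[of "\<tau> w"] t Omega_mem(3)[OF assms] by simp
  show "M *v w \<in> \<Omega>" using sigma_mem[OF image_ball[OF t]] eq by simp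
  show "\<phi> (\<tau> w) = \<tau> (M *v w)" using tau_sigma[of "\<phi> (\<tau> w)"] image_ball[OF t] eq by simp
qed

lemma open_Omega: "open \<Omega>"
  unfolding \<Omega>_def by (intro open_Collect_less continuous_intros continuous_on_g)

lemma zero_mem_Omega: "0 \<in> \<Omega>"
  using p by (simp add: \<Omega>_def g_zero)

text \<open>The form \<open>|1 - g w|\<^sup>2 - |(1 - g w) p + w|\<^sup>2\<close> is concave along rays from \<open>0\<close>, because its
  quadratic part is nonpositive.\<close>

lemma Omega_star:
  fixes r :: real
  assumes w: "w \<in> \<Omega>" and r: "r \<in> {0..1}"
  shows "r *\<^sub>R w \<in> \<Omega>"
proof -
  define G where "G s = (norm (1 - g (s *\<^sub>R w)))\<^sup>2 - (norm ((1 - g (s *\<^sub>R w)) *s p + s *\<^sub>R w))\<^sup>2" for s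
  define x where "x = w - g w *s p"
  \<comment> \<open>Were this false, \<open>p - w / g w\<close> would be a point of the closed ball
    at which \<open>1 + g\<close> vanishes.\<close>
  have le: "norm (g w) \<le> norm x"
  proof (cases "g w = 0")
    case False
    show ?thesis
    proof (rule ccontr)
      assume "\<not> norm (g w) \<le> norm x"
      then have lt: "norm x < norm (g w)" by simp
      have "p + (- 1 / g w) *s w = (- 1 / g w) *s x"
        unfolding x_def vec.scale_right_diff_distrib vector_smult_assoc using False by simp
      then have "norm (p + (- 1 / g w) *s w) \<le> 1"
        using lt by (simp add: norm_vec_smult norm_divide divide_simps)
      from one_plus_g_nonzero[OF this] show False unfolding g_smult using False by simp
    qed
  qed simp
  define \<beta> where "\<beta> = - Re (g w) - inner p x"
  define q where "q = (norm (g w))\<^sup>2 - (norm x)\<^sup>2"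
  have q: "q \<le> 0" using le by (simp add: q_def power_mono)
  have G: "G s = (1 - (norm p)\<^sup>2) + 2 * \<beta> * s + q * s\<^sup>2" for s
  proof -
    have gs: "g (s *\<^sub>R w) = of_real s * g w" by (simp only: scaleR_eq_smult g_smult)
    have "(1 - g (s *\<^sub>R w)) *s p + s *\<^sub>R w = p + s *\<^sub>R x"
      unfolding x_def scaleR_eq_smult g_smult
      by (simp add: vec.scale_left_diff_distrib vec.scale_right_diff_distrib vector_smult_assoc)
    moreover have "(norm (p + s *\<^sub>R x))\<^sup>2 = (norm p)\<^sup>2 + 2 * s * inner p x + s\<^sup>2 * (norm x)\<^sup>2"
      by (simp add: norm_add_sq Re_cinner power_mult_distrib)
    moreover have "(norm (1 - of_real s * g w))\<^sup>2 = 1 - 2 * s * Re (g w) + s\<^sup>2 * (norm (g w))\<^sup>2"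
      unfolding cmod_power2 by (simp add: power2_eq_square algebra_simps)
    ultimately show ?thesis unfolding G_def gs \<beta>_def q_def by (simp add: algebra_simps)
  qed
  have "0 < G 1" using w unfolding G_def \<Omega>_def by (simp add: power_strict_mono)
  moreover have "0 < G 0" using p(1) by (simp add: G power_less_one_iff abs_square_less_1)
  moreover have "G r = (1 - r) * G 0 + r * G 1 + (- q) * (r * (1 - r))"
    unfolding G by (simp add: power2_eq_square algebra_simps)
  moreover have "0 \<le> (- q) * (r * (1 - r))" using q r by (intro mult_nonneg_nonneg) auto
  moreover have "0 < (1 - r) * G 0 + r * G 1"
  proof (cases "r = 0")
    case False
    then have "0 < r * G 1" using r \<open>0 < G 1\<close> by simp
    moreover have "0 \<le> (1 - r) * G 0" using r \<open>0 < G 0\<close> by simp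
    ultimately show ?thesis by linarith
  qed (use \<open>0 < G 0\<close> in simp)
  ultimately have "0 < G r" by linarith
  then show ?thesis unfolding G_def \<Omega>_def mem_Collect_eq by (simp add: power_less_imp_less_base)
qed

lemma mv_holomorphic_g: "mv_holomorphic_on g S"
  using denominator[of p] p(1)
  by (intro mv_holomorphic_on_linear bounded_linearI')
     (simp_all add: g_add g_smult scaleR_eq_smult scaleR_conv_of_real)

lemma mv_holomorphic_tau: "mv_holomorphic_on (\<lambda>w. \<tau> w $ i) \<Omega>"
proof -
  have "mv_holomorphic_on (\<lambda>w. p $ i + inverse (1 - g w) * w $ i) \<Omega>"
    using Omega_mem(1)
    by (intro mv_holomorphic_on_add mv_holomorphic_on_const mv_holomorphic_on_mult mv_holomorphic_on_nth
        mv_holomorphic_on_inverse mv_holomorphic_on_diff mv_holomorphic_g) auto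
  then show ?thesis by (simp add: \<tau>_def inverse_eq_divide)
qed

lemma mv_holomorphic_sigma: "mv_holomorphic_on (\<lambda>z. \<sigma> z $ i) (ball 0 1)"
proof -
  have g: "mv_holomorphic_on (\<lambda>z. g (z - p)) (ball 0 1)"
    by (rule mv_holomorphic_on_compose[OF mv_holomorphic_g[of UNIV]])
       (auto intro!: mv_holomorphic_on_diff mv_holomorphic_on_nth)
  have "mv_holomorphic_on (\<lambda>z. inverse (1 + g (z - p)) * (z $ i - p $ i)) (ball 0 1)"
    using one_plus_g_nonzero'
    by (intro mv_holomorphic_on_mult mv_holomorphic_on_inverse mv_holomorphic_on_add mv_holomorphic_on_diff
        mv_holomorphic_on_const mv_holomorphic_on_nth g) auto
  then show ?thesis by (simp add: \<sigma>_def inverse_eq_divide right_diff_distrib diff_divide_distrib)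
qed

lemma continuous_on_sigma: "continuous_on (cball 0 1) \<sigma>"
  unfolding \<sigma>_def using one_plus_g_nonzero'
  by (intro continuous_on_vec_smult continuous_on_divide continuous_on_const continuous_on_add
      continuous_on_g continuous_on_diff continuous_on_id) auto

lemma continuous_on_tau: "continuous_on \<Omega> \<tau>"
  unfolding \<tau>_def using Omega_mem(1)
  by (intro continuous_on_vec_smult continuous_on_divide continuous_on_const continuous_on_add
      continuous_on_g continuous_on_diff continuous_on_id) auto

lemma phi_iterate:
  assumes "norm z \<le> 1"
  shows "norm (((linear_fractional A B C d) ^^ n) z) \<le> 1"
    "\<sigma> (((linear_fractional A B C d) ^^ n) z) = ((*v) M ^^ n) (\<sigma> z)"
  using assms by (induction n) (simp_all add: image_cball sigma_phi)

text \<open>The image of the closed ball under \<sigma> is bounded, so a high power of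
  \<open>M\<close> carries it into a neighbourhood of 0 that \<tau> maps close to p.\<close>

lemma phi_iterate_compact:
  "\<exists>n \<rho>. 0 \<le> \<rho> \<and> \<rho> < 1 \<and> (\<forall>z. norm z \<le> 1 \<longrightarrow> norm (((linear_fractional A B C d) ^^ n) z) \<le> \<rho>)"
proof -
  obtain R where R: "\<forall>w\<in>\<sigma> ` cball 0 1. norm w \<le> R"
    using compact_imp_bounded[OF compact_continuous_image[OF continuous_on_sigma compact_cball]]
    unfolding bounded_iff by blast
  \<comment> \<open>Midway between the norm of the fixed point and 1.\<close>
  define \<rho> where "\<rho> = (1 + norm p) / 2"
  have \<rho>: "0 \<le> \<rho>" "\<rho> < 1" "norm p < \<rho>" using p by (auto simp: \<rho>_def)
  have "isCont \<tau> 0"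
    using continuous_on_tau open_Omega zero_mem_Omega by (simp add: continuous_on_eq_continuous_at)
  moreover have "\<tau> 0 = p" by (simp add: \<tau>_def)
  ultimately obtain e where e: "e > 0" "\<And>w. norm w < e \<Longrightarrow> norm (\<tau> w - p) < \<rho> - norm p"
    using \<rho>(3) unfolding continuous_at_eps_delta dist_norm by (metis diff_gt_0_iff_gt diff_zero)
  have "0 < e / (2 * (\<bar>R\<bar> + 1))" using e by simp
  then obtain n where n: "\<And>v. norm (((*v) M ^^ n) v) \<le> e / (2 * (\<bar>R\<bar> + 1)) * norm v"
    using matrix_powers_norm_bound[of M] eigenvalue_less_1 by blast
  have "norm (((linear_fractional A B C d) ^^ n) z) \<le> \<rho>" if z: "norm z \<le> 1" for z
  proof -
    have "norm (\<sigma> z) \<le> \<bar>R\<bar> + 1" using R z by (force simp: abs_le_iff)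
    then have "norm (((*v) M ^^ n) (\<sigma> z)) \<le> e / (2 * (\<bar>R\<bar> + 1)) * (\<bar>R\<bar> + 1)"
      using n[of "\<sigma> z"] e by (intro order_trans[OF n mult_left_mono]) auto
    also have "\<dots> = e / 2" by (simp add: field_simps)
    finally have "norm (\<sigma> (((linear_fractional A B C d) ^^ n) z)) < e"
      using e(1) phi_iterate(2)[OF z] by simp
    from e(2)[OF this] have "norm (((linear_fractional A B C d) ^^ n) z - p) < \<rho> - norm p"
      using tau_sigma[OF phi_iterate(1)[OF z]] by simp
    then show ?thesis using norm_triangle_ineq2[of "((linear_fractional A B C d) ^^ n) z" p] by linarith
  qed
  then show ?thesis using \<rho> by blast
qed

end

section \<open>The linear model\<close>

definition critical_values :: "complex ^ 'n ^ 'n \<Rightarrow> complex set" where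
  "critical_values M = {0, 1} \<union> {prod_list \<mu>s | \<mu>s. \<mu>s \<noteq> [] \<and> set \<mu>s \<subseteq> matrix_eigenvalues M}"

text \<open>Used in contrapositive form: dividing a noncritical number by a nonzero eigenvalue
  leaves it noncritical.\<close>

lemma critical_values_mult:
  assumes "\<mu> \<in> matrix_eigenvalues M" "\<nu> \<in> critical_values M"
  shows "\<mu> * \<nu> \<in> critical_values M"
proof -
  consider "\<nu> = 0" | "\<nu> = 1" | \<mu>s where "\<nu> = prod_list \<mu>s" "set \<mu>s \<subseteq> matrix_eigenvalues M"
    using assms(2) by (auto simp: critical_values_def)
  then show ?thesis
  proof cases
    case 2
    have "\<mu> = prod_list [\<mu>]" "set [\<mu>] \<subseteq> matrix_eigenvalues M" using assms(1) by auto
    then show ?thesis using 2 unfolding critical_values_def by (auto intro!: exI[of _ "[\<mu>]"])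
  next
    case 3
    then show ?thesis using assms(1) unfolding critical_values_def
      by (intro UnI2 CollectI exI[of _ "\<mu> # \<mu>s"]) auto
  qed (auto simp: critical_values_def)
qed

text \<open>The pairing is bilinear, not Hermitian, to preserve holomorphy; hence the transpose and
  not the adjoint.\<close>

lemma pairing_transpose: "(\<Sum>i\<in>UNIV. (M *v w) $ i * v $ i) = (\<Sum>i\<in>UNIV. w $ i * (transpose M *v v) $ i)"
  for M :: "complex ^ 'n ^ 'n"
  by (simp add: matrix_vector_mult_def transpose_def sum_distrib_left sum_distrib_right mult_ac)
     (rule sum.swap)

lemma norm_vec_le_sum: "norm (v :: 'a :: real_normed_vector ^ 'n) \<le> (\<Sum>i\<in>UNIV. norm (v $ i))"
  unfolding norm_vec_def by (rule L2_set_le_sum) simp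

text \<open>The coordinate \<open>\<sigma>\<close> conjugates the composition operator to \<open>k \<mapsto> k \<circ> M\<close> on such a domain \<open>\<Omega>\<close>.\<close>

locale linear_model =
  fixes \<Omega> :: "(complex ^ 'n) set" and M :: "complex ^ 'n ^ 'n"
  assumes open_Omega: "open \<Omega>" and zero_mem: "0 \<in> \<Omega>"
    and star: "\<And>w t. w \<in> \<Omega> \<Longrightarrow> t \<in> {0..1} \<Longrightarrow> t *\<^sub>R w \<in> \<Omega>"
    and inv: "\<And>w. w \<in> \<Omega> \<Longrightarrow> M *v w \<in> \<Omega>"
    and eig: "\<And>\<mu>. \<mu> \<in> matrix_eigenvalues M \<Longrightarrow> norm \<mu> < 1"
begin

section \<open>Holomorphic functions on the model domain\<close>

definition hol :: "(complex ^ 'n \<Rightarrow> complex) \<Rightarrow> bool" where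
  "hol k \<longleftrightarrow> mv_holomorphic_on k \<Omega>"

definition vhol :: "(complex ^ 'n \<Rightarrow> complex ^ 'n) \<Rightarrow> bool" where
  "vhol G \<longleftrightarrow> (\<forall>i. hol (\<lambda>w. G w $ i))"

lemma inv_power: "w \<in> \<Omega> \<Longrightarrow> ((*v) M ^^ n) w \<in> \<Omega>"
  by (induction n) (auto intro: inv)

lemma mv_holomorphic_matrix: "mv_holomorphic_on (\<lambda>w. (X *v G w) $ i) S"
  if "\<And>i. mv_holomorphic_on (\<lambda>w. G w $ i) S" for X :: "complex ^ 'n ^ 'n"
  unfolding matrix_vector_mult_def using that
  by (auto intro!: mv_holomorphic_on_sum mv_holomorphic_on_cmult)

lemma hol_comp: "hol k \<Longrightarrow> hol (\<lambda>w. k (M *v w))"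
  unfolding hol_def
  by (rule mv_holomorphic_on_compose[where T = \<Omega>])
     (auto intro!: inv mv_holomorphic_matrix[of "\<lambda>w. w"] mv_holomorphic_on_nth)

lemma hol_comp_power: "hol k \<Longrightarrow> hol (\<lambda>w. k (((*v) M ^^ n) w))"
proof (induction n arbitrary: k)
  case (Suc n)
  from Suc.IH[OF hol_comp[OF Suc.prems]] show ?case by simp
qed simp

lemma vhol_comp: "vhol G \<Longrightarrow> vhol (\<lambda>w. G (M *v w))"
  unfolding vhol_def using hol_comp by blast

lemma vhol_matrix: "vhol G \<Longrightarrow> vhol (\<lambda>w. X *v G w)"
  unfolding vhol_def hol_def by (blast intro: mv_holomorphic_matrix)

lemma vhol_diff: "vhol F \<Longrightarrow> vhol G \<Longrightarrow> vhol (\<lambda>w. F w - G w)"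
  unfolding vhol_def hol_def by (simp add: mv_holomorphic_on_diff)

lemma vhol_add: "vhol F \<Longrightarrow> vhol G \<Longrightarrow> vhol (\<lambda>w. F w + G w)"
  unfolding vhol_def hol_def by (simp add: mv_holomorphic_on_add)

lemma vhol_smult: "vhol F \<Longrightarrow> vhol (\<lambda>w. c *s F w)"
  unfolding vhol_def hol_def by (simp add: mv_holomorphic_on_cmult)

lemma vhol_linpoly: "vhol F \<Longrightarrow> vhol (\<lambda>w. linpoly X \<mu>s (F w))"
  by (induction \<mu>s arbitrary: F) (simp_all add: vhol_diff vhol_matrix vhol_smult)

definition Had :: "(complex ^ 'n \<Rightarrow> complex) \<Rightarrow> complex ^ 'n \<Rightarrow> complex ^ 'n" where
  "Had k w = (\<chi> i. hadamard i k w)"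

lemma vhol_Had: "hol k \<Longrightarrow> vhol (Had k)"
  unfolding vhol_def hol_def Had_def using mv_holomorphic_on_hadamard[OF open_Omega _ star] by simp

lemma Had_decomposition: "hol k \<Longrightarrow> w \<in> \<Omega> \<Longrightarrow> k w = k 0 + (\<Sum>i\<in>UNIV. w $ i * Had k w $ i)"
  unfolding hol_def Had_def using hadamard_decomposition[OF open_Omega _ star] by simp

lemma cpartial_comp:
  assumes "hol k" "w \<in> \<Omega>"
  shows "cpartial i (\<lambda>w. k (M *v w)) w = (\<Sum>j\<in>UNIV. M $ j $ i * cpartial j k (M *v w))"
proof -
  have "((\<lambda>c. k (M *v w + c *s (M *v axis i 1))) has_field_derivative
      (\<Sum>j\<in>UNIV. (M *v axis i 1) $ j * cpartial j k (M *v w + 0 *s (M *v axis i 1)))) (at 0)"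
    by (rule mv_holomorphic_on_chain) (use assms inv in \<open>auto simp: hol_def\<close>)
  moreover have "(M *v axis i 1) $ j = M $ j $ i" for j
    by (simp add: matrix_vector_mult_def axis_def if_distrib cong: if_cong)
  ultimately show ?thesis
    unfolding cpartial_def
    by (intro DERIV_imp_deriv) (simp add: matrix_vector_right_distrib vector_scalar_commute)
qed

text \<open>The chain rule under the integral. It turns an eigenfunction equation for k into one for
  the vector of its Hadamard coefficients.\<close>

lemma Had_equivariant:
  assumes k: "hol k" and w: "w \<in> \<Omega>"
  shows "Had (\<lambda>w. k (M *v w)) w = transpose M *v Had k (M *v w)"
proof -
  have int: "(\<lambda>t. cpartial j k (t *\<^sub>R (M *v w))) integrable_on {0..1}" for j
  proof -
    have "continuous_on {0..1} (\<lambda>t. cpartial j k (t *\<^sub>R (M *v w)))"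
      by (rule continuous_on_compose2[OF mv_holomorphic_on_imp_continuous_on[OF
          mv_holomorphic_on_cpartial[OF open_Omega k[unfolded hol_def]]]])
         (auto intro!: continuous_intros star inv w)
    then show ?thesis by (rule integrable_continuous_real)
  qed
  have "hadamard i (\<lambda>w. k (M *v w)) w = (\<Sum>j\<in>UNIV. M $ j $ i * hadamard j k (M *v w))" for i
  proof -
    have "integral {0..1} (\<lambda>t. cpartial i (\<lambda>w. k (M *v w)) (t *\<^sub>R w))
      = integral {0..1} (\<lambda>t. \<Sum>j\<in>UNIV. M $ j $ i * cpartial j k (t *\<^sub>R (M *v w)))"
    proof (rule integral_cong)
      fix t :: real assume "t \<in> {0..1}"
      from cpartial_comp[OF k star[OF w this], of i]
      show "cpartial i (\<lambda>w. k (M *v w)) (t *\<^sub>R w) = (\<Sum>j\<in>UNIV. M $ j $ i * cpartial j k (t *\<^sub>R (M *v w)))"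
        by (simp add: scaleR_eq_smult vector_scalar_commute)
    qed
    also have "\<dots> = (\<Sum>j\<in>UNIV. M $ j $ i * integral {0..1} (\<lambda>t. cpartial j k (t *\<^sub>R (M *v w))))"
      using int by (subst integral_sum) (auto intro!: integrable_on_mult_right)
    finally show ?thesis by (simp add: hadamard_def)
  qed
  then show ?thesis
    by (simp add: vec_eq_iff Had_def matrix_vector_mult_def transpose_def)
qed

text \<open>From some power on all images of K lie in a closed ball around 0 inside \<Omega>; only
  finitely many other images remain.\<close>

lemma compact_orbit:
  assumes K: "compact K" "K \<subseteq> \<Omega>"
  shows "\<exists>K'. compact K' \<and> K' \<subseteq> \<Omega> \<and> (\<forall>w\<in>K. \<forall>n. ((*v) M ^^ n) w \<in> K')"
proof -
  obtain e where e: "e > 0" "cball 0 e \<subseteq> \<Omega>"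
    using open_Omega zero_mem open_contains_cball by blast
  obtain R where R: "\<forall>w\<in>K. norm w \<le> R"
    using compact_imp_bounded[OF K(1)] unfolding bounded_iff by blast
  have "0 < e / (\<bar>R\<bar> + 1)" using e by simp
  then obtain n0 where n0: "\<And>n v. n \<ge> n0 \<Longrightarrow> norm (((*v) M ^^ n) v) \<le> e / (\<bar>R\<bar> + 1) * norm v"
    using matrix_powers_norm_bound[of M] eig by blast
  define K' where "K' = cball 0 e \<union> (\<Union>n<n0. ((*v) M ^^ n) ` K)"
  have cont: "continuous_on K ((*v) M ^^ n)" for n
    by (induction n) (simp_all add: continuous_on_matrix_vector_mult_complex continuous_on_id o_def)
  have "compact K'"
    unfolding K'_def by (intro compact_Un compact_cball compact_UN finite_lessThan compact_continuous_image cont K(1))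
  moreover have "K' \<subseteq> \<Omega>" using e(2) K(2) inv_power by (auto simp: K'_def)
  moreover have "((*v) M ^^ n) w \<in> K'" if w: "w \<in> K" for w n
  proof (cases "n < n0")
    case False
    have "norm w \<le> \<bar>R\<bar> + 1" using R w by (force simp: abs_le_iff)
    then have "norm (((*v) M ^^ n) w) \<le> e / (\<bar>R\<bar> + 1) * (\<bar>R\<bar> + 1)"
      using e False by (intro order_trans[OF n0 mult_left_mono]) auto
    then show ?thesis by (simp add: K'_def)
  qed (use w in \<open>auto simp: K'_def\<close>)
  ultimately show ?thesis by blast
qed

lemma compact_bound:
  assumes "hol k" "compact K" "K \<subseteq> \<Omega>"
  shows "\<exists>B. \<forall>w\<in>K. norm (k w) \<le> B"
proof -
  have "continuous_on K k"
    using mv_holomorphic_on_imp_continuous_on assms continuous_on_subset unfolding hol_def by blast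
  from compact_imp_bounded[OF compact_continuous_image[OF this assms(2)]]
  show ?thesis unfolding bounded_iff by blast
qed

text \<open>\<open>K'\<close> and \<open>c\<close> are chosen before f, so the solution depends
  boundedly on the data for uniform convergence on compact sets. Linearity of the choice is not
  demanded; it follows later from uniqueness.\<close>

definition solvable :: "complex \<Rightarrow> bool" where
  "solvable \<nu> \<longleftrightarrow> (\<forall>K. compact K \<longrightarrow> K \<subseteq> \<Omega> \<longrightarrow> (\<exists>K' c. compact K' \<and> K' \<subseteq> \<Omega> \<and> 0 \<le> c \<and>
    (\<forall>f. hol f \<longrightarrow> (\<exists>k. hol k \<and> (\<forall>w\<in>\<Omega>. k (M *v w) - \<nu> * k w = f w) \<and>
      (\<forall>B. (\<forall>w\<in>K'. norm (f w) \<le> B) \<longrightarrow> (\<forall>w\<in>K. norm (k w) \<le> c * B))))))"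

definition injective_at :: "complex \<Rightarrow> bool" where
  "injective_at \<nu> \<longleftrightarrow> (\<forall>k. hol k \<longrightarrow> (\<forall>w\<in>\<Omega>. k (M *v w) = \<nu> * k w) \<longrightarrow> (\<forall>w\<in>\<Omega>. k w = 0))"

text \<open>Along an orbit k grows like the powers of \<nu>, yet the orbit stays in a compact set,
  where k is bounded.\<close>

lemma injective_at_large:
  assumes "norm \<nu> > 1"
  shows "injective_at \<nu>"
  unfolding injective_at_def
proof (intro allI impI ballI)
  fix k w assume k: "hol k" and eq: "\<forall>w\<in>\<Omega>. k (M *v w) = \<nu> * k w" and w: "w \<in> \<Omega>"
  have it: "k (((*v) M ^^ n) w) = \<nu> ^ n * k w" for n
    by (induction n) (use eq inv_power[OF w] in auto)
  obtain K' where K': "compact K'" "K' \<subseteq> \<Omega>" "\<And>n. ((*v) M ^^ n) w \<in> K'"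
    using compact_orbit[of "{w}"] w by auto
  obtain B where B: "\<And>w. w \<in> K' \<Longrightarrow> norm (k w) \<le> B" using compact_bound[OF k K'(1,2)] by blast
  show "k w = 0"
  proof (rule ccontr)
    assume "k w \<noteq> 0"
    obtain n where n: "B / norm (k w) < norm \<nu> ^ n" using real_arch_pow[OF assms] by blast
    have "norm \<nu> ^ n * norm (k w) \<le> B" using B[OF K'(3)[of n]] by (simp add: it norm_mult norm_power)
    then show False using n \<open>k w \<noteq> 0\<close> by (simp add: field_simps)
  qed
qed

text \<open>The Neumann series \<open>k w = - (\<Sum>n. f (M^n w) / \<nu>^(n+1))\<close> converges
  locally uniformly because orbits of compact sets stay in compact sets.\<close>

lemma solvable_large:
  assumes \<nu>: "norm \<nu> > 1"
  shows "solvable \<nu>"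
  unfolding solvable_def
proof (intro allI impI)
  fix K assume K: "compact K" "K \<subseteq> \<Omega>"
  have \<nu>0: "\<nu> \<noteq> 0" using \<nu> by auto
  define q where "q = 1 / norm \<nu>"
  have q: "0 < q" "q < 1" using \<nu> less_trans[OF zero_less_one \<nu>] by (auto simp: q_def)
  obtain K' where K': "compact K'" "K' \<subseteq> \<Omega>" "\<And>w n. w \<in> K \<Longrightarrow> ((*v) M ^^ n) w \<in> K'"
    using compact_orbit[OF K] by blast
  \<comment> \<open>The sum of the powers \<open>q^(n+1)\<close>, that is,
    \<open>1 / (norm \<nu> - 1)\<close>.\<close>
  define c where "c = q / (1 - q)"
  have c: "0 \<le> c" using q by (simp add: c_def)
  show "\<exists>K' c. compact K' \<and> K' \<subseteq> \<Omega> \<and> 0 \<le> c \<and>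
    (\<forall>f. hol f \<longrightarrow> (\<exists>k. hol k \<and> (\<forall>w\<in>\<Omega>. k (M *v w) - \<nu> * k w = f w) \<and>
      (\<forall>B. (\<forall>w\<in>K'. norm (f w) \<le> B) \<longrightarrow> (\<forall>w\<in>K. norm (k w) \<le> c * B))))"
  proof (intro exI[of _ K'] exI[of _ c] conjI allI impI K' c)
    fix f assume f: "hol f"
    let ?t = "\<lambda>n w. - (f (((*v) M ^^ n) w) / \<nu> ^ Suc n)"
    define k where "k w = (\<Sum>n. ?t n w)" for w
    have t_le: "norm (?t n w) \<le> B * q * q ^ n" if "\<And>n. norm (f (((*v) M ^^ n) w)) \<le> B" for B w n
    proof -
      have "norm (?t n w) = norm (f (((*v) M ^^ n) w)) * (q * q ^ n)"
        by (simp add: norm_divide norm_mult norm_power q_def power_one_over)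
      also have "\<dots> \<le> B * (q * q ^ n)" using q that by (intro mult_right_mono) auto
      finally show ?thesis by (simp add: mult.assoc)
    qed
    have qs: "summable (\<lambda>n. B * q * q ^ n)" for B using q by (intro summable_mult summable_geometric) auto
    have orbit_bound: "\<exists>B. \<forall>w\<in>L. \<forall>n. norm (f (((*v) M ^^ n) w)) \<le> B" if L: "compact L" "L \<subseteq> \<Omega>" for L
    proof -
      obtain L' where "compact L'" "L' \<subseteq> \<Omega>" "\<And>w n. w \<in> L \<Longrightarrow> ((*v) M ^^ n) w \<in> L'"
        using compact_orbit[OF L] by blast
      then show ?thesis using compact_bound[OF f, of L'] by blast
    qed
    have summ: "summable (\<lambda>n. ?t n w)" if w: "w \<in> \<Omega>" for w
    proof -
      obtain B where "\<And>n. norm (f (((*v) M ^^ n) w)) \<le> B" using orbit_bound[of "{w}"] w by auto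
      from t_le[OF this] show ?thesis by (intro summable_comparison_test'[OF qs[of B]])
    qed
    have "mv_holomorphic_on k \<Omega>"
    proof (rule mv_holomorphic_on_uniform_limit[OF open_Omega, where f = "\<lambda>N w. \<Sum>n<N. ?t n w"])
      show "mv_holomorphic_on (\<lambda>w. \<Sum>n<N. ?t n w) \<Omega>" for N
      proof (rule mv_holomorphic_on_sum)
        fix n
        have "mv_holomorphic_on (\<lambda>w. (- 1 / \<nu> ^ Suc n) * f (((*v) M ^^ n) w)) \<Omega>"
          using hol_comp_power[OF f] unfolding hol_def by (rule mv_holomorphic_on_cmult)
        then show "mv_holomorphic_on (?t n) \<Omega>" by simp
      qed
      fix w assume "w \<in> \<Omega>"
      then obtain r where r: "r > 0" "cball w r \<subseteq> \<Omega>" using open_Omega open_contains_cball by blast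
      obtain B where B: "\<And>w' n. w' \<in> cball w r \<Longrightarrow> norm (f (((*v) M ^^ n) w')) \<le> B"
        using orbit_bound[OF compact_cball r(2)] by blast
      have "uniform_limit (cball w r) (\<lambda>N w. \<Sum>n<N. ?t n w) k sequentially"
        unfolding k_def by (rule Weierstrass_m_test[OF t_le qs]) (rule B)
      then show "\<exists>d>0. cball w d \<subseteq> \<Omega> \<and> uniform_limit (cball w d) (\<lambda>N w. \<Sum>n<N. ?t n w) k sequentially"
        using r by blast
    qed
    then have "hol k" by (simp add: hol_def)
    moreover have "k (M *v w) - \<nu> * k w = f w" if w: "w \<in> \<Omega>" for w
    proof -
      have shift: "?t (Suc n) w = (1 / \<nu>) * ?t n (M *v w)" for n
        using \<nu>0 by (simp add: funpow_swap1)
      have "k w = ?t 0 w + (\<Sum>n. ?t (Suc n) w)"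
        unfolding k_def using suminf_split_head[OF summ[OF w]] by simp
      also have "(\<Sum>n. ?t (Suc n) w) = (1 / \<nu>) * k (M *v w)"
        unfolding shift k_def by (rule suminf_mult[OF summ[OF inv[OF w]]])
      finally show ?thesis using \<nu>0 by (simp add: field_simps)
    qed
    moreover have "norm (k w) \<le> c * B" if B: "\<forall>w\<in>K'. norm (f w) \<le> B" and w: "w \<in> K" for B w
    proof -
      have t: "norm (?t n w) \<le> B * q * q ^ n" for n by (rule t_le) (use B K'(3)[OF w] in blast)
      have "norm (k w) \<le> (\<Sum>n. B * q * q ^ n)"
        unfolding k_def by (rule norm_suminf_le[OF t qs])
      also have "\<dots> = c * B"
        using q by (simp add: suminf_mult summable_geometric suminf_geometric c_def)
      finally show ?thesis .
    qed
    ultimately show "\<exists>k. hol k \<and> (\<forall>w\<in>\<Omega>. k (M *v w) - \<nu> * k w = f w) \<and>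
      (\<forall>B. (\<forall>w\<in>K'. norm (f w) \<le> B) \<longrightarrow> (\<forall>w\<in>K. norm (k w) \<le> c * B))" by blast
  qed
qed

section \<open>The vector equation for the Hadamard coefficients\<close>

abbreviation "X \<equiv> transpose M"

lemma linpoly_bounded: "\<exists>L\<ge>0. \<forall>v. norm (linpoly X \<mu>s v) \<le> L * norm v"
proof -
  have "bounded_linear (linpoly X \<mu>s)"
    by (intro linear_conv_bounded_linear[THEN iffD1] linearI)
       (simp_all add: linpoly_add scaleR_eq_smult linpoly_smult)
  then show ?thesis using bounded_linear.nonneg_bounded by (metis mult.commute)
qed

text \<open>For nonzero \<mu> division by \<mu> gives the scalar equation at
  \<open>\<nu> / \<mu>\<close> in each coordinate; for \<open>\<mu> = 0\<close> the equation is
  algebraic, with solution \<open>- H / \<nu>\<close>.\<close>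

lemma scalar_solve:
  assumes \<nu>: "\<nu> \<noteq> 0" and solv: "\<mu> \<noteq> 0 \<longrightarrow> solvable (\<nu> / \<mu>)" and K: "compact K" "K \<subseteq> \<Omega>"
  shows "\<exists>K' c. compact K' \<and> K' \<subseteq> \<Omega> \<and> 0 \<le> c \<and> (\<forall>H. vhol H \<longrightarrow> (\<exists>G. vhol G \<and>
    (\<forall>w\<in>\<Omega>. \<mu> *s G (M *v w) - \<nu> *s G w = H w) \<and>
    (\<forall>B. (\<forall>w\<in>K'. norm (H w) \<le> B) \<longrightarrow> (\<forall>w\<in>K. norm (G w) \<le> c * B))))"
proof (cases "\<mu> = 0")
  case True
  show ?thesis
  proof (intro exI[of _ K] exI[of _ "1 / norm \<nu>"] conjI allI impI K)
    fix H assume "vhol H"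
    then have "vhol (\<lambda>w. (- 1 / \<nu>) *s H w)" by (rule vhol_smult)
    moreover have "\<mu> *s ((- 1 / \<nu>) *s H (M *v w)) - \<nu> *s ((- 1 / \<nu>) *s H w) = H w" for w
      using True \<nu> by (simp add: vector_smult_assoc)
    moreover have "norm ((- 1 / \<nu>) *s H w) \<le> 1 / norm \<nu> * B" if "norm (H w) \<le> B" for w B
      using that by (simp add: norm_vec_smult norm_divide divide_right_mono)
    ultimately show "\<exists>G. vhol G \<and> (\<forall>w\<in>\<Omega>. \<mu> *s G (M *v w) - \<nu> *s G w = H w) \<and>
      (\<forall>B. (\<forall>w\<in>K. norm (H w) \<le> B) \<longrightarrow> (\<forall>w\<in>K. norm (G w) \<le> 1 / norm \<nu> * B))"
      by (intro exI[of _ "\<lambda>w. (- 1 / \<nu>) *s H w"]) blast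
  qed simp
next
  case False
  from solv False have "solvable (\<nu> / \<mu>)" by blast
  from this[unfolded solvable_def, THEN spec, THEN mp, THEN mp, OF K]
  obtain K' c where K': "compact K'" "K' \<subseteq> \<Omega>" "0 \<le> c"
    and S: "\<forall>f. hol f \<longrightarrow> (\<exists>k. hol k \<and> (\<forall>w\<in>\<Omega>. k (M *v w) - (\<nu> / \<mu>) * k w = f w) \<and>
      (\<forall>B. (\<forall>w\<in>K'. norm (f w) \<le> B) \<longrightarrow> (\<forall>w\<in>K. norm (k w) \<le> c * B)))"
    by (elim exE conjE) (rule that)
  let ?c = "real CARD('n) * (c / norm \<mu>)"
  show ?thesis
  proof (intro exI[of _ K'] exI[of _ ?c] conjI allI impI K')
    show "0 \<le> ?c" using K' by simp
    fix H assume H: "vhol H"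
    have "hol (\<lambda>w. (1 / \<mu>) * H w $ i)" for i
      unfolding hol_def by (rule mv_holomorphic_on_cmult) (use H in \<open>simp add: vhol_def hol_def\<close>)
    then have "\<forall>i. \<exists>k. hol k \<and> (\<forall>w\<in>\<Omega>. k (M *v w) - (\<nu> / \<mu>) * k w = (1 / \<mu>) * H w $ i) \<and>
      (\<forall>B. (\<forall>w\<in>K'. norm ((1 / \<mu>) * H w $ i) \<le> B) \<longrightarrow> (\<forall>w\<in>K. norm (k w) \<le> c * B))"
      by (intro allI S[rule_format])
    from choice[OF this] obtain k where k: "\<forall>i. hol (k i) \<and>
      (\<forall>w\<in>\<Omega>. k i (M *v w) - (\<nu> / \<mu>) * k i w = (1 / \<mu>) * H w $ i) \<and>
      (\<forall>B. (\<forall>w\<in>K'. norm ((1 / \<mu>) * H w $ i) \<le> B) \<longrightarrow> (\<forall>w\<in>K. norm (k i w) \<le> c * B))" ..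
    have k_eq: "k i (M *v w) - (\<nu> / \<mu>) * k i w = (1 / \<mu>) * H w $ i" if "w \<in> \<Omega>" for i w
      using k that by blast
    have k_bound: "norm (k i w) \<le> c * B" if "\<forall>w\<in>K'. norm ((1 / \<mu>) * H w $ i) \<le> B" "w \<in> K" for i w B
      using k[THEN spec, of i] that by blast
    define G where "G w = (\<chi> i. k i w)" for w
    have "vhol G" using k by (simp add: vhol_def G_def)
    moreover have "\<mu> *s G (M *v w) - \<nu> *s G w = H w" if "w \<in> \<Omega>" for w
    proof -
      have "\<mu> * k i (M *v w) - \<nu> * k i w = H w $ i" for i
      proof -
        have "\<mu> * k i (M *v w) - \<nu> * k i w = \<mu> * (k i (M *v w) - (\<nu> / \<mu>) * k i w)"
          using False by (simp add: right_diff_distrib)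
        then show ?thesis unfolding k_eq[OF that] using False by simp
      qed
      then show ?thesis by (simp add: vec_eq_iff G_def)
    qed
    moreover have "norm (G w) \<le> ?c * B" if B: "\<forall>w\<in>K'. norm (H w) \<le> B" and w: "w \<in> K" for w B
    proof -
      have "norm (k i w) \<le> c * (B / norm \<mu>)" for i
      proof (rule k_bound[OF _ w], intro ballI)
        fix w assume "w \<in> K'"
        then have "norm (H w $ i) \<le> B" using B Finite_Cartesian_Product.norm_nth_le order_trans by blast
        then show "norm ((1 / \<mu>) * H w $ i) \<le> B / norm \<mu>"
          by (simp add: norm_divide divide_right_mono)
      qed
      then have "norm (G w) \<le> (\<Sum>i\<in>(UNIV :: 'n set). c * (B / norm \<mu>))"
        unfolding G_def by (intro order_trans[OF norm_vec_le_sum] sum_mono) simp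
      then show ?thesis by simp
    qed
    ultimately show "\<exists>G. vhol G \<and> (\<forall>w\<in>\<Omega>. \<mu> *s G (M *v w) - \<nu> *s G w = H w) \<and>
      (\<forall>B. (\<forall>w\<in>K'. norm (H w) \<le> B) \<longrightarrow> (\<forall>w\<in>K. norm (G w) \<le> ?c * B))" by blast
  qed
qed

text \<open>Each eigenvalue in the list removes one factor of the annihilating polynomial from the residual.\<close>

lemma vector_solve:
  assumes \<nu>: "\<nu> \<noteq> 0" and solv: "\<forall>\<mu>\<in>set bs. \<mu> \<noteq> 0 \<longrightarrow> solvable (\<nu> / \<mu>)"
    and ann: "\<And>v. linpoly X (as @ bs) v = 0" and K: "compact K" "K \<subseteq> \<Omega>"
  shows "\<exists>K' c. compact K' \<and> K' \<subseteq> \<Omega> \<and> 0 \<le> c \<and> (\<forall>H. vhol H \<longrightarrow> (\<exists>G. vhol G \<and>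
    (\<forall>w\<in>\<Omega>. X *v G (M *v w) - \<nu> *s G w = linpoly X as (H w)) \<and>
    (\<forall>B. (\<forall>w\<in>K'. norm (H w) \<le> B) \<longrightarrow> (\<forall>w\<in>K. norm (G w) \<le> c * B))))"
  using solv ann K
proof (induction bs arbitrary: as K)
  case Nil
  have "vhol (\<lambda>w. 0)" by (simp add: vhol_def hol_def mv_holomorphic_on_const)
  then show ?case using Nil
    by (intro exI[of _ "{}"] exI[of _ 0]) (auto intro!: exI[of _ "\<lambda>w. 0"])
next
  case (Cons \<mu> bs)
  have ann': "linpoly X ((as @ [\<mu>]) @ bs) v = 0" for v using Cons.prems(2)[of v] by simp
  have solv': "\<forall>\<mu>\<in>set bs. \<mu> \<noteq> 0 \<longrightarrow> solvable (\<nu> / \<mu>)" using Cons.prems(1) by simp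
  from Cons.IH[OF solv' ann' Cons.prems(3,4)] obtain K2 c2 where K2: "compact K2" "K2 \<subseteq> \<Omega>" "0 \<le> c2"
    and S2: "\<forall>H. vhol H \<longrightarrow> (\<exists>G. vhol G \<and>
    (\<forall>w\<in>\<Omega>. X *v G (M *v w) - \<nu> *s G w = linpoly X (as @ [\<mu>]) (H w)) \<and>
    (\<forall>B. (\<forall>w\<in>K2. norm (H w) \<le> B) \<longrightarrow> (\<forall>w\<in>K. norm (G w) \<le> c2 * B)))"
    by (elim exE conjE) (rule that)
  \<comment> \<open>The image of \<open>K2\<close> is included because the second solution takes
    \<open>G1 (M *v w)\<close>, with w in \<open>K2\<close>, as its data.\<close>
  let ?K1 = "K \<union> (\<lambda>w. M *v w) ` K2"
  have K1: "compact ?K1" "?K1 \<subseteq> \<Omega>"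
    using Cons.prems(3,4) K2 inv
    by (auto intro!: compact_Un compact_continuous_image continuous_on_matrix_vector_mult_complex continuous_on_id)
  have "\<mu> \<noteq> 0 \<longrightarrow> solvable (\<nu> / \<mu>)" using Cons.prems(1) by simp
  from scalar_solve[OF \<nu> this K1] obtain K3 c3 where K3: "compact K3" "K3 \<subseteq> \<Omega>" "0 \<le> c3"
    and S3: "\<forall>H. vhol H \<longrightarrow> (\<exists>G. vhol G \<and> (\<forall>w\<in>\<Omega>. \<mu> *s G (M *v w) - \<nu> *s G w = H w) \<and>
    (\<forall>B. (\<forall>w\<in>K3. norm (H w) \<le> B) \<longrightarrow> (\<forall>w\<in>?K1. norm (G w) \<le> c3 * B)))"
    by (elim exE conjE) (rule that)
  obtain L where L: "0 \<le> L" "\<And>v. norm (linpoly X as v) \<le> L * norm v" using linpoly_bounded by blast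
  let ?c = "L * c3 + c2 * c3"
  show ?case
  proof (intro exI[of _ K3] exI[of _ ?c] conjI allI impI K3)
    show "0 \<le> ?c" using L K2 K3 by simp
    fix H assume H: "vhol H"
    from S3[rule_format, OF H] obtain G1 where G1: "vhol G1" "\<forall>w\<in>\<Omega>. \<mu> *s G1 (M *v w) - \<nu> *s G1 w = H w"
      "\<forall>B. (\<forall>w\<in>K3. norm (H w) \<le> B) \<longrightarrow> (\<forall>w\<in>?K1. norm (G1 w) \<le> c3 * B)" by (elim exE conjE) (rule that)
    \<comment> \<open>Using \<open>G1\<close> in place of a solution leaves the error
      \<open>X - \<mu>\<close> applied to \<open>G1 (M *v w)\<close>; \<open>G2\<close> compensates
      it and has one more annihilating factor available.\<close>
    have "vhol (\<lambda>w. (-1) *s G1 (M *v w))" by (rule vhol_smult[OF vhol_comp[OF G1(1)]])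
    from S2[rule_format, OF this] obtain G2 where G2: "vhol G2"
      "\<forall>w\<in>\<Omega>. X *v G2 (M *v w) - \<nu> *s G2 w = linpoly X (as @ [\<mu>]) ((-1) *s G1 (M *v w))"
      "\<forall>B. (\<forall>w\<in>K2. norm ((-1) *s G1 (M *v w)) \<le> B) \<longrightarrow> (\<forall>w\<in>K. norm (G2 w) \<le> c2 * B)" by (elim exE conjE) (rule that)
    let ?G = "\<lambda>w. linpoly X as (G1 w) + G2 w"
    have "vhol ?G" by (intro vhol_add vhol_linpoly G1 G2)
    moreover have "X *v ?G (M *v w) - \<nu> *s ?G w = linpoly X as (H w)" if w: "w \<in> \<Omega>" for w
    proof -
      have "X *v ?G (M *v w) - \<nu> *s ?G w
        = (X *v linpoly X as (G1 (M *v w)) - \<nu> *s linpoly X as (G1 w)) + (X *v G2 (M *v w) - \<nu> *s G2 w)"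
        by (simp add: matrix_vector_right_distrib vector_add_ldistrib)
      also have "X *v linpoly X as (G1 (M *v w)) - \<nu> *s linpoly X as (G1 w)
        = linpoly X as (X *v G1 (M *v w) - \<nu> *s G1 w)"
        by (simp only: linpoly_diff linpoly_mult linpoly_smult)
      also have "X *v G2 (M *v w) - \<nu> *s G2 w = linpoly X as (X *v ((-1) *s G1 (M *v w)) - \<mu> *s ((-1) *s G1 (M *v w)))"
        unfolding G2(2)[rule_format, OF w] linpoly_append linpoly.simps linpoly_factor ..
      also have "linpoly X as (X *v G1 (M *v w) - \<nu> *s G1 w) + \<dots>
        = linpoly X as (\<mu> *s G1 (M *v w) - \<nu> *s G1 w)"
        unfolding linpoly_add[symmetric] vector_scalar_commute by (intro arg_cong[of _ _ "linpoly X as"]) simp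
      finally show ?thesis unfolding G1(2)[rule_format, OF w] .
    qed
    moreover have "norm (?G w) \<le> ?c * B" if B: "\<forall>w\<in>K3. norm (H w) \<le> B" and w: "w \<in> K" for B w
    proof -
      have G1B: "\<forall>w\<in>?K1. norm (G1 w) \<le> c3 * B" by (rule G1(3)[THEN spec, THEN mp, OF B])
      then have "norm (G1 w) \<le> c3 * B" using w by blast
      then have 1: "norm (linpoly X as (G1 w)) \<le> L * (c3 * B)"
        by (intro order_trans[OF L(2) mult_left_mono] L)
      have "\<forall>w\<in>K2. norm ((-1) *s G1 (M *v w)) \<le> c3 * B"
      proof
        fix w assume "w \<in> K2"
        then have "M *v w \<in> ?K1" by blast
        with G1B show "norm ((-1) *s G1 (M *v w)) \<le> c3 * B" by (simp add: norm_vec_smult)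
      qed
      from G2(3)[THEN spec, THEN mp, OF this] w have "norm (G2 w) \<le> c2 * (c3 * B)" by blast
      with 1 have "norm (?G w) \<le> L * (c3 * B) + c2 * (c3 * B)"
        by (intro order_trans[OF norm_triangle_ineq] add_mono)
      then show ?thesis by (simp add: algebra_simps)
    qed
    ultimately show "\<exists>G. vhol G \<and> (\<forall>w\<in>\<Omega>. X *v G (M *v w) - \<nu> *s G w = linpoly X as (H w)) \<and>
    (\<forall>B. (\<forall>w\<in>K3. norm (H w) \<le> B) \<longrightarrow> (\<forall>w\<in>K. norm (G w) \<le> ?c * B))" by blast
  qed
qed

text \<open>Cauchy's estimate for the partial derivatives on a closed neighbourhood of all segments
  from 0 to points of K.\<close>

lemma Had_bound:
  assumes K: "compact K" "K \<subseteq> \<Omega>"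
  shows "\<exists>K' c. compact K' \<and> K' \<subseteq> \<Omega> \<and> 0 \<in> K' \<and> 0 \<le> c \<and> (\<forall>f B. hol f \<longrightarrow> (\<forall>w\<in>K'. norm (f w) \<le> B)
    \<longrightarrow> (\<forall>w\<in>K. norm (Had f w) \<le> c * B))"
proof -
  \<comment> \<open>The origin is inserted explicitly, since the value at 0 has to be controlled
    even when K is empty.\<close>
  define K2 where "K2 = insert 0 ((\<lambda>(t, w). t *\<^sub>R w) ` ({0..1::real} \<times> K))"
  have "compact K2"
    unfolding K2_def case_prod_beta
    by (intro compact_insert compact_continuous_image compact_Times K compact_Icc continuous_intros)
  moreover have "K2 \<subseteq> \<Omega>" using K star zero_mem by (auto simp: K2_def)
  ultimately obtain e where e: "e > 0" "(\<Union>x\<in>K2. cball x e) \<subseteq> \<Omega>"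
    using compact_subset_open_imp_cball_epsilon_subset[of K2 \<Omega>] open_Omega by blast
  let ?K' = "\<Union>x\<in>K2. cball x e"
  have "?K' = {x + y | x y. x \<in> K2 \<and> y \<in> cball 0 e}"
  proof (intro set_eqI iffI)
    fix z assume "z \<in> ?K'"
    then obtain x where "x \<in> K2" "z - x \<in> cball 0 e" by (auto simp: dist_norm norm_minus_commute)
    then show "z \<in> {x + y | x y. x \<in> K2 \<and> y \<in> cball 0 e}" by (intro CollectI exI[of _ x] exI[of _ "z - x"]) simp
  next
    fix z assume "z \<in> {x + y | x y. x \<in> K2 \<and> y \<in> cball 0 e}"
    then obtain x y where "x \<in> K2" "norm y \<le> e" "z = x + y" by auto
    then show "z \<in> ?K'" by (intro UN_I[of x]) (simp_all add: dist_norm)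
  qed
  then have "compact ?K'" using compact_sums[OF \<open>compact K2\<close> compact_cball[of 0 e]] by metis
  let ?c = "real CARD('n) * (1 / e)"
  show ?thesis
  proof (intro exI[of _ ?K'] exI[of _ ?c] conjI allI impI ballI)
    show "0 \<in> ?K'" using e by (auto simp: K2_def)
    show "0 \<le> ?c" using e by simp
    fix f B w assume f: "hol f" and B: "\<forall>w\<in>?K'. norm (f w) \<le> B" and w: "w \<in> K"
    have "norm (hadamard i f w) \<le> B / e" for i
    proof -
      have cp: "norm (cpartial i f (t *\<^sub>R w)) \<le> B / e" if "t \<in> {0..1}" for t
      proof -
        have "t *\<^sub>R w \<in> K2" using that w by (force simp: K2_def)
        then have "cball (t *\<^sub>R w) e \<subseteq> ?K'" by blast
        then show ?thesis
          using B e f unfolding hol_def by (intro cpartial_bound[OF open_Omega]) blast+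
      qed
      have "continuous_on {0..1} (\<lambda>t. cpartial i f (t *\<^sub>R w))"
        by (rule continuous_on_compose2[OF mv_holomorphic_on_imp_continuous_on[OF
            mv_holomorphic_on_cpartial[OF open_Omega f[unfolded hol_def]]]])
           (use w K star in \<open>auto intro!: continuous_intros\<close>)
      from integral_bound[OF _ this cp] show ?thesis by (simp add: hadamard_def)
    qed
    then have "norm (Had f w) \<le> (\<Sum>i\<in>(UNIV :: 'n set). B / e)"
      unfolding Had_def by (intro order_trans[OF norm_vec_le_sum] sum_mono) simp
    then show "norm (Had f w) \<le> ?c * B" by simp
  qed (use e \<open>compact ?K'\<close> in auto)
qed

text \<open>The constant term of k is forced to be \<open>f 0 / (1 - \<nu>)\<close>; the rest is the
  pairing of w with a solution G of the vector equation whose data are the Hadamard coefficients of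
  f.\<close>

lemma solvable_step:
  assumes \<nu>: "\<nu> \<noteq> 0" "\<nu> \<noteq> 1" and solv: "\<forall>\<mu>\<in>set \<mu>s. \<mu> \<noteq> 0 \<longrightarrow> solvable (\<nu> / \<mu>)"
    and ann: "\<And>v. linpoly X \<mu>s v = 0"
  shows "solvable \<nu>"
  unfolding solvable_def
proof (intro allI impI)
  fix K assume K: "compact K" "K \<subseteq> \<Omega>"
  obtain K1 c1 where K1: "compact K1" "K1 \<subseteq> \<Omega>" "0 \<le> c1"
    and S1: "\<forall>H. vhol H \<longrightarrow> (\<exists>G. vhol G \<and> (\<forall>w\<in>\<Omega>. X *v G (M *v w) - \<nu> *s G w = H w) \<and>
    (\<forall>B. (\<forall>w\<in>K1. norm (H w) \<le> B) \<longrightarrow> (\<forall>w\<in>K. norm (G w) \<le> c1 * B)))"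
    using vector_solve[OF \<nu>(1) solv, where as = "[]", unfolded append_Nil linpoly.simps, OF ann K]
    by (elim exE conjE) (rule that)
  obtain K2 c2 where K2: "compact K2" "K2 \<subseteq> \<Omega>" "0 \<in> K2" "0 \<le> c2"
    and S2: "\<forall>f B. hol f \<longrightarrow> (\<forall>w\<in>K2. norm (f w) \<le> B) \<longrightarrow> (\<forall>w\<in>K1. norm (Had f w) \<le> c2 * B)"
    using Had_bound[OF K1(1,2)] by (elim exE conjE) (rule that)
  obtain R0 where "\<forall>w\<in>K. norm w \<le> R0" using compact_imp_bounded[OF K(1)] unfolding bounded_iff by blast
  then have R: "\<forall>w\<in>K. norm w \<le> \<bar>R0\<bar>" by fastforce
  let ?c = "1 / norm (1 - \<nu>) + real CARD('n) * (\<bar>R0\<bar> * (c1 * c2))"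
  show "\<exists>K' c. compact K' \<and> K' \<subseteq> \<Omega> \<and> 0 \<le> c \<and>
    (\<forall>f. hol f \<longrightarrow> (\<exists>k. hol k \<and> (\<forall>w\<in>\<Omega>. k (M *v w) - \<nu> * k w = f w) \<and>
      (\<forall>B. (\<forall>w\<in>K'. norm (f w) \<le> B) \<longrightarrow> (\<forall>w\<in>K. norm (k w) \<le> c * B))))"
  proof (intro exI[of _ K2] exI[of _ ?c] conjI allI impI K2)
    show "0 \<le> ?c" using K1 K2 by simp
    fix f assume f: "hol f"
    from S1[rule_format, OF vhol_Had[OF f]] obtain G where G: "vhol G"
      "\<forall>w\<in>\<Omega>. X *v G (M *v w) - \<nu> *s G w = Had f w"
      "\<forall>B. (\<forall>w\<in>K1. norm (Had f w) \<le> B) \<longrightarrow> (\<forall>w\<in>K. norm (G w) \<le> c1 * B)" by (elim exE conjE) (rule that)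
    define k where "k w = f 0 / (1 - \<nu>) + (\<Sum>i\<in>UNIV. w $ i * G w $ i)" for w
    have "hol k"
      using G(1) unfolding k_def vhol_def hol_def
      by (auto intro!: mv_holomorphic_on_add mv_holomorphic_on_sum mv_holomorphic_on_mult mv_holomorphic_on_nth)
    moreover have "k (M *v w) - \<nu> * k w = f w" if w: "w \<in> \<Omega>" for w
    proof -
      have "k (M *v w) - \<nu> * k w = (f 0 / (1 - \<nu>) - \<nu> * (f 0 / (1 - \<nu>)))
        + ((\<Sum>i\<in>UNIV. w $ i * (X *v G (M *v w)) $ i) - \<nu> * (\<Sum>i\<in>UNIV. w $ i * G w $ i))"
        unfolding k_def pairing_transpose by (simp add: algebra_simps)
      also have "f 0 / (1 - \<nu>) - \<nu> * (f 0 / (1 - \<nu>)) = f 0"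
        using \<nu>(2) by (simp add: diff_divide_distrib[symmetric] divide_eq_eq algebra_simps)
      also have "(\<Sum>i\<in>UNIV. w $ i * (X *v G (M *v w)) $ i) - \<nu> * (\<Sum>i\<in>UNIV. w $ i * G w $ i)
        = (\<Sum>i\<in>UNIV. w $ i * (X *v G (M *v w) - \<nu> *s G w) $ i)"
        by (simp add: sum_distrib_left right_diff_distrib sum_subtractf mult_ac)
      finally show ?thesis unfolding G(2)[rule_format, OF w] using Had_decomposition[OF f w] by simp
    qed
    moreover have "norm (k w) \<le> ?c * B" if B: "\<forall>w\<in>K2. norm (f w) \<le> B" and w: "w \<in> K" for B w
    proof -
      have f0: "norm (f 0) \<le> B" using B K2(3) by blast
      have "\<forall>w\<in>K1. norm (Had f w) \<le> c2 * B" by (rule S2[THEN spec, THEN spec, THEN mp, THEN mp, OF f B])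
      from G(3)[THEN spec, THEN mp, OF this] w have Gw: "norm (G w) \<le> c1 * (c2 * B)" by blast
      have "norm (w $ i * G w $ i) \<le> \<bar>R0\<bar> * (c1 * (c2 * B))" for i
        unfolding norm_mult
        by (intro mult_mono order_trans[OF Finite_Cartesian_Product.norm_nth_le] Gw) (use R w in auto)
      then have "norm (\<Sum>i\<in>UNIV. w $ i * G w $ i) \<le> (\<Sum>i\<in>(UNIV :: 'n set). \<bar>R0\<bar> * (c1 * (c2 * B)))"
        by (intro sum_norm_le) auto
      moreover have "norm (f 0 / (1 - \<nu>)) \<le> 1 / norm (1 - \<nu>) * B"
        using f0 by (simp add: norm_divide divide_right_mono)
      ultimately have "norm (k w) \<le> 1 / norm (1 - \<nu>) * B + real CARD('n) * (\<bar>R0\<bar> * (c1 * (c2 * B)))"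
        unfolding k_def by (intro order_trans[OF norm_triangle_ineq] add_mono) auto
      then show ?thesis by (simp add: distrib_right mult.assoc)
    qed
    ultimately show "\<exists>k. hol k \<and> (\<forall>w\<in>\<Omega>. k (M *v w) - \<nu> * k w = f w) \<and>
      (\<forall>B. (\<forall>w\<in>K2. norm (f w) \<le> B) \<longrightarrow> (\<forall>w\<in>K. norm (k w) \<le> ?c * B))" by blast
  qed
qed

text \<open>\<open>X - \<mu>\<close> applied to H solves the same equation and is killed by the
  shorter list, hence vanishes. Then X acts on H as the scalar \<mu>, and each coordinate solves the
  scalar equation at \<open>\<nu> / \<mu>\<close>.\<close>

lemma vector_injective:
  assumes \<nu>: "\<nu> \<noteq> 0" and inj: "\<forall>\<mu>\<in>set \<mu>s. \<mu> \<noteq> 0 \<longrightarrow> injective_at (\<nu> / \<mu>)"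
    and H: "vhol H" "\<And>w. w \<in> \<Omega> \<Longrightarrow> X *v H (M *v w) = \<nu> *s H w"
      "\<And>w. w \<in> \<Omega> \<Longrightarrow> linpoly X \<mu>s (H w) = 0" and w: "w \<in> \<Omega>"
  shows "H w = 0"
  using inj H w
proof (induction \<mu>s arbitrary: H w)
  case Nil
  then show ?case by simp
next
  case (Cons \<mu> \<mu>s)
  have H1: "X *v H w - \<mu> *s H w = 0" if w: "w \<in> \<Omega>" for w
  proof (rule Cons.IH[where H = "\<lambda>w. X *v H w - \<mu> *s H w"])
    show "vhol (\<lambda>w. X *v H w - \<mu> *s H w)"
      by (intro vhol_diff vhol_matrix vhol_smult Cons.prems)
    fix w assume w: "w \<in> \<Omega>"
    show "X *v (X *v H (M *v w) - \<mu> *s H (M *v w)) = \<nu> *s (X *v H w - \<mu> *s H w)"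
      unfolding matrix_vector_mult_diff_distrib vector_scalar_commute Cons.prems(3)[OF w]
      by (simp add: vector_scalar_commute vec.scale_right_diff_distrib vector_smult_assoc mult.commute)
    show "linpoly X \<mu>s (X *v H w - \<mu> *s H w) = 0" using Cons.prems(4)[OF w] by simp
  qed (use Cons.prems w in auto)
  have eq: "\<mu> *s H (M *v w) = \<nu> *s H w" if "w \<in> \<Omega>" for w
    using H1[OF inv[OF that]] Cons.prems(3)[OF that] by simp
  show ?case
  proof (cases "\<mu> = 0")
    case True
    then show ?thesis using eq[OF Cons.prems(5)] \<nu> by simp
  next
    case False
    then have i: "injective_at (\<nu> / \<mu>)" using Cons.prems(1) by simp
    have "H w $ i = 0" for i
    proof -
      have "H (M *v w) $ i = (\<nu> / \<mu>) * H w $ i" if "w \<in> \<Omega>" for w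
      proof -
        have "\<mu> * H (M *v w) $ i = \<nu> * H w $ i" using eq[OF that] by (metis vector_smult_component)
        then show ?thesis using False by (simp add: field_simps)
      qed
      then show ?thesis
        using i Cons.prems(2,5) unfolding injective_at_def vhol_def by blast
    qed
    then show ?thesis by (simp add: vec_eq_iff)
  qed
qed

text \<open>The equation at 0 gives \<open>k 0 = 0\<close> because \<nu> is not 1; its derivative
  makes the Hadamard coefficients a solution of the homogeneous vector equation.\<close>

lemma injective_step:
  assumes \<nu>: "\<nu> \<noteq> 0" "\<nu> \<noteq> 1" and inj: "\<forall>\<mu>\<in>set \<mu>s. \<mu> \<noteq> 0 \<longrightarrow> injective_at (\<nu> / \<mu>)"
    and ann: "\<And>v. linpoly X \<mu>s v = 0"
  shows "injective_at \<nu>"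
  unfolding injective_at_def
proof (intro allI impI ballI)
  fix k w assume k: "hol k" and eq: "\<forall>w\<in>\<Omega>. k (M *v w) = \<nu> * k w" and w: "w \<in> \<Omega>"
  have "k 0 = \<nu> * k 0" using eq zero_mem by force
  then have k0: "k 0 = 0" using \<nu>(2) by simp
  have cp: "cpartial i (\<lambda>w. k (M *v w)) w = \<nu> * cpartial i k w" if w: "w \<in> \<Omega>" for i w
  proof -
    obtain e where e: "e > 0" "ball w e \<subseteq> \<Omega>" using open_Omega w open_contains_ball by blast
    have d: "((\<lambda>c. \<nu> * k (w + c *s axis i 1)) has_field_derivative \<nu> * cpartial i k w) (at 0)"
      unfolding cpartial_def
      by (intro DERIV_cmult field_differentiable_derivI mv_holomorphic_on_coord_differentiable[OF k[unfolded hol_def] w])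
    have "\<nu> * k (w + c *s axis i 1) = k (M *v (w + c *s axis i 1))" if "c \<in> ball 0 e" for c
    proof -
      have "w + c *s axis i 1 \<in> ball w e" using that by (simp add: dist_norm norm_vec_smult)
      then have "w + c *s axis i 1 \<in> \<Omega>" using e(2) by blast
      then show ?thesis using eq by simp
    qed
    with e(1) have "((\<lambda>c. k (M *v (w + c *s axis i 1))) has_field_derivative \<nu> * cpartial i k w) (at 0)"
      by (intro has_field_derivative_transform_within_open[OF d open_ball[of 0 e]]) simp_all
    then show ?thesis unfolding cpartial_def[of i "\<lambda>w. k (M *v w)"] by (rule DERIV_imp_deriv)
  qed
  have Had_eq: "X *v Had k (M *v w) = \<nu> *s Had k w" if w: "w \<in> \<Omega>" for w
  proof -
    have "hadamard i (\<lambda>w. k (M *v w)) w = \<nu> * hadamard i k w" for i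
    proof -
      have "integral {0..1} (\<lambda>t. cpartial i (\<lambda>w. k (M *v w)) (t *\<^sub>R w)) = integral {0..1} (\<lambda>t. \<nu> * cpartial i k (t *\<^sub>R w))"
        by (intro integral_cong cp star w)
      then show ?thesis by (simp add: hadamard_def)
    qed
    then have "Had (\<lambda>w. k (M *v w)) w = \<nu> *s Had k w" by (simp add: vec_eq_iff Had_def)
    then show ?thesis using Had_equivariant[OF k w] by simp
  qed
  have "Had k w = 0"
    by (rule vector_injective[OF \<nu>(1) inj vhol_Had[OF k] Had_eq ann w])
  then show "k w = 0" using Had_decomposition[OF k w] k0 by simp
qed

text \<open>Induction on an n with \<open>\<rho> ^ n < norm \<nu>\<close>: division by an eigenvalue
  of modulus at most \<rho> lowers n by one, and at \<open>n = 0\<close> the Neumann series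
  applies.\<close>

theorem solvable_injective:
  assumes "\<nu> \<notin> critical_values M"
  shows "solvable \<nu>" "injective_at \<nu>"
proof -
  obtain \<mu>s where \<mu>s: "set \<mu>s \<subseteq> matrix_eigenvalues M" "\<And>v. linpoly X \<mu>s v = 0"
    using ex_annihilating_eigenvalues[of X] unfolding matrix_eigenvalues_transpose by blast
  \<comment> \<open>The element 1/2 keeps the maximum defined and positive without changing the
    bound below 1.\<close>
  define \<rho> where "\<rho> = Max (insert (1/2) (norm ` set \<mu>s))"
  have \<rho>: "\<rho> < 1" unfolding \<rho>_def using \<mu>s(1) eig by (subst Max_less_iff) auto
  have \<rho>half: "1/2 \<le> \<rho>" unfolding \<rho>_def by (rule Max_ge) auto
  have \<rho>_ge: "norm \<mu> \<le> \<rho>" if "\<mu> \<in> set \<mu>s" for \<mu> unfolding \<rho>_def by (rule Max_ge) (use that in auto)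
  have main: "solvable \<nu> \<and> injective_at \<nu>" if "\<nu> \<notin> critical_values M" "\<rho> ^ n < norm \<nu>" for n \<nu>
    using that
  proof (induction n arbitrary: \<nu>)
    case 0
    then show ?case using solvable_large injective_at_large by simp
  next
    case (Suc n)
    have \<nu>: "\<nu> \<noteq> 0" "\<nu> \<noteq> 1" using Suc.prems(1) by (auto simp: critical_values_def)
    have IH: "solvable (\<nu> / \<mu>) \<and> injective_at (\<nu> / \<mu>)" if \<mu>: "\<mu> \<in> set \<mu>s" "\<mu> \<noteq> 0" for \<mu>
    proof (rule Suc.IH)
      show "\<nu> / \<mu> \<notin> critical_values M"
        using critical_values_mult[of \<mu> M "\<nu> / \<mu>"] \<mu> \<mu>s(1) Suc.prems(1) by auto
      have "\<rho> ^ n * norm \<mu> \<le> \<rho> ^ n * \<rho>" using \<rho>_ge[OF \<mu>(1)] \<rho>half by (intro mult_left_mono) auto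
      also have "\<dots> < norm \<nu>" using Suc.prems(2) by (simp add: mult.commute)
      finally show "\<rho> ^ n < norm (\<nu> / \<mu>)" using \<mu>(2) by (simp add: norm_divide field_simps)
    qed
    have "solvable \<nu>" by (rule solvable_step[OF \<nu> _ \<mu>s(2)]) (simp add: IH)
    moreover have "injective_at \<nu>" by (rule injective_step[OF \<nu> _ \<mu>s(2)]) (simp add: IH)
    ultimately show ?case ..
  qed
  have "norm \<nu> > 0" using assms by (auto simp: critical_values_def)
  from real_arch_pow_inv[OF this \<rho>] obtain n where "\<rho> ^ n < norm \<nu>" ..
  from main[OF assms this] show "solvable \<nu>" "injective_at \<nu>" by auto
qed

end

section \<open>The spectrum\<close>

text \<open>Nonvanishing somewhere in every nonempty open set is carried through the induction
  because, unlike nonvanishing at one point, it survives multiplication by a further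
  functional.\<close>

lemma ex_semi_invariant:
  fixes M :: "complex ^ 'n ^ 'n"
  assumes "set \<mu>s \<subseteq> matrix_eigenvalues M"
  shows "\<exists>E. mv_holomorphic_on E UNIV \<and> (\<forall>w. E (M *v w) = prod_list \<mu>s * E w) \<and>
    (\<forall>U. open U \<longrightarrow> U \<noteq> {} \<longrightarrow> (\<exists>w\<in>U. E w \<noteq> 0))"
  using assms
proof (induction \<mu>s)
  case Nil
  show ?case by (rule exI[of _ "\<lambda>w. 1"]) (auto intro: mv_holomorphic_on_const)
next
  case (Cons \<mu> \<mu>s)
  then obtain E where E: "mv_holomorphic_on E UNIV" "\<And>w. E (M *v w) = prod_list \<mu>s * E w"
    and dense: "\<And>U. open U \<Longrightarrow> U \<noteq> {} \<Longrightarrow> \<exists>w\<in>U. E w \<noteq> 0" by auto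
  have "\<mu> \<in> matrix_eigenvalues (transpose M)" using Cons.prems by (simp add: matrix_eigenvalues_transpose)
  then obtain l where l: "l \<noteq> 0" "transpose M *v l = \<mu> *s l" unfolding matrix_eigenvalues_def by blast
  define L where "L w = (\<Sum>i\<in>UNIV. w $ i * l $ i)" for w
  have L_M: "L (M *v w) = \<mu> * L w" for w
    unfolding L_def pairing_transpose l(2) by (simp add: sum_distrib_left mult_ac)
  have hol_L: "mv_holomorphic_on L UNIV"
    unfolding L_def by (intro mv_holomorphic_on_sum mv_holomorphic_on_mult mv_holomorphic_on_nth mv_holomorphic_on_const)
  show ?case
  proof (intro exI[of _ "\<lambda>w. L w * E w"] conjI allI impI)
    show "mv_holomorphic_on (\<lambda>w. L w * E w) UNIV" by (rule mv_holomorphic_on_mult[OF hol_L E(1)])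
    show "L (M *v w) * E (M *v w) = prod_list (\<mu> # \<mu>s) * (L w * E w)" for w
      by (simp add: L_M E(2))
    fix U :: "(complex ^ 'n) set" assume U: "open U" "U \<noteq> {}"
    define V where "V = U \<inter> {w. E w \<noteq> 0}"
    have "open {w. E w \<noteq> 0}"
      by (intro open_Collect_neq mv_holomorphic_on_imp_continuous_on[OF E(1)] continuous_on_const)
    then have "open V" using U by (auto simp: V_def)
    moreover obtain w where w: "w \<in> V" using dense[OF U] by (auto simp: V_def)
    ultimately obtain e where e: "e > 0" "cball w e \<subseteq> V" using open_contains_cball by blast
    \<comment> \<open>Conjugating l gives \<open>L v\<close> the value of the squared norm of l, so
      moving from w along v changes L, and L is nonzero at one of the two points.\<close>
    define v where "v = (\<chi> i. cnj (l $ i))"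
    have nv: "norm v = norm l" by (simp add: v_def norm_vec_def)
    define w' where "w' = w + complex_of_real (e / norm l) *s v"
    have "norm (complex_of_real (e / norm l) *s v) = e"
      unfolding norm_vec_smult nv using e(1) l(1) by (simp add: norm_divide)
    then have w': "w' \<in> V" using e(2) by (auto simp: w'_def dist_norm)
    have "L w' = L w + complex_of_real (e / norm l) * L v"
      by (simp add: L_def w'_def sum.distrib sum_distrib_left algebra_simps)
    moreover have "L v = complex_of_real ((norm l)\<^sup>2)"
    proof -
      have "(norm l)\<^sup>2 = (\<Sum>i\<in>UNIV. (norm (l $ i))\<^sup>2)" by (simp add: norm_vec_def L2_set_def sum_nonneg)
      then have "complex_of_real ((norm l)\<^sup>2) = (\<Sum>i\<in>UNIV. l $ i * cnj (l $ i))"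
        by (simp only: of_real_sum complex_norm_square)
      then show ?thesis by (simp add: L_def v_def mult.commute)
    qed
    ultimately have "L w' \<noteq> 0 \<or> L w \<noteq> 0" using e(1) l(1) by auto
    then show "\<exists>w\<in>U. L w * E w \<noteq> 0" using w w' by (auto simp: V_def)
  qed
qed

lemma composition_operator_cong:
  "(\<And>z. z \<in> ball 0 1 \<Longrightarrow> \<phi> z = \<psi> z) \<Longrightarrow> composition_operator \<phi> = composition_operator \<psi>"
  by (auto simp: composition_operator_def fun_eq_iff)

lemma hardy_bounded_operator_zero:
  assumes "hardy_bounded_operator S"
  shows "S (\<lambda>z. 0) = (\<lambda>z. 0)"
proof -
  have "\<forall>c. \<forall>f\<in>hardy_space. S (\<lambda>z. c * f z) = (\<lambda>z. c * S f z)"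
    using assms unfolding hardy_bounded_operator_def by (elim conjE)
  from this[THEN spec, of 0, THEN bspec, OF hardy_space_zero] show ?thesis by simp
qed

lemma eigenvalue_in_hardy_spectrum:
  assumes "f \<in> hardy_space" "f z \<noteq> 0" "\<And>z. T f z = \<nu> * f z"
  shows "\<nu> \<in> hardy_spectrum T"
proof -
  have False if S: "hardy_bounded_operator S" "\<forall>f\<in>hardy_space. S (\<lambda>z. T f z - \<nu> * f z) = f" for S
  proof -
    have "(\<lambda>z. T f z - \<nu> * f z) = (\<lambda>z. 0)" using assms(3) by simp
    then have "f = (\<lambda>z. 0)" using S(2)[THEN bspec, OF assms(1)] hardy_bounded_operator_zero[OF S(1)] by simp
    then show False using assms(2) by simp
  qed
  then show ?thesis unfolding hardy_spectrum_def by blast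
qed

context lfm_attracting
begin

sublocale model: linear_model \<Omega> M
proof
  show "t *\<^sub>R w \<in> \<Omega>" if "w \<in> \<Omega>" "t \<in> {0..1}" for w and t :: real using Omega_star[OF that] .
qed (simp_all add: open_Omega zero_mem_Omega Omega_invariant(1) eigenvalue_less_1)

abbreviation "\<Phi> \<equiv> linear_fractional A B C d"
abbreviation "T \<equiv> composition_operator \<Phi>"

lemma T_apply: "T f z = (if z \<in> ball 0 1 then f (\<phi> z) else 0)"
  by (simp add: composition_operator_def)

lemma T_bounded: "\<exists>K\<ge>0. \<forall>f\<in>hardy_space. T f \<in> hardy_space \<and> hardy_norm (T f) \<le> K * hardy_norm f"
  using composition_hardy unfolding composition_operator_def .

lemma T_hardy: "f \<in> hardy_space \<Longrightarrow> T f \<in> hardy_space"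
  using T_bounded by blast

lemma iterate_ball: "z \<in> ball 0 1 \<Longrightarrow> (\<Phi> ^^ n) z \<in> ball 0 1"
  by (induction n) (simp_all add: image_ball)

lemma T_power_apply: "((T ^^ n) f) z = (if z \<in> ball 0 1 then f ((\<Phi> ^^ n) z) else 0)"
  if "\<And>z. z \<notin> ball 0 1 \<Longrightarrow> f z = 0"
proof (induction n arbitrary: z)
  case (Suc n)
  have "(\<Phi> ^^ n) (\<phi> z) = \<phi> ((\<Phi> ^^ n) z)" by (simp add: funpow_swap1)
  then show ?case using Suc.IH[of "\<phi> z"] image_ball[of z] by (simp add: T_apply)
qed (use that in simp)

text \<open>A bounded inverse would bound the norm of f by a constant times the norm of the n-th
  iterate applied to f; on the coordinate powers this fails for large k.\<close>

lemma zero_in_spectrum: "0 \<in> hardy_spectrum T"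
proof -
  have False if S: "hardy_bounded_operator S" "\<forall>f\<in>hardy_space. S (\<lambda>z. T f z - 0 * f z) = f" for S
  proof -
    obtain K0 where K0: "\<forall>f\<in>hardy_space. hardy_norm (S f) \<le> K0 * hardy_norm f"
      using S(1) unfolding hardy_bounded_operator_def by blast
    have K: "hardy_norm f \<le> \<bar>K0\<bar> * hardy_norm (T f)" if f: "f \<in> hardy_space" for f
    proof -
      have "S (T f) = f" using S(2) f by simp
      then have "hardy_norm f \<le> K0 * hardy_norm (T f)" using K0 T_hardy[OF f] by force
      also have "\<dots> \<le> \<bar>K0\<bar> * hardy_norm (T f)"
        by (intro mult_right_mono hardy_norm_nonneg T_hardy f) simp
      finally show ?thesis .
    qed
    have K_power: "hardy_norm f \<le> \<bar>K0\<bar> ^ n * hardy_norm ((T ^^ n) f) \<and> (T ^^ n) f \<in> hardy_space"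
      if f: "f \<in> hardy_space" for f n
    proof (induction n)
      case (Suc n)
      have "\<bar>K0\<bar> ^ n * hardy_norm ((T ^^ n) f) \<le> \<bar>K0\<bar> ^ n * (\<bar>K0\<bar> * hardy_norm (T ((T ^^ n) f)))"
        using Suc K by (intro mult_left_mono) auto
      then show ?case using Suc T_hardy by (auto simp: mult_ac)
    qed (use f in auto)
    obtain n \<rho> where \<rho>: "0 \<le> \<rho>" "\<rho> < 1" "\<And>z. norm z \<le> 1 \<Longrightarrow> norm ((\<Phi> ^^ n) z) \<le> \<rho>"
      using phi_iterate_compact by blast
    \<comment> \<open>Strictly above \<rho>: evaluation at s times a unit coordinate vector bounds
      the norm of the k-th coordinate power below by a multiple of \<open>s ^ k\<close>.\<close>
    define s where "s = (1 + \<rho>) / 2"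
    have s: "0 \<le> s" "s < 1" "\<rho> < s" "0 < s" using \<rho> by (auto simp: s_def)
    obtain c where c: "c \<ge> 0" "\<And>f z. f \<in> hardy_space \<Longrightarrow> norm (z :: complex ^ 'n) \<le> s \<Longrightarrow> norm (f z) \<le> c * hardy_norm f"
      using hardy_point_evaluation[OF s(1,2)] by blast
    obtain i :: 'n where True by blast
    have ax: "norm (axis i (complex_of_real s) :: complex ^ 'n) = s"
    proof -
      have "axis i (complex_of_real s) = complex_of_real s *s (axis i 1 :: complex ^ 'n)" by (simp add: vec_eq_iff axis_def)
      then show ?thesis using s by (simp add: norm_vec_smult)
    qed
    define D where "D = c * \<bar>K0\<bar> ^ n"
    have D: "D \<ge> 0" using c(1) by (simp add: D_def)
    have le: "s ^ k \<le> D * \<rho> ^ k" for k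
    proof -
      define f where "f = (\<lambda>z. if z \<in> ball 0 1 then (z $ i) ^ k else 0 :: complex)"
      have f0: "\<And>z. z \<notin> ball 0 1 \<Longrightarrow> f z = 0" by (simp add: f_def)
      have "mv_holomorphic_on f (ball 0 1) \<longleftrightarrow> mv_holomorphic_on (\<lambda>z. (z $ i) ^ k) (ball 0 1)"
        by (rule mv_holomorphic_on_cong) (simp_all add: f_def)
      then have hol_f: "mv_holomorphic_on f (ball 0 1)"
        by (simp add: mv_holomorphic_on_power mv_holomorphic_on_nth)
      have f: "f \<in> hardy_space"
      proof (rule hardy_space_bounded(1)[OF hol_f f0, of 1])
        fix z :: "complex ^ 'n" assume z: "z \<in> ball 0 1"
        have "norm (z $ i) \<le> 1" using Finite_Cartesian_Product.norm_nth_le[of z i] z by simp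
        then show "norm (f z) \<le> 1" using z by (simp add: f_def norm_power power_le_one)
      qed
      have "hardy_norm ((T ^^ n) f) \<le> \<rho> ^ k"
      proof (rule hardy_space_bounded(2))
        show "mv_holomorphic_on ((T ^^ n) f) (ball 0 1)" using K_power[OF f] hardy_spaceD(1) by blast
        show "(T ^^ n) f z = 0" if "z \<notin> ball 0 1" for z using T_power_apply[of f] f0 that by simp
        fix z :: "complex ^ 'n" assume z: "z \<in> ball 0 1"
        have "norm ((\<Phi> ^^ n) z $ i) \<le> \<rho>"
          using Finite_Cartesian_Product.norm_nth_le[of "(\<Phi> ^^ n) z" i] \<rho>(3)[of z] z by simp
        moreover have "(T ^^ n) f z = ((\<Phi> ^^ n) z $ i) ^ k"
          using T_power_apply[of f n z] f0 z iterate_ball[OF z, of n] by (simp add: f_def)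
        ultimately show "norm ((T ^^ n) f z) \<le> \<rho> ^ k" by (simp add: norm_power power_mono)
      qed
      then have "\<bar>K0\<bar> ^ n * hardy_norm ((T ^^ n) f) \<le> \<bar>K0\<bar> ^ n * \<rho> ^ k" by (intro mult_left_mono) auto
      with K_power[OF f] have "hardy_norm f \<le> \<bar>K0\<bar> ^ n * \<rho> ^ k" by (meson order_trans)
      then have "c * hardy_norm f \<le> c * (\<bar>K0\<bar> ^ n * \<rho> ^ k)" by (rule mult_left_mono[OF _ c(1)])
      moreover have "norm (f (axis i (complex_of_real s))) \<le> c * hardy_norm f"
        by (rule c(2)[OF f]) (simp add: ax)
      moreover have "f (axis i (complex_of_real s)) = complex_of_real s ^ k"
        using s by (simp add: f_def ax)
      ultimately show ?thesis using s by (simp add: norm_power D_def mult.assoc)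
    qed
    have "\<rho> / s < 1" using s by simp
    from real_arch_pow_inv[OF _ this, of "1 / (D + 1)"] D obtain k where k: "(\<rho> / s) ^ k < 1 / (D + 1)" by auto
    have "s ^ k / s ^ k \<le> D * \<rho> ^ k / s ^ k" using le[of k] s by (intro divide_right_mono) auto
    then have "1 \<le> D * (\<rho> / s) ^ k" using s by (simp add: power_divide)
    also have "\<dots> \<le> D * (1 / (D + 1))" using k D by (intro mult_left_mono) auto
    also have "\<dots> < 1" using D by (simp add: field_simps)
    finally show False by simp
  qed
  then show ?thesis unfolding hardy_spectrum_def by blast
qed

lemma compose_sigma_holomorphic:
  assumes "mv_holomorphic_on k \<Omega>"
  shows "mv_holomorphic_on (\<lambda>z. if z \<in> ball 0 1 then k (\<sigma> z) else 0) (ball 0 1)"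
proof -
  have "mv_holomorphic_on (\<lambda>z. k (\<sigma> z)) (ball 0 1)"
    by (rule mv_holomorphic_on_compose[OF assms mv_holomorphic_sigma]) (simp add: sigma_mem)
  moreover have "mv_holomorphic_on (\<lambda>z. if z \<in> ball 0 1 then k (\<sigma> z) else 0) (ball 0 1) \<longleftrightarrow>
      mv_holomorphic_on (\<lambda>z. k (\<sigma> z)) (ball 0 1)"
    by (rule mv_holomorphic_on_cong) simp_all
  ultimately show ?thesis by simp
qed

lemma compose_tau_holomorphic: "f \<in> hardy_space \<Longrightarrow> mv_holomorphic_on (\<lambda>w. f (\<tau> w)) \<Omega>"
  by (rule mv_holomorphic_on_compose[OF hardy_spaceD(1) mv_holomorphic_tau]) (simp_all add: Omega_mem(2))

text \<open>The eigenfunction is bounded, hence a Hardy function, because \<sigma> is continuous on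
  the closed ball. The empty list yields the constants and the value 1.\<close>

lemma products_in_spectrum:
  assumes "set \<mu>s \<subseteq> matrix_eigenvalues M"
  shows "prod_list \<mu>s \<in> hardy_spectrum T"
proof -
  obtain E where E: "mv_holomorphic_on E UNIV" "\<And>w. E (M *v w) = prod_list \<mu>s * E w"
    and dense: "\<And>U. open U \<Longrightarrow> U \<noteq> {} \<Longrightarrow> \<exists>w\<in>U. E w \<noteq> 0"
    using ex_semi_invariant[OF assms] by auto
  define e where "e = (\<lambda>z. if z \<in> ball 0 1 then E (\<sigma> z) else 0)"
  have "continuous_on (cball 0 1) (\<lambda>z. E (\<sigma> z))"
    by (rule continuous_on_compose2[OF mv_holomorphic_on_imp_continuous_on[OF E(1)] continuous_on_sigma]) simp
  from compact_imp_bounded[OF compact_continuous_image[OF this compact_cball]]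
  obtain b where b: "\<And>z. z \<in> cball 0 1 \<Longrightarrow> norm (E (\<sigma> z)) \<le> b" unfolding bounded_iff by blast
  have "e \<in> hardy_space"
  proof (rule hardy_space_bounded(1))
    show "mv_holomorphic_on e (ball 0 1)"
      unfolding e_def by (rule compose_sigma_holomorphic[OF mv_holomorphic_on_subset[OF E(1)]]) simp
    show "norm (e z) \<le> b" if "z \<in> ball 0 1" for z using b[of z] that by (simp add: e_def)
  qed (simp add: e_def)
  moreover obtain w where w: "w \<in> \<Omega>" "E w \<noteq> 0" using dense[OF open_Omega] zero_mem_Omega by blast
  have "e (\<tau> w) \<noteq> 0" using w Omega_mem(2,3)[OF w(1)] by (simp add: e_def)
  moreover have "T e z = prod_list \<mu>s * e z" for z
    using image_ball[of z] sigma_phi[of z] by (simp add: T_apply e_def E(2))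
  ultimately show ?thesis by (rule eigenvalue_in_hardy_spectrum)
qed

section \<open>Uniqueness, existence and boundedness of the inverse\<close>

lemma intertwining_unique:
  assumes \<nu>: "\<nu> \<notin> critical_values M" and f: "f \<in> hardy_space"
    and eq: "\<And>z. z \<in> ball 0 1 \<Longrightarrow> f (\<phi> z) = \<nu> * f z"
  shows "f z = 0"
proof (cases "z \<in> ball 0 1")
  case True
  have "f (\<tau> (M *v w)) = \<nu> * f (\<tau> w)" if "w \<in> \<Omega>" for w
    using Omega_invariant(2)[OF that] eq[of "\<tau> w"] Omega_mem(2)[OF that] by simp
  then have "\<forall>w\<in>\<Omega>. f (\<tau> w) = 0"
    using model.solvable_injective(2)[OF \<nu>] compose_tau_holomorphic[OF f]
    unfolding model.injective_at_def model.hol_def by blast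
  then show ?thesis using True sigma_mem[of z] tau_sigma[of z] by force
next
  case False
  then show ?thesis using hardy_spaceD(2)[OF f] by blast
qed

text \<open>Solving the equation for \<open>g\<close> expresses \<open>g\<close> through \<open>g \<circ> \<phi>\<close>, so a bound far along the orbits
  propagates back to the whole ball.\<close>

lemma solution_bound:
  assumes \<nu>: "\<nu> \<noteq> 0"
  shows "\<exists>c\<ge>0. \<forall>f g b. f \<in> hardy_space \<longrightarrow> mv_holomorphic_on g (ball 0 1) \<longrightarrow> (\<forall>z. z \<notin> ball 0 1 \<longrightarrow> g z = 0) \<longrightarrow>
    (\<forall>z\<in>ball 0 1. g (\<phi> z) - \<nu> * g z = f z) \<longrightarrow> (\<forall>z\<in>ball 0 1. norm (g ((\<Phi> ^^ n) z)) \<le> b) \<longrightarrow>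
    g \<in> hardy_space \<and> hardy_norm g \<le> c * (b + hardy_norm f)"
proof (induction n)
  case 0
  show ?case
  proof (intro exI[of _ 1] conjI allI impI)
    fix f g :: "complex ^ 'n \<Rightarrow> complex" and b
    assume f: "f \<in> hardy_space" and g: "mv_holomorphic_on g (ball 0 1)" "\<forall>z. z \<notin> ball 0 1 \<longrightarrow> g z = 0"
      and b: "\<forall>z\<in>ball 0 1. norm (g ((\<Phi> ^^ 0) z)) \<le> b"
    have g0: "\<And>z. z \<notin> ball 0 1 \<Longrightarrow> g z = 0" and gb: "\<And>z. z \<in> ball 0 1 \<Longrightarrow> norm (g z) \<le> b" using g b by auto
    show "g \<in> hardy_space" by (rule hardy_space_bounded(1)[OF g(1) g0 gb])
    have "hardy_norm g \<le> b" by (rule hardy_space_bounded(2)[OF g(1) g0 gb])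
    then show "hardy_norm g \<le> 1 * (b + hardy_norm f)" using hardy_norm_nonneg[OF f] by simp
  qed simp
next
  case (Suc n)
  then obtain c where c: "c \<ge> 0" and IH: "\<forall>f g b. f \<in> hardy_space \<longrightarrow> mv_holomorphic_on g (ball 0 1) \<longrightarrow> (\<forall>z. z \<notin> ball 0 1 \<longrightarrow> g z = 0) \<longrightarrow>
    (\<forall>z\<in>ball 0 1. g (\<phi> z) - \<nu> * g z = f z) \<longrightarrow> (\<forall>z\<in>ball 0 1. norm (g ((\<Phi> ^^ n) z)) \<le> b) \<longrightarrow>
    g \<in> hardy_space \<and> hardy_norm g \<le> c * (b + hardy_norm f)" by (elim exE conjE) (rule that)
  obtain K where K: "K \<ge> 0" "\<forall>f\<in>hardy_space. T f \<in> hardy_space \<and> hardy_norm (T f) \<le> K * hardy_norm f"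
    using T_bounded by blast
  let ?c = "norm (1 / \<nu>) * (2 * (c * (K + 1) + 1))"
  show ?case
  proof (rule exI[of _ ?c], rule conjI, goal_cases)
    case 1
    show ?case using c K by simp
  next
    case 2
    show ?case
    proof (intro allI impI)
      fix f g :: "complex ^ 'n \<Rightarrow> complex" and b
      assume f: "f \<in> hardy_space" and g: "mv_holomorphic_on g (ball 0 1)" "\<forall>z. z \<notin> ball 0 1 \<longrightarrow> g z = 0"
        and eq: "\<forall>z\<in>ball 0 1. g (\<phi> z) - \<nu> * g z = f z"
        and b: "\<forall>z\<in>ball 0 1. norm (g ((\<Phi> ^^ Suc n) z)) \<le> b"
      have "norm (g ((\<Phi> ^^ Suc n) 0)) \<le> b" using b by (metis centre_in_ball zero_less_one)
      then have b0: "0 \<le> b" using norm_ge_zero order_trans by blast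
      note nf = hardy_norm_nonneg[OF f]
      \<comment> \<open>\<open>T g\<close> solves the equation with data \<open>T f\<close>, and the
        assumed bound for g reaches it one iterate earlier.\<close>
      have Tg: "T g \<in> hardy_space \<and> hardy_norm (T g) \<le> c * (b + hardy_norm (T f))"
      proof (rule IH[rule_format])
        show "T f \<in> hardy_space" by (rule T_hardy[OF f])
        have "mv_holomorphic_on (\<lambda>z. g (\<phi> z)) (ball 0 1)"
          by (rule mv_holomorphic_on_compose[OF g(1) mv_holomorphic_phi]) (simp add: image_ball)
        moreover have "mv_holomorphic_on (T g) (ball 0 1) \<longleftrightarrow> mv_holomorphic_on (\<lambda>z. g (\<phi> z)) (ball 0 1)"
          by (rule mv_holomorphic_on_cong) (simp_all add: T_apply)
        ultimately show "mv_holomorphic_on (T g) (ball 0 1)" by simp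
        show "T g z = 0" if "z \<notin> ball 0 1" for z using that by (simp add: T_apply)
        show "T g (\<phi> z) - \<nu> * T g z = T f z" if "z \<in> ball 0 1" for z
          using that image_ball[of z] eq by (simp add: T_apply)
        show "norm (T g ((\<Phi> ^^ n) z)) \<le> b" if "z \<in> ball 0 1" for z
          using b that iterate_ball[OF that, of n] by (simp add: T_apply)
      qed
      have g_eq: "g = (\<lambda>z. (1 / \<nu>) * (T g z + (- 1) * f z))"
      proof
        show "g z = (1 / \<nu>) * (T g z + (- 1) * f z)" for z
          using eq[rule_format, of z] g(2) hardy_spaceD(2)[OF f, of z] \<nu> by (cases "z \<in> ball 0 1") (auto simp: T_apply field_simps)
      qed
      note mf = hardy_space_cmult[OF f, of "- 1"]
      note sum = hardy_space_add[OF Tg[THEN conjunct1] mf(1)]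
      note res = hardy_space_cmult[OF sum(1), of "1 / \<nu>"]
      have "hardy_norm g \<le> norm (1 / \<nu>) * hardy_norm (\<lambda>z. T g z + (- 1) * f z)"
        by (subst g_eq) (rule res(2))
      also have "\<dots> \<le> norm (1 / \<nu>) * (2 * (c * (b + K * hardy_norm f) + hardy_norm f))"
      proof (rule mult_left_mono)
        have "c * (b + hardy_norm (T f)) \<le> c * (b + K * hardy_norm f)"
          using K(2) f c by (intro mult_left_mono add_left_mono) auto
        then show "hardy_norm (\<lambda>z. T g z + (- 1) * f z) \<le> 2 * (c * (b + K * hardy_norm f) + hardy_norm f)"
          using sum(2) mf(2) Tg by simp
      qed simp
      also have "\<dots> \<le> norm (1 / \<nu>) * (2 * ((c * (K + 1) + 1) * (b + hardy_norm f)))"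
      proof (intro mult_left_mono)
        have "0 \<le> c * K * b" "0 \<le> c * hardy_norm f" using c K b0 nf by simp_all
        then show "c * (b + K * hardy_norm f) + hardy_norm f \<le> (c * (K + 1) + 1) * (b + hardy_norm f)"
          using b0 by (simp add: algebra_simps)
      qed simp_all
      finally have "hardy_norm g \<le> ?c * (b + hardy_norm f)" by (simp only: mult.assoc)
      moreover have "g \<in> hardy_space" by (subst g_eq) (rule res(1))
      ultimately show "g \<in> hardy_space \<and> hardy_norm g \<le> ?c * (b + hardy_norm f)" by simp
    qed
  qed
qed

text \<open>Point evaluation bounds the transported data on \<open>K'\<close>, solvability bounds
  the solution on \<open>K\<close>, and the bound is carried back from the n-th iterate of \<phi> to
  the whole ball.\<close>

lemma resolvent_exists:
  assumes \<nu>: "\<nu> \<notin> critical_values M"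
  shows "\<exists>c\<ge>0. \<forall>f\<in>hardy_space. \<exists>g\<in>hardy_space. (\<forall>z\<in>ball 0 1. g (\<phi> z) - \<nu> * g z = f z) \<and>
    hardy_norm g \<le> c * hardy_norm f"
proof -
  have \<nu>0: "\<nu> \<noteq> 0" using \<nu> by (auto simp: critical_values_def)
  obtain n \<rho> where \<rho>: "0 \<le> \<rho>" "\<rho> < 1" "\<And>z. norm z \<le> 1 \<Longrightarrow> norm ((\<Phi> ^^ n) z) \<le> \<rho>"
    using phi_iterate_compact by blast
  \<comment> \<open>Compact in \<Omega>, and it contains the \<sigma>-image of the n-th iterate of
    every point of the ball.\<close>
  define K where "K = \<sigma> ` cball 0 \<rho>"
  have "compact K" unfolding K_def
    by (rule compact_continuous_image[OF continuous_on_subset[OF continuous_on_sigma]]) (use \<rho> in auto)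
  moreover have "K \<subseteq> \<Omega>" using sigma_mem \<rho> by (auto simp: K_def)
  ultimately obtain K' c1 where K': "compact K'" "K' \<subseteq> \<Omega>" "0 \<le> c1"
    and solve: "\<forall>f. model.hol f \<longrightarrow> (\<exists>k. model.hol k \<and> (\<forall>w\<in>\<Omega>. k (M *v w) - \<nu> * k w = f w) \<and>
      (\<forall>B. (\<forall>w\<in>K'. norm (f w) \<le> B) \<longrightarrow> (\<forall>w\<in>K. norm (k w) \<le> c1 * B)))"
    using model.solvable_injective(1)[OF \<nu>, unfolded model.solvable_def, THEN spec, of K]
    by (elim impE exE conjE) (auto intro: that)
  have "\<exists>\<rho>'. 0 \<le> \<rho>' \<and> \<rho>' < 1 \<and> (\<forall>w\<in>K'. norm (\<tau> w) \<le> \<rho>')"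
  proof (cases "K' = {}")
    case False
    have "continuous_on K' (\<lambda>w. norm (\<tau> w))"
      by (intro continuous_on_norm continuous_on_subset[OF continuous_on_tau K'(2)])
    from continuous_attains_sup[OF K'(1) False this]
    obtain w where "w \<in> K'" "\<forall>v\<in>K'. norm (\<tau> v) \<le> norm (\<tau> w)" by blast
    then show ?thesis using Omega_mem(2)[of w] K'(2) by (intro exI[of _ "norm (\<tau> w)"]) auto
  qed (auto intro: exI[of _ 0])
  then obtain \<rho>' where \<rho>': "0 \<le> \<rho>'" "\<rho>' < 1" "\<forall>w\<in>K'. norm (\<tau> w) \<le> \<rho>'" by blast
  obtain c2 where c2: "c2 \<ge> 0" "\<forall>f\<in>hardy_space. \<forall>z :: complex ^ 'n. norm z \<le> \<rho>' \<longrightarrow> norm (f z) \<le> c2 * hardy_norm f"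
    using hardy_point_evaluation[OF \<rho>'(1,2)] by blast
  obtain c3 where c3: "c3 \<ge> 0" and bound: "\<forall>f g b. f \<in> hardy_space \<longrightarrow> mv_holomorphic_on g (ball 0 1) \<longrightarrow>
    (\<forall>z. z \<notin> ball 0 1 \<longrightarrow> g z = 0) \<longrightarrow>
    (\<forall>z\<in>ball 0 1. g (\<phi> z) - \<nu> * g z = f z) \<longrightarrow> (\<forall>z\<in>ball 0 1. norm (g ((\<Phi> ^^ n) z)) \<le> b) \<longrightarrow>
    g \<in> hardy_space \<and> hardy_norm g \<le> c3 * (b + hardy_norm f)"
    using solution_bound[OF \<nu>0, of n] by (elim exE conjE) (rule that)
  show ?thesis
  proof (rule exI[of _ "c3 * (c1 * c2 + 1)"], rule conjI)
    show "0 \<le> c3 * (c1 * c2 + 1)" using c3 K' c2 by simp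
    show "\<forall>f\<in>hardy_space. \<exists>g\<in>hardy_space. (\<forall>z\<in>ball 0 1. g (\<phi> z) - \<nu> * g z = f z) \<and>
      hardy_norm g \<le> c3 * (c1 * c2 + 1) * hardy_norm f"
    proof
      fix f :: "complex ^ 'n \<Rightarrow> complex" assume f: "f \<in> hardy_space"
      have "model.hol (\<lambda>w. f (\<tau> w))" unfolding model.hol_def by (rule compose_tau_holomorphic[OF f])
      from solve[rule_format, OF this] obtain k where k: "model.hol k"
        "\<forall>w\<in>\<Omega>. k (M *v w) - \<nu> * k w = f (\<tau> w)"
        "\<forall>B. (\<forall>w\<in>K'. norm (f (\<tau> w)) \<le> B) \<longrightarrow> (\<forall>w\<in>K. norm (k w) \<le> c1 * B)"
        by (elim exE conjE) (rule that)
      have "\<forall>w\<in>K'. norm (f (\<tau> w)) \<le> c2 * hardy_norm f" using c2(2) f \<rho>'(3) by blast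
      then have kb: "\<forall>w\<in>K. norm (k w) \<le> c1 * (c2 * hardy_norm f)" by (rule k(3)[THEN spec, THEN mp])
      define g where "g = (\<lambda>z. if z \<in> ball 0 1 then k (\<sigma> z) else 0)"
      have eq: "g (\<phi> z) - \<nu> * g z = f z" if "z \<in> ball 0 1" for z
      proof -
        have z: "norm z < 1" "norm z \<le> 1" "norm (\<phi> z) < 1" using that image_ball[of z] by auto
        have "k (M *v \<sigma> z) - \<nu> * k (\<sigma> z) = f (\<tau> (\<sigma> z))" using k(2) sigma_mem[OF z(1)] by blast
        then show ?thesis using z by (simp add: g_def sigma_phi tau_sigma)
      qed
      have "g \<in> hardy_space \<and> hardy_norm g \<le> c3 * (c1 * (c2 * hardy_norm f) + hardy_norm f)"
      proof (rule bound[rule_format, OF f])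
        show "mv_holomorphic_on g (ball 0 1)"
          unfolding g_def by (rule compose_sigma_holomorphic[OF k(1)[unfolded model.hol_def]])
        show "norm (g ((\<Phi> ^^ n) z)) \<le> c1 * (c2 * hardy_norm f)" if "z \<in> ball 0 1" for z
        proof -
          have "(\<Phi> ^^ n) z \<in> cball 0 \<rho>" using \<rho>(3)[of z] that by simp
          then have "\<sigma> ((\<Phi> ^^ n) z) \<in> K" unfolding K_def by blast
          then show ?thesis using kb iterate_ball[OF that, of n] by (simp add: g_def)
        qed
        show "g z = 0" if "z \<notin> ball 0 1" for z using that by (simp add: g_def)
      qed (rule eq)
      moreover have "c3 * (c1 * (c2 * hardy_norm f) + hardy_norm f) = c3 * (c1 * c2 + 1) * hardy_norm f"
        by (simp add: algebra_simps)
      ultimately have "g \<in> hardy_space" "hardy_norm g \<le> c3 * (c1 * c2 + 1) * hardy_norm f" by simp_all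
      then show "\<exists>g\<in>hardy_space. (\<forall>z\<in>ball 0 1. g (\<phi> z) - \<nu> * g z = f z) \<and>
        hardy_norm g \<le> c3 * (c1 * c2 + 1) * hardy_norm f"
        using eq by (intro bexI[of _ g] conjI ballI)
    qed
  qed
qed

text \<open>The inverse is a choice of solutions; uniqueness makes it linear, gives it the norm
  bound of the solution found, and yields both inverse identities.\<close>

lemma not_in_spectrum:
  assumes \<nu>: "\<nu> \<notin> critical_values M"
  shows "\<nu> \<notin> hardy_spectrum T"
proof -
  define sol where "sol f g \<longleftrightarrow> g \<in> hardy_space \<and> (\<forall>z\<in>ball 0 1. g (\<phi> z) - \<nu> * g z = f z)" for f g
  have unique: "g = h" if "sol f g" "sol f h" for f g h
  proof -
    have h: "(\<lambda>z. (-1) * h z) \<in> hardy_space" by (rule hardy_space_cmult(1)) (use that(2) in \<open>simp add: sol_def\<close>)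
    have "(\<lambda>z. g z + (-1) * h z) \<in> hardy_space"
      by (rule hardy_space_add(1)[OF _ h]) (use that(1) in \<open>simp add: sol_def\<close>)
    then have "g z + (-1) * h z = 0" for z
    proof (rule intertwining_unique[OF \<nu>])
      fix z :: "complex ^ 'n" assume "z \<in> ball 0 1"
      then have "g (\<phi> z) - \<nu> * g z = h (\<phi> z) - \<nu> * h z" using that by (simp add: sol_def)
      then show "g (\<phi> z) + - 1 * h (\<phi> z) = \<nu> * (g z + - 1 * h z)" by (simp add: algebra_simps)
    qed
    then show ?thesis by (simp add: fun_eq_iff)
  qed
  obtain c where "\<forall>f\<in>hardy_space. \<exists>g\<in>hardy_space. (\<forall>z\<in>ball 0 1. g (\<phi> z) - \<nu> * g z = f z) \<and>
      hardy_norm g \<le> c * hardy_norm f"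
    using resolvent_exists[OF \<nu>] by (elim exE conjE) (rule that)
  then have c: "\<forall>f\<in>hardy_space. \<exists>g. sol f g \<and> hardy_norm g \<le> c * hardy_norm f"
    by (simp add: sol_def Bex_def conj_assoc)
  define S where "S f = (SOME g. sol f g)" for f
  have S: "sol f (S f)" if "f \<in> hardy_space" for f unfolding S_def using bspec[OF c that] by (intro someI_ex[of "sol f"]) (elim exE conjE, rule exI)
  have S_eq: "S f = g" if "f \<in> hardy_space" "sol f g" for f g using unique[OF S[OF that(1)] that(2)] .
  have "hardy_bounded_operator S"
    unfolding hardy_bounded_operator_def
  proof (intro conjI ballI allI)
    fix f g :: "complex ^ 'n \<Rightarrow> complex" and a
    assume f: "f \<in> hardy_space"
    show "S f \<in> hardy_space" using S[OF f] by (simp add: sol_def)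
    show "S (\<lambda>z. a * f z) = (\<lambda>z. a * S f z)"
    proof (rule S_eq[OF hardy_space_cmult(1)[OF f]])
      have "a * S f (\<phi> z) - \<nu> * (a * S f z) = a * f z" if "z \<in> ball 0 1" for z
      proof -
        have "a * S f (\<phi> z) - \<nu> * (a * S f z) = a * (S f (\<phi> z) - \<nu> * S f z)" by (simp add: algebra_simps)
        then show ?thesis using S[OF f] that by (simp add: sol_def)
      qed
      then show "sol (\<lambda>z. a * f z) (\<lambda>z. a * S f z)"
        unfolding sol_def by (intro conjI ballI hardy_space_cmult(1)) (use S[OF f] in \<open>simp_all add: sol_def\<close>)
    qed
    assume g: "g \<in> hardy_space"
    show "S (\<lambda>z. f z + g z) = (\<lambda>z. S f z + S g z)"
    proof (rule S_eq[OF hardy_space_add(1)[OF f g]])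
      have "S f (\<phi> z) + S g (\<phi> z) - \<nu> * (S f z + S g z) = f z + g z" if "z \<in> ball 0 1" for z
      proof -
        have "S f (\<phi> z) - \<nu> * S f z = f z" "S g (\<phi> z) - \<nu> * S g z = g z"
          using S[OF f] S[OF g] that by (simp_all add: sol_def)
        then show ?thesis by (simp add: algebra_simps)
      qed
      then show "sol (\<lambda>z. f z + g z) (\<lambda>z. S f z + S g z)"
        unfolding sol_def by (intro conjI ballI hardy_space_add(1)) (use S[OF f] S[OF g] in \<open>simp_all add: sol_def\<close>)
    qed
  next
    have "hardy_norm (S f) \<le> c * hardy_norm f" if f: "f \<in> hardy_space" for f
      using bspec[OF c f] S_eq[OF f] by (elim exE conjE) simp
    then show "\<exists>K. \<forall>f\<in>hardy_space. hardy_norm (S f) \<le> K * hardy_norm f" by blast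
  qed
  then have "\<exists>S. hardy_bounded_operator S \<and> (\<forall>f\<in>hardy_space. S (\<lambda>z. T f z - \<nu> * f z) = f) \<and>
      (\<forall>f\<in>hardy_space. (\<lambda>z. T (S f) z - \<nu> * S f z) = f)"
  proof (intro exI[of _ S] conjI ballI)
    fix f :: "complex ^ 'n \<Rightarrow> complex" assume f: "f \<in> hardy_space"
    show "S (\<lambda>z. T f z - \<nu> * f z) = f"
    proof (rule S_eq)
      have "(\<lambda>z. T f z + (- \<nu>) * f z) \<in> hardy_space"
        by (rule hardy_space_add(1)[OF T_hardy[OF f] hardy_space_cmult(1)[OF f]])
      then show "(\<lambda>z. T f z - \<nu> * f z) \<in> hardy_space" by simp
      show "sol (\<lambda>z. T f z - \<nu> * f z) f" using f by (simp add: sol_def T_apply)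
    qed
    show "(\<lambda>z. T (S f) z - \<nu> * S f z) = f"
    proof
      fix z :: "complex ^ 'n"
      have "S f \<in> hardy_space" "\<forall>z\<in>ball 0 1. S f (\<phi> z) - \<nu> * S f z = f z" using S[OF f] by (simp_all add: sol_def)
      then show "T (S f) z - \<nu> * S f z = f z"
        using hardy_spaceD(2)[OF f, of z] hardy_spaceD(2)[of "S f" z] by (cases "z \<in> ball 0 1") (simp_all add: T_apply)
    qed
  qed
  then show ?thesis unfolding hardy_spectrum_def by simp
qed

theorem spectrum_eq: "hardy_spectrum T = critical_values M"
proof
  show "hardy_spectrum T \<subseteq> critical_values M" using not_in_spectrum by blast
  have "1 \<in> hardy_spectrum T" using products_in_spectrum[of "[]"] by simp
  then show "critical_values M \<subseteq> hardy_spectrum T"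
    using zero_in_spectrum products_in_spectrum by (auto simp: critical_values_def)
qed

end

text \<open>An eigenvector is already killed by the first power of \<open>J - \<alpha> I\<close>,
  hence by the positive power \<open>CARD('a)\<close>, and is a nonzero element of the unitary
  space.\<close>

lemma unimodular_eigenvalue_dim:
  assumes "\<alpha> \<in> matrix_eigenvalues (complex_jacobian \<phi> z)" "norm \<alpha> = 1"
  shows "vec.dim (unitary_space \<phi> z) \<noteq> 0"
proof
  assume "vec.dim (unitary_space \<phi> z) = 0"
  then have zero: "unitary_space \<phi> z \<subseteq> {0}" by simp
  let ?J = "complex_jacobian \<phi> z"
  obtain v where v: "v \<noteq> 0" "?J *v v = \<alpha> *s v" using assms(1) unfolding matrix_eigenvalues_def by blast
  have "(?J - mat \<alpha>) *v v = 0"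
    by (simp add: matrix_vector_mult_diff_rdistrib mat_mult_vec v(2))
  moreover obtain k where "CARD('a) = Suc k" using not0_implies_Suc[of "CARD('a)"] by auto
  moreover have "((\<lambda>w. (?J - mat \<alpha>) *v w) ^^ k) 0 = 0" for k by (induction k) simp_all
  ultimately have "((\<lambda>w. (?J - mat \<alpha>) *v w) ^^ CARD('a)) v = 0"
    by (simp only: funpow_Suc_right o_apply)
  then have "v \<in> unitary_space \<phi> z"
    unfolding unitary_space_def using assms(2) by (intro vec.span_base) blast
  then show False using zero v(1) by blast
qed

theorem theorem2p3:
  fixes \<phi> :: "complex ^ 'n \<Rightarrow> complex ^ 'n" and z\<^sub>0 :: "complex ^ 'n" and p :: nat
  assumes "\<phi> \<in> LFM"
    and "elliptic \<phi>"
    and "\<not> ball_automorphism \<phi>"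
    and "z\<^sub>0 \<in> ball 0 1" and "\<phi> z\<^sub>0 = z\<^sub>0"
    and "p = vec.dim (unitary_space \<phi> z\<^sub>0)"
    and "p = 0"
    and "\<not> (\<exists>\<zeta>\<in>sphere 0 1. \<phi> \<zeta> = \<zeta>)"
  shows "hardy_spectrum (composition_operator \<phi>) =
    {0, 1} \<union> {prod_list \<mu>s | \<mu>s. \<mu>s \<noteq> [] \<and>
      set \<mu>s \<subseteq> matrix_eigenvalues (complex_jacobian \<phi> z\<^sub>0)}"
proof -
  obtain A B C d t where form: "lfm_form A B C d t"
    and rep: "\<forall>z\<in>cball 0 1. \<phi> z = linear_fractional A B C d z"
    using ex_lfm_form[OF assms(1)] by blast
  interpret lfm_form A B C d t by (rule form)
  have z0: "norm z\<^sub>0 < 1" "linear_fractional A B C d z\<^sub>0 = z\<^sub>0" using assms(4,5) rep by auto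
  have J: "complex_jacobian \<phi> z\<^sub>0 = jac z\<^sub>0" by (rule jac_eq_complex_jacobian[OF z0]) (use rep in auto)
  interpret lfm_attracting A B C d t z\<^sub>0
  proof
    show "norm \<mu> \<noteq> 1" if "\<mu> \<in> matrix_eigenvalues (jac z\<^sub>0)" for \<mu>
      using unimodular_eigenvalue_dim[of \<mu> \<phi> z\<^sub>0] assms(6,7) that by (auto simp: J)
    \<comment> \<open>The representation holds on the closed ball, so the absence of boundary fixed
      points passes to the explicit formula.\<close>
    show "linear_fractional A B C d z \<noteq> z" if "norm z = 1" for z
      using assms(8) rep that by force
  qed (use z0 in auto)
  have "composition_operator \<phi> = T" by (rule composition_operator_cong) (use rep in auto)
  then show ?thesis using spectrum_eq by (simp add: J critical_values_def)
qed

end
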